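(* Let $N\ge1$, $0<\theta<2$, and $\varphi\in L^1_K\cap L^\infty$ with $K\ge0$. Let $F\in C(\mathbb R^N\times[0,\infty)\times\mathbb R)$ satisfy, for some $p>1+\theta/N$ and $C>0$, $$|F(x,t,v)-F(x,t,w)|\le C(|v|+|w|)^{p-1}|v-w|\quad\text{for all }(x,t,v,w)\in\mathbb R^N\times[0,\infty)\times\mathbb R^2.$$ Let $u\in C(\mathbb R^N\times(0,\infty))$ be a solution to $\partial_tu+(-\Delta)^{\theta/2}u=F(x,t,u)$ in $\mathbb R^N\times(0,\infty)$, $u(\cdot,0)=\varphi$ in $\mathbb R^N$. Set $F(x,t):=F(x,t,u(x,t))$ for $(x,t)\in\mathbb R^N\times(0,\infty)$ and $A_p:=N(p-1)/\theta>1$. (a) Assume that $\varphi\in L^\infty_k$ with $k=\min\{N+\theta,K\}$ and that $\sup_{t>0}(t+1)^{N/\theta}\|u(t)\|_\infty<\infty$. Then $$\sup_{t>0}\,(t+1)^{\frac N\theta\left(1-\frac1q\right)-\frac\ell\theta}|||u(t)|||_{q,\ell}<\infty\qquad( * )$$ for $1\le q\le\infty$ and $0\le\ell\le K$ with $\ell<\theta+N(1-1/q)$. (b) Let $u$ satisfy $( * )$ for $1\le q\le\infty$ and $0\le\ell\le K$ with $\ell<\theta+N(1-1/q)$. If $p(N+\theta)>K+N$, then, for $1\le q\le\infty$, there is $C>0$ such that $$E_{K,q}[F](t)\le C(t+1)^{\frac K\theta-A_p},\quad t>0.\qquad( ** )$$ (c) Assume that $( ** )$ holds for $1\le q\le\infty$.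 Set $$U_0(x,t):=\sum_{m=0}^{K_\theta}\sum_{|\alpha|\le K}\left(M_\alpha(\varphi)+\int_0^t(s+1)^mM_\alpha(F(s))\,ds\right)g_{\alpha,m}(x,t).$$ Then, for $1\le q\le\infty$ and $0\le\ell\le K$, $$\sup_{t>0}\,t^{\frac N\theta\left(1-\frac1q\right)}(t+1)^{-\frac\ell\theta}|||u(t)-U_0(t)|||_{q,\ell}<\infty$$ and, as $t\to\infty$, $$t^{\frac N\theta\left(1-\frac1q\right)-\frac\ell\theta}|||u(t)-U_0(t)|||_{q,\ell}=\begin{cases}o(t^{-\frac K\theta})+O(t^{-A_p+1})&\text{if }A_p-1\ne K/\theta,\\ O(t^{-\frac K\theta}\log t)&\text{if }A_p-1=K/\theta.\end{cases}$$
   Context: $\|\cdot\|_q$ is the norm of $L^q=L^q(\mathbb R^N)$. For $K\ge0$ and $1\le q\le\infty$, $|||h|||_{q,K}:=\|\,|x|^Kh\,\|_q$, and $L^q_K:=\{h\in L^q: \|h\|_q+|||h|||_{q,K}<\infty\}$. Write $u(t)=u(\cdot,t)$, $F(t)=F(\cdot,t)$, etc. For a multi-index $\alpha\in\mathbb M:=\mathbb N_0^N$ with $|\alpha|\le K$ and $h\in L^1_K$, $M_\alpha(h):=\int_{\mathbb R^N}x^\alpha h(x)\,dx$. For $k\ge0$, $[k]$ is the integer with $k-1<[k]\le k$, and $K_\theta:=[K/\theta]$. $G_\theta(x,t)=(2\pi)^{-N}\int_{\mathbb R^N}e^{ix\cdot\xi}e^{-t|\xi|^\theta}\,d\xi$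 is the fundamental solution of $\partial_tv+(-\Delta)^{\theta/2}v=0$ in $\mathbb R^N\times(0,\infty)$, and $[e^{-t(-\Delta)^{\theta/2}}\psi](x):=\int_{\mathbb R^N}G_\theta(x-y,t)\psi(y)\,dy$. For $\alpha\in\mathbb M$, $m\in\mathbb N_0$, $g_{\alpha,m}(x,t):=\frac{(-1)^{|\alpha|+m}}{\alpha!\,m!}(\partial_t^m\partial_x^\alpha G_\theta)(x,t+1)$. For measurable $f$ on $\mathbb R^N\times(0,\infty)$, $$E_{K,q}[f](t):=(t+1)^{\frac K\theta}\left[t^{\frac N\theta\left(1-\frac1q\right)}\|f(t)\|_q+\|f(t)\|_1\right]+t^{\frac N\theta\left(1-\frac1q\right)}|||f(t)|||_{q,K}+|||f(t)|||_{1,K},\quad t>0.$$ A solution $u$ means that $u(x,t)=[e^{-t(-\Delta)^{\theta/2}}\varphi](x)+\int_0^t[e^{-(t-s)(-\Delta)^{\theta/2}}F(\cdot,s,u(\cdot,s))](x)\,ds$ for $(x,t)\in\mathbb R^N\times(0,\infty)$.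
   Formalization: Parts (a) and (b) additionally assume F(x,t,0)=0 for all x and t≥0 (so |F(x,t,v)|≤C|v|^p); without it both are false, e.g. (a) for K=0, φ=0, F=χ'(t), u=χ(t)=te^{-t}, where ‖u(t)‖_1=∞. *)

theory Defs
  imports "HOL-Probability.Probability"
begin

text \<open>\<open>\<real>\<^sup>N\<close> is \<^typ>\<open>real ^ 'n\<close>, so that \<open>N = CARD('n)\<close>. All spatial notions refer to Lebesgue
  measurable functions and Lebesgue measure. Exponents \<open>1 \<le> q \<le> \<infinity>\<close> have type \<^typ>\<open>ennreal\<close>, and
  norms take values in \<^typ>\<open>ennreal\<close>, so that finiteness of a norm is part of every claim.\<close>

definition Lq_norm :: "ennreal \<Rightarrow> (real ^ 'n \<Rightarrow> real) \<Rightarrow> ennreal" where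
  "Lq_norm q h =
     (if q = \<infinity> then esssup lebesgue (\<lambda>x. ennreal \<bar>h x\<bar>)
      else let I = (\<integral>\<^sup>+ x. ennreal (\<bar>h x\<bar> powr enn2real q) \<partial>lebesgue)
           in if I = \<infinity> then \<infinity> else ennreal (enn2real I powr (1 / enn2real q)))"

text \<open>For \<open>K = 0\<close> the factor \<open>norm x powr K\<close> is \<open>1\<close> except at the single point \<open>x = 0\<close>
  (a null set), where it is \<open>0\<close>; hence the weighted norm with \<open>K = 0\<close> is the plain one.\<close>

definition wLq_norm :: "ennreal \<Rightarrow> real \<Rightarrow> (real ^ 'n \<Rightarrow> real) \<Rightarrow> ennreal" where
  "wLq_norm q K h = Lq_norm q (\<lambda>x. norm x powr K * h x)"

definition Lq :: "ennreal \<Rightarrow> (real ^ 'n \<Rightarrow> real) set" where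
  "Lq q = {h. h \<in> borel_measurable lebesgue \<and> Lq_norm q h < \<infinity>}"

definition wLq :: "ennreal \<Rightarrow> real \<Rightarrow> (real ^ 'n \<Rightarrow> real) set" where
  "wLq q K = {h \<in> Lq q. Lq_norm q h + wLq_norm q K h < \<infinity>}"

text \<open>The real number \<open>1/q\<close>, with \<open>1/\<infinity> = 0\<close>.\<close>

definition recip :: "ennreal \<Rightarrow> real" where
  "recip q = enn2real (inverse q)"

text \<open>Multi-indices are functions \<^typ>\<open>'n \<Rightarrow> nat\<close>.\<close>

definition mi_abs :: "('n::finite \<Rightarrow> nat) \<Rightarrow> nat" where
  "mi_abs \<alpha> = (\<Sum>i\<in>UNIV. \<alpha> i)"

definition mi_fact :: "('n::finite \<Rightarrow> nat) \<Rightarrow> real" where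
  "mi_fact \<alpha> = (\<Prod>i\<in>UNIV. fact (\<alpha> i))"

definition mi_power :: "real ^ 'n \<Rightarrow> ('n \<Rightarrow> nat) \<Rightarrow> real" where
  "mi_power x \<alpha> = (\<Prod>i\<in>UNIV. (x $ i) ^ \<alpha> i)"

definition moment :: "('n \<Rightarrow> nat) \<Rightarrow> (real ^ 'n \<Rightarrow> real) \<Rightarrow> real" where
  "moment \<alpha> h = (LINT x|lebesgue. mi_power x \<alpha> * h x)"

definition partial_deriv :: "'n \<Rightarrow> (real ^ 'n \<Rightarrow> real) \<Rightarrow> real ^ 'n \<Rightarrow> real" where
  "partial_deriv i h x = deriv (\<lambda>s. h (x + s *\<^sub>R axis i 1)) 0"

text \<open>\<open>mi_deriv \<alpha>\<close> is \<open>\<partial>\<^sup>\<alpha>\<close>: a list containing each index \<open>i\<close> exactly \<open>\<alpha> i\<close> times fixes an order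
  of differentiation. The order is irrelevant for the smooth functions to which it is applied.\<close>

definition mi_deriv :: "('n \<Rightarrow> nat) \<Rightarrow> (real ^ 'n \<Rightarrow> real) \<Rightarrow> real ^ 'n \<Rightarrow> real" where
  "mi_deriv \<alpha> h = foldr partial_deriv (SOME is. \<forall>i. count_list is i = \<alpha> i) h"

text \<open>The Fourier integral is real because \<open>exp (- t |\<xi>|\<^sup>\<theta>)\<close> is even in \<open>\<xi>\<close>; \<^const>\<open>Re\<close> only
  changes the type.\<close>

definition G :: "real \<Rightarrow> real ^ 'n \<Rightarrow> real \<Rightarrow> real" where
  "G \<theta> x t = (2 * pi) powr (- real CARD('n)) *
     Re (LINT \<xi>|lebesgue. exp (\<i> * complex_of_real (x \<bullet> \<xi>)) *
                          complex_of_real (exp (- t * norm \<xi> powr \<theta>)))"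

definition heat :: "real \<Rightarrow> real \<Rightarrow> (real ^ 'n \<Rightarrow> real) \<Rightarrow> real ^ 'n \<Rightarrow> real" where
  "heat \<theta> t \<psi> x = (LINT y|lebesgue. G \<theta> (x - y) t * \<psi> y)"

definition g :: "real \<Rightarrow> ('n \<Rightarrow> nat) \<Rightarrow> nat \<Rightarrow> real ^ 'n \<Rightarrow> real \<Rightarrow> real" where
  "g \<theta> \<alpha> m x t = (-1) ^ (mi_abs \<alpha> + m) / (mi_fact \<alpha> * fact m) *
     (deriv ^^ m) (\<lambda>\<tau>. mi_deriv \<alpha> (\<lambda>z. G \<theta> z \<tau>) x) (t + 1)"

text \<open>The integral equation, together with the (tacit) existence of the integrals occurring in it;
  Isabelle's integral of a non-integrable function is \<open>0\<close>.\<close>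

definition solution ::
  "real \<Rightarrow> (real ^ 'n \<Rightarrow> real \<Rightarrow> real \<Rightarrow> real) \<Rightarrow> (real ^ 'n \<Rightarrow> real) \<Rightarrow> (real ^ 'n \<Rightarrow> real \<Rightarrow> real) \<Rightarrow> bool"
  where
  "solution \<theta> F \<phi> u \<longleftrightarrow>
     (\<forall>x. \<forall>t>0.
        integrable lebesgue (\<lambda>y. G \<theta> (x - y) t * \<phi> y) \<and>
        (AE s in lebesgue. s \<in> {0<..<t} \<longrightarrow>
           integrable lebesgue (\<lambda>y. G \<theta> (x - y) (t - s) * F y s (u y s))) \<and>
        set_integrable lebesgue {0<..<t} (\<lambda>s. heat \<theta> (t - s) (\<lambda>y. F y s (u y s)) x) \<and>
        u x t = heat \<theta> t \<phi> x +
          (LINT s:{0<..<t}|lebesgue. heat \<theta> (t - s) (\<lambda>y. F y s (u y s)) x))"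

definition E_norm :: "real \<Rightarrow> real \<Rightarrow> ennreal \<Rightarrow> (real ^ 'n \<Rightarrow> real \<Rightarrow> real) \<Rightarrow> real \<Rightarrow> ennreal" where
  "E_norm \<theta> K q f t =
     (let N = real CARD('n); h = (\<lambda>x. f x t) in
      ennreal ((t + 1) powr (K / \<theta>)) *
        (ennreal (t powr (N / \<theta> * (1 - recip q))) * Lq_norm q h + Lq_norm 1 h) +
      ennreal (t powr (N / \<theta> * (1 - recip q))) * wLq_norm q K h + wLq_norm 1 K h)"

definition weighted_decay :: "real \<Rightarrow> real \<Rightarrow> (real ^ 'n \<Rightarrow> real \<Rightarrow> real) \<Rightarrow> bool" where
  "weighted_decay \<theta> K u \<longleftrightarrow>
     (let N = real CARD('n) in
      \<forall>q l. 1 \<le> q \<and> 0 \<le> l \<and> l \<le> K \<and> l < \<theta> + N * (1 - recip q) \<longrightarrow>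
        (SUP t\<in>{0<..}. ennreal ((t + 1) powr (N / \<theta> * (1 - recip q) - l / \<theta>)) *
                       wLq_norm q l (\<lambda>x. u x t)) < \<infinity>)"

definition source_decay :: "real \<Rightarrow> real \<Rightarrow> real \<Rightarrow> (real ^ 'n \<Rightarrow> real \<Rightarrow> real) \<Rightarrow> bool" where
  "source_decay \<theta> K A f \<longleftrightarrow>
     (\<forall>q\<ge>1. \<exists>C>0. \<forall>t>0. E_norm \<theta> K q f t \<le> ennreal (C * (t + 1) powr (K / \<theta> - A)))"

text \<open>The bracket \<open>[k]\<close> with \<open>k - 1 < [k] \<le> k\<close> is the floor.\<close>

definition U0 ::
  "real \<Rightarrow> real \<Rightarrow> (real ^ 'n \<Rightarrow> real) \<Rightarrow> (real ^ 'n \<Rightarrow> real \<Rightarrow> real) \<Rightarrow> real ^ 'n \<Rightarrow> real \<Rightarrow> real" where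
  "U0 \<theta> K \<phi> f x t =
     (\<Sum>m = 0..nat \<lfloor>K / \<theta>\<rfloor>. \<Sum>\<alpha> | real (mi_abs \<alpha>) \<le> K.
        (moment \<alpha> \<phi> + (LINT s:{0<..<t}|lebesgue. (s + 1) ^ m * moment \<alpha> (\<lambda>y. f y s))) *
        g \<theta> \<alpha> m x t)"

text \<open>The index set of the inner sum is finite, so the sum is not the default value \<open>0\<close>.\<close>

lemma finite_mi_abs_le: "finite {\<alpha> :: 'n::finite \<Rightarrow> nat. real (mi_abs \<alpha>) \<le> K}"
proof (rule finite_subset)
  show "{\<alpha> :: 'n \<Rightarrow> nat. real (mi_abs \<alpha>) \<le> K} \<subseteq> PiE UNIV (\<lambda>_. {..nat \<lfloor>K\<rfloor>})"
  proof (intro subsetI PiE_I)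
    fix \<alpha> :: "'n \<Rightarrow> nat" and i
    assume "\<alpha> \<in> {\<alpha>. real (mi_abs \<alpha>) \<le> K}"
    moreover have "\<alpha> i \<le> mi_abs \<alpha>"
      unfolding mi_abs_def by (rule member_le_sum) auto
    ultimately have "real (\<alpha> i) \<le> K" by simp
    then show "\<alpha> i \<in> {..nat \<lfloor>K\<rfloor>}" by (simp add: le_nat_floor)
  qed auto
  show "finite (PiE (UNIV :: 'n set) (\<lambda>_. {..nat \<lfloor>K\<rfloor>}))"
    by (rule finite_PiE) auto
qed

end

theory Submission
 imports Defs "HOL-Complex_Analysis.Complex_Analysis" "HOL-Real_Asymp.Real_Asymp"
begin

text \<open>Subordinating \<open>G\<close> to Gaussians by a one-sided stable density gives, for derivatives of order
 \<open>j\<close> in \<open>x\<close> and \<open>m\<close> in \<open>t\<close>, the bound \<open>C (t\<^sup>1\<^sup>/\<^sup>\<theta> + |x|)\<close> to the power \<open>- N - j - \<theta> m\<close>. \<open>U0\<close> arises from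
 the integral equation by replacing \<open>G (x - y) (t - s)\<close> with its Taylor polynomial in \<open>(y, s)\<close> at
 \<open>(0, -1)\<close>, so \<open>u - U0\<close> is the data integrated against the Taylor remainder. With
 \<open>r = |y| + (s + 1)\<^sup>1\<^sup>/\<^sup>\<theta>\<close> and \<open>D = (t + 1)\<^sup>1\<^sup>/\<^sup>\<theta>\<close>, the remainder has \<open>|x|\<^sup>l\<close>-weighted \<open>L\<^sup>1\<close> norm at most
 \<open>C D\<^sup>l (r / D)\<^sup>K min(1, r / D)\<^sup>\<delta>\<close>, and a similar supremum bound. Interpolation in \<open>q\<close>, and dominated
 convergence for the \<open>o\<close> term, give (c). For (a), iterating the integral inequality yields
 \<open>|u| \<le> C P\<^sub>t * |\<phi>|\<close> (convolution), where \<open>P\<^sub>t x\<close> is \<open>t\<close> times \<open>t\<^sup>1\<^sup>/\<^sup>\<theta> + |x|\<close> to the power \<open>- N - \<theta>\<close>,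
 and (b) is the scaling of \<open>|u|\<^sup>p\<close> in weighted norms. In the lemmas \<open>\<theta>\<close> is written \<open>th\<close>.\<close>

text \<open>The symbol \<open>norm xi powr th\<close> is not smooth at the origin, so decay of the
  kernel in \<open>x\<close> cannot be obtained to every order by integrating by parts in
  \<open>xi\<close>. This is why the stable density is built explicitly, as a contour integral, and
  bounded by the choice of contour. Space derivatives are taken only along the direction
  \<open>y\<close>, which keeps Taylor's formula one-dimensional; the multinomial formula restores
  the multi-indices.

  Taylor's formula in time runs from \<open>t + 1\<close> down to \<open>t - s\<close>, and the
  kernel is singular at time \<open>0\<close>. It is therefore applied only if
  \<open>s + 1 <= (t + 1) / 2\<close>, or if \<open>norm x\<close> dominates both \<open>D\<close>
  and \<open>norm y\<close>. In the remaining region \<open>r\<close> is at least a fixed multiple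
  of \<open>D\<close>; there the kernel and its Taylor polynomial are estimated separately, and all
  losses are absorbed by powers of \<open>r / D\<close>.

  The positive exponent \<delta> is the gap between \<open>K\<close> and the order of the first
  neglected Taylor term. The gap exists because both truncation indices are rounded down, and it is
  what improves boundedness to the \<open>o\<close> term.\<close>

abbreviation nn_integral_real :: "('a::euclidean_space => real) => ennreal" (binder "\<I>" 10)
 where "nn_integral_real f \<equiv> \<integral>\<^sup>+ x. ennreal (f x) \<partial>lborel"

abbreviation nn_integral_lborel :: "('a::euclidean_space => ennreal) => ennreal" (binder "\<N>" 10)
 where "nn_integral_lborel f \<equiv> \<integral>\<^sup>+ x. f x \<partial>lborel"

abbreviation tint :: "real => (real => ennreal) => ennreal" where
 "tint t h \<equiv> \<integral>\<^sup>+ s\<in>{0<..<t}. h s \<partial>lborel"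

abbreviation cx :: "real => complex" where "cx \<equiv> complex_of_real"

abbreviation expi :: "real => complex" where "expi u \<equiv> exp (\<i> * cx u)"

section \<open>Integrals of powers and of stretched exponentials\<close>

lemma nn_integral_powr_tail:
 fixes D \<epsilon> :: real
 assumes "D > 0" "\<epsilon> > 0"
 shows "(\<integral>\<^sup>+ t\<in>{0..}. ennreal ((D + t) powr (-(1 + \<epsilon>))) \<partial>lborel) = ennreal (D powr (-\<epsilon>) / \<epsilon>)"
proof -
 have "(\<N> t. ennreal ((D + t) powr (-(1 + \<epsilon>))) * indicator {0..} t)
   = ennreal (0 - (- ((D + 0) powr (-\<epsilon>) / \<epsilon>)))"
 proof (rule nn_integral_FTC_atLeast)
  fix x :: real assume "0 <= x"
  then show "((%x. - ((D + x) powr (-\<epsilon>) / \<epsilon>)) has_real_derivative (D + x) powr (-(1 + \<epsilon>))) (at x)"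
   using assms by (auto intro!: derivative_eq_intros simp: powr_diff powr_minus_divide powr_add divide_simps)
 next
  have "((%x. (D + x) powr (-\<epsilon>)) \<longlongrightarrow> 0) at_top"
   using assms by (intro tendsto_neg_powr filterlim_tendsto_add_at_top[OF tendsto_const] filterlim_ident) auto
  then have "((%x. - ((D + x) powr (-\<epsilon>) / \<epsilon>)) \<longlongrightarrow> - (0 / \<epsilon>)) at_top"
   using assms by (intro tendsto_intros) auto
  then show "((%x. - ((D + x) powr (-\<epsilon>) / \<epsilon>)) \<longlongrightarrow> 0) at_top" by simp
 qed auto
 then show ?thesis by simp
qed

lemma nn_integral_powr_abs_tail:
 fixes D \<epsilon> :: real
 assumes "D > 0" "\<epsilon> > 0"
 shows "(\<I> t. (D + \<bar>t\<bar>) powr (-(1 + \<epsilon>))) <= ennreal (2 / \<epsilon> * D powr (-\<epsilon>))"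
proof -
 let ?A = "D powr (-\<epsilon>) / \<epsilon>"
 let ?f = "%t. ennreal ((D + \<bar>t\<bar>) powr (-(1 + \<epsilon>)))"
 have "(\<N> t. ?f t) <= (\<N> t. ?f t * indicator {0..} t + ?f t * indicator {..0} t)"
  by (intro nn_integral_mono) (auto simp: indicator_def)
 also have "... = (\<N> t. ?f t * indicator {0..} t) + (\<N> t. ?f t * indicator {..0} t)"
  by (intro nn_integral_add) auto
 also have "(\<N> t. ?f t * indicator {..0} t) = (\<N> t. ?f t * indicator {0..} t)"
  using nn_integral_real_affine[of "%t. ?f t * indicator {..0} t" "-1" 0]
  by (simp add: indicator_def cong: nn_integral_cong_simp)
 also have "(\<N> t. ?f t * indicator {0..} t) = ennreal ?A"
  unfolding nn_integral_powr_tail[OF assms, symmetric] by (intro nn_integral_cong) (auto simp: indicator_def)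
 also have "ennreal ?A + ennreal ?A = ennreal (2 / \<epsilon> * D powr (-\<epsilon>))"
  using assms by (subst ennreal_plus[symmetric]) auto
 finally show ?thesis .
qed

text \<open>The exponent is shared among the coordinates: \<open>-(N + \<delta>)\<close> is
  \<open>N\<close> times \<open>-(1 + \<epsilon>)\<close> with
  \<open>\<epsilon> = \<delta> / N\<close>, and in each factor \<open>norm x\<close> may be lowered
  to one coordinate. This leaves a product of one-dimensional integrals and replaces polar
  coordinates.\<close>

lemma nn_integral_radial_powr:
 fixes \<delta> :: real
 assumes "\<delta> > 0"
 shows "\<exists>C>0. \<forall>D>0. (\<I> (x::real^'n). (D + norm x) powr (-(real CARD('n) + \<delta>)))
     <= ennreal (C * D powr (-\<delta>))"
proof (intro exI conjI allI impI)
 let ?N = "real CARD('n)"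
 let ?\<epsilon> = "\<delta> / ?N"
 have N: "?N > 0" by simp
 show "(2 / ?\<epsilon>) ^ CARD('n) > 0" using assms N by simp
 fix D :: real assume D: "D > 0"
 have "(\<I> (x::real^'n). (D + norm x) powr (-(?N + \<delta>)))
   <= (\<N> (x::real^'n). (\<Prod>b\<in>Basis. ennreal ((D + \<bar>x \<bullet> b\<bar>) powr (-(1 + ?\<epsilon>)))))"
 proof (intro nn_integral_mono)
  fix x :: "real^'n"
  have "(D + norm x) powr (-(?N + \<delta>)) = (\<Prod>b\<in>(Basis::(real^'n) set). (D + norm x) powr (-(1 + ?\<epsilon>)))"
  proof -
   have "?N * (-(1 + ?\<epsilon>)) = -(?N + \<delta>)" using N by (simp add: field_simps)
   then have "((D + norm x) powr (-(1 + ?\<epsilon>))) powr ?N = (D + norm x) powr (-(?N + \<delta>))"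
    by (simp only: powr_powr mult.commute)
   then show ?thesis
    using powr_realpow[of "(D + norm x) powr (-(1 + ?\<epsilon>))" "CARD('n)"] D
    using add_pos_nonneg[OF D norm_ge_zero[of x]] by (simp only: prod_constant) simp
  qed
  also have "... <= (\<Prod>b\<in>(Basis::(real^'n) set). (D + \<bar>x \<bullet> b\<bar>) powr (-(1 + ?\<epsilon>)))"
   using D assms N by (intro prod_mono conjI powr_mono2' add_left_mono Basis_le_norm)
     (auto intro: order_trans[of _ "0::real"])
  finally show "ennreal ((D + norm x) powr (-(?N + \<delta>)))
    <= (\<Prod>b\<in>(Basis::(real^'n) set). ennreal ((D + \<bar>x \<bullet> b\<bar>) powr (-(1 + ?\<epsilon>))))"
   by (subst prod_ennreal) (auto intro: ennreal_leI)
 qed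
 also have "... = (\<Prod>b\<in>(Basis::(real^'n) set). \<integral>\<^sup>+ t. ennreal ((D + \<bar>t\<bar>) powr (-(1 + ?\<epsilon>))) \<partial>lborel)"
  by (rule nn_integral_lborel_prod) auto
 also have "... <= (\<Prod>b\<in>(Basis::(real^'n) set). ennreal (2 / ?\<epsilon> * D powr (-?\<epsilon>)))"
  using D assms N by (intro prod_mono_ennreal nn_integral_powr_abs_tail) auto
 also have "... = ennreal ((2 / ?\<epsilon>) ^ CARD('n) * D powr (-\<delta>))"
 proof -
  have "(D powr (-?\<epsilon>)) ^ CARD('n) = D powr (-\<delta>)"
   using D powr_realpow[of "D powr (-?\<epsilon>)" "CARD('n)"] by (simp add: powr_powr)
  then show ?thesis
   using D assms by (simp add: ennreal_power power_mult_distrib power_divide)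
 qed
 finally show "(\<I> (x::real^'n). (D + norm x) powr (-(?N + \<delta>)))
   <= ennreal ((2 / ?\<epsilon>) ^ CARD('n) * D powr (-\<delta>))" .
qed

lemma powr_exp_bounded:
 fixes p th c :: real
 assumes "th > 0" "c > 0"
 shows "\<exists>C>0. \<forall>u\<ge>0. (1 + u) powr p * exp (- c * u powr th) <= C"
proof -
 have lim: "((%u. (1 + u) powr p * exp (- c * u powr th)) \<longlongrightarrow> 0) at_top"
  using assms by real_asymp
 then obtain U where U: "!!u. u >= U ==> (1 + u) powr p * exp (- c * u powr th) <= 1"
  using order_tendstoD(2)[OF lim, of 1] unfolding eventually_at_top_linorder
  by (auto intro: less_imp_le)
 have "u >= 0 ==> (1 + u) powr p * exp (- c * u powr th) <= 1 + (1 + max U 0) powr \<bar>p\<bar>" for u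
 proof (cases "u >= U")
  case True then show ?thesis using U[of u] by (smt (verit) powr_ge_zero)
 next
  case False
  assume u: "u >= 0"
  have "(1 + u) powr p * exp (- c * u powr th) <= (1 + u) powr p * 1"
   using assms by (intro mult_left_mono) auto
  also have "... <= (1 + u) powr \<bar>p\<bar>" using u by (simp add: powr_mono)
  also have "... <= (1 + max U 0) powr \<bar>p\<bar>" using u False by (intro powr_mono2) auto
  finally show ?thesis by simp
 qed
 then show ?thesis by (intro exI[of _ "1 + (1 + max U 0) powr \<bar>p\<bar>"]) (auto simp: add_pos_nonneg)
qed

lemma nn_integral_powr_exp:
 fixes n th :: real
 assumes "th > 0" "n >= 0"
 shows "\<exists>C>0. \<forall>tau>0. (\<I> (xi::real^'n). norm xi powr n * exp (- tau * norm xi powr th))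
     <= ennreal (C * tau powr (- (real CARD('n) + n) / th))"
proof -
 let ?N = "real CARD('n)"
 \<comment> \<open>Apart from \<open>n\<close>, which compensates \<open>u powr n\<close>, the
   exponent contains \<open>N + 1\<close>, enough for integrability over the whole space.\<close>
 obtain C1 where C1: "C1 > 0" "!!u. u >= 0 ==> (1 + u) powr (n + ?N + 1) * exp (- 1 * u powr th) <= C1"
  using powr_exp_bounded[of th 1 "n + ?N + 1"] assms by auto
 obtain C2 where C2: "C2 > 0" "!!D. D > 0 ==>
   (\<I> (x::real^'n). (D + norm x) powr (-(?N + 1))) <= ennreal (C2 * D powr (-1))"
  using nn_integral_radial_powr[where 'n='n, of 1] by auto
 show ?thesis
 proof (intro exI[of _ "C1 * C2"] conjI allI impI)
  show "C1 * C2 > 0" using C1 C2 by simp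
  fix tau :: real assume t: "tau > 0"
  \<comment> \<open>The length at which \<open>tau * norm xi powr th\<close> equals
    \<open>1\<close>. In the variable \<open>u = norm xi / D\<close> the exponential no longer
    depends on \<open>tau\<close>.\<close>
  define D where "D = tau powr (-1/th)"
  have D: "D > 0" using t by (simp add: D_def)
  have "(\<I> (xi::real^'n). norm xi powr n * exp (- tau * norm xi powr th))
   <= (\<N> (xi::real^'n). ennreal (C1 * D powr (n + ?N + 1)) * ennreal ((D + norm xi) powr (-(?N + 1))))"
  proof (intro nn_integral_mono)
   fix xi :: "real^'n"
   define u where "u = norm xi / D"
   have u: "u >= 0" using D by (simp add: u_def)
   have nx: "norm xi = u * D" using D by (simp add: u_def)
   have "tau * norm xi powr th = u powr th"
    using t u assms D unfolding nx D_def by (simp add: powr_mult powr_divide powr_powr powr_minus_divide)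
   then have e: "exp (- tau * norm xi powr th) = exp (- 1 * u powr th)" by simp
   have "u powr n * exp (- 1 * u powr th) = (u powr n * (1+u) powr (-(n + ?N + 1))) * ((1 + u) powr (n + ?N + 1) * exp (- 1 * u powr th))"
    using u by (subst powr_minus) (simp add: field_simps)
   also have "... <= (u powr n * (1+u) powr (-(n + ?N + 1))) * C1"
    using C1(2)[OF u] by (intro mult_left_mono) auto
   also have "... <= ((1+u) powr n * (1+u) powr (-(n + ?N + 1))) * C1"
    using u C1 assms by (intro mult_right_mono powr_mono2) auto
   also have "(1+u) powr n * (1+u) powr (-(n + ?N + 1)) = (1+u) powr (-(?N + 1))"
    using u by (simp add: powr_add[symmetric])
   finally have *: "u powr n * exp (- 1 * u powr th) <= C1 * (1+u) powr (-(?N + 1))" by (simp add: mult.commute)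
   have "norm xi powr n * exp (- tau * norm xi powr th) = D powr n * (u powr n * exp (- 1 * u powr th))"
    unfolding e using u D by (simp add: nx powr_mult)
   also have "... <= D powr n * (C1 * (1+u) powr (-(?N + 1)))"
    using * by (intro mult_left_mono) auto
   also have "(1 + u) = (D + norm xi) / D" using D by (simp add: u_def field_simps)
   also have "((D + norm xi) / D) powr (-(?N + 1)) = (D + norm xi) powr (-(?N + 1)) * D powr (?N + 1)"
    using D powr_add[of D "?N + 1" "-(?N+1)"] by (subst powr_divide) (auto simp: divide_simps)
   finally have "norm xi powr n * exp (- tau * norm xi powr th)
     <= (C1 * D powr (n + ?N + 1)) * (D + norm xi) powr (-(?N + 1))"
    using D by (simp add: powr_add mult_ac)
   then show "ennreal (norm xi powr n * exp (- tau * norm xi powr th))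
     <= ennreal (C1 * D powr (n + ?N + 1)) * ennreal ((D + norm xi) powr (-(?N + 1)))"
    using C1 D by (subst ennreal_mult[symmetric]) (auto intro!: ennreal_leI)
  qed
  also have "... = ennreal (C1 * D powr (n + ?N + 1)) * (\<I> (xi::real^'n). (D + norm xi) powr (-(?N + 1)))"
   by (rule nn_integral_cmult) auto
  also have "... <= ennreal (C1 * D powr (n + ?N + 1)) * ennreal (C2 * D powr (-1))"
   by (intro mult_left_mono C2 D) auto
  also have "... = ennreal (C1 * C2 * (D powr (n + ?N + 1) * D powr (-1)))"
   using C1 C2 D by (subst ennreal_mult[symmetric]) (auto simp: mult_ac)
  also have "D powr (n + ?N + 1) * D powr (-1) = tau powr (- (?N + n) / th)"
  proof -
   have "(-1/th) * (n + ?N + 1) + (-1/th) * (-1) = - (?N + n) / th"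
    using assms by (simp add: field_simps)
   then show ?thesis by (simp only: D_def powr_powr powr_add[symmetric])
  qed
  finally show "(\<I> (xi::real^'n). norm xi powr n * exp (- tau * norm xi powr th))
   <= ennreal (C1 * C2 * tau powr (- (?N + n) / th))" .
 qed
qed

section \<open>Differentiation under the integral sign\<close>

lemma has_vector_derivative_iff_quotient:
 fixes f :: "real => 'a::real_normed_vector"
 shows "(f has_vector_derivative D) (at s0) \<longleftrightarrow> ((%s. (f s - f s0) /\<^sub>R (s - s0)) \<longlongrightarrow> D) (at s0)"
proof -
 have *: "norm ((1 / norm (s - s0)) *\<^sub>R (f s - (f s0 + (s - s0) *\<^sub>R D))) = norm ((f s - f s0) /\<^sub>R (s - s0) - D)"
  if "s \<noteq> s0" for s
 proof -
  have "(f s - f s0) /\<^sub>R (s - s0) - D = (1 / (s - s0)) *\<^sub>R (f s - (f s0 + (s - s0) *\<^sub>R D))"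
   using that by (simp add: diff_diff_eq[symmetric] scaleR_diff_right[of _ "f s - f s0" "(s - s0) *\<^sub>R D"] inverse_eq_divide)
  then show ?thesis by (simp only: norm_scaleR) simp
 qed
 have "(f has_vector_derivative D) (at s0) \<longleftrightarrow>
   ((%s. norm ((1 / norm (s - s0)) *\<^sub>R (f s - (f s0 + (s - s0) *\<^sub>R D)))) \<longlongrightarrow> 0) (at s0)"
  unfolding has_vector_derivative_def has_derivative_within tendsto_norm_zero_iff
  by (simp add: bounded_linear_scaleR_left)
 also have "... \<longleftrightarrow> ((%s. norm ((f s - f s0) /\<^sub>R (s - s0) - D)) \<longlongrightarrow> 0) (at s0)"
  by (intro Lim_cong_within) (simp_all only: * not_False_eq_True)
 also have "... \<longleftrightarrow> ((%s. (f s - f s0) /\<^sub>R (s - s0)) \<longlongrightarrow> D) (at s0)"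
  by (simp add: tendsto_norm_zero_iff LIM_zero_iff)
 finally show ?thesis .
qed

text \<open>By the mean value inequality the bound \<open>B\<close> on the derivatives also bounds
  the difference quotients, so dominated convergence applies along every sequence tending to
  \<open>s0\<close>.\<close>

lemma has_vector_derivative_integral:
 fixes f :: "real => 'a => complex"
 assumes s0: "s0 \<in> {a<..<b}"
  and int: "!!s. s \<in> {a<..<b} ==> integrable M (f s)"
  and der: "!!s x. s \<in> {a<..<b} ==> ((%s. f s x) has_vector_derivative f' s x) (at s)"
  and bnd: "!!s x. s \<in> {a<..<b} ==> norm (f' s x) <= B x"
  and B: "integrable M B" and meas: "f' s0 \<in> borel_measurable M"
 shows "((%s. LINT x|M. f s x) has_vector_derivative (LINT x|M. f' s0 x)) (at s0)"
proof -
 let ?q = "%s x. (f s x - f s0 x) /\<^sub>R (s - s0)"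
 have 1: "((%s. LINT x|M. ?q s x) \<longlongrightarrow> (LINT x|M. f' s0 x)) (at s0)"
  unfolding tendsto_at_iff_sequentially comp_def
 proof (intro allI impI)
  fix X :: "nat => real" assume X: "\<forall>i. X i \<in> UNIV - {s0}" "X \<longlonglongrightarrow> s0"
  \<comment> \<open>The hypotheses are available only inside the interval, so the finitely many
    terms of the sequence that may lie outside are cut off; the limit does not change.\<close>
  obtain n0 where n0: "!!n. n >= n0 ==> X n \<in> {a<..<b}"
   using topological_tendstoD[OF X(2), of "{a<..<b}"] s0 by (auto simp: eventually_sequentially)
  have "(%n. LINT x|M. ?q (X (n + n0)) x) \<longlonglongrightarrow> (LINT x|M. f' s0 x)"
  proof (rule integral_dominated_convergence[where w=B])
   show "AE x in M. (%n. ?q (X (n + n0)) x) \<longlonglongrightarrow> f' s0 x"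
   proof (rule AE_I2)
    fix x
    have "((%s. f s x) has_vector_derivative f' s0 x) (at s0)" by (rule der[OF s0])
    then have "((%s. ?q s x) \<longlongrightarrow> f' s0 x) (at s0)"
     by (simp add: has_vector_derivative_iff_quotient)
    then show "(%n. ?q (X (n + n0)) x) \<longlonglongrightarrow> f' s0 x"
     using X(1) LIMSEQ_ignore_initial_segment[OF X(2), of n0]
     unfolding tendsto_at_iff_sequentially comp_def by auto
   qed
   show "AE x in M. norm (?q (X (n + n0)) x) <= B x" for n
   proof (rule AE_I2)
    fix x
    have "norm (f (X (n + n0)) x - f s0 x) <= B x * norm (X (n+n0) - s0)"
    proof (rule differentiable_bound[of "{a<..<b}" _ "%s h. h *\<^sub>R f' s x"])
     show "X (n + n0) \<in> {a<..<b}" by (rule n0) simp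
     show "((%s. f s x) has_derivative (%h. h *\<^sub>R f' s x)) (at s within {a<..<b})"
      if "s \<in> {a<..<b}" for s
      using der[OF that, of x] has_derivative_at_withinI unfolding has_vector_derivative_def by blast
     show "onorm (%h. h *\<^sub>R f' s x) <= B x" if "s \<in> {a<..<b}" for s
      using mult_right_mono[OF bnd[OF that, of x] abs_ge_zero]
      by (intro onorm_le) (simp add: mult.commute)
    qed (use s0 in auto)
    then show "norm (?q (X (n + n0)) x) <= B x"
     using X(1) by (simp only: norm_scaleR norm_inverse) (simp add: field_simps)
   qed
  qed (use int n0 s0 meas B in \<open>auto intro!: borel_measurable_integrable Bochner_Integration.integrable_diff integrable_scaleR_right\<close>)
  then show "(%n. LINT x|M. ?q (X n) x) \<longlonglongrightarrow> (LINT x|M. f' s0 x)"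
   by (rule LIMSEQ_offset)
 qed
 have ev: "\<forall>\<^sub>F s in at s0. s \<in> {a<..<b}"
  using s0 by (intro eventually_at_in_open') auto
 show ?thesis
  unfolding has_vector_derivative_iff_quotient
 proof (rule Lim_transform_eventually[OF 1])
  show "\<forall>\<^sub>F s in at s0. (LINT x|M. ?q s x) = ((LINT x|M. f s x) - (LINT x|M. f s0 x)) /\<^sub>R (s - s0)"
   using ev by eventually_elim (use int s0 in \<open>simp add: Bochner_Integration.integral_diff\<close>)
 qed
qed

section \<open>Fourier integrals\<close>

text \<open>Finite moments of all orders take the place of Schwartz functions, since
  \<open>norm xi powr th\<close> is not smooth at the origin. The class is closed under
  multiplication by functions of polynomial growth, hence under the differentiations of
  \<open>Fou\<close> below.\<close>

definition rapid :: "(real^'n => complex) => bool" where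
 "rapid Q \<longleftrightarrow> Q \<in> borel_measurable borel \<and> (\<forall>k::nat. integrable lborel (%xi. (1 + norm xi) ^ k * norm (Q xi)))"

definition Fou :: "(real^'n => complex) => real^'n => real" where
 "Fou Q x = (2 * pi) powr (- real CARD('n)) * Re (LINT xi|lborel. expi (x \<bullet> xi) * Q xi)"

lemma rapid_measurable: "rapid Q ==> Q \<in> borel_measurable borel"
 by (simp add: rapid_def)

lemma rapid_mult:
 assumes Q: "rapid Q" and w: "w \<in> borel_measurable borel" and b: "!!xi. norm (w xi) <= C * (1 + norm xi) ^ k"
 shows "rapid (%xi. w xi * Q xi)"
 unfolding rapid_def
proof (intro conjI allI)
 have [measurable]: "Q \<in> borel_measurable borel" "w \<in> borel_measurable borel"
  using Q w by (auto simp: rapid_def)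
 show "(%xi. w xi * Q xi) \<in> borel_measurable borel" by measurable
 fix j :: nat
 have "integrable lborel (%xi. C * ((1 + norm xi) ^ (j + k) * norm (Q xi)))"
  using Q by (simp add: rapid_def)
 then show "integrable lborel (%xi. (1 + norm xi) ^ j * norm (w xi * Q xi))"
 proof (rule Bochner_Integration.integrable_bound)
  show "(%xi. (1 + norm xi) ^ j * norm (w xi * Q xi)) \<in> borel_measurable lborel"
   by measurable
  show "AE xi in lborel. norm ((1 + norm xi) ^ j * norm (w xi * Q xi)) <= norm (C * ((1 + norm xi) ^ (j + k) * norm (Q xi)))"
  proof (rule AE_I2)
   fix xi :: "real^'a"
   have "(1 + norm xi) ^ j * norm (w xi * Q xi) <= (1 + norm xi) ^ j * ((C * (1 + norm xi) ^ k) * norm (Q xi))"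
    unfolding norm_mult by (intro mult_left_mono mult_right_mono b) auto
   also have "... = C * ((1 + norm xi) ^ (j + k) * norm (Q xi))" by (simp add: power_add mult_ac)
   finally have "(1 + norm xi) ^ j * norm (w xi * Q xi) <= ..." .
   moreover have "norm ((1 + norm xi) ^ j * norm (w xi * Q xi)) = (1 + norm xi) ^ j * norm (w xi * Q xi)"
    by (simp add: abs_mult)
   ultimately show "norm ((1 + norm xi) ^ j * norm (w xi * Q xi)) <= norm (C * ((1 + norm xi) ^ (j + k) * norm (Q xi)))"
    by (metis abs_ge_self order_trans real_norm_def)
  qed
 qed
qed

lemma rapid_integrable: assumes "rapid Q" shows "integrable lborel Q"
proof -
 have "integrable lborel (%xi. (1 + norm xi) ^ 0 * norm (Q xi))" using assms unfolding rapid_def by blast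
 then show ?thesis using assms by (subst integrable_norm_iff[symmetric]) (auto simp: rapid_def)
qed

lemma rapid_exp_integrable:
 assumes "rapid Q" shows "integrable lborel (%xi. expi (x \<bullet> xi) * Q xi)"
proof -
 have "rapid (%xi. expi (x \<bullet> xi) * Q xi)"
  by (rule rapid_mult[OF assms, of _ 1 0]) auto
 then show ?thesis by (rule rapid_integrable)
qed

lemma rapid_exp:
 assumes "th > 0" "tau > 0"
 shows "rapid (%xi::real^'n. cx (exp (- tau * norm xi powr th)))"
 unfolding rapid_def
proof (intro conjI allI)
 fix k :: nat
 let ?N = "real CARD('n)"
 obtain C where C: "C > 0" "!!u. u >= 0 ==> (1 + u) powr (real k + ?N + 1) * exp (- tau * u powr th) <= C"
  using powr_exp_bounded[of th tau "real k + ?N + 1"] assms by auto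
 obtain C2 where C2: "(\<I> (x::real^'n). (1 + norm x) powr (-(?N + 1))) <= ennreal (C2 * 1 powr (-1))"
  using nn_integral_radial_powr[where 'n='n, of 1] zero_less_one by blast
 have "integrable lborel (%x::real^'n. (1 + norm x) powr (-(?N + 1)))"
  using C2 by (intro integrableI_bounded) (auto intro: order_le_less_trans)
 then have "integrable lborel (%x::real^'n. C * (1 + norm x) powr (-(?N + 1)))" by simp
 then show "integrable lborel (%xi::real^'n. (1 + norm xi) ^ k * norm (cx (exp (- tau * norm xi powr th))))"
 proof (rule Bochner_Integration.integrable_bound)
  show "AE xi in lborel. norm ((1 + norm (xi::real^'n)) ^ k * norm (cx (exp (- tau * norm xi powr th))))
    <= norm (C * (1 + norm xi) powr (-(?N + 1)))"
  proof (rule AE_I2)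
   fix xi :: "real^'n"
   have pos: "1 + norm xi > 0" by (simp add: add_pos_nonneg)
   have "(1 + norm xi) ^ k = (1 + norm xi) powr (-(?N + 1)) * (1 + norm xi) powr (real k + ?N + 1)"
    unfolding powr_add[symmetric] using pos by (simp add: powr_realpow)
   then have "(1 + norm xi) ^ k * exp (- tau * norm xi powr th)
     = (1 + norm xi) powr (-(?N + 1)) * ((1 + norm xi) powr (real k + ?N + 1) * exp (- tau * norm xi powr th))"
    by (simp only: mult.assoc)
   also have "... <= (1 + norm xi) powr (-(?N + 1)) * C"
    by (intro mult_left_mono C) auto
   finally show "norm ((1 + norm xi) ^ k * norm (cx (exp (- tau * norm xi powr th))))
     <= norm (C * (1 + norm xi) powr (-(?N + 1)))"
    using C(1) by (simp add: abs_mult mult.commute)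
  qed
 qed auto
qed auto

lemma Fou_has_real_derivative:
 assumes "rapid Q"
 shows "((%s. Fou Q (x + s *\<^sub>R v)) has_real_derivative Fou (%xi. \<i> * cx (v \<bullet> xi) * Q xi) (x + s *\<^sub>R v)) (at s)"
proof -
 have [measurable]: "Q \<in> borel_measurable borel"
  using assms by (rule rapid_measurable)
 have "((%s. LINT xi|lborel. expi ((x + s *\<^sub>R v) \<bullet> xi) * Q xi) has_vector_derivative
   (LINT xi|lborel. expi ((x + s *\<^sub>R v) \<bullet> xi) * (\<i> * cx (v \<bullet> xi) * Q xi))) (at s)"
 proof (rule has_vector_derivative_integral[where a="s - 1" and b="s + 1" and B="%xi. norm v * ((1 + norm xi) ^ 1 * norm (Q xi))"])
  fix r xi
  have "((%z. exp (\<i> * (cx (x \<bullet> xi) + z * cx (v \<bullet> xi))) * Q xi) has_field_derivative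
   exp (\<i> * (cx (x \<bullet> xi) + of_real r * cx (v \<bullet> xi))) * (\<i> * cx (v \<bullet> xi) * Q xi)) (at (of_real r))"
   by (auto intro!: derivative_eq_intros simp: algebra_simps)
  from has_vector_derivative_real_field[OF this]
  show "((%s. expi ((x + s *\<^sub>R v) \<bullet> xi) * Q xi) has_vector_derivative
   expi ((x + r *\<^sub>R v) \<bullet> xi) * (\<i> * cx (v \<bullet> xi) * Q xi)) (at r)"
   by (simp add: inner_add_left)
  have "\<bar>v \<bullet> xi\<bar> <= norm v * (1 + norm xi)"
   using Cauchy_Schwarz_ineq2[of v xi] by (simp add: algebra_simps add_increasing)
  then show "cmod (expi ((x + r *\<^sub>R v) \<bullet> xi) * (\<i> * cx (v \<bullet> xi) * Q xi))
   <= norm v * ((1 + norm xi) ^ 1 * cmod (Q xi))"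
   by (auto simp: norm_mult mult.assoc[symmetric] intro!: mult_right_mono)
 next
  show "integrable lborel (%xi. norm v * ((1 + norm xi) ^ 1 * norm (Q xi)))"
   using assms unfolding rapid_def by (intro integrable_mult_right) blast
  show "(%xi. expi ((x + s *\<^sub>R v) \<bullet> xi) * (\<i> * cx (v \<bullet> xi) * Q xi)) \<in> borel_measurable lborel"
   by measurable
 qed (auto intro: rapid_exp_integrable assms)
 from bounded_linear.has_vector_derivative[OF bounded_linear_Re this]
 show ?thesis
  unfolding Fou_def has_real_derivative_iff_has_vector_derivative[symmetric]
  by (rule DERIV_cmult)
qed

lemma Fou_time_derivative:
 fixes Q :: "real^'n => complex"
 assumes rap: "!!tau. tau > 0 ==> rapid (%xi. cx (exp (- tau * w xi)) * Q xi)"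
  and w: "w \<in> borel_measurable borel" "!!xi. 0 <= w xi" "!!xi. w xi <= (1 + norm xi) ^ k"
  and t: "tau > 0" and Q: "Q \<in> borel_measurable borel"
 shows "((%tau. Fou (%xi. cx (exp (- tau * w xi)) * Q xi) x) has_real_derivative
     Fou (%xi. cx (exp (- tau * w xi)) * (cx (- w xi) * Q xi)) x) (at tau)"
proof -
 note [measurable] = w(1) Q
 have "((%tau. LINT xi|lborel. expi (x \<bullet> xi) * (cx (exp (- tau * w xi)) * Q xi)) has_vector_derivative
   (LINT xi|lborel. expi (x \<bullet> xi) * (cx (exp (- tau * w xi)) * (cx (- w xi) * Q xi)))) (at tau)"
 \<comment> \<open>On this interval around \<open>tau\<close> the exponential at time
   \<open>tau / 2\<close> dominates all the others, which gives one integrable majorant.\<close>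
 proof (rule has_vector_derivative_integral[where a="tau / 2" and b="2 * tau"
    and B="%xi. (1 + norm xi) ^ k * norm (cx (exp (- (tau / 2) * w xi)) * Q xi)"])
  fix r xi assume r: "r \<in> {tau / 2<..<2 * tau}"
  have "((%z. expi (x \<bullet> xi) * (exp (- z * of_real (w xi)) * Q xi)) has_field_derivative
   expi (x \<bullet> xi) * (exp (- of_real r * of_real (w xi)) * (cx (- w xi) * Q xi))) (at (of_real r))"
   by (auto intro!: derivative_eq_intros simp: algebra_simps)
  from has_vector_derivative_real_field[OF this]
  show "((%tau. expi (x \<bullet> xi) * (cx (exp (- tau * w xi)) * Q xi)) has_vector_derivative
   expi (x \<bullet> xi) * (cx (exp (- r * w xi)) * (cx (- w xi) * Q xi))) (at r)"
   by (simp add: exp_of_real[symmetric])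
  have "exp (- r * w xi) <= exp (- (tau / 2) * w xi)"
   using r mult_right_mono[of tau "r * 2" "w xi"] w(2)[of xi] by auto
  then have "exp (- r * w xi) * w xi <= exp (- (tau / 2) * w xi) * (1 + norm xi) ^ k"
   by (intro mult_mono w) auto
  then have "exp (- r * w xi) * w xi * norm (Q xi) <= exp (- (tau / 2) * w xi) * (1 + norm xi) ^ k * norm (Q xi)"
   by (rule mult_right_mono) auto
  then show "cmod (expi (x \<bullet> xi) * (cx (exp (- r * w xi)) * (cx (- w xi) * Q xi)))
   <= (1 + norm xi) ^ k * norm (cx (exp (- (tau / 2) * w xi)) * Q xi)"
   using w(2)[of xi] by (simp add: norm_mult mult_ac)
 next
  show "integrable lborel (%xi. (1 + norm xi) ^ k * norm (cx (exp (- (tau / 2) * w xi)) * Q xi))"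
   using rap[of "tau / 2"] t unfolding rapid_def by auto
 next
  fix r assume r: "r \<in> {tau / 2<..<2 * tau}"
  then have "r > 0" using t by auto
  then show "integrable lborel (%xi. expi (x \<bullet> xi) * (cx (exp (- r * w xi)) * Q xi))"
   by (intro rapid_exp_integrable rap)
 next
  show "(%xi. expi (x \<bullet> xi) * (cx (exp (- tau * w xi)) * (cx (- w xi) * Q xi)))
   \<in> borel_measurable lborel"
   by measurable
 qed (use t in auto)
 from bounded_linear.has_vector_derivative[OF bounded_linear_Re this]
 show ?thesis
  unfolding Fou_def has_real_derivative_iff_has_vector_derivative[symmetric]
  by (rule DERIV_cmult)
qed

lemma Fou_sum:
 assumes "finite A" "!!i. i \<in> A ==> rapid (Q i)"
 shows "Fou (%xi. \<Sum>i\<in>A. cx (c i) * Q i xi) x = (\<Sum>i\<in>A. c i * Fou (Q i) x)"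
proof -
 have "(LINT xi|lborel. expi (x \<bullet> xi) * (\<Sum>i\<in>A. cx (c i) * Q i xi))
   = (LINT xi|lborel. (\<Sum>i\<in>A. cx (c i) * (expi (x \<bullet> xi) * Q i xi)))"
  by (simp add: sum_distrib_left mult_ac)
 also have "... = (\<Sum>i\<in>A. cx (c i) * (LINT xi|lborel. expi (x \<bullet> xi) * Q i xi))"
  using assms by (subst Bochner_Integration.integral_sum) (auto intro!: rapid_exp_integrable)
 finally show ?thesis by (simp add: Fou_def sum_distrib_left mult_ac)
qed

section \<open>Kernel derivatives along a direction and in time\<close>

text \<open>\<open>J th j m x y t\<close> is the value at \<open>h = 0\<close> of \<open>(d/dh)\<^sup>j (d/dt)\<^sup>m G th (x - h y) t\<close>.\<close>

definition symb :: "real => nat => nat => real^'n => real^'n => complex" where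
 "symb th j m y xi = (- (\<i> * cx (y \<bullet> xi))) ^ j * cx ((- (norm xi powr th)) ^ m)"

definition J :: "real => nat => nat => real^'n => real^'n => real => real" where
 "J th j m x y tau = Fou (%xi. cx (exp (- tau * norm xi powr th)) * symb th j m y xi) x"

lemma symb_measurable [measurable]: "symb th j m y \<in> borel_measurable borel"
 unfolding symb_def by measurable

lemma norm_powr_le:
 assumes "0 < th" "th <= 2" shows "norm (xi::'a::real_normed_vector) powr th <= (1 + norm xi) ^ 2"
proof -
 have "norm xi powr th <= (1 + norm xi) powr th" using assms by (intro powr_mono2) auto
 also have "... <= (1 + norm xi) powr 2" using assms by (intro powr_mono) auto
 also have "... = (1 + norm xi) ^ 2" by (simp add: add_pos_nonneg powr_numeral)
 finally show ?thesis .
qed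

lemma norm_symb_le:
 assumes "0 < th" "th <= 2"
 shows "norm (symb th j m y xi) <= norm y ^ j * (1 + norm xi) ^ (j + 2 * m)"
proof -
 have "\<bar>y \<bullet> xi\<bar> <= norm y * (1 + norm xi)"
  using Cauchy_Schwarz_ineq2[of y xi] by (simp add: algebra_simps add_increasing)
 then have "\<bar>y \<bullet> xi\<bar> ^ j <= (norm y * (1 + norm xi)) ^ j" by (rule power_mono) simp
 moreover have "(norm xi powr th) ^ m <= ((1 + norm xi) ^ 2) ^ m"
  using norm_powr_le[OF assms] by (rule power_mono) simp
 ultimately have "\<bar>y \<bullet> xi\<bar> ^ j * (norm xi powr th) ^ m <= (norm y * (1 + norm xi)) ^ j * ((1 + norm xi) ^ 2) ^ m"
  by (rule mult_mono) auto
 then show ?thesis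
  by (simp add: symb_def norm_mult norm_power power_mult_distrib power_add power_mult[symmetric] mult_ac)
qed

lemma rapid_exp_mult:
 assumes "th > 0" "tau > 0" "Q \<in> borel_measurable borel" "!!xi. norm (Q xi) <= C * (1 + norm xi) ^ k"
 shows "rapid (%xi::real^'n. cx (exp (- tau * norm xi powr th)) * Q xi)"
 using rapid_mult[OF rapid_exp[OF assms(1,2)] assms(3,4)] by (simp add: mult.commute)

lemma rapid_exp_symb:
 assumes "0 < th" "th <= 2" "tau > 0"
 shows "rapid (%xi::real^'n. cx (exp (- tau * norm xi powr th)) * symb th j m y xi)"
 using assms by (intro rapid_exp_mult[where C="norm y ^ j" and k="j + 2 * m"] norm_symb_le) auto

lemma J_space_derivative:
 assumes "0 < th" "th <= 2" "tau > 0"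
 shows "((%h. J th j m (x - h *\<^sub>R y) y tau) has_real_derivative J th (Suc j) m (x - h *\<^sub>R y) y tau) (at h)"
 using Fou_has_real_derivative[OF rapid_exp_symb[OF assms, where j=j and m=m and y=y], where x=x and v="-y" and s=h]
 by (simp add: J_def symb_def mult_ac)

lemma J_time_derivative:
 assumes "0 < th" "th <= 2" "tau > 0"
 shows "((%tau. J th j m x y tau) has_real_derivative J th j (Suc m) x y tau) (at tau)"
 using Fou_time_derivative[where Q="symb th j m y" and w="%xi. norm xi powr th" and k=2 and x=x, OF rapid_exp_symb[OF assms(1,2)] _ _ norm_powr_le[OF assms(1,2)] assms(3)]
 by (simp add: J_def symb_def mult_ac)

lemma G_eq_Fou: "G th x tau = Fou (%xi. cx (exp (- tau * norm xi powr th))) x"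
 unfolding G_def Fou_def by (subst integral_completion) auto

lemma G_eq_J: "G th x tau = J th 0 0 x y tau"
 unfolding G_eq_Fou by (simp add: J_def symb_def)

section \<open>Multi-index derivatives and the functions \<open>g\<close>\<close>

text \<open>Each partial derivative multiplies the symbol by \<open>\<i> * xi $ a\<close>, so only
  the number of occurrences of each index matters and the list chosen in \<open>mi_deriv\<close> is
  immaterial. That the new symbol is again \<open>rapid\<close> is carried along because the next
  differentiation needs it.\<close>

lemma foldr_partial_deriv_Fou:
 fixes Q :: "real^'n => complex"
 assumes "rapid Q"
 shows "rapid (%xi. (\<Prod>i\<in>UNIV. (\<i> * cx (xi $ i)) ^ count_list is i) * Q xi) \<and>
  foldr partial_deriv is (Fou Q) = Fou (%xi. (\<Prod>i\<in>UNIV. (\<i> * cx (xi $ i)) ^ count_list is i) * Q xi)"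
proof (induction "is")
 case Nil then show ?case using assms by simp
next
 case (Cons a "is")
 let ?Q = "%xi. (\<Prod>i\<in>UNIV. (\<i> * cx (xi $ i)) ^ count_list is i) * Q xi"
 have *: "(\<Prod>i\<in>UNIV. (\<i> * cx (xi $ i)) ^ count_list (a # is) i) * Q xi
   = \<i> * cx (xi $ a) * ?Q xi" for xi :: "real^'n"
 proof -
  have "(\<Prod>i\<in>UNIV. (\<i> * cx (xi $ i)) ^ count_list (a # is) i)
    = (\<Prod>i\<in>UNIV. (if a = i then \<i> * cx (xi $ i) else 1) * (\<i> * cx (xi $ i)) ^ count_list is i)"
   by (intro prod.cong) auto
  also have "... = \<i> * cx (xi $ a) * (\<Prod>i\<in>UNIV. (\<i> * cx (xi $ i)) ^ count_list is i)"
   by (simp add: prod.distrib prod.delta')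
  finally show ?thesis by simp
 qed
 have rap: "rapid ?Q" using Cons by blast
 have "rapid (%xi. (\<i> * cx (xi $ a)) * ?Q xi)"
  by (rule rapid_mult[OF rap, of _ 1 1]) (auto simp: norm_mult intro: order_trans[OF component_le_norm_cart])
 moreover have "partial_deriv a (Fou ?Q) = Fou (%xi. (\<i> * cx (xi $ a)) * ?Q xi)"
 proof
  fix x
  have "((%s. Fou ?Q (x + s *\<^sub>R axis a 1)) has_real_derivative
   Fou (%xi. \<i> * cx (axis a 1 \<bullet> xi) * ?Q xi) (x + 0 *\<^sub>R axis a 1)) (at 0)"
   by (rule Fou_has_real_derivative[OF rap])
  from DERIV_imp_deriv[OF this]
  show "partial_deriv a (Fou ?Q) x = Fou (%xi. (\<i> * cx (xi $ a)) * ?Q xi) x"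
   by (simp add: partial_deriv_def inner_axis')
 qed
 ultimately show ?case using Cons by (simp only: foldr_Cons comp_def *) 
qed

text \<open>Ensures that the choice operator in \<open>mi_deriv\<close> really returns a list with
  the prescribed multiplicities.\<close>

lemma ex_count_list: "\<exists>is. \<forall>i::'n::finite. count_list is i = \<alpha> i"
proof -
 obtain xs :: "'n list" where xs: "mset xs = (\<Sum>i\<in>UNIV. replicate_mset (\<alpha> i) i)" using ex_mset by blast
 have "count_list xs i = \<alpha> i" for i
 proof -
  have "count_list xs i = count (\<Sum>i\<in>UNIV. replicate_mset (\<alpha> i) i) i" by (simp add: xs[symmetric] count_mset)
  also have "... = (\<Sum>k\<in>UNIV. if k = i then \<alpha> k else 0)" by (auto simp: count_sum intro!: sum.cong)
  finally show ?thesis by simp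
 qed
 then show ?thesis by blast
qed

lemma mi_deriv_Fou:
 fixes Q :: "real^'n => complex"
 assumes "rapid Q"
 shows "mi_deriv \<alpha> (Fou Q) = Fou (%xi. (\<Prod>i\<in>UNIV. (\<i> * cx (xi $ i)) ^ \<alpha> i) * Q xi)"
proof -
 have "\<forall>i. count_list (SOME is. \<forall>i. count_list is i = \<alpha> i) i = \<alpha> i"
  using someI_ex[OF ex_count_list[of \<alpha>]] .
 then show ?thesis
  unfolding mi_deriv_def foldr_partial_deriv_Fou[OF assms, THEN conjunct2] by simp
qed

lemma g_eq_Fou:
 fixes x :: "real^'n"
 assumes "0 < th" "th <= 2" "t > -1"
 shows "rapid (%xi. cx (exp (- (t + 1) * norm xi powr th)) * (cx ((- (norm xi powr th)) ^ m) * (\<Prod>i\<in>UNIV. (\<i> * cx (xi $ i)) ^ \<alpha> i)))" (is ?th1)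
  and "g th \<alpha> m x t = (-1) ^ (mi_abs \<alpha> + m) / (mi_fact \<alpha> * fact m) *
  Fou (%xi. cx (exp (- (t + 1) * norm xi powr th)) * (cx ((- (norm xi powr th)) ^ m) * (\<Prod>i\<in>UNIV. (\<i> * cx (xi $ i)) ^ \<alpha> i))) x" (is ?th2)
proof -
 let ?P = "%m (xi::real^'n). cx ((- (norm xi powr th)) ^ m) * (\<Prod>i\<in>UNIV. (\<i> * cx (xi $ i)) ^ \<alpha> i)"
 have meas: "?P m \<in> borel_measurable borel" for m by measurable
 have rap: "rapid (%xi. cx (exp (- tau * norm xi powr th)) * ?P m xi)" if "tau > 0" for tau m
 proof (rule rapid_exp_mult[OF assms(1) that meas, of _ 1 "2 * m + mi_abs \<alpha>"])
  fix xi :: "real^'n"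
  have "norm (\<Prod>i\<in>UNIV. (\<i> * cx (xi $ i)) ^ \<alpha> i) <= (\<Prod>i\<in>UNIV. (1 + norm xi) ^ \<alpha> i)"
   unfolding prod_norm[symmetric]
   by (intro prod_mono conjI) (auto simp: norm_power norm_mult intro!: power_mono order_trans[OF component_le_norm_cart])
  also have "... = (1 + norm xi) ^ mi_abs \<alpha>" by (simp add: mi_abs_def power_sum)
  finally have 1: "norm (\<Prod>i\<in>UNIV. (\<i> * cx (xi $ i)) ^ \<alpha> i) <= ..." .
  have "(norm xi powr th) ^ m <= ((1 + norm xi) ^ 2) ^ m"
   using norm_powr_le[OF assms(1,2)] by (rule power_mono) simp
  from mult_mono[OF this 1] show "norm (?P m xi) <= 1 * (1 + norm xi) ^ (2 * m + mi_abs \<alpha>)"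
   by (simp add: norm_mult norm_power power_add power_mult)
 qed
 show ?th1 using rap[of "t + 1" m] assms by simp
 have "(deriv ^^ m) (%tau. mi_deriv \<alpha> (%z. G th z tau) x) tau
  = Fou (%xi. cx (exp (- tau * norm xi powr th)) * ?P m xi) x" if "tau > 0" for tau
  using that
 proof (induction m arbitrary: tau)
  case 0
  have "(%z. G th z tau) = Fou (%xi. cx (exp (- tau * norm xi powr th)))" by (rule ext, rule G_eq_Fou)
  then have "mi_deriv \<alpha> (%z. G th z tau) = mi_deriv \<alpha> (Fou (%xi. cx (exp (- tau * norm xi powr th))))"
   by (rule arg_cong)
  then show ?case unfolding mi_deriv_Fou[OF rapid_exp[OF assms(1) 0]] by (simp add: mult.commute)
 next
  case (Suc m)
  \<comment> \<open>The induction hypothesis holds for positive times only. These form a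
    neighbourhood of \<open>tau\<close>, which is all that \<open>deriv\<close> sees.\<close>
  have ev: "\<forall>\<^sub>F r in nhds tau. r > 0" using Suc.prems by (intro eventually_nhds_in_open[of "{0<..}", simplified]) auto
  have "(deriv ^^ Suc m) (%tau. mi_deriv \<alpha> (%z. G th z tau) x) tau =
   deriv (%tau. Fou (%xi. cx (exp (- tau * norm xi powr th)) * ?P m xi) x) tau"
   unfolding funpow.simps comp_def
   by (rule deriv_cong_ev[OF _ refl]) (use ev in eventually_elim, rule Suc.IH)
  also have "... = Fou (%xi. cx (exp (- tau * norm xi powr th)) * (cx (- (norm xi powr th)) * ?P m xi)) x"
   by (rule DERIV_imp_deriv, rule Fou_time_derivative[where k=2])
    (use rap meas Suc.prems norm_powr_le[OF assms(1,2)] in auto)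
  finally show ?case by (simp add: mult_ac)
 qed
 from this[of "t + 1"] show ?th2 using assms by (simp add: g_def)
qed

lemma finite_mi_abs_eq: "finite {\<alpha> :: 'n::finite => nat. mi_abs \<alpha> = j}"
 by (rule finite_subset[OF _ finite_mi_abs_le[of "real j"]]) auto

text \<open>The multinomial theorem in divided form. The induction step multiplies by
  \<open>Suc j\<close>, which on the index set is the sum of the \<alpha> i. Each factor \<alpha> i
  cancels one factor of the factorial, and lowering that entry by one is a bijection onto the
  multi-indices of order \<open>j\<close>.\<close>

lemma multinomial_exponential:
 fixes a :: "'n::finite => complex"
 shows "(\<Sum>\<alpha> | mi_abs \<alpha> = j. (\<Prod>i\<in>UNIV. a i ^ \<alpha> i) / cx (mi_fact \<alpha>)) = (\<Sum>i\<in>UNIV. a i) ^ j / fact j"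
proof (induction j)
 case 0
 have "{\<alpha>::'n => nat. mi_abs \<alpha> = 0} = {%_. 0}" by (auto simp: mi_abs_def)
 then show ?case by (simp add: mi_fact_def)
next
 case (Suc j)
 let ?t = "%\<alpha>. (\<Prod>i\<in>UNIV. a i ^ \<alpha> i) / cx (mi_fact \<alpha>)"
 have step: "(\<Sum>\<alpha> | mi_abs \<alpha> = Suc j. of_nat (\<alpha> i) * ?t \<alpha>) = a i * (\<Sum>\<alpha> | mi_abs \<alpha> = j. ?t \<alpha>)" for i
 proof -
  have "(\<Sum>\<alpha> | mi_abs \<alpha> = Suc j. of_nat (\<alpha> i) * ?t \<alpha>) = (\<Sum>\<alpha> | mi_abs \<alpha> = Suc j \<and> \<alpha> i > 0. of_nat (\<alpha> i) * ?t \<alpha>)"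
   by (rule sum.mono_neutral_right) (auto intro: finite_mi_abs_eq)
  also have "... = (\<Sum>\<alpha> | mi_abs \<alpha> = j. a i * ?t \<alpha>)"
  proof (rule sum.reindex_bij_witness[of _ "%\<alpha>. \<alpha>(i := \<alpha> i + 1)" "%\<alpha>. \<alpha>(i := \<alpha> i - 1)"])
   have abs: "mi_abs \<alpha> = \<alpha> i + (\<Sum>k\<in>UNIV - {i}. \<alpha> k)" for \<alpha> unfolding mi_abs_def by (simp add: sum.remove)
   fix \<alpha> :: "'n => nat"
   show "\<alpha>(i := \<alpha> i - 1) \<in> {\<alpha>. mi_abs \<alpha> = j}" if "\<alpha> \<in> {\<alpha>. mi_abs \<alpha> = Suc j \<and> 0 < \<alpha> i}"
    using that by (auto simp: abs)
   show "\<alpha>(i := \<alpha> i + 1) \<in> {\<alpha>. mi_abs \<alpha> = Suc j \<and> 0 < \<alpha> i}" if "\<alpha> \<in> {\<alpha>. mi_abs \<alpha> = j}"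
    using that by (auto simp: abs)
   show "a i * ?t (\<alpha>(i := \<alpha> i - 1)) = of_nat (\<alpha> i) * ?t \<alpha>" if A: "\<alpha> \<in> {\<alpha>. mi_abs \<alpha> = Suc j \<and> 0 < \<alpha> i}"
   proof -
    obtain n where n: "\<alpha> i = Suc n" using A by (cases "\<alpha> i") auto
    have 0: "\<alpha>(i := \<alpha> i - 1) = \<alpha>(i := n)" using n by simp
    have 1: "(\<Prod>k\<in>UNIV. a k ^ \<alpha> k) = a i ^ Suc n * (\<Prod>k\<in>UNIV-{i}. a k ^ \<alpha> k)"
     by (simp add: prod.remove[of UNIV i] n)
    have 2: "(\<Prod>k\<in>UNIV. a k ^ (\<alpha>(i := n)) k) = a i ^ n * (\<Prod>k\<in>UNIV-{i}. a k ^ \<alpha> k)"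
     by (simp add: prod.remove[of UNIV i] n)
    have 3: "mi_fact \<alpha> = fact (Suc n) * (\<Prod>k\<in>UNIV-{i}. fact (\<alpha> k))"
     unfolding mi_fact_def by (simp add: prod.remove[of UNIV i] n)
    have 4: "mi_fact (\<alpha>(i := n)) = fact n * (\<Prod>k\<in>UNIV-{i}. fact (\<alpha> k))"
     unfolding mi_fact_def by (simp add: prod.remove[of UNIV i] n)
    have 5: "(\<Prod>k\<in>UNIV-{i}. fact (\<alpha> k) :: real) \<noteq> 0" by simp
    show ?thesis unfolding 0 unfolding 1 2 3 4 n using 5 by (simp add: field_simps del: of_nat_Suc)
   qed
  qed auto
  also have "... = a i * (\<Sum>\<alpha> | mi_abs \<alpha> = j. ?t \<alpha>)" by (simp add: sum_distrib_left)
  finally show ?thesis .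
 qed
 have "of_nat (Suc j) * (\<Sum>\<alpha> | mi_abs \<alpha> = Suc j. ?t \<alpha>) = (\<Sum>\<alpha> | mi_abs \<alpha> = Suc j. (\<Sum>i\<in>UNIV. of_nat (\<alpha> i) * ?t \<alpha>))"
  unfolding sum_distrib_left
 proof (intro sum.cong refl)
  fix \<alpha> :: "'n => nat" assume "\<alpha> \<in> {\<alpha>. mi_abs \<alpha> = Suc j}"
  then have "Suc j = (\<Sum>i\<in>UNIV. \<alpha> i)" by (simp add: mi_abs_def)
  then show "of_nat (Suc j) * ?t \<alpha> = (\<Sum>i\<in>UNIV. of_nat (\<alpha> i) * ?t \<alpha>)"
   by (simp only: of_nat_sum sum_distrib_right)
 qed
 also have "... = (\<Sum>i\<in>UNIV. a i * (\<Sum>\<alpha> | mi_abs \<alpha> = j. ?t \<alpha>))"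
  by (subst sum.swap) (simp only: step)
 also have "... = (\<Sum>i\<in>UNIV. a i) * ((\<Sum>i\<in>UNIV. a i) ^ j / fact j)"
  by (simp only: Suc sum_distrib_right)
 finally have "of_nat (Suc j) * (\<Sum>\<alpha> | mi_abs \<alpha> = Suc j. ?t \<alpha>) = (\<Sum>i\<in>UNIV. a i) ^ Suc j / fact j" by simp
 then have "(\<Sum>\<alpha> | mi_abs \<alpha> = Suc j. ?t \<alpha>) = (\<Sum>i\<in>UNIV. a i) ^ Suc j / fact j / of_nat (Suc j)"
  by (simp only: nonzero_eq_divide_eq[OF of_nat_neq_0] mult.commute)
 then show ?case by (simp add: field_simps)
qed

text \<open>The bridge between the coordinate form of \<open>U0\<close> and the directional
  derivatives \<open>J\<close>: the sign \<open>(-1) ^ mi_abs \<alpha>\<close> in \<open>g\<close>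
  becomes the minus sign in \<open>symb\<close>, and the multinomial formula collects the monomials
  into a power of \<open>y \<bullet> xi\<close>.\<close>

lemma sum_g_eq_J:
 fixes x y :: "real^'n"
 assumes "0 < th" "th <= 2" "t > -1"
 shows "(\<Sum>\<alpha> | mi_abs \<alpha> = j. mi_power y \<alpha> * g th \<alpha> m x t) = (-1) ^ m / (fact m * fact j) * J th j m x y (t + 1)"
proof -
 let ?E = "%xi::real^'n. cx (exp (- (t + 1) * norm xi powr th))"
 let ?W = "%xi::real^'n. cx ((- (norm xi powr th)) ^ m)"
 let ?Q = "%\<alpha> xi. ?E xi * (?W xi * (\<Prod>i\<in>UNIV. (\<i> * cx (xi $ i)) ^ \<alpha> i))"
 let ?c = "%\<alpha>. mi_power y \<alpha> * ((-1) ^ (mi_abs \<alpha> + m) / (mi_fact \<alpha> * fact m))"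
 have "(\<Sum>\<alpha> | mi_abs \<alpha> = j. mi_power y \<alpha> * g th \<alpha> m x t) = (\<Sum>\<alpha> | mi_abs \<alpha> = j. ?c \<alpha> * Fou (?Q \<alpha>) x)"
  by (simp add: g_eq_Fou(2)[OF assms] mult_ac)
 also have "... = Fou (%xi. \<Sum>\<alpha> | mi_abs \<alpha> = j. cx (?c \<alpha>) * ?Q \<alpha> xi) x"
  by (rule Fou_sum[symmetric]) (rule finite_mi_abs_eq, rule g_eq_Fou(1)[OF assms])
 \<comment> \<open>The sum over a one-element set lets \<open>Fou_sum\<close> pull out the constant
   factor as well.\<close>
 also have "(%xi. \<Sum>\<alpha> | mi_abs \<alpha> = j. cx (?c \<alpha>) * ?Q \<alpha> xi)
   = (%xi. \<Sum>k\<in>{()}. cx ((-1) ^ m / (fact m * fact j)) * (?E xi * symb th j m y xi))"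
 proof
  fix xi :: "real^'n"
  have "(\<Sum>\<alpha> | mi_abs \<alpha> = j. cx (?c \<alpha>) * ?Q \<alpha> xi)
    = (\<Sum>\<alpha> | mi_abs \<alpha> = j. cx ((-1) ^ m / fact m) * ?E xi * ?W xi *
      ((\<Prod>i\<in>UNIV. (- (\<i> * cx (y $ i * xi $ i))) ^ \<alpha> i) / cx (mi_fact \<alpha>)))"
  proof (intro sum.cong refl)
   fix \<alpha> :: "'n => nat" 
   have "(\<Prod>i\<in>UNIV. (- (\<i> * cx (y $ i * xi $ i))) ^ \<alpha> i)
    = (\<Prod>i\<in>UNIV. (-1) ^ \<alpha> i * (cx (y $ i) ^ \<alpha> i * (\<i> * cx (xi $ i)) ^ \<alpha> i))"
    by (intro prod.cong refl) (simp add: power_mult_distrib[symmetric] mult_ac)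
   also have "... = (-1) ^ mi_abs \<alpha> * (cx (mi_power y \<alpha>) * (\<Prod>i\<in>UNIV. (\<i> * cx (xi $ i)) ^ \<alpha> i))"
    by (simp add: prod.distrib mi_power_def mi_abs_def power_sum)
   finally show "cx (?c \<alpha>) * ?Q \<alpha> xi = cx ((-1) ^ m / fact m) * ?E xi * ?W xi *
      ((\<Prod>i\<in>UNIV. (- (\<i> * cx (y $ i * xi $ i))) ^ \<alpha> i) / cx (mi_fact \<alpha>))"
    by (simp add: power_add mult_ac)
  qed
  also have "... = cx ((-1) ^ m / fact m) * ?E xi * ?W xi * ((- (\<i> * cx (y \<bullet> xi))) ^ j / fact j)"
   unfolding sum_distrib_left[symmetric] multinomial_exponential
   by (simp add: inner_vec_def sum_negf sum_distrib_left)
  finally show "(\<Sum>\<alpha> | mi_abs \<alpha> = j. cx (?c \<alpha>) * ?Q \<alpha> xi)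
   = (\<Sum>k\<in>{()}. cx ((-1) ^ m / (fact m * fact j)) * (?E xi * symb th j m y xi))"
   by (simp add: symb_def mult_ac)
 qed
 also have "Fou ... x = (-1) ^ m / (fact m * fact j) * J th j m x y (t + 1)"
  using rapid_exp_symb[OF assms(1,2), of "t + 1"] assms by (subst Fou_sum) (auto simp: J_def)
 finally show ?thesis .
qed

section \<open>The one-sided stable density\<close>

text \<open>On this set the principal branch of \<open>z powr a\<close> is holomorphic, and it is
  starlike, so holomorphic functions on it have primitives.\<close>

definition slit :: "complex set" where "slit = - {z. Im z = 0 \<and> Re z <= 0}"

lemma slit_eq: "slit = - \<real>\<^sub>\<le>\<^sub>0"
 by (auto simp: slit_def complex_nonpos_Reals_iff)

lemma open_slit: "open slit" unfolding slit_eq by (rule open_Compl) simp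

lemma starlike_slit: "starlike slit"
proof -
 have "slit = - (cx ` {..0})"
  by (auto simp: slit_def complex_eq_iff image_iff intro: bexI[of _ "Re _"])
 then show ?thesis using starlike_slotted_complex_plane_left[of 0] by simp
qed

lemma rcis_slit: "r > 0 ==> \<bar>\<phi>\<bar> < pi ==> cx r * cis \<phi> \<in> slit"
proof (rule ccontr)
 assume r: "r > 0" "\<bar>\<phi>\<bar> < pi" and "cx r * cis \<phi> \<notin> slit"
 then have "sin \<phi> = 0" "cos \<phi> <= 0" by (auto simp: slit_def mult_le_0_iff)
 moreover have "\<phi> = 0"
  using sin_gt_zero[of \<phi>] sin_gt_zero[of "-\<phi>"] r(2) \<open>sin \<phi> = 0\<close> by (cases "\<phi> = 0"; cases "\<phi> > 0") auto
 ultimately show False by simp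
qed

text \<open>A primitive along the positive axis has constant imaginary part, and the arcs joining it to
 the ray contribute nothing in the limit.\<close>

lemma Im_ray_integral_eq_0:
 fixes q :: "complex => complex"
 assumes hol: "q holomorphic_on slit" and real: "!!r. r > 0 ==> Im (q (of_real r)) = 0"
  and b: "0 < \<beta>" "\<beta> < pi"
  and bda: "!!r \<phi>. r > 0 ==> r <= ra ==> 0 <= \<phi> ==> \<phi> <= \<beta> ==> norm (q (of_real r * cis \<phi>)) <= Ba"
  and bd: "!!r \<phi>. r > 0 ==> r >= rb ==> 0 <= \<phi> ==> \<phi> <= \<beta> ==> norm (q (of_real r * cis \<phi>)) <= B r"
  and ra: "ra > 0" and Binf: "((%r. r * B r) \<longlongrightarrow> 0) at_top"
  and int: "set_integrable lborel {0<..} (%r. q (of_real r * cis \<beta>) * cis \<beta>)"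
 shows "Im (LINT r:{0<..}|lborel. q (of_real r * cis \<beta>) * cis \<beta>) = 0"
proof -
 obtain H where H: "!!z. z \<in> slit ==> (H has_field_derivative q z) (at z)"
  using holomorphic_starlike_primitive[of slit q "{}"] hol open_slit starlike_slit
  by (auto simp: holomorphic_on_imp_continuous_on holomorphic_on_imp_differentiable_at)
 define e where "e = cis \<beta>"
 \<comment> \<open>These compact intervals exhaust the open half line; the shift by two keeps both
   endpoints positive and in the right order.\<close>
 define S where "S = (%n::nat. {1 / real (n + 2) .. real (n + 2)})"
 have ray: "(LINT r:S n|lborel. q (of_real r * e) * e) = H (of_real (real (n + 2)) * e) - H (of_real (1 / real (n + 2)) * e)" for n
  unfolding S_def
 proof (rule integral_FTC_Icc[unfolded set_lebesgue_integral_def[symmetric]])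
  show le: "1 / real (n + 2) <= real (n + 2)" by (simp add: field_simps)
  have pos: "r > 0" if "1 / real (n + 2) <= r" for r :: real
   using that by (rule less_le_trans[rotated]) simp
  fix r assume r: "1 / real (n + 2) <= r" "r <= real (n + 2)"
  have sl: "of_real r * e \<in> slit" using pos[OF r(1)] b by (auto simp: e_def intro!: rcis_slit)
  have "((%z. H (z * e)) has_field_derivative q (of_real r * e) * e) (at (of_real r))"
   by (rule DERIV_chain2[where f=H and g="%z. z * e", OF H[OF sl]]) (auto intro!: derivative_eq_intros)
  from has_vector_derivative_real_field[OF this]
  show "((%r. H (of_real r * e)) has_vector_derivative q (of_real r * e) * e) (at r within {1 / real (n + 2)..real (n + 2)})" .
 next
  have sub: "(%r. cx r * e) ` {1 / real (n + 2)..real (n + 2)} \<subseteq> slit"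
  proof clarify
   fix r :: real assume "r \<in> {1 / real (n + 2)..real (n + 2)}"
   then have "r > 0" by (auto intro: less_le_trans[rotated])
   then show "cx r * e \<in> slit" using b by (auto simp: e_def intro!: rcis_slit)
  qed
  show "continuous_on {1 / real (n + 2)..real (n + 2)} (%r. q (of_real r * e) * e)"
   by (intro continuous_intros continuous_on_compose2[OF holomorphic_on_imp_continuous_on[OF hol] _ sub])
 qed
 have arc: "norm (H (of_real r * e) - H (of_real r)) <= \<beta> * (r * C)"
  if r: "r > 0" and bd: "!!\<phi>. 0 <= \<phi> ==> \<phi> <= \<beta> ==> norm (q (of_real r * cis \<phi>)) <= C" for r C
 proof -
  have "norm (H (of_real r * cis \<beta>) - H (of_real r * cis 0)) <= (r * C) * norm (\<beta> - 0)"
  proof (rule differentiable_bound[of "{0..\<beta>}" "%\<phi>. H (of_real r * cis \<phi>)" "%\<phi> h. h *\<^sub>R (q (of_real r * cis \<phi>) * (of_real r * (\<i> * cis \<phi>)))"])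
   fix \<phi> assume p: "\<phi> \<in> {0..\<beta>}"
   have sl: "of_real r * cis \<phi> \<in> slit" using r p b by (auto intro!: rcis_slit)
   have "((%z. H (of_real r * exp (\<i> * z))) has_field_derivative q (of_real r * cis \<phi>) * (of_real r * (\<i> * cis \<phi>))) (at (of_real \<phi>))"
    by (rule DERIV_chain2[where f=H and g="%z. of_real r * exp (\<i> * z)"])
     (use sl H in \<open>auto intro!: derivative_eq_intros simp: cis_conv_exp\<close>)
   from has_vector_derivative_real_field[OF this]
   show "((%\<phi>. H (of_real r * cis \<phi>)) has_derivative (%h. h *\<^sub>R (q (of_real r * cis \<phi>) * (of_real r * (\<i> * cis \<phi>))))) (at \<phi> within {0..\<beta>})"
    by (simp add: has_vector_derivative_def cis_conv_exp)
   have "norm (q (of_real r * cis \<phi>) * (of_real r * (\<i> * cis \<phi>))) <= r * C"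
    using bd[of \<phi>] p r by (simp add: norm_mult mult.commute)
   from mult_right_mono[OF this abs_ge_zero]
   show "onorm (%h. h *\<^sub>R (q (of_real r * cis \<phi>) * (of_real r * (\<i> * cis \<phi>)))) <= r * C"
    by (intro onorm_le) (simp add: mult.commute)
  qed (use b in auto)
  then show ?thesis using b by (simp add: e_def mult.commute)
 qed
 have "Im (H (of_real r) - H (of_real s)) = 0" if "0 < s" "s <= r" for r s :: real
 proof -
  have "((%r. Im (H (of_real r))) has_real_derivative 0) (at x)" if "x > 0" for x
  proof -
   have "cx x \<in> slit" using that by (simp add: slit_def)
   from has_vector_derivative_real_field[OF H[OF this]]
   have "((%r. Im (H (of_real r))) has_vector_derivative Im (q (of_real x))) (at x)"
    by (rule bounded_linear.has_vector_derivative[OF bounded_linear_Im])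
   then show ?thesis using real[OF that] by (simp add: has_real_derivative_iff_has_vector_derivative)
  qed
  note der = this
  have "Im (H (of_real r)) = Im (H (of_real s))"
  proof (cases "s = r")
   case False
   show ?thesis
   proof (rule DERIV_isconst_end[of s r "%r. Im (H (of_real r))"])
    show "s < r" using False that by simp
    show "continuous_on {s..r} (%r. Im (H (of_real r)))"
     by (rule DERIV_continuous_on[where D="%_. 0"])
      (use that in \<open>auto intro!: has_field_derivative_at_within der\<close>)
   qed (use that der in auto)
  qed simp
  then show ?thesis by simp
 qed note Hre = this
 \<comment> \<open>The primitive \<open>H\<close> is compared at the two ends of the ray segment by
   a detour: an arc at each end and a piece of the real axis, where the imaginary part of
   \<open>H\<close> does not change.\<close>
 have bound: "\<bar>Im (LINT r:S n|lborel. q (of_real r * e) * e)\<bar>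
   <= \<beta> * (real (n + 2) * B (real (n + 2))) + \<beta> * (1 / real (n + 2) * Ba)" if n: "1 / real (n + 2) <= ra" "real (n + 2) >= rb" for n
 proof -
  let ?r = "real (n + 2)" and ?s = "1 / real (n + 2)"
  have "Im (H (of_real ?r * e) - H (of_real ?s * e))
   = Im (H (of_real ?r * e) - H (of_real ?r)) - Im (H (of_real ?s * e) - H (of_real ?s)) + Im (H (of_real ?r) - H (of_real ?s))"
   by simp
  also have "Im (H (of_real ?r) - H (of_real ?s)) = 0" by (rule Hre) (auto simp: field_simps)
  finally show ?thesis
   unfolding ray using arc[of ?r "B ?r", OF _ bd] arc[of ?s Ba, OF _ bda] n abs_Im_le_cmod[of "H (of_real ?r * e) - H (of_real ?r)"]
    abs_Im_le_cmod[of "H (of_real ?s * e) - H (of_real ?s)"] by simp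
 qed
 have lim: "(%n. LINT r:S n|lborel. q (of_real r * e) * e) \<longlonglongrightarrow> (LINT r:{0<..}|lborel. q (of_real r * e) * e)"
  unfolding set_lebesgue_integral_def
 proof (rule integral_dominated_convergence[where w="%r. norm (indicator {0<..} r *\<^sub>R (q (of_real r * e) * e))"])
  show "integrable lborel (%r. norm (indicator {0<..} r *\<^sub>R (q (of_real r * e) * e)))"
   using int unfolding set_integrable_def e_def by (rule integrable_norm)
  show meas: "(%r. indicator {0<..} r *\<^sub>R (q (of_real r * e) * e)) \<in> borel_measurable lborel"
   using int unfolding set_integrable_def e_def by (rule borel_measurable_integrable)
  have sub: "S n \<subseteq> {0<..}" for n by (auto simp: S_def intro: less_le_trans[rotated])
  show "(%r. indicator (S n) r *\<^sub>R (q (of_real r * e) * e)) \<in> borel_measurable lborel" for n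
  proof -
   have "(%r. indicator (S n) r *\<^sub>R (q (of_real r * e) * e)) = (%r. indicator (S n) r *\<^sub>R (indicator {0<..} r *\<^sub>R (q (of_real r * e) * e)))"
    using sub[of n] by (auto simp: fun_eq_iff indicator_def)
   moreover have "(%r. indicator (S n) r *\<^sub>R (indicator {0<..} r *\<^sub>R (q (of_real r * e) * e))) \<in> borel_measurable lborel"
    by (intro borel_measurable_scaleR meas) (auto simp: S_def)
   ultimately show ?thesis by simp
  qed
  show "AE r in lborel. norm (indicator (S n) r *\<^sub>R (q (of_real r * e) * e)) <= norm (indicator {0<..} r *\<^sub>R (q (of_real r * e) * e))" for n
   using sub[of n] by (intro AE_I2) (auto simp: indicator_def)
  show "AE r in lborel. (%n. indicator (S n) r *\<^sub>R (q (of_real r * e) * e)) \<longlonglongrightarrow> indicator {0<..} r *\<^sub>R (q (of_real r * e) * e)"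
  proof (rule AE_I2)
   fix r :: real
   have "\<forall>\<^sub>F n in sequentially. indicator (S n) r = (indicator {0<..} r :: real)"
   proof (cases "r > 0")
    case True
    obtain n0 where n0: "real n0 > r" "real n0 > 1 / r" using reals_Archimedean2[of "max r (1/r)"] by auto
    have "indicator (S n) r = (indicator {0<..} r :: real)" if "n >= n0" for n
    proof -
     have "real (n + 2) > r" "real (n + 2) > 1 / r" using n0 that by auto
     then show ?thesis using True by (auto simp: S_def indicator_def field_simps)
    qed
    then show ?thesis by (auto simp: eventually_sequentially)
   next
    case False
    then show ?thesis using sub by (intro always_eventually allI) (auto simp: indicator_def)
   qed
   then show "(%n. indicator (S n) r *\<^sub>R (q (of_real r * e) * e)) \<longlonglongrightarrow> indicator {0<..} r *\<^sub>R (q (of_real r * e) * e)"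
    by (intro tendsto_eventually) (auto elim: eventually_mono)
  qed
 qed
 have l1: "filterlim (%n. real (n + 2)) at_top sequentially" 
  by real_asymp
 have l2: "(%n. 1 / real (n + 2)) \<longlonglongrightarrow> 0"
  by real_asymp
 have lim0: "(%n. \<beta> * (real (n + 2) * B (real (n + 2))) + \<beta> * (1 / real (n + 2) * Ba)) \<longlonglongrightarrow> \<beta> * 0 + \<beta> * (0 * Ba)"
  by (intro tendsto_intros filterlim_compose[OF Binf l1] l2)
 have ev: "\<forall>\<^sub>F n in sequentially. norm (Im (LINT r:S n|lborel. q (of_real r * e) * e))
   <= \<beta> * (real (n + 2) * B (real (n + 2))) + \<beta> * (1 / real (n + 2) * Ba)"
 proof -
  have "\<forall>\<^sub>F n in sequentially. real (n + 2) >= rb"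
   using l1 by (rule filterlim_at_top[THEN iffD1, rule_format])
  moreover have "\<forall>\<^sub>F n in sequentially. 1 / real (n + 2) <= ra"
   using order_tendstoD(2)[OF l2 ra] by (auto elim: eventually_mono)
  ultimately show ?thesis by eventually_elim (use bound in auto)
 qed
 have "\<beta> * 0 + \<beta> * (0 * Ba) = 0" by simp
 then have "(%n. Im (LINT r:S n|lborel. q (of_real r * e) * e)) \<longlonglongrightarrow> 0"
  using Lim_null_comparison[OF ev] lim0 by (simp only:)
 with tendsto_Im[OF lim] show ?thesis unfolding e_def[symmetric] using LIMSEQ_unique by blast
qed

lemma set_integrable_powr_exp:
 fixes p k a :: real
 assumes "a > 0" "k > 0" "p >= 0"
 shows "set_integrable lborel {0<..} (%r. r powr p * exp (- k * r powr a))"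
proof -
 obtain C where C: "C > 0" "!!u. u >= 0 ==> (1 + u) powr (p + 2) * exp (- k * u powr a) <= C"
  using powr_exp_bounded[of a k "p + 2"] assms by auto
 have "integrable lborel (%t::real. C * (1 + \<bar>t\<bar>) powr (-(1 + 1)))"
  using nn_integral_powr_abs_tail[of 1 1]
  by (intro integrable_mult_right integrableI_bounded) (auto intro: order_le_less_trans)
 then show ?thesis
  unfolding set_integrable_def
 proof (rule Bochner_Integration.integrable_bound)
  show "AE r in lborel. norm (indicat_real {0<..} r *\<^sub>R (r powr p * exp (- k * r powr a))) <= norm (C * (1 + \<bar>r\<bar>) powr (-(1 + 1)))"
  proof (rule AE_I2)
   fix r :: real
   show "norm (indicat_real {0<..} r *\<^sub>R (r powr p * exp (- k * r powr a))) <= norm (C * (1 + \<bar>r\<bar>) powr (-(1 + 1)))"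
   proof (cases "r > 0")
    case True
    have "r powr p * exp (- k * r powr a) <= (1 + r) powr p * exp (- k * r powr a)"
     using True assms by (intro mult_right_mono powr_mono2) auto
    also have "(1 + r) powr p = (1 + r) powr (-2) * (1 + r) powr (p + 2)"
     using True unfolding powr_add[symmetric] by simp
    also have "... * exp (- k * r powr a) <= (1 + r) powr (-2) * C"
     using C(2)[of r] True by (simp only: mult.assoc) (intro mult_left_mono, auto)
    finally show ?thesis using True C(1) by (simp add: mult.commute)
   qed simp
  qed
 qed auto
qed

lemma set_integral_sum:
 fixes f :: "'i => 'a => 'b::{banach, second_countable_topology}"
 assumes "!!i. i \<in> I ==> set_integrable M A (f i)"
 shows "set_integrable M A (%x. \<Sum>i\<in>I. f i x)" "(LINT x:A|M. (\<Sum>i\<in>I. f i x)) = (\<Sum>i\<in>I. LINT x:A|M. f i x)"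
 using assms unfolding set_integrable_def set_lebesgue_integral_def scaleR_sum_right
 by (auto intro!: Bochner_Integration.integral_sum)

lemma norm_set_integral_le:
 fixes f :: "real => complex"
 assumes "set_integrable lborel A b" "!!r. r \<in> A ==> norm (f r) <= b r" "f \<in> borel_measurable borel" "A \<in> sets borel"
 shows "set_integrable lborel A f" "norm (LINT r:A|lborel. f r) <= (LINT r:A|lborel. b r)"
proof -
 show *: "set_integrable lborel A f"
  using assms(1) unfolding set_integrable_def
  by (rule Bochner_Integration.integrable_bound)
   (use assms in \<open>auto simp: indicator_def intro: order_trans[OF _ abs_ge_self]\<close>)
 have "norm (LINT r:A|lborel. f r) <= (LINT r:A|lborel. norm (f r))"
  unfolding set_lebesgue_integral_def using integral_norm_bound[of lborel "%r. indicator A r *\<^sub>R f r"] by simp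
 also have "... <= (LINT r:A|lborel. b r)"
  by (intro set_integral_mono set_integrable_norm * assms)
 finally show "norm (LINT r:A|lborel. f r) <= ..." .
qed

lemma laplace_exp:
 fixes \<mu> :: complex
 assumes "Re \<mu> > 0"
 shows "set_integrable lborel {0<..} (%s. exp (- of_real s * \<mu>))" "(LINT s:{0<..}|lborel. exp (- of_real s * \<mu>)) = 1 / \<mu>"
proof -
 have mu: "\<mu> \<noteq> 0" using assms by auto
 have "set_integrable lborel {0<..} (%r. r powr 0 * exp (- Re \<mu> * r powr 1))"
  using assms by (intro set_integrable_powr_exp) auto
 from norm_set_integral_le(1)[OF this, of "%s. exp (- of_real s * \<mu>)"]
 show int: "set_integrable lborel {0<..} (%s. exp (- of_real s * \<mu>))" by (simp add: mult.commute)
 have "(LBINT s=0..\<infinity>. exp (- of_real s * \<mu>)) = 0 - (- (1 / \<mu>))"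
 proof (rule interval_integral_FTC_integrable[where F="%s. - (exp (- of_real s * \<mu>) / \<mu>)"])
  fix s :: real
  have "((%z. - (exp (- z * \<mu>) / \<mu>)) has_field_derivative exp (- of_real s * \<mu>)) (at (of_real s))"
   using mu by (auto intro!: derivative_eq_intros)
  from has_vector_derivative_real_field[OF this]
  show "((%s. - (exp (- of_real s * \<mu>) / \<mu>)) has_vector_derivative exp (- of_real s * \<mu>)) (at s)" .
  show "isCont (%s. exp (- cx s * \<mu>)) s" by (intro continuous_intros)
 next
  show "set_integrable lborel (einterval 0 \<infinity>) (%s. exp (- cx s * \<mu>))"
   using int by (simp add: zero_ereal_def)
  have "((%s. - (exp (- cx s * \<mu>) / \<mu>)) \<longlongrightarrow> - (exp (- cx 0 * \<mu>) / \<mu>)) (at_right 0)"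
   using mu by (intro tendsto_intros) auto
  then show "(((%s. - (exp (- cx s * \<mu>) / \<mu>)) \<circ> real_of_ereal) \<longlongrightarrow> - (1 / \<mu>)) (at_right 0)"
   unfolding zero_ereal_def by (subst ereal_tendsto_simps) simp
  have "((%s. exp (- Re \<mu> * s) / norm \<mu>) \<longlongrightarrow> 0) at_top"
  proof -
   have "((%s. exp (- Re \<mu> * s)) \<longlongrightarrow> 0) at_top" using assms by real_asymp
   from tendsto_divide[OF this tendsto_const[of "norm \<mu>"]] mu show ?thesis by simp
  qed
  then have "((%s. - (exp (- cx s * \<mu>) / \<mu>)) \<longlongrightarrow> 0) at_top"
   by (rule tendsto_norm_zero_cancel[OF Lim_transform_eventually]) (auto simp: norm_divide mult.commute)
  then show "(((%s. - (exp (- cx s * \<mu>) / \<mu>)) \<circ> real_of_ereal) \<longlongrightarrow> 0) (at_left \<infinity>)"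
   by (subst ereal_tendsto_simps)
 qed auto
 then show "(LINT s:{0<..}|lborel. exp (- of_real s * \<mu>)) = 1 / \<mu>"
  by (simp add: interval_lebesgue_integral_0_infty)
qed

lemma rcis_powr:
 assumes "r > 0" "0 <= \<phi>" "\<phi> < pi"
 shows "(cx r * cis \<phi>) powr cx a = cx (r powr a) * cis (a * \<phi>)"
proof -
 have "cx r * cis \<phi> = exp (Complex (ln r) \<phi>)"
 proof -
  have "exp (cx (ln r)) = cx r" using exp_of_real[of "ln r"] assms by simp
  then show ?thesis by (simp only: Complex_eq exp_add cis_conv_exp)
 qed
 then have "Ln (cx r * cis \<phi>) = Complex (ln r) \<phi>"
  using assms Ln_exp[of "Complex (ln r) \<phi>"] by simp
 moreover have "cx r * cis \<phi> \<noteq> 0" using assms by simp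
 ultimately have "(cx r * cis \<phi>) powr cx a = exp (cx a * Complex (ln r) \<phi>)"
  by (simp add: powr_def)
 also have "cx a * Complex (ln r) \<phi> = cx (a * ln r) + \<i> * cx (a * \<phi>)"
  by (simp add: complex_eq_iff)
 moreover have "exp (cx (a * ln r)) = cx (r powr a)"
  using exp_of_real[of "a * ln r"] assms by (simp add: powr_def)
 ultimately show ?thesis by (simp only: exp_add cis_conv_exp)
qed

section \<open>The stable density as a contour integral\<close>

text \<open>The function with Laplace transform \<open>(- z\<^sup>a)\<^sup>m exp (- tau z\<^sup>a)\<close>, as a Bromwich integral whose contour is
 turned onto the two rays of argument \<open>\<plusminus>pi / (1 + a)\<close>, where both exponentials decay.\<close>

definition stab_ray :: "real => nat => real => real => complex" where
 "stab_ray a m tau r = (- (cx (r powr a) * cis (a * (pi / (1 + a))))) ^ m *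
  exp (- cx tau * (cx (r powr a) * cis (a * (pi / (1 + a)))))"

text \<open>The integrals over the two rays are conjugate to each other. Their difference divided by
  \<open>2 * pi * \<i>\<close> is the imaginary part of one of them divided by \<open>pi\<close>, so
  only the upper ray occurs.\<close>

definition stab :: "real => nat => real => real => real" where
 "stab a m tau s = Im (LINT r:{0<..}|lborel. stab_ray a m tau r * exp (cx s * (cx r * cis (pi / (1 + a)))) * cis (pi / (1 + a))) / pi"

text \<open>The exponent will be \<open>th / 2\<close>, because the Laplace variable is going to be
  the square of \<open>norm xi\<close>.\<close>

locale stable_exponent =
 fixes a :: real
 assumes a: "0 < a" "a < 1"

begin

text \<open>The solution of \<open>a * x = pi - x\<close>. It makes \<open>cos (a * x)\<close> and
  \<open>- cos x\<close> the same positive number, so that \<open>stab_rate\<close> measures the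
  decay of both exponentials on the ray.\<close>

definition "stab_angle = pi / (1 + a)"
definition "stab_rate = cos (a * stab_angle)"
text \<open>The holomorphic function with boundary values \<open>stab_ray\<close> on the upper ray.
  It is real on the positive axis, which makes \<open>Im_ray_integral_eq_0\<close>
  applicable.\<close>

definition stab_hol :: "nat => real => complex => complex" where
 "stab_hol m tau z = (- (z powr cx a)) ^ m * exp (- cx tau * z powr cx a)"

lemma angle: "pi / 2 < stab_angle" "stab_angle < pi" "0 < a * stab_angle" "a * stab_angle < pi / 2" "a * stab_angle = pi - stab_angle"
proof -
 show "pi / 2 < stab_angle" "stab_angle < pi" using a pi_gt_zero by (auto simp: stab_angle_def field_simps)
 show e: "a * stab_angle = pi - stab_angle" using a by (simp add: stab_angle_def field_simps)
 show "0 < a * stab_angle" using a by (simp add: stab_angle_def)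
 show "a * stab_angle < pi / 2" unfolding e using \<open>pi / 2 < stab_angle\<close> by simp
qed

lemma angle_pos: "0 < stab_angle" using angle(1) pi_gt_zero by linarith

lemma rate: "0 < stab_rate" "stab_rate <= 1" "cos stab_angle = - stab_rate" "sin stab_angle > 0"
proof -
 show "0 < stab_rate" unfolding stab_rate_def using angle by (intro cos_gt_zero_pi) auto
 show "stab_rate <= 1" by (simp add: stab_rate_def)
 show "cos stab_angle = - stab_rate" unfolding stab_rate_def angle(5) by simp
 show "sin stab_angle > 0" using angle angle_pos by (intro sin_gt_zero) auto
qed

lemma stab_hol_rcis:
 assumes "r > 0" "0 <= \<phi>" "\<phi> <= stab_angle"
 shows "stab_hol m tau (of_real r * cis \<phi>) =
  (- (cx (r powr a) * cis (a * \<phi>))) ^ m * exp (- cx tau * (cx (r powr a) * cis (a * \<phi>)))"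
proof -
 have "\<phi> < pi" using assms angle by linarith
 then show ?thesis unfolding stab_hol_def using assms by (simp only: rcis_powr)
qed

lemma stab_hol_ray: "r > 0 ==> stab_hol m tau (of_real r * cis stab_angle) = stab_ray a m tau r"
 using angle_pos by (subst stab_hol_rcis) (auto simp: stab_ray_def stab_angle_def)

lemma stab_hol_real: "r > 0 ==> stab_hol m tau (of_real r) = of_real ((- (r powr a)) ^ m * exp (- tau * r powr a))"
 using stab_hol_rcis[of r 0 m tau] angle_pos by (simp add: exp_of_real[symmetric])

text \<open>The cosine decreases on the sector, so the decay on its upper edge is the weakest. The
  bound holds on the whole sector and hence on the arcs of the contour argument.\<close>

lemma norm_stab_hol:
 assumes "r > 0" "0 <= \<phi>" "\<phi> <= stab_angle" "tau >= 0"
 shows "norm (stab_hol m tau (of_real r * cis \<phi>)) <= r powr (a * real m) * exp (- (tau * stab_rate) * r powr a)"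
proof -
 have "cos (a * stab_angle) <= cos (a * \<phi>)"
 proof (rule cos_monotone_0_pi_le)
  show "a * \<phi> <= a * stab_angle" using assms a by (intro mult_left_mono) auto
  show "a * stab_angle <= pi" using angle(4) pi_gt_zero by linarith
 qed (use a assms in auto)
 then have "tau * stab_rate * r powr a <= tau * cos (a * \<phi>) * r powr a"
  unfolding stab_rate_def using assms by (intro mult_right_mono mult_left_mono) auto
 then have "exp (- (tau * (r powr a * cos (a * \<phi>)))) <= exp (- (tau * stab_rate) * r powr a)" by (simp add: mult_ac)
 moreover have "(r powr a) ^ m = r powr (a * real m)"
  using assms by (simp add: powr_powr powr_realpow[symmetric])
 ultimately show ?thesis
  unfolding stab_hol_rcis[OF assms(1-3)] by (simp add: norm_mult norm_power mult_left_mono)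
qed

lemma norm_stab_ray:
 "r > 0 ==> tau >= 0 ==> norm (stab_ray a m tau r) <= r powr (a * real m) * exp (- (tau * stab_rate) * r powr a)"
 using norm_stab_hol[of r stab_angle tau m] angle_pos by (simp add: stab_hol_ray)

lemma holomorphic_stab_hol: "stab_hol m tau holomorphic_on slit"
 unfolding stab_hol_def slit_eq by (intro holomorphic_intros) auto

lemma stab_ray_measurable [measurable]: "stab_ray a m tau \<in> borel_measurable borel"
 unfolding stab_ray_def by measurable

lemma norm_exp_ray: "norm (exp (cx s * (cx r * cis stab_angle))) = exp (- stab_rate * (s * r))"
 by (simp add: rate(3) mult_ac)

lemma stab_eq: "stab a m tau s = Im (LINT r:{0<..}|lborel. stab_ray a m tau r * exp (cx s * (cx r * cis stab_angle)) * cis stab_angle) / pi"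
 by (simp add: stab_def stab_angle_def)

lemma stab_integrable:
 assumes "tau > 0" "s >= 0"
 shows "set_integrable lborel {0<..} (%r. stab_ray a m tau r * exp (cx s * (cx r * cis stab_angle)) * cis stab_angle)"
proof (rule norm_set_integral_le(1))
 show "set_integrable lborel {0<..} (%r. r powr (a * real m) * exp (- (tau * stab_rate) * r powr a))"
  using a rate assms by (intro set_integrable_powr_exp) auto
 fix r :: real assume "r \<in> {0<..}"
 then have "norm (stab_ray a m tau r) * exp (- stab_rate * (s * r)) <= r powr (a * real m) * exp (- (tau * stab_rate) * r powr a) * 1"
  using assms rate by (intro mult_mono norm_stab_ray) auto
 then show "norm (stab_ray a m tau r * exp (cx s * (cx r * cis stab_angle)) * cis stab_angle)
   <= r powr (a * real m) * exp (- (tau * stab_rate) * r powr a)"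
  by (simp only: norm_mult norm_exp_ray norm_cis mult_1_right)
qed auto

lemma powr_exp_tendsto_0:
 assumes "k > 0"
 shows "((%r. r powr p * exp (- k * r powr a)) \<longlongrightarrow> 0) at_top"
proof -
 obtain C where C: "C > 0" "!!u. u >= 0 ==> (1 + u) powr (\<bar>p\<bar> + 1) * exp (- k * u powr a) <= C"
  using powr_exp_bounded[of a k "\<bar>p\<bar> + 1"] assms a by auto
 have "((%r. C / (1 + r)) \<longlongrightarrow> 0) at_top" by real_asymp
 moreover have "\<forall>\<^sub>F r in at_top. norm (r powr p * exp (- k * r powr a)) <= C / (1 + r)"
  using eventually_ge_at_top[of 1]
 proof eventually_elim
  fix r :: real assume r: "r >= 1"
  have "r powr p <= r powr \<bar>p\<bar>" using r by (intro powr_mono) auto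
  also have "... <= (1 + r) powr \<bar>p\<bar>" using r by (intro powr_mono2) auto
  finally have "r powr p * exp (- k * r powr a) * (1 + r) <= (1 + r) powr \<bar>p\<bar> * exp (- k * r powr a) * (1 + r)"
   using r by (intro mult_right_mono) auto
  also have "... = (1 + r) powr (\<bar>p\<bar> + 1) * exp (- k * r powr a)" using r by (simp add: powr_add mult_ac)
  also have "... <= C" using C(2)[of r] r by simp
  finally show "norm (r powr p * exp (- k * r powr a)) <= C / (1 + r)" using r by (simp add: field_simps)
 qed
 ultimately show ?thesis by (rule Lim_null_comparison[rotated])
qed

text \<open>The integrand extends to \<open>z ^ k * stab_hol m tau z\<close>, which is real on the
  positive axis and decays in the sector. Up to the factor \<open>pi\<close> these imaginary parts
  are the derivatives of \<open>stab\<close> at \<open>s = 0\<close>.\<close>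

lemma moments_vanish:
 assumes "tau > 0"
 shows "Im (LINT r:{0<..}|lborel. ((of_real r * cis stab_angle) ^ k * stab_ray a m tau r) * cis stab_angle) = 0" (is ?th1)
 and "set_integrable lborel {0<..} (%r. ((of_real r * cis stab_angle) ^ k * stab_ray a m tau r) * cis stab_angle)" (is ?th2)
proof -
 let ?p = "real k + a * real m"
 have p: "r ^ k * r powr (a * real m) = r powr ?p" if "r > 0" for r
  using that by (simp add: powr_add powr_realpow)
 have nb: "norm ((of_real r * cis \<phi>) ^ k * stab_hol m tau (of_real r * cis \<phi>)) <= r powr ?p * exp (- (tau * stab_rate) * r powr a)"
  if "r > 0" "0 <= \<phi>" "\<phi> <= stab_angle" for r \<phi>
 proof -
  have "norm ((of_real r * cis \<phi>) ^ k * stab_hol m tau (of_real r * cis \<phi>)) = r ^ k * norm (stab_hol m tau (of_real r * cis \<phi>))"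
   using that by (simp add: norm_mult norm_power)
  also have "... <= r ^ k * (r powr (a * real m) * exp (- (tau * stab_rate) * r powr a))"
   using that assms by (intro mult_left_mono norm_stab_hol) auto
  finally show ?thesis by (simp only: p[OF that(1), symmetric] mult.assoc)
 qed
 show int: ?th2
 proof (rule norm_set_integral_le(1))
  show "set_integrable lborel {0<..} (%r. r powr ?p * exp (- (tau * stab_rate) * r powr a))"
   using a rate assms by (intro set_integrable_powr_exp) auto
  fix r :: real assume "r \<in> {0<..}"
  then show "norm (((of_real r * cis stab_angle) ^ k * stab_ray a m tau r) * cis stab_angle) <= r powr ?p * exp (- (tau * stab_rate) * r powr a)"
   using nb[of r stab_angle] angle_pos by (simp add: stab_hol_ray norm_mult)
 qed auto
 have eq: "(LINT r:{0<..}|lborel. ((of_real r * cis stab_angle) ^ k * stab_ray a m tau r) * cis stab_angle)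
  = (LINT r:{0<..}|lborel. ((of_real r * cis stab_angle) ^ k * stab_hol m tau (of_real r * cis stab_angle)) * cis stab_angle)"
  by (intro set_lebesgue_integral_cong) (auto simp: stab_hol_ray)
 have int': "set_integrable lborel {0<..} (%r. ((of_real r * cis stab_angle) ^ k * stab_hol m tau (of_real r * cis stab_angle)) * cis stab_angle)"
  using int by (subst set_integrable_cong[OF refl refl, of "{0<..}" _ "%r. ((of_real r * cis stab_angle) ^ k * stab_ray a m tau r) * cis stab_angle"])
   (auto simp: stab_hol_ray)
 show ?th1
  unfolding eq
 proof (rule Im_ray_integral_eq_0[where q="%z. z ^ k * stab_hol m tau z" and B="%r. r powr ?p * exp (- (tau * stab_rate) * r powr a)" and ra=1 and rb=1 and Ba=1])
  show "(%z. z ^ k * stab_hol m tau z) holomorphic_on slit"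
   by (intro holomorphic_intros holomorphic_stab_hol)
  show "Im (of_real r ^ k * stab_hol m tau (of_real r)) = 0" if "r > 0" for r
   using that by (simp add: stab_hol_real flip: of_real_power)
  show "norm ((of_real r * cis \<phi>) ^ k * stab_hol m tau (of_real r * cis \<phi>)) <= 1"
   if "r > 0" "r <= 1" "0 <= \<phi>" "\<phi> <= stab_angle" for r \<phi>
  proof -
   have "r powr ?p * exp (- (tau * stab_rate) * r powr a) <= 1 * 1"
    using that assms rate a by (intro mult_mono) (auto intro: powr_le1)
   with nb[OF that(1,3,4)] show ?thesis by linarith
  qed
  have "((%r. r powr (1 + ?p) * exp (- (tau * stab_rate) * r powr a)) \<longlongrightarrow> 0) at_top"
   using assms rate by (intro powr_exp_tendsto_0) auto
  then show "((%r. r * (r powr ?p * exp (- (tau * stab_rate) * r powr a))) \<longlongrightarrow> 0) at_top"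
   by (rule Lim_transform_eventually)
    (use eventually_gt_at_top[of 0] in eventually_elim, auto simp: powr_add)
 qed (use nb angle angle_pos int' in \<open>auto simp: \<close>)
qed

text \<open>In the left half plane all derivatives of \<open>exp\<close> are bounded by
  \<open>1\<close>, so the remainder carries no exponential factor.\<close>

lemma norm_exp_Taylor:
 fixes w :: complex assumes "Re w <= 0"
 shows "norm (exp w - (\<Sum>i\<le>n. w ^ i / fact i)) <= norm w ^ Suc n / fact n"
proof -
 have "norm (exp w - (\<Sum>i\<le>n. exp 0 * (w - 0) ^ i / fact i)) <= 1 * norm (w - 0) ^ Suc n / fact n"
 proof (rule complex_Taylor[of "{z. Re z <= 0}" n "%_. exp"])
  show "convex {z. Re z <= 0}" by (rule convex_halfspace_Re_le)
 qed (use assms in \<open>auto intro: has_field_derivative_at_within\<close>)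
 then show ?thesis by simp
qed

text \<open>Subtracting the Taylor polynomial of \<open>exp (s z)\<close> under the integral does
  not change \<open>stab\<close>, because its terms contribute only the vanishing moments. The
  remainder supplies the power of \<open>s\<close>. This flatness at \<open>0\<close> will beat the
  negative powers of \<open>s\<close> in the Gaussians.\<close>

lemma stab_small:
 assumes "tau > 0"
 shows "\<exists>C. \<forall>s\<ge>0. \<bar>stab a m tau s\<bar> <= C * s ^ Suc n"
proof -
 let ?p = "real (Suc n) + a * real m"
 let ?b = "%r. r powr ?p * exp (- (tau * stab_rate) * r powr a)"
 let ?C = "(LINT r:{0<..}|lborel. ?b r) / (fact n * pi)"
 have "\<bar>stab a m tau s\<bar> <= ?C * s ^ Suc n" if s: "s >= 0" for s
 proof -
  let ?z = "%r::real. of_real r * cis stab_angle"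
  let ?P = "%r::real. (\<Sum>i\<le>n. (of_real s * ?z r) ^ i / fact i)"
  have P: "stab_ray a m tau r * ?P r * cis stab_angle
    = (\<Sum>i\<le>n. cx (s ^ i / fact i) * ((?z r ^ i * stab_ray a m tau r) * cis stab_angle))" for r
   by (simp add: sum_distrib_left sum_distrib_right power_mult_distrib mult_ac)
  have Pint: "set_integrable lborel {0<..} (%r. stab_ray a m tau r * ?P r * cis stab_angle)"
   unfolding P using moments_vanish(2)[OF assms] by (intro set_integral_sum(1) set_integrable_mult_right) auto
  have "(LINT r:{0<..}|lborel. stab_ray a m tau r * ?P r * cis stab_angle)
   = (\<Sum>i\<le>n. cx (s ^ i / fact i) * (LINT r:{0<..}|lborel. ((?z r ^ i * stab_ray a m tau r) * cis stab_angle)))"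
   unfolding P using moments_vanish(2)[OF assms]
   by (subst set_integral_sum(2)) (auto intro!: sum.cong set_integrable_mult_right set_integral_mult_right)
  then have "Im (LINT r:{0<..}|lborel. stab_ray a m tau r * ?P r * cis stab_angle)
   = (\<Sum>i\<le>n. Im (cx (s ^ i / fact i) * (LINT r:{0<..}|lborel. ((?z r ^ i * stab_ray a m tau r) * cis stab_angle))))"
   by (simp only: Im_sum)
  also have "... = 0"
   by (intro sum.neutral ballI) (simp only: times_complex.sel Re_complex_of_real Im_complex_of_real moments_vanish(1)[OF assms] mult_zero_left mult_zero_right add_0)
  finally have "Im (LINT r:{0<..}|lborel. stab_ray a m tau r * ?P r * cis stab_angle) = 0" .
  then have "stab a m tau s = Im (LINT r:{0<..}|lborel. stab_ray a m tau r * exp (of_real s * ?z r) * cis stab_angle - stab_ray a m tau r * ?P r * cis stab_angle) / pi"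
   unfolding stab_eq by (subst set_integral_diff(2)[OF stab_integrable[OF assms s] Pint]) simp
  also have "(%r. stab_ray a m tau r * exp (of_real s * ?z r) * cis stab_angle - stab_ray a m tau r * ?P r * cis stab_angle)
   = (%r. stab_ray a m tau r * (exp (of_real s * ?z r) - ?P r) * cis stab_angle)"
   by (simp add: algebra_simps)
  finally have st: "stab a m tau s = Im (LINT r:{0<..}|lborel. stab_ray a m tau r * (exp (of_real s * ?z r) - ?P r) * cis stab_angle) / pi" .
  have "norm (LINT r:{0<..}|lborel. stab_ray a m tau r * (exp (of_real s * ?z r) - ?P r) * cis stab_angle)
    <= (LINT r:{0<..}|lborel. s ^ Suc n / fact n * ?b r)"
  proof (rule norm_set_integral_le(2))
   show "set_integrable lborel {0<..} (%r. s ^ Suc n / fact n * ?b r)"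
    using a rate assms by (intro set_integrable_mult_right set_integrable_powr_exp) auto
   fix r :: real assume r: "r \<in> {0<..}"
   have "norm (exp (of_real s * ?z r) - ?P r) <= norm (of_real s * ?z r) ^ Suc n / fact n"
    using r s rate by (intro norm_exp_Taylor) (auto simp: mult_nonneg_nonpos)
   also have "norm (of_real s * ?z r) = s * r" using r s by (simp add: norm_mult)
   finally have "norm (stab_ray a m tau r) * norm (exp (of_real s * ?z r) - ?P r)
    <= (r powr (a * real m) * exp (- (tau * stab_rate) * r powr a)) * ((s * r) ^ Suc n / fact n)"
    using r s assms by (intro mult_mono norm_stab_ray) auto
   also have "... = s ^ Suc n / fact n * ?b r"
    using r powr_realpow[of r "Suc n"] by (simp only: power_mult_distrib powr_add greaterThan_iff) (simp add: mult_ac)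
   finally show "norm (stab_ray a m tau r * (exp (of_real s * ?z r) - ?P r) * cis stab_angle) <= ..."
    by (simp add: norm_mult)
  qed auto
  then have "\<bar>Im (LINT r:{0<..}|lborel. stab_ray a m tau r * (exp (of_real s * ?z r) - ?P r) * cis stab_angle)\<bar> <= s ^ Suc n / fact n * (LINT r:{0<..}|lborel. ?b r)"
   using order_trans[OF abs_Im_le_cmod] by (simp only: set_integral_mult_right)
  then show ?thesis unfolding st by (simp add: field_simps)
 qed
 then show ?thesis by blast
qed

end

section \<open>Decay and Laplace transform of the stable density\<close>

context stable_exponent

begin

lemma integral_powr_exp_scaled:
 fixes p k :: real
 assumes "p >= 0" "k > 0"
 shows "\<exists>C\<ge>0. \<forall>s>0. (LINT r:{0<..}|lborel. r powr p * exp (- k * (s * r))) <= C * s powr (- 1 - p)"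
proof -
 let ?C = "LINT r:{0<..}|lborel. r powr p * exp (- k * r)"
 have "(LINT r:{0<..}|lborel. r powr p * exp (- k * (s * r))) = ?C * s powr (- 1 - p)" if s: "s > 0" for s
 proof -
  let ?f = "%r. indicat_real {0<..} r *\<^sub>R (r powr p * exp (- k * r))"
  have "?C = s *\<^sub>R (LINT r|lborel. ?f (0 + s * r))"
   unfolding set_lebesgue_integral_def using s lborel_integral_real_affine[of s ?f 0] by simp
  also have "(%r. ?f (0 + s * r)) = (%r. s powr p *\<^sub>R (indicat_real {0<..} r *\<^sub>R (r powr p * exp (- k * (s * r)))))"
   using s by (auto simp: fun_eq_iff indicator_def powr_mult zero_less_mult_iff)
  also have "(LINT r|lborel. s powr p *\<^sub>R (indicat_real {0<..} r *\<^sub>R (r powr p * exp (- k * (s * r)))))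
   = s powr p * (LINT r:{0<..}|lborel. r powr p * exp (- k * (s * r)))"
   unfolding set_lebesgue_integral_def by simp
  finally have "?C * s powr (- 1 - p) = (s * s powr p * s powr (- 1 - p)) * (LINT r:{0<..}|lborel. r powr p * exp (- k * (s * r)))"
   by (simp add: mult_ac)
  also have "s * s powr p * s powr (- 1 - p) = s powr 1 * s powr p * s powr (- 1 - p)" using s by simp
  also have "... = 1" using s unfolding powr_add[symmetric] by simp
  finally show ?thesis by simp
 qed
 moreover have "?C >= 0" unfolding set_lebesgue_integral_def by (intro integral_nonneg_AE) auto
 ultimately show ?thesis by (intro exI[of _ ?C]) auto
qed

lemma set_integrable_powr_exp_linear:
 fixes p k :: real
 assumes "p >= 0" "k > 0"
 shows "set_integrable lborel {0<..} (%r. r powr p * exp (- k * r))"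
proof -
 from assms have "set_integrable lborel {0<..} (%r. r powr p * exp (- k * r powr 1))" by (intro set_integrable_powr_exp) auto
 then show ?thesis by (rule set_integrable_cong[THEN iffD1, rotated -1]) auto
qed

text \<open>Only the factor \<open>exp (s z)\<close> is used for decay and the other exponential is
  bounded by \<open>1\<close>. This costs nothing in \<open>s\<close> and makes the constant
  independent of \<open>tau\<close>.\<close>

lemma stab_large:
 "\<exists>C\<ge>0. \<forall>tau>0. \<forall>s>0. \<bar>stab a m tau s\<bar> <= C * s powr (- 1 - a * real m)"
proof -
 obtain C where C: "C >= 0" "!!s. s > 0 ==> (LINT r:{0<..}|lborel. r powr (a * real m) * exp (- stab_rate * (s * r))) <= C * s powr (- 1 - a * real m)"
  using integral_powr_exp_scaled[of "a * real m" stab_rate] a rate by auto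
 have "\<bar>stab a m tau s\<bar> <= (C / pi) * s powr (- 1 - a * real m)" if "tau > 0" "s > 0" for tau s
 proof -
  have "norm (LINT r:{0<..}|lborel. stab_ray a m tau r * exp (cx s * (cx r * cis stab_angle)) * cis stab_angle)
    <= (LINT r:{0<..}|lborel. r powr (a * real m) * exp (- stab_rate * (s * r)))"
  proof (rule norm_set_integral_le(2))
   have "set_integrable lborel {0<..} (%r. r powr (a * real m) * exp (- (stab_rate * s) * r))"
    using a rate that by (intro set_integrable_powr_exp_linear) auto
   then show "set_integrable lborel {0<..} (%r. r powr (a * real m) * exp (- stab_rate * (s * r)))" by (simp add: mult_ac)
   fix r :: real assume r: "r \<in> {0<..}"
   have "norm (stab_ray a m tau r) <= r powr (a * real m) * exp (- (tau * stab_rate) * r powr a)"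
    using r that by (intro norm_stab_ray) auto
   also have "... <= r powr (a * real m) * 1" using that rate by (intro mult_left_mono) auto
   finally have "norm (stab_ray a m tau r) * exp (- stab_rate * (s * r)) <= r powr (a * real m) * exp (- stab_rate * (s * r))"
    by (intro mult_right_mono) auto
   then show "norm (stab_ray a m tau r * exp (cx s * (cx r * cis stab_angle)) * cis stab_angle)
    <= r powr (a * real m) * exp (- stab_rate * (s * r))"
    by (simp only: norm_mult norm_exp_ray norm_cis mult_1_right)
  qed auto
  also have "... <= C * s powr (- 1 - a * real m)" by (rule C(2)[OF that(2)])
  finally have "\<bar>Im (LINT r:{0<..}|lborel. stab_ray a m tau r * exp (cx s * (cx r * cis stab_angle)) * cis stab_angle)\<bar> <= ..."
   by (rule order_trans[OF abs_Im_le_cmod])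
  then show ?thesis unfolding stab_eq by (simp add: divide_right_mono)
 qed
 then show ?thesis using C(1) by (intro exI[of _ "C / pi"]) auto
qed

lemma norm_exp_minus_1_le:
 fixes w :: complex assumes "Re w >= 0"
 shows "norm (exp (- w) - 1) <= norm w"
 using norm_exp_Taylor[of "-w" 0] assms by simp

text \<open>The integral of \<open>exp (s z)\<close> alone along the ray is \<open>- 1 / s\<close>,
  a real number, so \<open>1\<close> may be subtracted from \<open>stab_ray\<close> without changing
  the imaginary part. The difference is at most \<open>tau * r powr a\<close>. This is the source of
  the factor \<open>tau\<close> in the second bound for \<open>J\<close>, and of the additional
  decay in space that goes with it.\<close>

lemma stab_large_0:
 "\<exists>C\<ge>0. \<forall>tau>0. \<forall>s>0. \<bar>stab a 0 tau s\<bar> <= C * tau * s powr (- 1 - a)"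
proof -
 obtain C where C: "C >= 0" "!!s. s > 0 ==> (LINT r:{0<..}|lborel. r powr a * exp (- stab_rate * (s * r))) <= C * s powr (- 1 - a)"
  using integral_powr_exp_scaled[of a stab_rate] a rate by auto
 have "\<bar>stab a 0 tau s\<bar> <= (C / pi) * tau * s powr (- 1 - a)" if t: "tau > 0" and s: "s > 0" for tau s
 proof -
  let ?E = "%r::real. exp (cx s * (cx r * cis stab_angle)) * cis stab_angle"
  define \<mu> where "\<mu> = - (cx s * cis stab_angle)"
  have mu: "Re \<mu> > 0" using s rate by (simp add: \<mu>_def)
  have E: "?E r = exp (- cx r * \<mu>) * cis stab_angle" for r by (simp add: \<mu>_def mult_ac)
  have Eint: "set_integrable lborel {0<..} ?E" unfolding E by (intro set_integrable_mult_left laplace_exp(1) mu)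
  have "(LINT r:{0<..}|lborel. ?E r) = 1 / \<mu> * cis stab_angle"
   unfolding E using laplace_exp(2)[OF mu] by simp
  also have "... = of_real (- 1 / s)" using s by (simp add: \<mu>_def field_simps)
  finally have E0: "Im (LINT r:{0<..}|lborel. ?E r) = 0" by simp
  have "stab a 0 tau s = Im (LINT r:{0<..}|lborel. stab_ray a 0 tau r * exp (cx s * (cx r * cis stab_angle)) * cis stab_angle - ?E r) / pi"
   unfolding stab_eq using E0 s by (subst set_integral_diff(2)[OF stab_integrable[OF t] Eint]) auto
  also have "(%r. stab_ray a 0 tau r * exp (cx s * (cx r * cis stab_angle)) * cis stab_angle - ?E r) = (%r. (stab_ray a 0 tau r - 1) * ?E r)"
   by (simp add: algebra_simps)
  finally have st: "stab a 0 tau s = Im (LINT r:{0<..}|lborel. (stab_ray a 0 tau r - 1) * ?E r) / pi" .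
  have "norm (LINT r:{0<..}|lborel. (stab_ray a 0 tau r - 1) * ?E r) <= (LINT r:{0<..}|lborel. tau * (r powr a * exp (- stab_rate * (s * r))))"
  proof (rule norm_set_integral_le(2))
   have "set_integrable lborel {0<..} (%r. r powr a * exp (- (stab_rate * s) * r))"
    using a rate s by (intro set_integrable_powr_exp_linear) auto
   then show "set_integrable lborel {0<..} (%r. tau * (r powr a * exp (- stab_rate * (s * r))))"
    by (intro set_integrable_mult_right) (simp add: mult_ac)
   fix r :: real assume r: "r \<in> {0<..}"
   have "norm (stab_ray a 0 tau r - 1) = norm (exp (- (cx tau * (cx (r powr a) * cis (a * stab_angle)))) - 1)"
    by (simp add: stab_ray_def stab_angle_def)
   also have "... <= norm (cx tau * (cx (r powr a) * cis (a * stab_angle)))"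
    using t rate(1) by (intro norm_exp_minus_1_le) (simp add: stab_rate_def)
   also have "... = tau * r powr a" using t by (simp add: norm_mult)
   finally have "norm (stab_ray a 0 tau r - 1) * exp (- stab_rate * (s * r)) <= tau * r powr a * exp (- stab_rate * (s * r))"
    by (intro mult_right_mono) auto
   then show "norm ((stab_ray a 0 tau r - 1) * ?E r) <= tau * (r powr a * exp (- stab_rate * (s * r)))"
    by (simp only: norm_mult norm_exp_ray norm_cis mult_1_right mult.assoc)
  qed auto
  also have "... <= tau * (C * s powr (- 1 - a))" using C(2)[OF s] t by simp
  finally have "\<bar>Im (LINT r:{0<..}|lborel. (stab_ray a 0 tau r - 1) * ?E r)\<bar> <= ..."
   by (rule order_trans[OF abs_Im_le_cmod])
  then show ?thesis unfolding st by (simp add: divide_right_mono mult_ac)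
 qed
 then show ?thesis using C(1) by (intro exI[of _ "C / pi"]) auto
qed

text \<open>The angle is obtuse, so all terms in the law of cosines are nonnegative.\<close>

lemma norm_ray_minus:
 assumes "r > 0" "l > 0"
 shows "norm (cx r * cis stab_angle - of_real l) >= r" "norm (cx r * cis stab_angle - of_real l) >= l"
proof -
 have "(norm (cx r * cis stab_angle - of_real l))\<^sup>2 = (r * cos stab_angle - l)\<^sup>2 + (r * sin stab_angle)\<^sup>2"
  by (simp add: cmod_power2)
 also have "... = r\<^sup>2 * ((cos stab_angle)\<^sup>2 + (sin stab_angle)\<^sup>2) + l\<^sup>2 + 2 * r * l * stab_rate"
  unfolding rate(3) by (simp add: power2_eq_square algebra_simps)
 finally have "(norm (cx r * cis stab_angle - of_real l))\<^sup>2 = r\<^sup>2 + l\<^sup>2 + 2 * r * l * stab_rate" by simp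
 then have "(norm (cx r * cis stab_angle - of_real l))\<^sup>2 >= r\<^sup>2" "(norm (cx r * cis stab_angle - of_real l))\<^sup>2 >= l\<^sup>2"
  using assms rate by auto
 then show "norm (cx r * cis stab_angle - of_real l) >= r" "norm (cx r * cis stab_angle - of_real l) >= l"
  by (auto intro: power2_le_imp_le)
qed

lemma norm_ray_plus:
 assumes "r > 0" "l > 0"
 shows "norm (cx r * cis stab_angle + of_real l) >= r * sin stab_angle" "norm (cx r * cis stab_angle + of_real l) >= l * sin stab_angle"
proof -
 show "norm (cx r * cis stab_angle + of_real l) >= r * sin stab_angle"
  using abs_Im_le_cmod[of "cx r * cis stab_angle + of_real l"] by simp
 have "norm (cx r * cis stab_angle + of_real l) = norm ((cx r * cis stab_angle + of_real l) * cis (- stab_angle))"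
  by (simp add: norm_mult)
 also have "(cx r * cis stab_angle + of_real l) * cis (- stab_angle) = of_real r + of_real l * cis (- stab_angle)"
  by (simp add: algebra_simps cis_mult)
 finally show "norm (cx r * cis stab_angle + of_real l) >= l * sin stab_angle"
  using abs_Im_le_cmod[of "of_real r + of_real l * cis (- stab_angle)"] by simp
qed

lemma set_integrable_inverse_square:
 assumes "l > 0" shows "set_integrable lborel {0<..} (%r::real. (l + r) powr (-2))"
proof -
 have "integrable lborel (%t::real. (l + \<bar>t\<bar>) powr (-(1 + 1)))"
  using nn_integral_powr_abs_tail[of l 1] assms
  by (intro integrableI_bounded) (auto intro: order_le_less_trans)
 then show ?thesis unfolding set_integrable_def
  by (rule Bochner_Integration.integrable_bound) (auto simp: indicator_def)
qed

text \<open>The primitive \<open>Ln ((l - z) / (l + z))\<close> is rotated by \<open>\<i>\<close>, so that it stays off the branch cut.\<close>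

lemma pole_integral:
 assumes l: "l > 0"
 shows "set_integrable lborel {0<..} (%r. 2 * of_real l * cis stab_angle / ((of_real r * cis stab_angle)\<^sup>2 - (of_real l)\<^sup>2))"
  and "(LINT r:{0<..}|lborel. 2 * of_real l * cis stab_angle / ((of_real r * cis stab_angle)\<^sup>2 - (of_real l)\<^sup>2)) = - \<i> * of_real pi"
proof -
 let ?z = "%r::real. cx r * cis stab_angle"
 let ?f = "%r. 2 * of_real l * cis stab_angle / ((?z r)\<^sup>2 - (of_real l)\<^sup>2)"
 have fac: "(?z r)\<^sup>2 - (of_real l)\<^sup>2 = (?z r - of_real l) * (?z r + of_real l)" for r
  by (simp add: power2_eq_square algebra_simps)
 have nz: "?z r - of_real l \<noteq> 0" "?z r + of_real l \<noteq> 0" if "r > 0" for r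
  using norm_ray_minus(1)[OF that l] norm_ray_plus(1)[OF that l] rate(4) that
  by (auto simp del: norm_le_zero_iff simp: mult_le_0_iff)
 show int: "set_integrable lborel {0<..} ?f"
 proof (rule norm_set_integral_le(1))
  show "set_integrable lborel {0<..} (%r. (8 * l / sin stab_angle) * (l + r) powr (-2))"
   by (intro set_integrable_mult_right set_integrable_inverse_square l)
  fix r :: real assume "r \<in> {0<..}"
  then have r: "r > 0" by simp
  have "(l + r) / 2 <= norm (?z r - of_real l)" using norm_ray_minus[OF r l] by simp
  moreover have "(l + r) / 2 * sin stab_angle <= norm (?z r + of_real l)"
   using norm_ray_plus[OF r l] by (simp add: algebra_simps)
  ultimately have "(l + r) / 2 * ((l + r) / 2 * sin stab_angle) <= norm (?z r - of_real l) * norm (?z r + of_real l)"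
   using r l rate(4) by (intro mult_mono) auto
  then have lb: "(l + r)\<^sup>2 * sin stab_angle / 4 <= norm ((?z r)\<^sup>2 - (of_real l)\<^sup>2)"
   unfolding fac norm_mult by (simp add: power2_eq_square)
  have "norm (?f r) = 2 * l / norm ((?z r)\<^sup>2 - (of_real l)\<^sup>2)" using l by (simp add: norm_divide norm_mult)
  also have "... <= 2 * l / ((l + r)\<^sup>2 * sin stab_angle / 4)"
   using lb l r rate(4) by (intro divide_left_mono) (auto intro!: mult_pos_pos less_le_trans[OF _ lb] divide_pos_pos)
  also have "... = (8 * l / sin stab_angle) * (l + r) powr (-2)"
   using l r by (simp add: powr_minus powr_numeral divide_simps)
  finally show "norm (?f r) <= ..." .
 qed auto
 define F where "F = (%r::real. Ln (\<i> * ((of_real l - ?z r) / (of_real l + ?z r))))"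
 have "(LBINT r=0..\<infinity>. ?f r) = Ln (- \<i>) - Ln \<i>"
 proof (rule interval_integral_FTC_integrable[where F=F])
  fix r :: real assume "0 < ereal r" "ereal r < \<infinity>"
  then have r: "r > 0" by (simp add: zero_ereal_def)
  have ne: "of_real l + ?z r \<noteq> 0" "of_real l - ?z r \<noteq> 0" using nz[OF r] by (auto simp: algebra_simps)
  show "isCont ?f r" using nz[OF r] unfolding fac by (intro continuous_intros) auto
  have "Re (\<i> * ((of_real l - ?z r) / (of_real l + ?z r))) > 0"
  proof -
   have "Re (\<i> * ((of_real l - ?z r) / (of_real l + ?z r))) = 2 * l * (r * sin stab_angle) / (norm (of_real l + ?z r))\<^sup>2"
   proof -
    have e1: "(of_real l - ?z r) / (of_real l + ?z r) = ((of_real l - ?z r) * cnj (of_real l + ?z r)) / of_real ((norm (of_real l + ?z r))\<^sup>2)"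
     using complex_div_cnj[of "of_real l - ?z r" "of_real l + ?z r"] by (simp only: of_real_power)
    have e2: "Im ((of_real l - ?z r) * cnj (of_real l + ?z r)) = - 2 * l * (r * sin stab_angle)"
     by (simp add: algebra_simps)
    have e3: "Re (\<i> * (X / of_real n)) = - Im X / n" for X n by simp
    show ?thesis unfolding e1 e3 e2 by simp
   qed
   then show ?thesis using l r rate(4) ne(1) by simp
  qed
  then have nr: "\<i> * ((of_real l - ?z r) / (of_real l + ?z r)) \<notin> \<real>\<^sub>\<le>\<^sub>0"
   by (auto simp: complex_nonpos_Reals_iff)
  have "((%w. Ln (\<i> * ((of_real l - w * cis stab_angle) / (of_real l + w * cis stab_angle)))) has_field_derivative ?f r) (at (of_real r))"
  proof -
   have "((%w. \<i> * ((of_real l - w * cis stab_angle) / (of_real l + w * cis stab_angle))) has_field_derivative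
    \<i> * ((- cis stab_angle * (of_real l + ?z r) - (of_real l - ?z r) * cis stab_angle) / ((of_real l + ?z r) * (of_real l + ?z r)))) (at (of_real r))"
    using ne by (auto intro!: derivative_eq_intros simp: algebra_simps)
   from DERIV_chain2[where f=Ln, OF has_field_derivative_Ln[OF nr] this]
   have "((%w. Ln (\<i> * ((of_real l - w * cis stab_angle) / (of_real l + w * cis stab_angle)))) has_field_derivative
    inverse (\<i> * ((of_real l - ?z r) / (of_real l + ?z r))) * (\<i> * ((- cis stab_angle * (of_real l + ?z r) - (of_real l - ?z r) * cis stab_angle) / ((of_real l + ?z r) * (of_real l + ?z r))))) (at (of_real r))" .
   moreover have "inverse (\<i> * ((of_real l - ?z r) / (of_real l + ?z r))) * (\<i> * ((- cis stab_angle * (of_real l + ?z r) - (of_real l - ?z r) * cis stab_angle) / ((of_real l + ?z r) * (of_real l + ?z r)))) = ?f r"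
   proof -
    have "(- cis stab_angle * (of_real l + ?z r) - (of_real l - ?z r) * cis stab_angle) = - (2 * of_real l * cis stab_angle)"
     by (simp add: algebra_simps)
    moreover have "(?z r)\<^sup>2 - (of_real l)\<^sup>2 = - ((of_real l - ?z r) * (of_real l + ?z r))" by (simp add: power2_eq_square algebra_simps)
    moreover have "inverse (\<i> * (A / B)) * (\<i> * (- C / (B * B))) = C / (- (A * B))" if "A \<noteq> 0" "B \<noteq> 0" for A B C :: complex
     using that by (simp add: field_simps)
    ultimately show ?thesis using ne by simp
   qed
   ultimately show ?thesis by simp
  qed
  from has_vector_derivative_real_field[OF this]
  show "(F has_vector_derivative ?f r) (at r)" unfolding F_def .
 next
  show "set_integrable lborel (einterval 0 \<infinity>) ?f" using int by (simp add: zero_ereal_def)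
  have "(F \<longlongrightarrow> Ln (\<i> * ((of_real l - ?z 0) / (of_real l + ?z 0)))) (at_right 0)"
   unfolding F_def using l by (intro tendsto_intros) auto
  then show "((F \<circ> real_of_ereal) \<longlongrightarrow> Ln \<i>) (at_right 0)"
   unfolding zero_ereal_def using l by (subst ereal_tendsto_simps) simp
  \<comment> \<open>Numerator and denominator are divided by \<open>r\<close>, which turns the limit
    at infinity into one by continuity; the limiting value \<open>- \<i>\<close> is off the branch
    cut.\<close>
  have "((%r. Ln (\<i> * ((of_real l * of_real (inverse r) - cis stab_angle) / (of_real l * of_real (inverse r) + cis stab_angle))))
   \<longlongrightarrow> Ln (\<i> * ((of_real l * of_real 0 - cis stab_angle) / (of_real l * of_real 0 + cis stab_angle)))) at_top"
   by (intro tendsto_intros tendsto_inverse_0_at_top filterlim_ident) (auto simp: complex_nonpos_Reals_iff)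
  moreover have "\<forall>\<^sub>F r in at_top. Ln (\<i> * ((of_real l * of_real (inverse r) - cis stab_angle) / (of_real l * of_real (inverse r) + cis stab_angle))) = F r"
   using eventually_gt_at_top[of 0]
  proof eventually_elim
   fix r :: real assume r: "r > 0"
   have "of_real l * of_real (inverse r) - cis stab_angle = (of_real l - ?z r) / of_real r"
    "of_real l * of_real (inverse r) + cis stab_angle = (of_real l + ?z r) / of_real r"
    using r by (simp_all add: field_simps)
   then show "Ln (\<i> * ((of_real l * of_real (inverse r) - cis stab_angle) / (of_real l * of_real (inverse r) + cis stab_angle))) = F r"
    using r by (simp add: F_def)
  qed
  ultimately have "(F \<longlongrightarrow> Ln (- \<i>)) at_top"
   using Lim_transform_eventually by fastforce
  then show "((F \<circ> real_of_ereal) \<longlongrightarrow> Ln (- \<i>)) (at_left \<infinity>)" by (subst ereal_tendsto_simps)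
 qed auto
 then show "(LINT r:{0<..}|lborel. ?f r) = - \<i> * of_real pi"
  by (simp add: interval_lebesgue_integral_0_infty)
qed

end

lemma integrable_pair_mult:
 fixes g b :: "real => real"
 assumes g: "integrable lborel g" and b: "integrable lborel b"
 shows "integrable (lborel \<Otimes>\<^sub>M lborel) (%(s, r). g s * b r)"
proof (rule lborel_pair.Fubini_integrable)
 have [measurable]: "g \<in> borel_measurable borel" "b \<in> borel_measurable borel"
  using assms by auto
 show "(%(s, r). g s * b r) \<in> borel_measurable (lborel \<Otimes>\<^sub>M lborel)" by measurable
 have "integrable lborel (%s. norm (g s) * (LINT r|lborel. norm (b r)))" using g by simp
 then show "integrable lborel (%s. LINT r|lborel. norm (case (s, r) of (s, r) => g s * b r))" by (simp add: abs_mult)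
qed (use b in auto)

context stable_exponent

begin

text \<open>A Cauchy formula on the ray. The function \<open>f\<close> vanishes at \<open>l\<close>,
  so the quotient \<open>q\<close> has no pole there; it is real on the positive axis, hence its ray
  integral is real. The subtracted part is evaluated by \<open>pole_integral\<close> and yields
  \<open>pi * hl\<close>. A constant in place of \<open>2 * l / (z + l)\<close> would also cancel
  the pole, but would leave \<open>q\<close> of order \<open>1 / z\<close>, and then the outer arc
  does not vanish.\<close>

lemma stab_cauchy:
 assumes t: "tau > 0" and l: "l > 0"
 shows "Im (LINT r:{0<..}|lborel. stab_ray a m tau r * cis stab_angle / (of_real l - of_real r * cis stab_angle)) / pi
  = (- (l powr a)) ^ m * exp (- tau * l powr a)"
proof -
 let ?z = "%r::real. cx r * cis stab_angle"
 let ?L = "cx l"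
 define hl where "hl = (- (l powr a)) ^ m * exp (- tau * l powr a)"
 have hl: "stab_hol m tau ?L = of_real hl" unfolding hl_def by (rule stab_hol_real[OF l])
 define f where "f = (%z. stab_hol m tau z - of_real hl * (2 * ?L / (z + ?L)))"
 define q where "q = (%z. if z = ?L then deriv f ?L else (f z - f ?L) / (z - ?L))"
 have fl: "f ?L = 0" using l by (simp add: f_def hl)
 have pl: "z + ?L \<noteq> 0" if "z \<in> slit" for z
 proof
  assume "z + ?L = 0"
  then have "z = - ?L" by (simp add: add_eq_0_iff2)
  then show False using that l by (simp add: slit_def)
 qed
 have "f holomorphic_on slit" unfolding f_def
  by (intro holomorphic_intros holomorphic_stab_hol pl)
 then have qh: "q holomorphic_on slit" unfolding q_def by (rule pole_lemma_open[OF _ open_slit])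
 have qne: "q z = f z / (z - ?L)" if "z \<noteq> ?L" for z using that by (simp add: q_def fl)
 let ?p = "a * real m"
 let ?X = "%r. r powr ?p * exp (- (tau * stab_rate) * r powr a)"
 have znorm: "norm (of_real r * cis \<phi>) = r" if "r > 0" for r \<phi> using that by (simp add: norm_mult)
 have fb: "norm (f (of_real r * cis \<phi>)) <= ?X r + \<bar>hl\<bar> * (2 * l / d)"
  if "r > 0" "0 <= \<phi>" "\<phi> <= stab_angle" "d > 0" "d <= norm (of_real r * cis \<phi> + ?L)" for r \<phi> d
 proof -
  have "norm (f (of_real r * cis \<phi>)) <= norm (stab_hol m tau (of_real r * cis \<phi>)) + norm (of_real hl * (2 * ?L / (of_real r * cis \<phi> + ?L)))"
   unfolding f_def by (rule norm_triangle_ineq4)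
  also have "norm (of_real hl * (2 * ?L / (of_real r * cis \<phi> + ?L))) = \<bar>hl\<bar> * (2 * l / norm (of_real r * cis \<phi> + ?L))"
   using l by (simp add: norm_mult norm_divide)
  also have "... <= \<bar>hl\<bar> * (2 * l / d)"
   using that l by (intro mult_left_mono divide_left_mono) (auto intro!: mult_pos_pos)
  finally show ?thesis using norm_stab_hol[of r \<phi> tau m] that t by simp
 qed
 have qr: "Im (q (of_real r)) = 0" if "r > 0" for r
 proof (cases "r = l")
  case False
  have "q (of_real r) = of_real (((- (r powr a)) ^ m * exp (- tau * r powr a) - hl * (2 * l / (r + l))) / (r - l))"
   using False that by (subst qne) (simp_all add: f_def stab_hol_real)
  then show ?thesis by simp
 next
  \<comment> \<open>At \<open>r = l\<close> the value of \<open>q\<close> is a derivative; it is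
    real as a limit of real values.\<close>
  case True
  have "?L \<in> slit" using l by (simp add: slit_def)
  then have "isCont q ?L"
   using holomorphic_on_imp_continuous_on[OF qh] continuous_on_eq_continuous_at[OF open_slit, of q] by blast
  moreover have "isCont cx l" by (intro continuous_intros)
  ultimately have "isCont (%x. Im (q (of_real x))) l"
   by (intro isCont_Im isCont_o2[of l cx q])
  then have "((%x. Im (q (of_real x))) \<longlongrightarrow> Im (q ?L)) (at l)" by (simp add: isCont_def)
  moreover have "((%x. Im (q (of_real x))) \<longlongrightarrow> 0) (at l)"
  proof (rule tendsto_eventually)
   have "\<forall>\<^sub>F x in at l. x > 0 \<and> x \<noteq> l"
    using order_tendstoD(1)[OF tendsto_ident_at l] eventually_neq_at_within[of l] by eventually_elim auto
   then show "\<forall>\<^sub>F x in at l. Im (q (of_real x)) = 0"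
   proof eventually_elim
    fix r assume r: "0 < r \<and> r \<noteq> l"
    have "q (of_real r) = of_real (((- (r powr a)) ^ m * exp (- tau * r powr a) - hl * (2 * l / (r + l))) / (r - l))"
     using r by (subst qne) (simp_all add: f_def stab_hol_real)
    then show "Im (q (of_real r)) = 0" by simp
   qed
  qed
  ultimately show ?thesis using True tendsto_unique[OF trivial_limit_at] by blast
 qed
 have tri: "norm (of_real r * cis \<phi> + ?L) >= \<bar>r - l\<bar>" "norm (of_real r * cis \<phi> - ?L) >= \<bar>r - l\<bar>" if "r > 0" for r \<phi>
  using norm_triangle_ineq3[of "of_real r * cis \<phi>" ?L] norm_triangle_ineq3[of "of_real r * cis \<phi>" "- ?L"] l znorm[OF that] by auto
 have qray: "q (?z r) * cis stab_angle = - (stab_ray a m tau r * cis stab_angle / (?L - ?z r))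
   - of_real hl * (2 * ?L * cis stab_angle / ((?z r)\<^sup>2 - ?L\<^sup>2))" if "r > 0" for r
 proof -
  have n1: "?z r - ?L \<noteq> 0" using norm_ray_minus(1)[OF that l] that by auto
  have n2: "?z r + ?L \<noteq> 0" using norm_ray_plus(1)[OF that l] that rate(4) by (auto simp: mult_le_0_iff)
  have fac: "(?z r)\<^sup>2 - ?L\<^sup>2 = (?z r - ?L) * (?z r + ?L)" by (simp add: power2_eq_square algebra_simps)
  have gen: "(A - B * (2 * ?L / P)) / M * e = - (A * e / (- M)) - B * (2 * ?L * e / (M * P))"
   if "M \<noteq> 0" "P \<noteq> 0" for A B M P e :: complex
   using that by (simp add: field_simps)
  have m: "?L - ?z r = - (?z r - ?L)" by simp
  have qz: "q (?z r) = (stab_ray a m tau r - of_real hl * (2 * ?L / (?z r + ?L))) / (?z r - ?L)"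
   using qne[of "?z r"] n1 that by (simp add: f_def stab_hol_ray)
  show ?thesis unfolding qz fac m by (rule gen[OF n1 n2])
 qed
 have int1: "set_integrable lborel {0<..} (%r. stab_ray a m tau r * cis stab_angle / (?L - ?z r))"
 proof (rule norm_set_integral_le(1))
  show "set_integrable lborel {0<..} (%r. (1 / l) * ?X r)"
   using a rate t by (intro set_integrable_mult_right set_integrable_powr_exp) auto
  fix r :: real assume "r \<in> {0<..}"
  then have r: "r > 0" by simp
  have "norm (?L - ?z r) >= l" using norm_ray_minus(2)[OF r l] by (simp add: norm_minus_commute)
  then have "norm (stab_ray a m tau r) / norm (?L - ?z r) <= ?X r / l"
   using l r t by (intro frac_le norm_stab_ray) auto
  then show "norm (stab_ray a m tau r * cis stab_angle / (?L - ?z r)) <= (1 / l) * ?X r"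
   by (simp add: norm_divide norm_mult)
 qed auto
 have int2: "set_integrable lborel {0<..} (%r. of_real hl * (2 * ?L * cis stab_angle / ((?z r)\<^sup>2 - ?L\<^sup>2)))"
  by (intro set_integrable_mult_right pole_integral(1) l)
 have int12: "set_integrable lborel {0<..} (%r. - (stab_ray a m tau r * cis stab_angle / (?L - ?z r))
   - of_real hl * (2 * ?L * cis stab_angle / ((?z r)\<^sup>2 - ?L\<^sup>2)))"
  using int1 int2 by (intro set_integral_diff(1)) (auto simp: set_integrable_def)
 have intq: "set_integrable lborel {0<..} (%r. q (?z r) * cis stab_angle)"
  using int12 by (rule set_integrable_cong[THEN iffD1, rotated -1]) (auto simp: qray)
 have "Im (LINT r:{0<..}|lborel. q (?z r) * cis stab_angle) = 0"
 \<comment> \<open>For radii up to \<open>l / 2\<close> the distance to both \<open>l\<close> and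
   \<open>- l\<close> is at least \<open>l / 2\<close>; for radii from \<open>2 * l\<close> on it is
   at least \<open>r / 2\<close>.\<close>
 proof (rule Im_ray_integral_eq_0[where q=q and ra="min 1 (l / 2)" and rb="2 * l"
    and Ba="(1 + \<bar>hl\<bar> * (2 * l / (l / 2))) / (l / 2)" and B="%r. (?X r + \<bar>hl\<bar> * (2 * l / (r / 2))) / (r / 2)"])
  fix r \<phi> assume r: "r > 0" "r <= min 1 (l / 2)" "0 <= \<phi>" "\<phi> <= stab_angle"
  have ne: "of_real r * cis \<phi> \<noteq> ?L" using tri(2)[OF r(1), of \<phi>] r l by auto
  have "?X r <= 1 * 1" using r t rate a by (intro mult_mono) (auto intro: powr_le1)
  then have "norm (f (of_real r * cis \<phi>)) <= 1 + \<bar>hl\<bar> * (2 * l / (l / 2))"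
   using fb[OF r(1,3,4), of "l / 2"] tri(1)[OF r(1), of \<phi>] r l by auto
  moreover have "norm (of_real r * cis \<phi> - ?L) >= l / 2" using tri(2)[OF r(1), of \<phi>] r l by auto
  ultimately show "norm (q (of_real r * cis \<phi>)) <= (1 + \<bar>hl\<bar> * (2 * l / (l / 2))) / (l / 2)"
   unfolding qne[OF ne] norm_divide using l by (intro frac_le) auto
 next
  fix r \<phi> assume r: "r > 0" "2 * l <= r" "0 <= \<phi>" "\<phi> <= stab_angle"
  have ne: "of_real r * cis \<phi> \<noteq> ?L" using tri(2)[OF r(1), of \<phi>] r l by auto
  have "norm (f (of_real r * cis \<phi>)) <= ?X r + \<bar>hl\<bar> * (2 * l / (r / 2))"
   using fb[OF r(1,3,4), of "r / 2"] tri(1)[OF r(1), of \<phi>] r l by auto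
  moreover have "norm (of_real r * cis \<phi> - ?L) >= r / 2" using tri(2)[OF r(1), of \<phi>] r l by auto
  ultimately show "norm (q (of_real r * cis \<phi>)) <= (?X r + \<bar>hl\<bar> * (2 * l / (r / 2))) / (r / 2)"
   unfolding qne[OF ne] norm_divide using l r by (intro frac_le add_nonneg_nonneg mult_nonneg_nonneg) auto
 next
  have "((%r. 2 * (?X r) + 8 * \<bar>hl\<bar> * l * inverse r) \<longlongrightarrow> 2 * 0 + 8 * \<bar>hl\<bar> * l * 0) at_top"
   using t rate by (intro tendsto_intros powr_exp_tendsto_0 tendsto_inverse_0_at_top filterlim_ident) auto
  then have lim: "((%r. 2 * (?X r) + 8 * \<bar>hl\<bar> * l * inverse r) \<longlongrightarrow> 0) at_top" by simp
  show "((%r. r * ((?X r + \<bar>hl\<bar> * (2 * l / (r / 2))) / (r / 2))) \<longlongrightarrow> 0) at_top"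
  proof (rule Lim_transform_eventually[OF lim])
   show "\<forall>\<^sub>F r in at_top. 2 * (?X r) + 8 * \<bar>hl\<bar> * l * inverse r = r * ((?X r + \<bar>hl\<bar> * (2 * l / (r / 2))) / (r / 2))"
    using eventually_gt_at_top[of 0] by eventually_elim (simp add: field_simps)
  qed
 qed (use qh qr angle angle_pos l intq in auto)
 also have "(LINT r:{0<..}|lborel. q (?z r) * cis stab_angle) = (LINT r:{0<..}|lborel. - (stab_ray a m tau r * cis stab_angle / (?L - ?z r))
   - of_real hl * (2 * ?L * cis stab_angle / ((?z r)\<^sup>2 - ?L\<^sup>2)))"
  by (intro set_lebesgue_integral_cong) (auto simp: qray)
 also have "... = - (LINT r:{0<..}|lborel. stab_ray a m tau r * cis stab_angle / (?L - ?z r)) - of_real hl * (- \<i> * of_real pi)"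
 proof -
  have i1: "set_integrable lborel {0<..} (%r. - (stab_ray a m tau r * cis stab_angle / (?L - ?z r)))"
   using int1 by (simp add: set_integrable_def)
  have "(LINT r:{0<..}|lborel. - (stab_ray a m tau r * cis stab_angle / (?L - ?z r))) = - (LINT r:{0<..}|lborel. stab_ray a m tau r * cis stab_angle / (?L - ?z r))"
   by (simp add: set_lebesgue_integral_def)
  moreover have "(LINT r:{0<..}|lborel. of_real hl * (2 * ?L * cis stab_angle / ((?z r)\<^sup>2 - ?L\<^sup>2))) = of_real hl * (- \<i> * of_real pi)"
   unfolding pole_integral(2)[OF l, symmetric] by (rule set_integral_mult_right)
  ultimately show ?thesis by (simp only: set_integral_diff(2)[OF i1 int2])
 qed
 finally show ?thesis unfolding hl_def[symmetric] by (simp add: field_simps)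
qed

text \<open>After exchanging the integrals, the inner one is the Laplace transform of an
  exponential, \<open>1 / (l - z)\<close>, and the outer one is the Cauchy integral above.\<close>

lemma stab_laplace:
 assumes t: "tau > 0" and l: "l > 0"
 shows "(LINT s:{0<..}|lborel. exp (- s * l) * stab a m tau s) = (- (l powr a)) ^ m * exp (- tau * l powr a)"
proof -
 let ?z = "%r::real. cx r * cis stab_angle"
 define f where "f = (%s r. cx (indicator {0<..} s * indicator {0<..} r * exp (- s * l)) *
  (stab_ray a m tau r * exp (cx s * ?z r) * cis stab_angle))"
 have [measurable]: "(%(s, r). f s r) \<in> borel_measurable (lborel \<Otimes>\<^sub>M lborel)" unfolding f_def by measurable
 let ?X = "%r. r powr (a * real m) * exp (- (tau * stab_rate) * r powr a)"
 have "set_integrable lborel {0<..} (%s::real. s powr 0 * exp (- l * s))"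
  using l by (intro set_integrable_powr_exp_linear) auto
 then have g: "integrable lborel (%s::real. indicator {0<..} s *\<^sub>R (s powr 0 * exp (- l * s)))"
  by (simp add: set_integrable_def)
 have b: "integrable lborel (%r. indicator {0<..} r *\<^sub>R ?X r)"
  using set_integrable_powr_exp[of a "tau * stab_rate" "a * real m"] a rate t by (simp add: set_integrable_def)
 have intf: "integrable (lborel \<Otimes>\<^sub>M lborel) (case_prod f)"
 proof (rule Bochner_Integration.integrable_bound[OF integrable_pair_mult[OF g b]])
  show "AE x in lborel \<Otimes>\<^sub>M lborel. norm (case_prod f x)
   <= norm (case x of (s, r) => (indicator {0<..} s *\<^sub>R (s powr 0 * exp (- l * s))) * (indicator {0<..} r *\<^sub>R ?X r))"
  proof (rule AE_I2, clarify)
   fix s r :: real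
   show "norm (f s r) <= norm ((indicator {0<..} s *\<^sub>R (s powr 0 * exp (- l * s))) * (indicator {0<..} r *\<^sub>R ?X r))"
   proof (cases "s > 0 \<and> r > 0")
    case True
    have "norm (f s r) = exp (- l * s) * (norm (stab_ray a m tau r) * exp (- stab_rate * (s * r)))"
     unfolding f_def norm_mult norm_exp_ray using True by (simp add: mult.commute)
    also have "... <= exp (- l * s) * (?X r * 1)"
     using True t rate by (intro mult_left_mono mult_mono norm_stab_ray) auto
    finally show ?thesis using True by simp
   qed (auto simp: f_def)
  qed
 qed measurable
 have "(LINT s|lborel. LINT r|lborel. f s r) = (LINT r|lborel. LINT s|lborel. f s r)"
  by (rule lborel_pair.Fubini_integral[OF intf, symmetric])
 also have "... = (LINT r|lborel. indicator {0<..} r *\<^sub>R (stab_ray a m tau r * cis stab_angle / (of_real l - ?z r)))"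
 proof (intro Bochner_Integration.integral_cong refl)
  fix r :: real
  show "(LINT s|lborel. f s r) = indicator {0<..} r *\<^sub>R (stab_ray a m tau r * cis stab_angle / (of_real l - ?z r))"
  proof (cases "r > 0")
   case True
   have re: "Re (of_real l - ?z r) > 0" using True l rate by (simp add: add_pos_nonneg)
   have "(LINT s|lborel. f s r) = (LINT s:{0<..}|lborel. (stab_ray a m tau r * cis stab_angle) * exp (- of_real s * (of_real l - ?z r)))"
    unfolding set_lebesgue_integral_def using True
    by (intro Bochner_Integration.integral_cong refl)
     (simp add: f_def scaleR_conv_of_real exp_of_real[symmetric] exp_add[symmetric] algebra_simps mult_exp_exp)
   also have "... = (stab_ray a m tau r * cis stab_angle) * (1 / (of_real l - ?z r))"
    using laplace_exp(2)[OF re] by simp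
   finally show ?thesis using True by simp
  qed (simp add: f_def)
 qed
 finally have F: "(LINT s|lborel. LINT r|lborel. f s r) = (LINT r:{0<..}|lborel. stab_ray a m tau r * cis stab_angle / (of_real l - ?z r))"
  by (simp add: set_lebesgue_integral_def)
 have fs: "(LINT r|lborel. f s r) = cx (indicator {0<..} s * exp (- s * l)) *
  (LINT r:{0<..}|lborel. stab_ray a m tau r * exp (cx s * ?z r) * cis stab_angle)" for s
  unfolding f_def set_lebesgue_integral_def
  by (subst integral_mult_right_zero[symmetric]) (intro Bochner_Integration.integral_cong refl, simp add: scaleR_conv_of_real mult_ac)
 have "integrable lborel (%s. LINT r|lborel. f s r)"
  by (rule lborel_pair.integrable_fst[OF intf])
 then have "Im (LINT s|lborel. LINT r|lborel. f s r) = (LINT s|lborel. Im (LINT r|lborel. f s r))"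
  by (simp add: integral_Im)
 also have "(%s. Im (LINT r|lborel. f s r)) = (%s. pi * (indicator {0<..} s *\<^sub>R (exp (- s * l) * stab a m tau s)))"
  unfolding fs stab_eq by (auto simp: fun_eq_iff)
 finally have "Im (LINT s|lborel. LINT r|lborel. f s r) = pi * (LINT s:{0<..}|lborel. exp (- s * l) * stab a m tau s)"
  by (simp add: set_lebesgue_integral_def)
 then show ?thesis using stab_cauchy[OF t l, of m] unfolding F by simp
qed

lemma stab_measurable [measurable]: "stab a m tau \<in> borel_measurable borel"
 unfolding stab_def set_lebesgue_integral_def stab_ray_def by measurable

end

section \<open>Subordination and kernel bounds\<close>

lemma integral_lborel_prod:
 fixes f :: "'a::euclidean_space => real => complex"
 assumes "!!b. b \<in> Basis ==> integrable lborel (f b)"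
 shows "(LINT x|lborel. (\<Prod>b\<in>Basis. f b (x \<bullet> b))) = (\<Prod>b\<in>Basis. LINT t|lborel. f b t)"
proof -
 interpret product_sigma_finite "%_::'a. lborel :: real measure" ..
 have [measurable]: "b \<in> Basis ==> f b \<in> borel_measurable borel" for b using assms[of b] by auto
 have "(LINT x|lborel. (\<Prod>b\<in>Basis. f b (x \<bullet> b)))
  = (LINT g|(\<Pi>\<^sub>M b\<in>Basis. lborel). (\<Prod>b\<in>Basis. f b ((\<Sum>b\<in>Basis. g b *\<^sub>R b) \<bullet> b)))"
  by (subst lborel_eq) (subst integral_distr, auto)
 also have "... = (LINT g|(\<Pi>\<^sub>M b\<in>Basis. lborel). (\<Prod>b\<in>Basis. f b (g b)))"
  by (intro Bochner_Integration.integral_cong refl prod.cong) simp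
 also have "... = (\<Prod>b\<in>Basis. LINT t|lborel. f b t)"
  by (rule product_integral_prod) (auto intro: assms)
 finally show ?thesis .
qed

text \<open>A rescaling by \<open>sqrt (2 * s)\<close> of the characteristic function of the
  standard normal distribution.\<close>

lemma gaussian_fourier_1d:
 fixes u s :: real
 assumes s: "s > 0"
 shows "integrable lborel (%t. expi (u * t) * cx (exp (- s * t\<^sup>2)))"
  and "(LINT t|lborel. expi (u * t) * cx (exp (- s * t\<^sup>2)))
   = cx (sqrt (pi / s) * exp (- u\<^sup>2 / (4 * s)))"
proof -
 define r where "r = sqrt (2 * s)"
 have r: "r > 0" "r\<^sup>2 = 2 * s" using s by (auto simp: r_def)
 define k where "k = sqrt (pi / s)"
 have k: "k > 0" using s by (simp add: k_def)
 let ?h = "%x. std_normal_density x *\<^sub>R expi ((u / r) * x)"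
 have inth: "integrable lborel ?h"
  by (rule Bochner_Integration.integrable_bound[OF integrable_normal_density[of 1 0]]) (auto simp: norm_mult)
 have "char std_normal_distribution (u / r) = (LINT x|lborel. ?h x)"
  unfolding char_def by (subst integral_density) auto
 then have H: "(LINT x|lborel. ?h x) = cx (exp (- (u / r)\<^sup>2 / 2))"
  by (simp add: char_std_normal_distribution)
 have eq: "?h (0 + r * t) = cx (1 / sqrt (2 * pi)) * (expi (u * t) * cx (exp (- s * t\<^sup>2)))" for t
 proof -
  have "(r * t)\<^sup>2 / 2 = s * t\<^sup>2" using r by (simp add: power_mult_distrib)
  then show ?thesis using r by (simp add: std_normal_density_def scaleR_conv_of_real mult_ac)
 qed
 have "integrable lborel (%t. ?h (0 + r * t))" using inth r by (intro lborel_integrable_real_affine) auto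
 then have "integrable lborel (%t. cx (sqrt (2 * pi)) * (cx (1 / sqrt (2 * pi)) * (expi (u * t) * cx (exp (- s * t\<^sup>2)))))"
  unfolding eq by (rule integrable_mult_right)
 moreover have "cx (sqrt (2 * pi)) * (cx (1 / sqrt (2 * pi)) * w) = w" for w
  by (simp add: mult.assoc[symmetric] of_real_mult[symmetric] del: of_real_mult)
 ultimately show "integrable lborel (%t. expi (u * t) * cx (exp (- s * t\<^sup>2)))"
  by (simp only:)
 have "(LINT x|lborel. ?h x) = r *\<^sub>R (LINT t|lborel. ?h (0 + r * t))"
  using lborel_integral_real_affine[of r ?h 0] r by simp
 then have "cx (exp (- (u / r)\<^sup>2 / 2)) = cx (r / sqrt (2 * pi)) * (LINT t|lborel. expi (u * t) * cx (exp (- s * t\<^sup>2)))"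
  unfolding eq H by (simp add: scaleR_conv_of_real)
 moreover have "- (u / r)\<^sup>2 / 2 = - u\<^sup>2 / (4 * s)" using r by (simp add: power_divide)
 moreover have "r / sqrt (2 * pi) = 1 / k" using s unfolding r_def k_def by (simp add: real_sqrt_divide real_sqrt_mult)
 ultimately have "cx (exp (- u\<^sup>2 / (4 * s))) = cx (1 / k) * (LINT t|lborel. expi (u * t) * cx (exp (- s * t\<^sup>2)))"
  by (simp only:)
 then have "cx k * cx (exp (- u\<^sup>2 / (4 * s))) = (cx k * cx (1 / k)) * (LINT t|lborel. expi (u * t) * cx (exp (- s * t\<^sup>2)))"
  by (simp only: mult.assoc)
 moreover have "cx k * cx (1 / k) = 1" using k by (simp flip: of_real_mult)
 ultimately show "(LINT t|lborel. expi (u * t) * cx (exp (- s * t\<^sup>2)))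
   = cx (sqrt (pi / s) * exp (- u\<^sup>2 / (4 * s)))"
  unfolding k_def[symmetric] by (simp only: of_real_mult mult_1_left)
qed

lemma gaussian_fourier:
 fixes x :: "real^'n" and s :: real
 assumes s: "s > 0"
 shows "(LINT xi|lborel. expi (x \<bullet> xi) * cx (exp (- s * (norm xi)\<^sup>2)))
  = cx ((pi / s) powr (real CARD('n) / 2) * exp (- (norm x)\<^sup>2 / (4 * s)))"
proof -
 have "(%xi. expi (x \<bullet> xi) * cx (exp (- s * (norm xi)\<^sup>2)))
  = (%xi. \<Prod>b\<in>Basis. expi ((x \<bullet> b) * (xi \<bullet> b)) * cx (exp (- s * (xi \<bullet> b)\<^sup>2)))"
 proof
  fix xi :: "real^'n"
  have 1: "expi (x \<bullet> xi) = (\<Prod>b\<in>Basis. expi ((x \<bullet> b) * (xi \<bullet> b)))"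
   by (subst euclidean_inner) (simp add: sum_distrib_left exp_sum)
  have "(norm xi)\<^sup>2 = (\<Sum>b\<in>Basis. (xi \<bullet> b)\<^sup>2)"
   unfolding power2_norm_eq_inner by (subst euclidean_inner) (simp add: power2_eq_square)
  then have 2: "cx (exp (- s * (norm xi)\<^sup>2)) = (\<Prod>b\<in>Basis. cx (exp (- s * (xi \<bullet> b)\<^sup>2)))"
   by (simp only: sum_distrib_left exp_sum[OF finite_Basis] of_real_prod)
  show "expi (x \<bullet> xi) * cx (exp (- s * (norm xi)\<^sup>2))
   = (\<Prod>b\<in>Basis. expi ((x \<bullet> b) * (xi \<bullet> b)) * cx (exp (- s * (xi \<bullet> b)\<^sup>2)))"
   unfolding 1 2 by (rule prod.distrib[symmetric])
 qed
 then have "(LINT xi|lborel. expi (x \<bullet> xi) * cx (exp (- s * (norm xi)\<^sup>2)))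
  = (\<Prod>b\<in>(Basis::(real^'n) set). LINT t|lborel. expi ((x \<bullet> b) * t) * cx (exp (- s * t\<^sup>2)))"
  by (simp only:) (rule integral_lborel_prod[of "%b t. expi ((x \<bullet> b) * t) * cx (exp (- s * t\<^sup>2))"], rule gaussian_fourier_1d(1)[OF s])
 also have "... = (\<Prod>b\<in>(Basis::(real^'n) set). cx (sqrt (pi / s) * exp (- (x \<bullet> b)\<^sup>2 / (4 * s))))"
  by (simp only: gaussian_fourier_1d(2)[OF s])
 also have "... = cx (sqrt (pi / s) ^ CARD('n) * exp (- (norm x)\<^sup>2 / (4 * s)))"
 proof -
  have "(norm x)\<^sup>2 = (\<Sum>b\<in>Basis. (x \<bullet> b)\<^sup>2)"
   unfolding power2_norm_eq_inner by (subst euclidean_inner) (simp add: power2_eq_square)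
  then have "exp (- (norm x)\<^sup>2 / (4 * s)) = (\<Prod>b\<in>Basis. exp (- (x \<bullet> b)\<^sup>2 / (4 * s)))"
   by (simp only: exp_sum[OF finite_Basis, symmetric] sum_divide_distrib[symmetric] sum_negf)
  then show ?thesis by (simp only: of_real_prod[symmetric] prod.distrib prod_constant) simp
 qed
 also have "sqrt (pi / s) ^ CARD('n) = (pi / s) powr (real CARD('n) / 2)"
 proof -
  have "sqrt (pi / s) > 0" using s by simp
  from powr_realpow[OF this, of "CARD('n)"] show ?thesis using s by (simp add: powr_half_sqrt[symmetric] powr_powr)
 qed
 finally show ?thesis .
qed

lemma J_gaussian:
 fixes x :: "real^'n"
 assumes "s > 0"
 shows "J 2 0 0 x y s = (4 * pi * s) powr (- (real CARD('n) / 2)) * exp (- (norm x)\<^sup>2 / (4 * s))"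
proof -
 let ?A = "- (real CARD('n) / 2)"
 have "J 2 0 0 x y s = (2 * pi) powr (- real CARD('n)) * ((pi / s) powr (real CARD('n) / 2) * exp (- (norm x)\<^sup>2 / (4 * s)))"
  using gaussian_fourier[OF assms, of x] by (simp add: J_def Fou_def symb_def powr_numeral)
 moreover have "(2 * pi) powr (- real CARD('n)) * (pi / s) powr (real CARD('n) / 2) = (4 * pi * s) powr ?A"
 proof -
  have "(2 * pi) powr (- real CARD('n)) = ((2 * pi)\<^sup>2) powr ?A"
  proof -
   have "((2 * pi) powr 2) powr ?A = (2 * pi) powr (- real CARD('n))"
    unfolding powr_powr by simp
   then show ?thesis by simp
  qed
  moreover have "(pi / s) powr (real CARD('n) / 2) = (s / pi) powr ?A"
   using assms by (simp add: powr_minus powr_divide field_simps)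
  moreover have "(2 * pi)\<^sup>2 * (s / pi) = 4 * pi * s" by (simp add: power2_eq_square)
  ultimately show ?thesis using assms by (simp add: powr_mult[symmetric])
 qed
 ultimately show ?thesis by simp
qed

text \<open>Along the line \<open>x - h y\<close> the Gaussian is an entire function of
  \<open>h\<close>. Identifying \<open>J\<close> with its complex derivatives makes Cauchy's
  inequality available in place of Hermite polynomials.\<close>

lemma J_gaussian_deriv:
 fixes x y :: "real^'n"
 assumes s: "s > 0"
 defines "E \<equiv> %h::complex. cx ((4 * pi * s) powr (- (real CARD('n) / 2))) *
  exp (- (of_real ((norm x)\<^sup>2) - 2 * h * of_real (x \<bullet> y) + h\<^sup>2 * of_real ((norm y)\<^sup>2)) / of_real (4 * s))"
 shows "(deriv ^^ j) E (of_real h) = cx (J 2 j 0 (x - h *\<^sub>R y) y s)"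
proof (induction j arbitrary: h)
 case 0
 have "(norm (x - h *\<^sub>R y))\<^sup>2 = (norm x)\<^sup>2 - 2 * h * (x \<bullet> y) + h\<^sup>2 * (norm y)\<^sup>2"
  unfolding power2_norm_eq_inner by (simp add: inner_diff_left inner_diff_right inner_commute power2_eq_square algebra_simps)
 then show ?case unfolding J_gaussian[OF s] E_def by (simp add: exp_of_real[symmetric])
next
 case (Suc j)
 have hol: "E holomorphic_on UNIV" unfolding E_def using s by (intro holomorphic_intros) auto
 have "((deriv ^^ j) E has_field_derivative deriv ((deriv ^^ j) E) (of_real h)) (at (of_real h))"
  by (rule holomorphic_derivI[OF holomorphic_higher_deriv[OF hol open_UNIV] open_UNIV]) simp
 from has_vector_derivative_real_field[OF this]
 have "((%h. cx (J 2 j 0 (x - h *\<^sub>R y) y s)) has_vector_derivative (deriv ^^ Suc j) E (of_real h)) (at h)"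
  by (simp add: Suc)
 moreover have "((%h. cx (J 2 j 0 (x - h *\<^sub>R y) y s)) has_vector_derivative cx (J 2 (Suc j) 0 (x - h *\<^sub>R y) y s)) (at h)"
  by (rule has_vector_derivative_of_real, rule J_space_derivative) (use s in auto)
 ultimately show ?case by (rule vector_derivative_unique_at)
qed

lemma J_zero_direction: "J th (Suc j) m x 0 tau = 0"
 by (simp add: J_def symb_def Fou_def)

text \<open>Cauchy's inequality on the circle of radius \<open>sqrt s / norm y\<close>. There the
  mixed term in the exponent is at most half of the squared norm of \<open>x\<close> plus
  \<open>2 * s\<close>, and the term quadratic in \<open>h\<close> is at most \<open>s\<close>. Half
  of the Gaussian decay survives, hence \<open>8 * s\<close> instead of \<open>4 * s\<close>, and
  the total \<open>3 * s\<close> over \<open>4 * s\<close> gives the factor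
  \<open>exp (3/4)\<close>.\<close>

lemma J_gaussian_bound:
 "\<exists>C\<ge>0. \<forall>s>0. \<forall>x y::real^'n. \<bar>J 2 j 0 x y s\<bar> <= C * norm y ^ j * s powr (- (real CARD('n) + real j) / 2) * exp (- (norm x)\<^sup>2 / (8 * s))"
proof (intro exI[of _ "fact j * (exp (3/4) * (4 * pi) powr (- (real CARD('n) / 2)))"] conjI allI impI)
 let ?N2 = "real CARD('n) / 2"
 let ?C = "exp (3/4) * (4 * pi) powr (- ?N2)"
 fix s :: real and x y :: "real^'n" assume s: "s > 0"
 have sp: "s powr (- (real CARD('n) + real j) / 2) = s powr (- ?N2) / sqrt s ^ j"
 proof -
  have "sqrt s ^ j = s powr (real j / 2)"
   using powr_realpow[of "sqrt s" j] s by (simp add: powr_half_sqrt[symmetric] powr_powr)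
  moreover have "- (real CARD('n) + real j) / 2 = - ?N2 - real j / 2" by simp
  ultimately show ?thesis by (simp only: powr_diff)
 qed
 have const: "(4 * pi * s) powr (- ?N2) = (4 * pi) powr (- ?N2) * s powr (- ?N2)"
  using s by (simp add: powr_mult)
 show "\<bar>J 2 j 0 x y s\<bar> <= fact j * ?C * norm y ^ j * s powr (- (real CARD('n) + real j) / 2) * exp (- (norm x)\<^sup>2 / (8 * s))"
 \<comment> \<open>For \<open>y = 0\<close> the radius of the circle would be a division by zero;
   there all derivatives of positive order vanish.\<close>
 proof (cases "y = 0")
  case True
  show ?thesis
  proof (cases j)
   case 0
   have "exp (- (norm x)\<^sup>2 / (4 * s)) <= exp (3/4 + (- (norm x)\<^sup>2 / (8 * s)))"
   proof -
    have "(norm x)\<^sup>2 / (8 * s) <= (norm x)\<^sup>2 / (4 * s)" using s by (intro divide_left_mono) auto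
    then show ?thesis by simp
   qed
   then have "exp (- (norm x)\<^sup>2 / (4 * s)) <= exp (3/4) * exp (- (norm x)\<^sup>2 / (8 * s))" by (simp only: exp_add)
   then have "(4 * pi * s) powr (- ?N2) * exp (- (norm x)\<^sup>2 / (4 * s)) <= (4 * pi * s) powr (- ?N2) * (exp (3/4) * exp (- (norm x)\<^sup>2 / (8 * s)))"
    by (rule mult_left_mono) simp
   then show ?thesis unfolding 0 J_gaussian[OF s] const by (simp add: mult_ac)
  next
   case (Suc k)
   then show ?thesis using True by (simp add: J_zero_direction)
  qed
 next
  case False
  define E where "E = (%h::complex. cx ((4 * pi * s) powr (- ?N2)) *
  exp (- (of_real ((norm x)\<^sup>2) - 2 * h * of_real (x \<bullet> y) + h\<^sup>2 * of_real ((norm y)\<^sup>2)) / of_real (4 * s)))"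
  define r where "r = sqrt s / norm y"
  have r: "r > 0" using s False by (simp add: r_def)
  have hol: "E holomorphic_on UNIV" unfolding E_def using s by (intro holomorphic_intros) auto
  define B where "B = (4 * pi * s) powr (- ?N2) * (exp (3/4) * exp (- (norm x)\<^sup>2 / (8 * s)))"
  have "norm ((deriv ^^ j) E 0) <= fact j * B / r ^ j"
  proof (rule Cauchy_inequality[OF _ _ r])
   show "E holomorphic_on ball 0 r" using hol by (rule holomorphic_on_subset) auto
   show "continuous_on (cball 0 r) E" using hol by (intro holomorphic_on_imp_continuous_on) (rule holomorphic_on_subset, auto)
   fix h :: complex assume "norm (0 - h) = r"
   then have h: "norm h = r" by simp
   have ry: "r * norm y = sqrt s" using False by (simp add: r_def)
   have "Re (2 * h * of_real (x \<bullet> y)) <= norm (2 * h * of_real (x \<bullet> y))" by (rule complex_Re_le_cmod)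
   also have "... <= 2 * r * (norm x * norm y)"
    using Cauchy_Schwarz_ineq2[of x y] r by (simp add: norm_mult h mult_left_mono)
   also have "... = 2 * sqrt s * norm x" using ry by (simp add: mult_ac)
   also have "... <= (norm x)\<^sup>2 / 2 + 2 * s"
    using zero_le_power2[of "norm x - 2 * sqrt s"] s by (simp add: power2_diff mult_ac)
   finally have 1: "Re (2 * h * of_real (x \<bullet> y)) <= ..." .
   have "- Re (h\<^sup>2 * of_real ((norm y)\<^sup>2)) <= norm (h\<^sup>2 * of_real ((norm y)\<^sup>2))" using abs_Re_le_cmod[of "h\<^sup>2 * of_real ((norm y)\<^sup>2)"] by linarith
   also have "... = (r * norm y)\<^sup>2" by (simp add: norm_mult norm_power h power_mult_distrib)
   also have "... = s" using s by (simp add: ry)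
   finally have 2: "- Re (h\<^sup>2 * of_real ((norm y)\<^sup>2)) <= s" .
   have "Re (- (of_real ((norm x)\<^sup>2) - 2 * h * of_real (x \<bullet> y) + h\<^sup>2 * of_real ((norm y)\<^sup>2)) / of_real (4 * s))
     = (- (norm x)\<^sup>2 + Re (2 * h * of_real (x \<bullet> y)) - Re (h\<^sup>2 * of_real ((norm y)\<^sup>2))) / (4 * s)"
    by (simp only: Re_divide_of_real) simp
   also have "... <= (- (norm x)\<^sup>2 + ((norm x)\<^sup>2 / 2 + 2 * s) + s) / (4 * s)"
    using 1 2 s by (intro divide_right_mono) auto
   also have "... = 3/4 + (- (norm x)\<^sup>2 / (8 * s))" using s by (simp add: field_simps)
   finally have "exp (Re (- (of_real ((norm x)\<^sup>2) - 2 * h * of_real (x \<bullet> y) + h\<^sup>2 * of_real ((norm y)\<^sup>2)) / of_real (4 * s))) <= exp (3/4) * exp (- (norm x)\<^sup>2 / (8 * s))"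
    by (simp only: exp_le_cancel_iff exp_add[symmetric])
   then show "norm (E h) <= B"
    unfolding E_def B_def norm_mult norm_exp_eq_Re by (intro mult_mono) auto
  qed
  also have "(deriv ^^ j) E 0 = cx (J 2 j 0 x y s)"
   using J_gaussian_deriv[OF s, of j x y 0] by (simp add: E_def)
  finally have "\<bar>J 2 j 0 x y s\<bar> <= fact j * B / r ^ j" by simp
  also have "... = fact j * ?C * norm y ^ j * s powr (- (real CARD('n) + real j) / 2) * exp (- (norm x)\<^sup>2 / (8 * s))"
   unfolding sp B_def const r_def using s False by (simp add: power_divide field_simps)
  finally show ?thesis .
 qed
qed auto

lemma norm_integral_le_nn_integral:
 fixes f :: "'a => 'b::{banach, second_countable_topology}"
 assumes "(\<integral>\<^sup>+ x. ennreal (norm (f x)) \<partial>M) <= ennreal c" "c >= 0"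
 shows "norm (LINT x|M. f x) <= c"
proof (cases "integrable M f")
 case True
 then show ?thesis using integral_norm_bound_ennreal[OF True] assms by (metis ennreal_le_iff order_trans)
qed (use assms in \<open>simp add: not_integrable_integral_eq\<close>)

text \<open>With \<open>u = \<rho> / s\<close>, bounding \<open>exp (- u)\<close> by a multiple of
  \<open>(1 + u) powr (- 1 - \<kappa>)\<close> turns the integrand into a power of
  \<open>\<rho> + s\<close>. The precise value, a gamma function, is irrelevant.\<close>

lemma nn_integral_inverse_exp:
 fixes \<kappa> :: real
 assumes "\<kappa> > 0"
 shows "\<exists>C\<ge>0. \<forall>\<rho>>0. (\<integral>\<^sup>+ s\<in>{0<..}. ennreal (s powr (- 1 - \<kappa>) * exp (- \<rho> / s)) \<partial>lborel) <= ennreal (C * \<rho> powr (- \<kappa>))"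
proof -
 obtain C where C: "C > 0" "!!u. u >= 0 ==> (1 + u) powr (1 + \<kappa>) * exp (- 1 * u powr 1) <= C"
  using powr_exp_bounded[of 1 1 "1 + \<kappa>"] by auto
 show ?thesis
 proof (intro exI[of _ "C / \<kappa>"] conjI allI impI)
  show "C / \<kappa> >= 0" using C assms by simp
  fix \<rho> :: real assume rho: "\<rho> > 0"
  have "(\<integral>\<^sup>+ s\<in>{0<..}. ennreal (s powr (- 1 - \<kappa>) * exp (- \<rho> / s)) \<partial>lborel)
    <= (\<N> s. ennreal C * (ennreal ((\<rho> + s) powr (-(1 + \<kappa>))) * indicator {0..} s))"
  proof (intro nn_integral_mono)
   fix s :: real
   show "ennreal (s powr (- 1 - \<kappa>) * exp (- \<rho> / s)) * indicator {0<..} s <= ennreal C * (ennreal ((\<rho> + s) powr (-(1 + \<kappa>))) * indicator {0..} s)"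
   proof (cases "s > 0")
    case True
    have e: "1 + \<rho> / s = (\<rho> + s) / s" using True by (simp add: field_simps)
    have "(1 + \<rho> / s) powr (1 + \<kappa>) * exp (- \<rho> / s) <= C"
     using C(2)[of "\<rho> / s"] True rho by simp
    then have "(\<rho> + s) powr (-(1 + \<kappa>)) * ((1 + \<rho> / s) powr (1 + \<kappa>) * exp (- \<rho> / s)) <= (\<rho> + s) powr (-(1 + \<kappa>)) * C"
     by (rule mult_left_mono) simp
    moreover have "(\<rho> + s) powr (-(1 + \<kappa>)) * (1 + \<rho> / s) powr (1 + \<kappa>) = s powr (- 1 - \<kappa>)"
    proof -
     have "(\<rho> + s) powr (-(1 + \<kappa>)) * (\<rho> + s) powr (1 + \<kappa>) = 1"
      using True rho unfolding powr_add[symmetric] by simp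
     moreover have "- 1 - \<kappa> = -(1 + \<kappa>)" by simp
     ultimately show ?thesis unfolding e using True rho by (simp only: powr_divide powr_minus) (simp add: divide_inverse)
    qed
    ultimately have "s powr (- 1 - \<kappa>) * exp (- \<rho> / s) <= C * (\<rho> + s) powr (-(1 + \<kappa>))"
     by (simp add: mult_ac)
    then show ?thesis using True C(1) by (simp add: ennreal_mult[symmetric] ennreal_leI)
   qed simp
  qed
  also have "... = ennreal C * (\<integral>\<^sup>+ s\<in>{0..}. ennreal ((\<rho> + s) powr (-(1 + \<kappa>))) \<partial>lborel)"
   by (rule nn_integral_cmult) auto
  also have "... = ennreal (C / \<kappa> * \<rho> powr (- \<kappa>))"
   unfolding nn_integral_powr_tail[OF rho assms] using C assms by (simp add: ennreal_mult[symmetric])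
  finally show "(\<integral>\<^sup>+ s\<in>{0<..}. ennreal (s powr (- 1 - \<kappa>) * exp (- \<rho> / s)) \<partial>lborel) <= ..." .
 qed
qed

section \<open>The subordination formula\<close>

context stable_exponent

begin

text \<open>Near \<open>0\<close> the flatness of order \<open>Suc n\<close>, which is at least
  \<kappa>, cancels the negative power; at infinity the decay \<open>s powr (-1)\<close> together
  with \<kappa> at least \<open>1/2\<close> gives the exponent \<open>- 3/2\<close>. The right-hand
  side is integrable, as Fubini's theorem will require.\<close>

lemma stab_weighted:
 assumes "tau > 0" "\<kappa> >= 1/2"
 shows "\<exists>C\<ge>0. \<forall>s>0. \<bar>stab a m tau s\<bar> * s powr (- \<kappa>) <= C * (1 + s) powr (- (1 + 1/2))"
proof -
 define n where "n = nat \<lceil>\<kappa>\<rceil>"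
 have n: "\<kappa> <= real (Suc n)" unfolding n_def by linarith
 obtain C1 where C1: "!!s. s >= 0 ==> \<bar>stab a m tau s\<bar> <= C1 * s ^ Suc n"
  using stab_small[OF assms(1), of m n] by auto
 obtain C2 where C2: "C2 >= 0" "!!s. s > 0 ==> \<bar>stab a m tau s\<bar> <= C2 * s powr (- 1 - a * real m)"
  using stab_large[of m] assms by auto
 have C1p: "C1 >= 0" using C1[of 1] by simp
 let ?e = "- (1 + 1/2) :: real"
 let ?C = "(C1 + C2) * 2 powr (1 + 1/2)"
 show ?thesis
 proof (intro exI[of _ ?C] conjI allI impI)
  show "?C >= 0" using C1p C2 by simp
  fix s :: real assume s: "s > 0"
  show "\<bar>stab a m tau s\<bar> * s powr (- \<kappa>) <= ?C * (1 + s) powr ?e"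
  proof (cases "s <= 1")
   case True
   have "\<bar>stab a m tau s\<bar> * s powr (- \<kappa>) <= C1 * s ^ Suc n * s powr (- \<kappa>)"
    using C1[of s] s by (intro mult_right_mono) auto
   also have "... = C1 * s powr (real (Suc n) - \<kappa>)"
    using s powr_realpow[of s "Suc n"] by (simp only: powr_diff powr_minus) (simp add: divide_inverse)
   also have "... <= C1 * 1" using C1p s True n by (intro mult_left_mono) (auto intro: powr_le1)
   also have "... <= (C1 + C2) * (2 powr (1 + 1/2) * (1 + s) powr ?e)"
   proof -
    have "(1 + s) powr (1 + 1/2) <= 2 powr (1 + 1/2)" using s True by (intro powr_mono2) auto
    then have "1 <= 2 powr (1 + 1/2) * (1 + s) powr ?e" using s by (simp only: powr_minus) (simp add: field_simps)
    then show ?thesis using C1p C2 by (intro mult_mono) auto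
   qed
   finally show ?thesis by (simp only: mult.assoc)
  next
   case False
   have "\<bar>stab a m tau s\<bar> * s powr (- \<kappa>) <= C2 * s powr (- 1 - a * real m) * s powr (- \<kappa>)"
    using C2(2)[OF s] by (intro mult_right_mono) auto
   also have "... = C2 * s powr (- 1 - a * real m - \<kappa>)" using s by (simp add: powr_add[symmetric] mult.assoc)
   also have "... <= C2 * s powr ?e"
   proof -
    have "a * real m >= 0" using a by simp
    then have "- 1 - a * real m - \<kappa> <= ?e" using assms by simp
    then show ?thesis using C2 False by (intro mult_left_mono powr_mono) auto
   qed
   also have "s powr ?e <= ((1 + s) / 2) powr ?e" using False by (intro powr_mono2') auto
   also have "((1 + s) / 2) powr ?e = 2 powr (1 + 1/2) * (1 + s) powr ?e"
    using s by (simp only: powr_divide powr_minus) (simp add: field_simps)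
   finally have "\<bar>stab a m tau s\<bar> * s powr (- \<kappa>) <= C2 * (2 powr (1 + 1/2) * (1 + s) powr ?e)" using C2 by (simp add: mult_left_mono)
   also have "... <= (C1 + C2) * (2 powr (1 + 1/2) * (1 + s) powr ?e)" using C1p by (intro mult_right_mono) auto
   finally show ?thesis by (simp only: mult.assoc)
  qed
 qed
qed

text \<open>The Laplace formula at \<open>l\<close> equal to the square of \<open>norm xi\<close>,
  inserted into the Fourier integral. For Fubini's theorem the \<open>xi\<close>-integral of the
  absolute values costs \<open>s powr (- (N + j) / 2)\<close>, and \<open>stab_weighted\<close> pays
  for it.\<close>

lemma subordination:
 fixes x y :: "real^'n"
 assumes t: "tau > 0"
 shows "J (2 * a) j m x y tau = (LINT s:{0<..}|lborel. stab a m tau s * J 2 j 0 x y s)"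
proof -
 let ?N = "real CARD('n)"
 let ?\<kappa> = "(?N + real j) / 2"
 let ?e = "%xi. expi (x \<bullet> xi) * (- (\<i> * cx (y \<bullet> xi))) ^ j"
 define f where "f = (%s xi. ?e xi * cx (indicator {0<..} s * exp (- s * (norm xi)\<^sup>2) * stab a m tau s))"
 have fm: "(%(s, xi). f s xi) \<in> borel_measurable (lborel \<Otimes>\<^sub>M lborel)" unfolding f_def by measurable
 obtain C where C: "C > 0" "!!s. s > 0 ==> (\<I> (xi::real^'n). norm xi powr real j * exp (- s * norm xi powr 2))
     <= ennreal (C * s powr (- (?N + real j) / 2))"
  using nn_integral_powr_exp[where 'n='n, of 2 "real j"] by auto
 have "?N >= 1" by (simp add: Suc_leI)
 then have "?\<kappa> >= 1/2" by (simp add: add_increasing2)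
 then obtain C' where C': "C' >= 0" "!!s. s > 0 ==> \<bar>stab a m tau s\<bar> * s powr (- ?\<kappa>) <= C' * (1 + s) powr (- (1 + 1/2))"
  using stab_weighted[OF t, of ?\<kappa> m] by blast
 have rap: "rapid (%xi. cx (exp (- s * norm xi powr 2)) * symb 2 j 0 y xi)" if "s > 0" for s
  using that by (intro rapid_exp_symb) auto
 have fs: "f s xi = cx (indicator {0<..} s * stab a m tau s) * (expi (x \<bullet> xi) * (cx (exp (- s * norm xi powr 2)) * symb 2 j 0 y xi))" for s xi
  by (simp add: f_def symb_def powr_numeral mult_ac)
 have fint: "integrable lborel (f s)" for s
 proof (cases "s > 0")
  case True
  have "integrable lborel (%xi. cx (indicator {0<..} s * stab a m tau s) * (expi (x \<bullet> xi) * (cx (exp (- s * norm xi powr 2)) * symb 2 j 0 y xi)))"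
   by (intro integrable_mult_right rapid_exp_integrable rap True)
  then show ?thesis unfolding fs[abs_def] .
 next
  case False
  then have "f s = (%_. 0)" by (auto simp: f_def)
  then show ?thesis by simp
 qed
 have nb: "(LINT xi|lborel. norm (f s xi)) <= norm y ^ j * C * C' * (1 + \<bar>s\<bar>) powr (- (1 + 1/2))" for s
 proof (cases "s > 0")
  case True
  have "(\<I> xi. norm (norm (f s xi)))
   <= (\<N> (xi::real^'n). ennreal (norm y ^ j * \<bar>stab a m tau s\<bar>) * ennreal (norm xi powr real j * exp (- s * norm xi powr 2)))"
  proof (rule nn_integral_mono_AE)
  show "AE xi in lborel. ennreal (norm (norm (f s xi))) <= ennreal (norm y ^ j * \<bar>stab a m tau s\<bar>) * ennreal (norm xi powr real j * exp (- s * norm xi powr 2))"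
   using AE_lborel_singleton[of 0]
  proof eventually_elim
   fix xi :: "real^'n" assume x0: "xi \<noteq> 0"
   have "norm (f s xi) = \<bar>y \<bullet> xi\<bar> ^ j * (exp (- s * norm xi powr 2) * \<bar>stab a m tau s\<bar>)"
    using True by (simp add: f_def norm_mult norm_power powr_numeral)
   also have "... <= (norm y * norm xi) ^ j * (exp (- s * norm xi powr 2) * \<bar>stab a m tau s\<bar>)"
    by (intro mult_right_mono power_mono Cauchy_Schwarz_ineq2) auto
   also have "... <= norm y ^ j * \<bar>stab a m tau s\<bar> * (norm xi powr real j * exp (- s * norm xi powr 2))"
    using x0 by (simp add: power_mult_distrib powr_realpow mult_ac)
   finally show "ennreal (norm (norm (f s xi))) <= ennreal (norm y ^ j * \<bar>stab a m tau s\<bar>) * ennreal (norm xi powr real j * exp (- s * norm xi powr 2))"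
    by (simp add: ennreal_mult[symmetric] ennreal_leI)
  qed
  qed
  also have "... = ennreal (norm y ^ j * \<bar>stab a m tau s\<bar>) * (\<I> (xi::real^'n). norm xi powr real j * exp (- s * norm xi powr 2))"
   by (rule nn_integral_cmult) auto
  also have "... <= ennreal (norm y ^ j * \<bar>stab a m tau s\<bar>) * ennreal (C * s powr (- (?N + real j) / 2))"
   by (intro mult_left_mono C True) auto
  also have "... = ennreal (norm y ^ j * C * (\<bar>stab a m tau s\<bar> * s powr (- ?\<kappa>)))"
   using C(1) by (simp add: ennreal_mult[symmetric] mult_ac minus_divide_left)
  also have "... <= ennreal (norm y ^ j * C * (C' * (1 + s) powr (- (1 + 1/2))))"
   using C C'(2)[OF True] by (intro ennreal_leI mult_left_mono) auto
  finally have "norm (LINT xi|lborel. norm (f s xi)) <= norm y ^ j * C * (C' * (1 + s) powr (- (1 + 1/2)))"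
   using C C' by (intro norm_integral_le_nn_integral) auto
  then show ?thesis using True by (simp add: mult_ac)
 next
  case False
  then have "f s = (%_. 0)" by (auto simp: f_def)
  then show ?thesis using C C' by simp
 qed
 have intf: "integrable (lborel \<Otimes>\<^sub>M lborel) (case_prod f)"
 proof (rule lborel_pair.Fubini_integrable)
  show "case_prod f \<in> borel_measurable (lborel \<Otimes>\<^sub>M lborel)" using fm by simp
  have "integrable lborel (%s::real. (1 + \<bar>s\<bar>) powr (-(1 + 1/2)))"
   using nn_integral_powr_abs_tail[of 1 "1/2"]
   by (intro integrableI_bounded) (auto intro: order_le_less_trans)
  then have "integrable lborel (%s::real. norm y ^ j * C * C' * (1 + \<bar>s\<bar>) powr (-(1 + 1/2)))" by simp
  then show "integrable lborel (%s. LINT xi|lborel. norm (case (s, xi) of (s, xi) => f s xi))"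
  proof (rule Bochner_Integration.integrable_bound)
   show "(%s. LINT xi|lborel. norm (case (s, xi) of (s, xi) => f s xi)) \<in> borel_measurable lborel"
    using fm by measurable
   show "AE s in lborel. norm (LINT xi|lborel. norm (case (s, xi) of (s, xi) => f s xi)) <= norm (norm y ^ j * C * C' * (1 + \<bar>s\<bar>) powr (-(1 + 1/2)))"
   proof (rule AE_I2)
    fix s :: real
    have "(LINT xi|lborel. norm (f s xi)) >= 0" by simp
    then show "norm (LINT xi|lborel. norm (case (s, xi) of (s, xi) => f s xi)) <= norm (norm y ^ j * C * C' * (1 + \<bar>s\<bar>) powr (-(1 + 1/2)))"
     using order_trans[OF nb[of s] abs_ge_self] by (simp only: prod.case real_norm_def abs_of_nonneg)
   qed
  qed
  show "AE s in lborel. integrable lborel (%xi. case (s, xi) of (s, xi) => f s xi)" using fint by simp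
 qed
 have "(LINT xi|lborel. LINT s|lborel. f s xi) = (LINT s|lborel. LINT xi|lborel. f s xi)"
  by (rule lborel_pair.Fubini_integral[OF intf])
 moreover have "(LINT xi|lborel. LINT s|lborel. f s xi) = (LINT xi|lborel. expi (x \<bullet> xi) * (cx (exp (- tau * norm xi powr (2 * a))) * symb (2 * a) j m y xi))"
 proof (rule integral_cong_AE)
  show "AE xi in lborel. (LINT s|lborel. f s xi) = expi (x \<bullet> xi) * (cx (exp (- tau * norm xi powr (2 * a))) * symb (2 * a) j m y xi)"
   \<comment> \<open>The Laplace formula is available for positive arguments only, so the null set
     \<open>xi = 0\<close> is removed.\<close>
   using AE_lborel_singleton[of 0]
  proof eventually_elim
   fix xi :: "real^'n" assume "xi \<noteq> 0"
   then have n: "(norm xi)\<^sup>2 > 0" by simp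
   have p: "((norm xi)\<^sup>2) powr a = norm xi powr (2 * a)"
    using \<open>xi \<noteq> 0\<close> by (simp add: powr_powr[symmetric] powr_numeral)
   have "(LINT s|lborel. f s xi) = ?e xi * cx (LINT s:{0<..}|lborel. exp (- s * (norm xi)\<^sup>2) * stab a m tau s)"
    unfolding f_def set_lebesgue_integral_def by (simp only: integral_mult_right_zero integral_complex_of_real real_scaleR_def mult.assoc)
   also have "... = ?e xi * cx ((- (norm xi powr (2 * a))) ^ m * exp (- tau * norm xi powr (2 * a)))"
    unfolding stab_laplace[OF t n] p ..
   finally show "(LINT s|lborel. f s xi) = expi (x \<bullet> xi) * (cx (exp (- tau * norm xi powr (2 * a))) * symb (2 * a) j m y xi)"
    by (simp add: symb_def mult_ac)
  qed
  have "(%(xi, s). f s xi) \<in> borel_measurable (lborel \<Otimes>\<^sub>M lborel)" unfolding f_def by measurable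
  then show "(%xi. LINT s|lborel. f s xi) \<in> borel_measurable lborel" by measurable
 qed measurable
 moreover have "Re (LINT s|lborel. LINT xi|lborel. f s xi) = (2 * pi) powr ?N * (LINT s:{0<..}|lborel. stab a m tau s * J 2 j 0 x y s)"
 proof -
  have "integrable lborel (%s. LINT xi|lborel. f s xi)" by (rule lborel_pair.integrable_fst[OF intf])
  then have "Re (LINT s|lborel. LINT xi|lborel. f s xi) = (LINT s|lborel. Re (LINT xi|lborel. f s xi))"
   by (simp add: integral_Re)
  also have "... = (LINT s|lborel. (2 * pi) powr ?N * (indicator {0<..} s *\<^sub>R (stab a m tau s * J 2 j 0 x y s)))"
  proof (intro Bochner_Integration.integral_cong refl)
   fix s :: real
   have "(2 * pi) powr ?N * (2 * pi) powr (- ?N) = 1" unfolding powr_add[symmetric] by simp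
   then have "Re (LINT xi|lborel. expi (x \<bullet> xi) * (cx (exp (- s * norm xi powr 2)) * symb 2 j 0 y xi)) = (2 * pi) powr ?N * J 2 j 0 x y s"
    by (simp only: J_def Fou_def mult.assoc[symmetric] mult_1_left)
   moreover have "(LINT xi|lborel. f s xi) = cx (indicator {0<..} s * stab a m tau s) * (LINT xi|lborel. expi (x \<bullet> xi) * (cx (exp (- s * norm xi powr 2)) * symb 2 j 0 y xi))"
    unfolding fs by (rule integral_mult_right_zero)
   ultimately show "Re (LINT xi|lborel. f s xi) = (2 * pi) powr ?N * (indicator {0<..} s *\<^sub>R (stab a m tau s * J 2 j 0 x y s))"
    by (simp only: times_complex.sel Re_complex_of_real Im_complex_of_real) simp
  qed
  also have "... = (2 * pi) powr ?N * (LINT s:{0<..}|lborel. stab a m tau s * J 2 j 0 x y s)"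
   unfolding set_lebesgue_integral_def by (rule integral_mult_right_zero)
  finally show ?thesis .
 qed
 moreover have "(2 * pi) powr (- ?N) * ((2 * pi) powr ?N * z) = z" for z
  unfolding mult.assoc[symmetric] powr_add[symmetric] by simp
 ultimately show ?thesis by (simp add: J_def[of "2 * a"] Fou_def)
qed

lemma J_bound_near:
 "\<exists>C\<ge>0. \<forall>tau>0. \<forall>x y::real^'n. \<bar>J (2 * a) j m x y tau\<bar> <= C * norm y ^ j * tau powr (- (real CARD('n) + real j + 2 * a * real m) / (2 * a))"
proof -
 let ?N = "real CARD('n)" and ?n = "real j + 2 * a * real m"
 obtain C where C: "C > 0" "!!tau. tau > 0 ==> (\<I> (xi::real^'n). norm xi powr ?n * exp (- tau * norm xi powr (2 * a)))
     <= ennreal (C * tau powr (- (?N + ?n) / (2 * a)))"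
  using nn_integral_powr_exp[where 'n='n, of "2 * a" ?n] a by auto
 show ?thesis
 proof (intro exI[of _ "(2 * pi) powr (- ?N) * C"] conjI allI impI)
  show "0 <= (2 * pi) powr (- ?N) * C" using C by simp
  fix tau :: real and x y :: "real^'n" assume t: "tau > 0"
  let ?F = "%xi. expi (x \<bullet> xi) * (cx (exp (- tau * norm xi powr (2 * a))) * symb (2 * a) j m y xi)"
  have "(\<I> xi. norm (?F xi)) <= (\<N> (xi::real^'n). ennreal (norm y ^ j) * ennreal (norm xi powr ?n * exp (- tau * norm xi powr (2 * a))))"
  proof (rule nn_integral_mono_AE)
   show "AE xi in lborel. ennreal (norm (?F xi)) <= ennreal (norm y ^ j) * ennreal (norm xi powr ?n * exp (- tau * norm xi powr (2 * a)))"
    using AE_lborel_singleton[of 0]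
   proof eventually_elim
    fix xi :: "real^'n" assume x0: "xi \<noteq> 0"
    have p: "(norm xi powr (2 * a)) ^ m = norm xi powr (2 * a * real m)"
     using x0 powr_realpow[of "norm xi powr (2 * a)" m] by (simp add: powr_powr)
    have "norm (?F xi) = exp (- tau * norm xi powr (2 * a)) * (\<bar>y \<bullet> xi\<bar> ^ j * norm xi powr (2 * a * real m))"
     by (simp add: symb_def norm_mult norm_power p)
    also have "... <= exp (- tau * norm xi powr (2 * a)) * ((norm y * norm xi) ^ j * norm xi powr (2 * a * real m))"
     by (intro mult_left_mono mult_right_mono power_mono Cauchy_Schwarz_ineq2) auto
    also have "... = norm y ^ j * (norm xi powr ?n * exp (- tau * norm xi powr (2 * a)))"
     using x0 by (simp add: power_mult_distrib powr_add powr_realpow mult_ac)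
    finally show "ennreal (norm (?F xi)) <= ennreal (norm y ^ j) * ennreal (norm xi powr ?n * exp (- tau * norm xi powr (2 * a)))"
     by (simp add: ennreal_mult[symmetric] ennreal_leI)
   qed
  qed
  also have "... = ennreal (norm y ^ j) * (\<I> (xi::real^'n). norm xi powr ?n * exp (- tau * norm xi powr (2 * a)))"
   by (rule nn_integral_cmult) auto
  also have "... <= ennreal (norm y ^ j) * ennreal (C * tau powr (- (?N + ?n) / (2 * a)))"
   by (intro mult_left_mono C t) auto
  also have "... = ennreal (norm y ^ j * (C * tau powr (- (?N + ?n) / (2 * a))))"
   using C by (simp add: ennreal_mult[symmetric])
  finally have "norm (LINT xi|lborel. ?F xi) <= norm y ^ j * (C * tau powr (- (?N + ?n) / (2 * a)))"
   using C by (intro norm_integral_le_nn_integral) auto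
  then have "\<bar>Re (LINT xi|lborel. ?F xi)\<bar> <= norm y ^ j * (C * tau powr (- (?N + ?n) / (2 * a)))"
   by (rule order_trans[OF abs_Re_le_cmod])
  then have "(2 * pi) powr (- ?N) * \<bar>Re (LINT xi|lborel. ?F xi)\<bar> <= (2 * pi) powr (- ?N) * (norm y ^ j * (C * tau powr (- (?N + ?n) / (2 * a))))"
   by (rule mult_left_mono) simp
  then show "\<bar>J (2 * a) j m x y tau\<bar> <= (2 * pi) powr (- ?N) * C * norm y ^ j * tau powr (- (?N + real j + 2 * a * real m) / (2 * a))"
   by (simp add: J_def Fou_def abs_mult mult_ac add.assoc)
 qed
qed

text \<open>The bound on \<open>stab\<close> enters as a hypothesis with free exponent
  \<open>b\<close> and constant \<open>B\<close>, since two versions are used: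
  \<open>stab_large\<close> with \<open>b = a * m\<close>, and for \<open>m = 0\<close> also
  \<open>stab_large_0\<close> with \<open>b = a\<close> and a constant proportional to
  \<open>tau\<close>. Each unit of \<open>b\<close> yields two further powers of decay in
  \<open>norm x\<close>.\<close>

lemma J_bound_far:
 assumes st: "!!s. s > 0 ==> \<bar>stab a m tau s\<bar> <= B * s powr (- 1 - b)" and B: "B >= 0" and b: "b >= 0" and t: "tau > 0"
  and CJ: "CJ >= 0" "!!s. s > 0 ==> \<bar>J 2 j 0 x y s\<bar> <= CJ * norm y ^ j * s powr (- (real CARD('n) + real j) / 2) * exp (- (norm x)\<^sup>2 / (8 * s))"
  and CI: "CI >= 0" "!!\<rho>. \<rho> > 0 ==> (\<integral>\<^sup>+ s\<in>{0<..}. ennreal (s powr (- 1 - (b + (real CARD('n) + real j) / 2)) * exp (- \<rho> / s)) \<partial>lborel) <= ennreal (CI * \<rho> powr (- (b + (real CARD('n) + real j) / 2)))"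
  and x: "x \<noteq> (0::real^'n)"
 shows "\<bar>J (2 * a) j m x y tau\<bar> <= (CI * CJ * 8 powr (b + (real CARD('n) + real j) / 2)) * B * norm y ^ j * norm x powr (- (real CARD('n) + real j + 2 * b))"
proof -
 let ?k = "(real CARD('n) + real j) / 2"
 let ?\<rho> = "(norm x)\<^sup>2 / 8"
 have rho: "?\<rho> > 0" using x by simp
 let ?c = "B * (CJ * norm y ^ j)"
 have "(\<I> s. norm (indicator {0<..} s *\<^sub>R (stab a m tau s * J 2 j 0 x y s)))
  <= (\<N> s. ennreal ?c * (ennreal (s powr (- 1 - (b + ?k)) * exp (- ?\<rho> / s)) * indicator {0<..} s))"
 proof (intro nn_integral_mono)
  fix s :: real
  show "ennreal (norm (indicator {0<..} s *\<^sub>R (stab a m tau s * J 2 j 0 x y s))) <= ennreal ?c * (ennreal (s powr (- 1 - (b + ?k)) * exp (- ?\<rho> / s)) * indicator {0<..} s)"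
  proof (cases "s > 0")
   case True
   have "\<bar>stab a m tau s\<bar> * \<bar>J 2 j 0 x y s\<bar> <= (B * s powr (- 1 - b)) * (CJ * norm y ^ j * s powr (- (real CARD('n) + real j) / 2) * exp (- (norm x)\<^sup>2 / (8 * s)))"
    using st[OF True] CJ(2)[OF True] B by (intro mult_mono) auto
   also have "... = ?c * ((s powr (- 1 - b) * s powr (- (real CARD('n) + real j) / 2)) * exp (- ?\<rho> / s))" by (simp add: mult_ac)
   also have "s powr (- 1 - b) * s powr (- (real CARD('n) + real j) / 2) = s powr (- 1 - (b + ?k))"
   proof -
    have "- 1 - b + (- (real CARD('n) + real j) / 2) = - 1 - (b + ?k)" by (simp add: field_simps)
    then show ?thesis by (simp only: powr_add[symmetric])
   qed
   finally show ?thesis using True B CJ by (simp add: abs_mult ennreal_mult[symmetric] ennreal_leI)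
  qed simp
 qed
 also have "... = ennreal ?c * (\<integral>\<^sup>+ s\<in>{0<..}. ennreal (s powr (- 1 - (b + ?k)) * exp (- ?\<rho> / s)) \<partial>lborel)"
  by (rule nn_integral_cmult) auto
 also have "... <= ennreal ?c * ennreal (CI * ?\<rho> powr (- (b + ?k)))" by (intro mult_left_mono CI rho) auto
 also have "... = ennreal (?c * (CI * ?\<rho> powr (- (b + ?k))))" using B CJ CI by (simp add: ennreal_mult[symmetric])
 finally have "norm (LINT s:{0<..}|lborel. stab a m tau s * J 2 j 0 x y s) <= ?c * (CI * ?\<rho> powr (- (b + ?k)))"
  unfolding set_lebesgue_integral_def using B CJ CI by (intro norm_integral_le_nn_integral) auto
 also have "?\<rho> powr (- (b + ?k)) = 8 powr (b + ?k) * norm x powr (- (real CARD('n) + real j + 2 * b))"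
 proof -
  have "((norm x)\<^sup>2) powr (- (b + ?k)) = norm x powr (2 * (- (b + ?k)))"
   using x by (simp only: powr_powr[symmetric]) (simp add: powr_numeral)
  also have "2 * (- (b + ?k)) = - (real CARD('n) + real j + 2 * b)" by (simp add: field_simps)
  finally show ?thesis using x by (simp only: powr_divide powr_minus) (simp add: field_simps)
 qed
 finally show ?thesis unfolding subordination[OF t] by (simp add: mult_ac)
qed

end

text \<open>Near the diagonal the Fourier integral is estimated directly; away from it the
 subordination formula gives the decay in \<open>norm x\<close>.\<close>

lemma J_bound:
 assumes th: "0 < th" "th < 2"
 shows "\<exists>C\<ge>0. \<forall>tau>0. \<forall>x y::real^'n. \<bar>J th j m x y tau\<bar> <= C * norm y ^ j * (tau powr (1/th) + norm x) powr (- (real CARD('n) + real j + th * real m))"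
  and "\<exists>C\<ge>0. \<forall>tau>0. \<forall>x y::real^'n. \<bar>J th j 0 x y tau\<bar> <= C * norm y ^ j * (tau * (tau powr (1/th) + norm x) powr (- (real CARD('n) + real j + th)))"
proof -
 interpret stable_exponent "th / 2" by standard (use th in auto)
 have a2: "2 * (th / 2) = th" by simp
 let ?N = "real CARD('n)"
 have N: "?N > 0" by simp
 obtain CN where CN: "CN >= 0" "!!tau x y. tau > 0 ==> \<bar>J th j m (x::real^'n) y tau\<bar> <= CN * norm y ^ j * tau powr (- (?N + real j + th * real m) / th)"
  using J_bound_near[where 'n='n, of j m, unfolded a2] by auto
 obtain CN0 where CN0: "CN0 >= 0" "!!tau x y. tau > 0 ==> \<bar>J th j 0 (x::real^'n) y tau\<bar> <= CN0 * norm y ^ j * tau powr (- (?N + real j + th * real 0) / th)"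
  using J_bound_near[where 'n='n, of j 0, unfolded a2] by blast
 obtain CJ where CJ: "CJ >= 0" "!!s x y. s > 0 ==> \<bar>J 2 j 0 (x::real^'n) y s\<bar> <= CJ * norm y ^ j * s powr (- (?N + real j) / 2) * exp (- (norm x)\<^sup>2 / (8 * s))"
  using J_gaussian_bound[where 'n='n, of j] by blast
 obtain S where S: "S >= 0" "!!tau s. tau > 0 ==> s > 0 ==> \<bar>stab (th/2) m tau s\<bar> <= S * s powr (- 1 - th / 2 * real m)"
  using stab_large[of m] by blast
 obtain S0 where S0: "S0 >= 0" "!!tau s. tau > 0 ==> s > 0 ==> \<bar>stab (th/2) 0 tau s\<bar> <= S0 * tau * s powr (- 1 - th / 2)"
  using stab_large_0 by blast
 have pos: "th / 2 * real m + (?N + real j) / 2 > 0" "th / 2 + (?N + real j) / 2 > 0"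
 proof -
  have "(?N + real j) / 2 > 0" using N by (simp add: add_pos_nonneg)
  moreover have "th / 2 * real m >= 0" "th / 2 >= 0" using th by auto
  ultimately show "th / 2 * real m + (?N + real j) / 2 > 0" "th / 2 + (?N + real j) / 2 > 0"
   by linarith+
 qed
 obtain CI where CI: "CI >= 0" "!!\<rho>. \<rho> > 0 ==> (\<integral>\<^sup>+ s\<in>{0<..}. ennreal (s powr (- 1 - (th / 2 * real m + (?N + real j) / 2)) * exp (- \<rho> / s)) \<partial>lborel) <= ennreal (CI * \<rho> powr (- (th / 2 * real m + (?N + real j) / 2)))"
  using nn_integral_inverse_exp[OF pos(1)] by blast
 obtain CI0 where CI0: "CI0 >= 0" "!!\<rho>. \<rho> > 0 ==> (\<integral>\<^sup>+ s\<in>{0<..}. ennreal (s powr (- 1 - (th / 2 + (?N + real j) / 2)) * exp (- \<rho> / s)) \<partial>lborel) <= ennreal (CI0 * \<rho> powr (- (th / 2 + (?N + real j) / 2)))"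
  using nn_integral_inverse_exp[OF pos(2)] by blast
 have two: "(z / 2) powr (- e) = 2 powr e * z powr (- e)" if "z > 0" for z e :: real
  using that by (simp add: powr_divide powr_minus field_simps)
 have nearpow: "tau powr (- e / th) <= 2 powr e * (tau powr (1/th) + norm x) powr (- e)"
  if "tau > 0" "norm x <= tau powr (1/th)" "e >= 0" for tau e and x :: "real^'n"
 proof -
  have "tau powr (- e / th) = (tau powr (1/th)) powr (- e)" by (simp add: powr_powr)
  also have "... <= ((tau powr (1/th) + norm x) / 2) powr (- e)"
   using that by (intro powr_mono2') (auto intro!: add_pos_nonneg)
  also have "... = 2 powr e * (tau powr (1/th) + norm x) powr (- e)"
   using that by (intro two) (auto intro!: add_pos_nonneg)
  finally show ?thesis .
 qed
 have farpow: "norm x powr (- e) <= 2 powr e * (tau powr (1/th) + norm x) powr (- e)"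
  if "tau > 0" "\<not> norm x <= tau powr (1/th)" "e >= 0" for tau e and x :: "real^'n"
 proof -
  have "norm x powr (- e) <= ((tau powr (1/th) + norm x) / 2) powr (- e)"
   using that by (intro powr_mono2') (auto intro!: add_pos_nonneg)
  also have "... = 2 powr e * (tau powr (1/th) + norm x) powr (- e)"
   using that by (intro two) (auto intro!: add_pos_nonneg)
  finally show ?thesis .
 qed
 show "\<exists>C\<ge>0. \<forall>tau>0. \<forall>x y::real^'n. \<bar>J th j m x y tau\<bar> <= C * norm y ^ j * (tau powr (1/th) + norm x) powr (- (?N + real j + th * real m))"
 proof -
  let ?e = "?N + real j + th * real m"
  let ?F = "CI * CJ * 8 powr (th / 2 * real m + (?N + real j) / 2) * S"
  have e: "?e >= 0" using th by simp
  have F: "?F >= 0" using CI CJ S by simp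
  show ?thesis
  proof (intro exI[of _ "(CN + ?F) * 2 powr ?e"] conjI allI impI)
   show "0 <= (CN + ?F) * 2 powr ?e" using CN F by simp
   fix tau :: real and x y :: "real^'n" assume t: "tau > 0"
   let ?H = "2 powr ?e * (tau powr (1/th) + norm x) powr (- ?e)"
   have "\<bar>J th j m x y tau\<bar> <= (CN + ?F) * norm y ^ j * ?H"
   proof (cases "norm x <= tau powr (1/th)")
    case True
    have "\<bar>J th j m x y tau\<bar> <= CN * norm y ^ j * tau powr (- ?e / th)" by (rule CN(2)[OF t])
    also have "... <= (CN + ?F) * norm y ^ j * ?H"
     using CN F nearpow[OF t True e] by (intro mult_mono) auto
    finally show ?thesis .
   next
    case False
    then have x: "x \<noteq> 0" using t by auto
    have "\<bar>J (2 * (th/2)) j m x y tau\<bar> <= (CI * CJ * 8 powr (th / 2 * real m + (?N + real j) / 2)) * S * norm y ^ j * norm x powr (- (?N + real j + 2 * (th / 2 * real m)))"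
     by (rule J_bound_far[where b="th / 2 * real m"]) (use S CI CJ t x th in auto)
    then have "\<bar>J th j m x y tau\<bar> <= ?F * norm y ^ j * norm x powr (- ?e)" by simp
    also have "... <= (CN + ?F) * norm y ^ j * ?H"
     using CN F farpow[OF t False e] by (intro mult_mono) auto
    finally show ?thesis .
   qed
   then show "\<bar>J th j m x y tau\<bar> <= (CN + ?F) * 2 powr ?e * norm y ^ j * (tau powr (1/th) + norm x) powr (- ?e)"
    by (simp only: mult_ac)
  qed
 qed
 show "\<exists>C\<ge>0. \<forall>tau>0. \<forall>x y::real^'n. \<bar>J th j 0 x y tau\<bar> <= C * norm y ^ j * (tau * (tau powr (1/th) + norm x) powr (- (?N + real j + th)))"
 proof -
  let ?e = "?N + real j + th"
  let ?F = "CI0 * CJ * 8 powr (th / 2 + (?N + real j) / 2) * S0"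
  have e: "?e >= 0" using th by simp
  have F: "?F >= 0" using CI0 CJ S0 by simp
  show ?thesis
  proof (intro exI[of _ "(CN0 + ?F) * 2 powr ?e"] conjI allI impI)
   show "0 <= (CN0 + ?F) * 2 powr ?e" using CN0 F by simp
   fix tau :: real and x y :: "real^'n" assume t: "tau > 0"
   let ?H = "2 powr ?e * (tau powr (1/th) + norm x) powr (- ?e)"
   have "\<bar>J th j 0 x y tau\<bar> <= (CN0 + ?F) * norm y ^ j * (tau * ?H)"
   proof (cases "norm x <= tau powr (1/th)")
    case True
    have "tau powr (- (?N + real j + th * real 0) / th) = tau powr 1 * tau powr (- ?e / th)"
     unfolding powr_add[symmetric] using th by (simp add: field_simps)
    then have "\<bar>J th j 0 x y tau\<bar> <= CN0 * norm y ^ j * (tau * tau powr (- ?e / th))" using CN0(2)[OF t, of x y] t by simp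
    also have "... <= (CN0 + ?F) * norm y ^ j * (tau * ?H)"
     using CN0 F t nearpow[OF t True e] by (intro mult_mono) auto
    finally show ?thesis .
   next
    case False
    then have x: "x \<noteq> 0" using t by auto
    have "\<bar>J (2 * (th/2)) j 0 x y tau\<bar> <= (CI0 * CJ * 8 powr (th / 2 + (?N + real j) / 2)) * (S0 * tau) * norm y ^ j * norm x powr (- (?N + real j + 2 * (th / 2)))"
     by (rule J_bound_far[where b="th / 2"]) (use S0 CI0 CJ t x th in auto)
    then have "\<bar>J th j 0 x y tau\<bar> <= ?F * norm y ^ j * (tau * norm x powr (- ?e))" by (simp add: mult_ac)
    also have "... <= (CN0 + ?F) * norm y ^ j * (tau * ?H)"
     using CN0 F t farpow[OF t False e] by (intro mult_mono) auto
    finally show ?thesis .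
   qed
   then show "\<bar>J th j 0 x y tau\<bar> <= (CN0 + ?F) * 2 powr ?e * norm y ^ j * (tau * (tau powr (1/th) + norm x) powr (- ?e))"
    by (simp only: mult_ac)
  qed
 qed
qed

section \<open>The Taylor remainder\<close>

text \<open>Kernel of the Taylor remainder: \<open>heat th (t - s) f x\<close> minus its expansion at time \<open>t + 1\<close>
 equals \<open>\<integral> rem_kernel th K t s x y * f y dy\<close>.\<close>

definition taylor_part :: "real => real => real => real => real^'n => real^'n => real" where
 "taylor_part th K t s x y = (\<Sum>m\<le>nat \<lfloor>K / th\<rfloor>. \<Sum>j\<le>nat \<lfloor>K\<rfloor>.
  (s + 1) ^ m * ((-1) ^ m / (fact m * fact j)) * J th j m x y (t + 1))"

definition rem_kernel :: "real => real => real => real => real^'n => real^'n => real" where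
 "rem_kernel th K t s x y = G th (x - y) (t - s) - taylor_part th K t s x y"

text \<open>The homogeneity of the first neglected term, where a power of time counts
  \<open>th\<close> times; the minimum is taken over the space and the time expansion.\<close>

definition taylor_ord :: "real => real => real" where
 "taylor_ord th K = min (real (Suc (nat \<lfloor>K\<rfloor>))) (th * real (Suc (nat \<lfloor>K / th\<rfloor>)))"

lemma taylor_ord_gt: "0 < th ==> 0 <= K ==> K < taylor_ord th K"
proof -
 assume a: "0 < th" "0 <= K"
 have "K < real (Suc (nat \<lfloor>K\<rfloor>))" using a by linarith
 moreover have "K / th < real (Suc (nat \<lfloor>K / th\<rfloor>))" using divide_nonneg_pos[OF a(2,1)] by linarith
 then have "K < th * real (Suc (nat \<lfloor>K / th\<rfloor>))" using a by (simp add: field_simps)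
 ultimately show ?thesis by (simp add: taylor_ord_def)
qed

text \<open>The expansion is carried out in time first, at the point \<open>x - y\<close> from
  \<open>t + 1\<close> to \<open>t - s\<close>, and then in space for each time coefficient. The
  first alternative in the hypotheses keeps \<open>D + norm (x - h y)\<close> comparable with
  \<open>H = D + norm x\<close> for all \<open>h\<close> between \<open>0\<close> and
  \<open>1\<close>; the second keeps \<open>tau powr (1/th) + norm (x - y)\<close> comparable with
  \<open>H\<close> for all times \<open>tau\<close> from \<open>t - s\<close> on. With both, every
  intermediate kernel bound becomes a power of \<open>H\<close>.\<close>

lemma taylor_estimate:
 assumes th: "0 < th" "th < 2" and K: "0 <= K"
 shows "\<exists>C\<ge>0. \<forall>(x::real^'n) y s t. 0 <= s --> s < t -->
  (norm y <= (t + 1) powr (1/th) \<or> 2 * norm y <= norm x) -->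
  (s + 1 <= (t + 1) / 2 \<or> 2 * norm y <= norm x \<and> (t + 1) powr (1/th) <= norm x) -->
  \<bar>rem_kernel th K t s x y\<bar> <= C * (norm y + (s + 1) powr (1/th)) powr taylor_ord th K
    * ((t + 1) powr (1/th) + norm x) powr (- (real CARD('n) + taylor_ord th K))"
proof -
 let ?N = "real CARD('n)" and ?\<kappa> = "taylor_ord th K"
 define M where "M = nat \<lfloor>K / th\<rfloor>"
 define k where "k = nat \<lfloor>K\<rfloor>"
 obtain C1 where C1: "C1 >= 0" "!!tau x y. tau > 0 ==> \<bar>J th 0 (Suc M) (x::real^'n) y tau\<bar> <= C1 * norm y ^ 0 * (tau powr (1/th) + norm x) powr (- (?N + real 0 + th * real (Suc M)))"
  using J_bound(1)[OF th, where 'n='n, of 0 "Suc M"] by blast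
 have "\<forall>m. \<exists>C\<ge>0. \<forall>tau>0. \<forall>x y::real^'n. \<bar>J th (Suc k) m x y tau\<bar> <= C * norm y ^ Suc k * (tau powr (1/th) + norm x) powr (- (?N + real (Suc k) + th * real m))"
  using J_bound(1)[OF th, where 'n='n, of "Suc k"] by blast
 then obtain C2 where C2: "!!m. C2 m >= 0" "!!m tau x y. tau > 0 ==> \<bar>J th (Suc k) m (x::real^'n) y tau\<bar> <= C2 m * norm y ^ Suc k * (tau powr (1/th) + norm x) powr (- (?N + real (Suc k) + th * real m))"
  by metis
 \<comment> \<open>If \<open>s + 1\<close> is at most half of \<open>t + 1\<close>, then every
   \<open>tau\<close> from \<open>t - s\<close> on is at least \<open>(t + 1) / 2\<close>, and so
   \<open>tau powr (1/th)\<close> is at least \<open>4 * b * D\<close>. The further factor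
   \<open>4\<close> absorbs the comparison of \<open>norm (x - y)\<close> with
   \<open>norm x\<close>.\<close>
 define b where "b = (1/2::real) powr (1/th) / 4"
 have b: "0 < b" "4 * b <= 1" using th by (auto simp: b_def intro: powr_le1)
 let ?A1 = "C1 * b powr (- (?N + th * real (Suc M))) / fact M"
 let ?A2 = "\<Sum>m\<le>M. C2 m * 3 powr (?N + real (Suc k) + th * real m) / (fact m * fact k)"
 show ?thesis
 proof (intro exI[of _ "?A1 + ?A2"] conjI allI impI)
  have A1: "?A1 >= 0" using C1 by simp
  have A2: "?A2 >= 0" using C2(1) by (intro sum_nonneg) simp
  show "?A1 + ?A2 >= 0" using A1 A2 by simp
  fix x y :: "real^'n" and s t :: real
  assume s: "0 <= s" and st: "s < t"
   and g1: "norm y <= (t + 1) powr (1/th) \<or> 2 * norm y <= norm x"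
   and g2: "s + 1 <= (t + 1) / 2 \<or> 2 * norm y <= norm x \<and> (t + 1) powr (1/th) <= norm x"
  define D where "D = (t + 1) powr (1/th)"
  define H where "H = D + norm x"
  define \<sigma> where "\<sigma> = s + 1"
  define r where "r = norm y + \<sigma> powr (1/th)"
  have T: "t + 1 > 0" and sig: "\<sigma> > 0" using s st by (auto simp: \<sigma>_def)
  have D: "D > 0" using T by (simp add: D_def)
  have H: "H > 0" "D <= H" "norm x <= H" using D by (auto simp: H_def add_pos_nonneg)
  have DT: "D powr th = t + 1" using T th by (simp add: D_def powr_powr)
  have sH: "\<sigma> powr (1/th) <= H"
  proof -
   have "\<sigma> powr (1/th) <= D" unfolding D_def \<sigma>_def using s st th by (intro powr_mono2) auto
   then show ?thesis using H by simp
  qed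
  have yH: "norm y <= H" using g1 H unfolding D_def[symmetric] by (smt (verit) norm_ge_zero)
  have r: "r > 0" using sig by (simp add: r_def add_nonneg_pos)
  have lowD: "H / 3 <= D + norm (x - h *\<^sub>R y)" if "0 <= h" "h <= 1" for h
  proof -
   have hy: "norm (h *\<^sub>R y) <= norm y" using that by (simp add: mult_left_le_one_le)
   have "norm x - norm (h *\<^sub>R y) <= norm (x - h *\<^sub>R y)" by (rule norm_triangle_ineq2)
   then have lo: "norm x - norm y <= norm (x - h *\<^sub>R y)" using hy by linarith
   have gen: "(d + u) / 3 <= d + w" if "u - v <= w" "0 < d" "0 <= u" "0 <= w" "v <= d \<or> 2 * v <= u" for d u v w :: real
    using that by (auto simp: field_simps)
   show ?thesis unfolding H_def by (rule gen[OF lo D norm_ge_zero norm_ge_zero g1[folded D_def]])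
  qed
  have lowt: "b * H <= tau powr (1/th) + norm (x - y)" if "t - s <= tau" for tau
  proof (cases "s + 1 <= (t + 1) / 2")
   case True
   have "4 * b * D = ((t + 1) * (1/2)) powr (1/th)"
    using T unfolding b_def D_def powr_mult by simp
   also have "... <= tau powr (1/th)" using True that th T by (intro powr_mono2) auto
   finally have "4 * b * D <= ..." .
   moreover have "4 * b * norm (x - y) <= 1 * norm (x - y)" using b by (intro mult_right_mono) auto
   ultimately have "4 * b * (D + norm (x - y)) <= tau powr (1/th) + norm (x - y)" by (simp add: distrib_left)
   moreover have "4 * b * (H / 3) <= 4 * b * (D + norm (x - y))" using lowD[of 1] b by (intro mult_left_mono) auto
   moreover have "b * H <= 4 * b * (H / 3)" using b H by simp
   ultimately show ?thesis by linarith
  next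
   case False
   then have "2 * norm y <= norm x" "D <= norm x" using g2 by (auto simp: D_def)
   moreover have "norm x - norm y <= norm (x - y)" by (rule norm_triangle_ineq2)
   moreover have "tau powr (1/th) >= 0" by simp
   moreover have "b * H <= (1/4) * H" using b H by (intro mult_right_mono) auto
   moreover have "B <= p + w" if "2 * v <= u" "d <= u" "u - v <= w" "0 <= p" "B <= (1/4) * (d + u)" for B d p u v w :: real
    using that by argo
   ultimately show ?thesis unfolding H_def by blast
  qed
  have time: "\<bar>J th 0 0 (x - y) y (t - s) - (\<Sum>m\<le>M. J th 0 m (x - y) y (t + 1) * (t - s - (t + 1)) ^ m / fact m)\<bar>
    <= C1 * (b * H) powr (- (?N + th * real (Suc M))) * \<sigma> ^ Suc M / fact M"
  proof -
   have "norm (J th 0 0 (x - y) y (t - s) - (\<Sum>m\<le>M. J th 0 m (x - y) y (t + 1) * (t - s - (t + 1)) ^ m / fact m))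
    <= C1 * (b * H) powr (- (?N + th * real (Suc M))) * norm (t - s - (t + 1)) ^ Suc M / fact M"
   proof (rule field_Taylor[of "{t - s..t + 1}" M "%m tau. J th 0 m (x - y) y tau"])
    fix m tau assume "tau \<in> {t - s..t + 1}"
    then show "((%tau. J th 0 m (x - y) y tau) has_real_derivative J th 0 (Suc m) (x - y) y tau) (at tau within {t - s..t + 1})"
     by (intro has_field_derivative_at_within[OF J_time_derivative]) (use th st in auto)
   next
    fix tau assume t: "tau \<in> {t - s..t + 1}"
    then have "norm (J th 0 (Suc M) (x - y) y tau) <= C1 * norm y ^ 0 * (tau powr (1/th) + norm (x - y)) powr (- (?N + real 0 + th * real (Suc M)))"
     using C1(2)[of tau "x - y" y] st by simp
    also have "... <= C1 * norm y ^ 0 * (b * H) powr (- (?N + real 0 + th * real (Suc M)))"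
    proof -
     have "0 <= th * real (Suc M)" using th by simp
     then have "- (?N + real 0 + th * real (Suc M)) <= 0" by simp
     then show ?thesis using lowt[of tau] t b H C1 by (intro mult_left_mono powr_mono2') auto
    qed
    finally show "norm (J th 0 (Suc M) (x - y) y tau) <= C1 * (b * H) powr (- (?N + th * real (Suc M)))" by simp
   qed (use s st in auto)
   moreover have "norm (t - s - (t + 1)) = \<sigma>" using s by (simp add: \<sigma>_def)
   ultimately show ?thesis by simp
  qed
  have space: "\<bar>J th 0 m (x - y) y (t + 1) - (\<Sum>j\<le>k. J th j m x y (t + 1) / fact j)\<bar>
    <= C2 m * norm y ^ Suc k * (H / 3) powr (- (?N + real (Suc k) + th * real m)) / fact k" for m
  proof -
   have "norm (J th 0 m (x - 1 *\<^sub>R y) y (t + 1) - (\<Sum>j\<le>k. J th j m (x - 0 *\<^sub>R y) y (t + 1) * (1 - 0) ^ j / fact j))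
    <= C2 m * norm y ^ Suc k * (H / 3) powr (- (?N + real (Suc k) + th * real m)) * norm (1 - 0 :: real) ^ Suc k / fact k"
   proof (rule field_Taylor[of "{0..1}" k "%j h. J th j m (x - h *\<^sub>R y) y (t + 1)"])
    fix j h
    show "((%h. J th j m (x - h *\<^sub>R y) y (t + 1)) has_real_derivative J th (Suc j) m (x - h *\<^sub>R y) y (t + 1)) (at h within {0..1})"
     by (intro has_field_derivative_at_within[OF J_space_derivative]) (use th T in auto)
   next
    fix h :: real assume h: "h \<in> {0..1}"
    have "norm (J th (Suc k) m (x - h *\<^sub>R y) y (t + 1)) <= C2 m * norm y ^ Suc k * ((t + 1) powr (1/th) + norm (x - h *\<^sub>R y)) powr (- (?N + real (Suc k) + th * real m))"
     using C2(2)[OF T, of m "x - h *\<^sub>R y" y] by simp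
    also have "... <= C2 m * norm y ^ Suc k * (H / 3) powr (- (?N + real (Suc k) + th * real m))"
    proof -
     have "0 <= th * real m" using th by simp
     then have "- (?N + real (Suc k) + th * real m) <= 0" by simp
     then show ?thesis unfolding D_def[symmetric] using lowD[of h] h H C2(1)[of m] by (intro mult_left_mono powr_mono2') auto
    qed
    finally show "norm (J th (Suc k) m (x - h *\<^sub>R y) y (t + 1)) <= ..." .
   qed auto
   then show ?thesis by simp
  qed
  \<comment> \<open>Both remainders have order at least \<open>?\<kappa>\<close> in
    \<open>u / H\<close>. As \<open>u / H\<close> is at most \<open>1\<close>, the exponent may be
    lowered to the common value.\<close>
  have frac: "(u / H) powr e <= (r / H) powr ?\<kappa>" if "0 <= u" "u <= H" "u <= r" "?\<kappa> <= e" for u e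
  proof -
   have "(u / H) powr e <= (u / H) powr ?\<kappa>" using that H by (intro powr_mono') auto
   also have "... <= (r / H) powr ?\<kappa>" using that H taylor_ord_gt[OF th(1) K] K by (intro powr_mono2 divide_right_mono) auto
   finally show ?thesis .
  qed
  have split: "H powr (- (?N + e)) * u powr e = H powr (- ?N) * (u / H) powr e" if "u >= 0" for u e
  proof -
   have "H powr (- (?N + e)) = H powr (- ?N) * H powr (- e)" unfolding powr_add[symmetric] by simp
   moreover have "(u / H) powr e = u powr e * H powr (- e)" by (simp only: powr_divide powr_minus_divide) simp
   ultimately show ?thesis by (simp only: mult_ac)
  qed
  have timeb: "C1 * (b * H) powr (- (?N + th * real (Suc M))) * \<sigma> ^ Suc M / fact M <= ?A1 * (H powr (- ?N) * (r / H) powr ?\<kappa>)"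
  proof -
   have "\<sigma> ^ Suc M = (\<sigma> powr (1/th)) powr (th * real (Suc M))"
    using th powr_realpow[OF sig, of "Suc M"] by (simp only: powr_powr) simp
   then have "H powr (- (?N + th * real (Suc M))) * \<sigma> ^ Suc M = H powr (- ?N) * (\<sigma> powr (1/th) / H) powr (th * real (Suc M))"
    by (simp only: split powr_ge_zero)
   also have "... <= H powr (- ?N) * (r / H) powr ?\<kappa>"
    using sH by (intro mult_left_mono frac) (auto simp: r_def taylor_ord_def M_def)
   finally have "?A1 * (H powr (- (?N + th * real (Suc M))) * \<sigma> ^ Suc M) <= ?A1 * (H powr (- ?N) * (r / H) powr ?\<kappa>)"
    using A1 by (rule mult_left_mono)
   moreover have "C1 * (b * H) powr (- (?N + th * real (Suc M))) * \<sigma> ^ Suc M / fact M = ?A1 * (H powr (- (?N + th * real (Suc M))) * \<sigma> ^ Suc M)"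
    using b H by (simp add: powr_mult)
   ultimately show ?thesis by (simp only:)
  qed
  have spaceb: "\<sigma> ^ m / fact m * (C2 m * norm y ^ Suc k * (H / 3) powr (- (?N + real (Suc k) + th * real m)) / fact k)
    <= C2 m * 3 powr (?N + real (Suc k) + th * real m) / (fact m * fact k) * (H powr (- ?N) * (r / H) powr ?\<kappa>)" for m
  proof -
   let ?e = "?N + real (Suc k) + th * real m"
   have "\<sigma> ^ m = (\<sigma> powr (1/th)) powr (th * real m)"
    using th powr_realpow[OF sig, of m] by (simp only: powr_powr) simp
   also have "... <= H powr (th * real m)" using sH th by (intro powr_mono2) auto
   finally have sm: "\<sigma> ^ m <= ..." .
   have yk: "norm y ^ Suc k = norm y powr real (Suc k)" using powr_realpow[of "norm y" "Suc k"] by (cases "y = 0") (auto simp del: power_Suc of_nat_Suc)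
   have "\<sigma> ^ m * (norm y ^ Suc k * H powr (- ?e)) <= H powr (th * real m) * (norm y ^ Suc k * H powr (- ?e))"
    using sm by (intro mult_right_mono) auto
   also have "... = norm y ^ Suc k * (H powr (th * real m) * H powr (- ?e))" by simp
   also have "H powr (th * real m) * H powr (- ?e) = H powr (- (?N + real (Suc k)))"
    unfolding powr_add[symmetric] by (simp add: algebra_simps)
   also have "norm y ^ Suc k * H powr (- (?N + real (Suc k))) = H powr (- ?N) * (norm y / H) powr real (Suc k)"
    unfolding yk using split[of "norm y" "real (Suc k)"] by (simp only: mult.commute norm_ge_zero)
   also have "... <= H powr (- ?N) * (r / H) powr ?\<kappa>"
    using yH by (intro mult_left_mono frac) (auto simp: r_def taylor_ord_def k_def)
   finally have "C2 m * 3 powr ?e / (fact m * fact k) * (\<sigma> ^ m * (norm y ^ Suc k * H powr (- ?e))) <= C2 m * 3 powr ?e / (fact m * fact k) * (H powr (- ?N) * (r / H) powr ?\<kappa>)"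
    using C2(1)[of m] by (intro mult_left_mono) auto
   moreover have "(H / 3) powr (- ?e) = 3 powr ?e * H powr (- ?e)" using H by (simp only: powr_divide powr_minus) (simp add: field_simps)
   ultimately show ?thesis by (simp add: mult_ac)
  qed
  have decomp: "rem_kernel th K t s x y = (J th 0 0 (x - y) y (t - s) - (\<Sum>m\<le>M. J th 0 m (x - y) y (t + 1) * (t - s - (t + 1)) ^ m / fact m))
   + (\<Sum>m\<le>M. \<sigma> ^ m * (-1) ^ m / fact m * (J th 0 m (x - y) y (t + 1) - (\<Sum>j\<le>k. J th j m x y (t + 1) / fact j)))"
  proof -
   have pw: "(t - s - (t + 1)) ^ m = \<sigma> ^ m * (-1) ^ m" for m
    unfolding power_mult_distrib[symmetric] by (simp add: \<sigma>_def)
   have tp: "taylor_part th K t s x y = (\<Sum>m\<le>M. \<sigma> ^ m * (-1) ^ m / fact m * (\<Sum>j\<le>k. J th j m x y (t + 1) / fact j))"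
    unfolding taylor_part_def M_def[symmetric] k_def[symmetric] \<sigma>_def[symmetric] by (simp add: sum_distrib_left mult_ac)
   have A: "(\<Sum>m\<le>M. J th 0 m (x - y) y (t + 1) * (t - s - (t + 1)) ^ m / fact m) = (\<Sum>m\<le>M. \<sigma> ^ m * (-1) ^ m / fact m * J th 0 m (x - y) y (t + 1))"
    unfolding pw by (intro sum.cong refl) simp
   show ?thesis
    unfolding rem_kernel_def tp A right_diff_distrib sum_subtractf G_eq_J[of th "x - y" "t - s" y] by simp
  qed
  have "\<bar>rem_kernel th K t s x y\<bar> <= \<bar>J th 0 0 (x - y) y (t - s) - (\<Sum>m\<le>M. J th 0 m (x - y) y (t + 1) * (t - s - (t + 1)) ^ m / fact m)\<bar>
   + (\<Sum>m\<le>M. \<bar>\<sigma> ^ m * (-1) ^ m / fact m * (J th 0 m (x - y) y (t + 1) - (\<Sum>j\<le>k. J th j m x y (t + 1) / fact j))\<bar>)"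
   unfolding decomp by (intro order_trans[OF abs_triangle_ineq] add_mono order_refl sum_abs)
  also have "... <= ?A1 * (H powr (- ?N) * (r / H) powr ?\<kappa>) + (\<Sum>m\<le>M. C2 m * 3 powr (?N + real (Suc k) + th * real m) / (fact m * fact k) * (H powr (- ?N) * (r / H) powr ?\<kappa>))"
  proof (intro add_mono sum_mono order_trans[OF time timeb])
   fix m
   have "\<bar>\<sigma> ^ m * (-1) ^ m / fact m * (J th 0 m (x - y) y (t + 1) - (\<Sum>j\<le>k. J th j m x y (t + 1) / fact j))\<bar>
    = \<sigma> ^ m / fact m * \<bar>J th 0 m (x - y) y (t + 1) - (\<Sum>j\<le>k. J th j m x y (t + 1) / fact j)\<bar>"
    using sig by (simp add: abs_mult power_abs)
   also have "... <= \<sigma> ^ m / fact m * (C2 m * norm y ^ Suc k * (H / 3) powr (- (?N + real (Suc k) + th * real m)) / fact k)"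
    using sig by (intro mult_left_mono space) auto
   also note spaceb
   finally show "\<bar>\<sigma> ^ m * (-1) ^ m / fact m * (J th 0 m (x - y) y (t + 1) - (\<Sum>j\<le>k. J th j m x y (t + 1) / fact j))\<bar>
    <= C2 m * 3 powr (?N + real (Suc k) + th * real m) / (fact m * fact k) * (H powr (- ?N) * (r / H) powr ?\<kappa>)" .
  qed
  also have "... = (?A1 + ?A2) * (H powr (- ?N) * (r / H) powr ?\<kappa>)" by (simp only: sum_distrib_right distrib_right)
  finally have "\<bar>rem_kernel th K t s x y\<bar> <= ..." .
  moreover have "H powr (- ?N) * (r / H) powr ?\<kappa> = r powr ?\<kappa> * H powr (- (?N + ?\<kappa>))"
   using split[of r ?\<kappa>] r by (simp add: mult.commute)
  ultimately show "\<bar>rem_kernel th K t s x y\<bar> <= (?A1 + ?A2) * (norm y + (s + 1) powr (1/th)) powr ?\<kappa> * ((t + 1) powr (1/th) + norm x) powr (- (?N + ?\<kappa>))"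
   by (simp add: r_def H_def D_def \<sigma>_def mult.assoc)
 qed
qed

section \<open>Radial profiles and the size of the kernel\<close>

text \<open>For \<open>\<delta> = th\<close> and \<open>\<rho> = t powr (1/th)\<close> this is the
  function called \<open>P\<close> in the overview. The prefactor makes the integral bounded
  independently of \<rho>.\<close>

definition prof :: "real => real => real^'n => real" where
 "prof \<rho> \<delta> x = \<rho> powr \<delta> * (\<rho> + norm x) powr (- (real CARD('n) + \<delta>))"

lemma prof_nonneg: "0 <= prof \<rho> \<delta> x"
 by (simp add: prof_def)

lemma prof_measurable [measurable]: "prof \<rho> \<delta> \<in> borel_measurable borel"
 unfolding prof_def by measurable

lemma prof_le: "\<rho> > 0 ==> \<delta> >= 0 ==> prof \<rho> \<delta> (x::real^'n) <= \<rho> powr (- real CARD('n))"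
proof -
 assume a: "\<rho> > 0" "\<delta> >= 0"
 have "prof \<rho> \<delta> x <= \<rho> powr \<delta> * \<rho> powr (- (real CARD('n) + \<delta>))"
  unfolding prof_def using a by (intro mult_left_mono powr_mono2') auto
 also have "... = \<rho> powr (- real CARD('n))" unfolding powr_add[symmetric] by simp
 finally show ?thesis .
qed

lemma nn_integral_prof:
 assumes "\<delta> > 0"
 shows "\<exists>C>0. \<forall>\<rho>>0. (\<I> x. prof \<rho> \<delta> (x::real^'n)) <= ennreal C"
proof -
 obtain C where C: "C > 0" "!!D. D > 0 ==> (\<I> (x::real^'n). (D + norm x) powr (-(real CARD('n) + \<delta>))) <= ennreal (C * D powr (-\<delta>))"
  using nn_integral_radial_powr[where 'n='n, OF assms] by blast
 have "(\<I> x. prof \<rho> \<delta> (x::real^'n)) <= ennreal C" if r: "\<rho> > 0" for \<rho>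
 proof -
  have "(\<I> x. prof \<rho> \<delta> (x::real^'n)) = (\<N> (x::real^'n). ennreal (\<rho> powr \<delta>) * ennreal ((\<rho> + norm x) powr (-(real CARD('n) + \<delta>))))"
   by (simp add: prof_def ennreal_mult)
  also have "... = ennreal (\<rho> powr \<delta>) * (\<I> (x::real^'n). (\<rho> + norm x) powr (-(real CARD('n) + \<delta>)))"
   by (rule nn_integral_cmult) auto
  also have "... <= ennreal (\<rho> powr \<delta>) * ennreal (C * \<rho> powr (-\<delta>))" by (intro mult_left_mono C r) auto
  also have "... = ennreal (C * (\<rho> powr \<delta> * \<rho> powr (-\<delta>)))" using C by (simp add: ennreal_mult[symmetric] mult_ac)
  also have "\<rho> powr \<delta> * \<rho> powr (-\<delta>) = 1" using r unfolding powr_add[symmetric] by simp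
  finally show ?thesis by simp
 qed
 then show ?thesis using C(1) by blast
qed

lemma nn_integral_lborel_shift:
 fixes f :: "'a::euclidean_space => ennreal"
 assumes "f \<in> borel_measurable borel"
 shows "(\<N> x. f (x - y)) = (\<N> x. f x)"
proof -
 have "(\<N> x. f x) = (\<integral>\<^sup>+ x. f x \<partial>distr lborel borel ((+) (- y)))" by (simp add: lborel_distr_plus)
 also have "... = (\<N> x. f (- y + x))" using assms by (intro nn_integral_distr) auto
 finally show ?thesis by simp
qed

lemma G_bound:
 assumes "0 < th" "th < 2"
 shows "\<exists>C>0. \<forall>tau>0. \<forall>x::real^'n. \<bar>G th x tau\<bar> <= C * prof (tau powr (1/th)) th x"
proof -
 obtain C where C: "C >= 0" "!!tau x y. tau > 0 ==> \<bar>J th 0 0 (x::real^'n) y tau\<bar> <= C * norm y ^ 0 * (tau * (tau powr (1/th) + norm x) powr (- (real CARD('n) + real 0 + th)))"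
  using J_bound(2)[OF assms, where 'n='n, of 0] by blast
 have "\<bar>G th x tau\<bar> <= (C + 1) * prof (tau powr (1/th)) th x" if "tau > 0" for tau and x :: "real^'n"
 proof -
  have "\<bar>G th x tau\<bar> <= C * prof (tau powr (1/th)) th x"
   using C(2)[OF that, of x x] that assms by (simp add: G_eq_J[of th x tau x] prof_def powr_powr)
  also have "... <= (C + 1) * prof (tau powr (1/th)) th x" by (intro mult_right_mono prof_nonneg) auto
  finally show ?thesis .
 qed
 then show ?thesis using C(1) by (intro exI[of _ "C + 1"]) auto
qed

lemma G_measurable [measurable]: "(%(x, t). G th x t) \<in> borel_measurable (borel \<Otimes>\<^sub>M borel)"
 unfolding G_eq_Fou Fou_def by measurable

lemma G_measurable' [measurable]:
 assumes "f \<in> borel_measurable M" "h \<in> borel_measurable M"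
 shows "(%x. G th (f x) (h x)) \<in> borel_measurable M"
 using measurable_compose[OF measurable_Pair[OF assms] G_measurable] by simp

lemma J_measurable [measurable]:
 assumes [measurable]: "f \<in> borel_measurable M" "h \<in> borel_measurable M" "k \<in> borel_measurable M"
 shows "(%x. J th j m (f x) (h x) (k x)) \<in> borel_measurable M"
proof -
 have "(%(x, y, t). J th j m x y t) \<in> borel_measurable (borel \<Otimes>\<^sub>M borel \<Otimes>\<^sub>M borel)"
  unfolding J_def symb_def Fou_def by measurable
 from measurable_compose[OF measurable_Pair[OF assms(1) measurable_Pair[OF assms(2,3)]] this]
 show ?thesis by simp
qed

lemma rem_kernel_measurable [measurable]:
 assumes [measurable]: "f \<in> borel_measurable M" "h \<in> borel_measurable M" "s \<in> borel_measurable M"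
 shows "(%x. rem_kernel th K t (s x) (f x) (h x)) \<in> borel_measurable M"
 unfolding rem_kernel_def taylor_part_def by measurable

section \<open>Weighted bounds for the remainder kernel\<close>

definition rad :: "real => real => real^'n => real" where
 "rad th s y = norm y + (s + 1) powr (1/th)"

definition scale :: "real => real => real" where
 "scale th t = (t + 1) powr (1/th)"

text \<open>If \<open>dbl th * rad th s y\<close> does not exceed \<open>scale th t\<close>, both
  expansions are legitimate: the entry \<open>2 powr (1/th)\<close> gives
  \<open>2 * (s + 1) <= t + 1\<close>, and the entry \<open>2\<close> keeps \<open>norm y\<close>
  below the scale. The entry \<open>2\<close> also ensures \<open>2 * norm y <= norm x\<close> once
  \<open>norm x\<close> exceeds \<open>dbl th * rad th s y\<close>.\<close>

definition dbl :: "real => real" where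
 "dbl th = max 2 (2 powr (1/th))"

definition kernel_wt :: "real => real => real => real => real^'n => real" where
 "kernel_wt th K t s y = (rad th s y / scale th t) powr K * min 1 (rad th s y / scale th t) powr (taylor_ord th K - K)"

lemma kernel_wt_nonneg: "0 <= kernel_wt th K t s y"
 by (simp add: kernel_wt_def)

context
 fixes th K l :: real
 assumes th: "0 < th" "th < 2" and K: "0 <= K" and l: "0 <= l" "l <= K"
begin

text \<open>In this region the Taylor polynomial has no cancellation with the kernel to offer and
  its terms are bounded one by one. A term of order \<open>j\<close> brings
  \<open>norm y ^ j\<close>, and part of the weight \<open>norm x powr l\<close> is charged to the
  decay in \<open>H\<close>, so that the total power of \<open>r\<close> never exceeds
  \<open>K\<close>.\<close>

lemma taylor_part_near:
 "\<exists>C\<ge>0. \<forall>(x::real^'n) y s t. 0 <= s --> s < t --> scale th t < dbl th * rad th s y --> norm x <= dbl th * rad th s y -->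
  norm x powr l * \<bar>taylor_part th K t s x y\<bar> <= C * (scale th t powr l * (rad th s y / scale th t) powr K * prof (scale th t) th x)"
proof -
 let ?N = "real CARD('n)"
 have "\<forall>j m. \<exists>C\<ge>0. \<forall>tau>0. \<forall>x y::real^'n. \<bar>J th j m x y tau\<bar> <= C * norm y ^ j * (tau powr (1/th) + norm x) powr (- (?N + real j + th * real m))"
  using J_bound(1)[OF th, where 'n='n] by blast
 then obtain C1 where C1: "!!j m. C1 j m >= 0" "!!j m tau x y. tau > 0 ==> \<bar>J th j m (x::real^'n) y tau\<bar> <= C1 j m * norm y ^ j * (tau powr (1/th) + norm x) powr (- (?N + real j + th * real m))"
  by metis
 have "\<forall>j. \<exists>C\<ge>0. \<forall>tau>0. \<forall>x y::real^'n. \<bar>J th j 0 x y tau\<bar> <= C * norm y ^ j * (tau * (tau powr (1/th) + norm x) powr (- (?N + real j + th)))"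
  using J_bound(2)[OF th, where 'n='n] by blast
 then obtain C2 where C2: "!!j. C2 j >= 0" "!!j tau x y. tau > 0 ==> \<bar>J th j 0 (x::real^'n) y tau\<bar> <= C2 j * norm y ^ j * (tau * (tau powr (1/th) + norm x) powr (- (?N + real j + th)))"
  by metis
 let ?c = "%j m. C1 j m + C2 j"
 let ?C = "\<Sum>m\<le>nat \<lfloor>K / th\<rfloor>. \<Sum>j\<le>nat \<lfloor>K\<rfloor>. ?c j m * dbl th powr (l + K)"
 have q: "dbl th >= 2" by (simp add: dbl_def)
 have c0: "?c j m >= 0" for j m using C1(1)[of j m] C2(1)[of j] by simp
 show ?thesis
 proof (intro exI[of _ ?C] conjI allI impI)
  show "?C >= 0" using c0 by (intro sum_nonneg mult_nonneg_nonneg) auto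
  fix x y :: "real^'n" and s t :: real
  assume s: "0 <= s" and st: "s < t" and c2: "scale th t < dbl th * rad th s y" and xn: "norm x <= dbl th * rad th s y"
  define D where "D = scale th t"
  define r where "r = rad th s y"
  define H where "H = D + norm x"
  have T: "t + 1 > 0" using s st by simp
  have D: "D > 0" using T by (simp add: D_def scale_def)
  have H: "H > 0" "D <= H" "norm x <= H" using D by (auto simp: H_def add_pos_nonneg)
  have Dd: "(t + 1) powr (1/th) = D" by (simp add: D_def scale_def)
  have DT: "t + 1 = D powr th" using T th by (simp add: D_def scale_def powr_powr)
  have r: "r > 0" using s by (simp add: r_def rad_def add_nonneg_pos)
  have yr: "norm y <= r" by (simp add: r_def rad_def)
  have Jb: "(s + 1) ^ m * \<bar>J th j m x y (t + 1)\<bar> <= ?c j m * norm y ^ j * (D powr th * H powr (- (?N + real j + th)))" for j m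
  \<comment> \<open>For \<open>m = 0\<close> the general bound decays only like
    \<open>H powr (- N - j)\<close>, too little when \<open>j = 0\<close>; the second bound, with
    the factor \<open>tau\<close>, supplies the missing \<open>th\<close>. For positive
    \<open>m\<close> the time derivative supplies it already.\<close>
  proof (cases m)
   case 0
   have "\<bar>J th j 0 x y (t + 1)\<bar> <= C2 j * norm y ^ j * (D powr th * H powr (- (?N + real j + th)))"
    using C2(2)[OF T, of j x y] by (simp only: Dd H_def DT[symmetric])
   also have "... <= ?c j m * norm y ^ j * (D powr th * H powr (- (?N + real j + th)))"
    using C1(1)[of j m] by (intro mult_right_mono) auto
   finally show ?thesis using 0 by simp
  next
   case (Suc m')
   have "(s + 1) ^ m <= (D powr th) ^ m" using s st unfolding DT[symmetric] by (intro power_mono) auto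
   also have "... = D powr (th * real m)" using D by (simp add: powr_realpow[symmetric] powr_powr)
   finally have "(s + 1) ^ m * \<bar>J th j m x y (t + 1)\<bar> <= D powr (th * real m) * (C1 j m * norm y ^ j * H powr (- (?N + real j + th * real m)))"
    using C1(2)[OF T, of j m x y] s by (intro mult_mono) (auto simp: H_def D_def scale_def)
   also have "... = C1 j m * norm y ^ j * (D powr (th * real m) * H powr (- (?N + real j + th * real m)))" by simp
   also have "D powr (th * real m) * H powr (- (?N + real j + th * real m)) <= D powr th * H powr (- (?N + real j + th))"
   proof -
    have "D powr (th * real m') <= H powr (th * real m')" using D H th by (intro powr_mono2) auto
    then have "D powr (th * real m') * (D powr th * H powr (- (?N + real j + th * real m))) <= H powr (th * real m') * (D powr th * H powr (- (?N + real j + th * real m)))"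
     by (rule mult_right_mono) simp
    moreover have "D powr (th * real m) = D powr (th * real m') * D powr th" unfolding powr_add[symmetric] Suc by (simp add: algebra_simps)
    moreover have "H powr (- (?N + real j + th)) = H powr (th * real m') * H powr (- (?N + real j + th * real m))" unfolding powr_add[symmetric] Suc by (simp add: algebra_simps)
    ultimately show ?thesis by (simp only: mult_ac)
   qed
   finally have "(s + 1) ^ m * \<bar>J th j m x y (t + 1)\<bar> <= C1 j m * norm y ^ j * (D powr th * H powr (- (?N + real j + th)))"
    using C1(1)[of j m] by (simp add: mult_left_mono)
   also have "... <= ?c j m * norm y ^ j * (D powr th * H powr (- (?N + real j + th)))"
    using C2(1)[of j] by (intro mult_right_mono) auto
   finally show ?thesis .
  qed
  let ?P = "D powr l * (r / D) powr K * prof D th x"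
  have trm: "norm x powr l * ((s + 1) ^ m * \<bar>J th j m x y (t + 1)\<bar>) <= ?c j m * dbl th powr (l + K) * ?P" if j: "real j <= K" for j m
  proof -
   \<comment> \<open>The share of the weight that is paid by \<open>H\<close>. It is as large as the
     decay of order \<open>j\<close> allows, and the rest \<open>l - e\<close> is paid by
     \<open>r\<close>; then \<open>l - e + j\<close> is the larger of \<open>l\<close> and
     \<open>j\<close>.\<close>
   define e where "e = min l (real j)"
   have e: "0 <= e" "e <= l" "e <= real j" using l by (auto simp: e_def)
   have ej: "l - e + real j <= K" using j l by (auto simp: e_def min_def)
   have "norm x powr l = norm x powr (l - e) * norm x powr e" unfolding powr_add[symmetric] by simp
   also have "... <= (dbl th * r) powr (l - e) * H powr e"
    using xn e H r q by (intro mult_mono powr_mono2) (auto simp: r_def)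
   finally have x1: "norm x powr l <= ..." .
   have y1: "norm y ^ j <= r powr real j" using yr r by (simp add: powr_realpow power_mono)
   have "norm x powr l * ((s + 1) ^ m * \<bar>J th j m x y (t + 1)\<bar>) <= ((dbl th * r) powr (l - e) * H powr e) * (?c j m * r powr real j * (D powr th * H powr (- (?N + real j + th))))"
   proof (rule mult_mono[OF x1 order_trans[OF Jb]])
    show "?c j m * norm y ^ j * (D powr th * H powr (- (?N + real j + th))) <= ?c j m * r powr real j * (D powr th * H powr (- (?N + real j + th)))"
     using y1 c0[of j m] by (intro mult_right_mono mult_left_mono) auto
   qed (use s in auto)
   also have "... = ?c j m * ((dbl th * r) powr (l - e) * r powr real j) * (H powr (e - real j)) * prof D th x"
   proof -
    have "H powr e * H powr (- (?N + real j + th)) = H powr (e - real j) * H powr (- (?N + th))" unfolding powr_add[symmetric] by (simp add: algebra_simps)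
    then show ?thesis by (simp add: prof_def H_def[symmetric] mult_ac)
   qed
   also have "... <= ?c j m * ((dbl th * r) powr (l - e) * r powr real j) * (D powr (e - real j)) * prof D th x"
   proof -
    have "H powr (e - real j) <= D powr (e - real j)" using D H e by (intro powr_mono2') auto
    then show ?thesis using c0[of j m] by (intro mult_right_mono mult_left_mono prof_nonneg) auto
   qed
   finally have s1: "norm x powr l * ((s + 1) ^ m * \<bar>J th j m x y (t + 1)\<bar>) <= ..." .
   have eq: "(dbl th * r) powr (l - e) * r powr real j * (D powr (e - real j)) = dbl th powr (l - e) * (D powr l * (r / D) powr (l - e + real j))"
   proof -
    have "(r / D) powr (l - e + real j) = r powr (l - e) * r powr real j * D powr (- (l - e + real j))"
     using powr_add[of r "l - e" "real j"] by (simp only: powr_divide powr_minus_divide) simp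
    moreover have "D powr l * D powr (- (l - e + real j)) = D powr (e - real j)" unfolding powr_add[symmetric] by simp
    ultimately show ?thesis using q r by (simp add: powr_mult mult_ac)
   qed
   note s1
   also have "?c j m * ((dbl th * r) powr (l - e) * r powr real j) * (D powr (e - real j)) * prof D th x = ?c j m * (dbl th powr (l - e) * (D powr l * (r / D) powr (l - e + real j))) * prof D th x"
    unfolding eq[symmetric] by (simp only: mult_ac)
   also have "... <= ?c j m * (dbl th powr l * (D powr l * (dbl th powr K * (r / D) powr K))) * prof D th x"
   proof -
    have 1: "dbl th powr (l - e) <= dbl th powr l" using q e by (intro powr_mono) auto
    \<comment> \<open>Since \<open>r\<close> is not small against \<open>D\<close>, a power of
      \<open>dbl th * (r / D)\<close> may be raised to the exponent \<open>K\<close>.\<close>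
    have "1 <= dbl th * (r / D)" using c2 D by (simp add: r_def[symmetric] D_def[symmetric] field_simps)
    then have "(dbl th * (r / D)) powr (l - e + real j) <= (dbl th * (r / D)) powr K" using ej by (intro powr_mono) auto
    moreover have "(r / D) powr (l - e + real j) <= (dbl th * (r / D)) powr (l - e + real j)"
     using q r D e mult_right_mono[of 1 "dbl th" "r / D"] by (intro powr_mono2) auto
    ultimately have "(r / D) powr (l - e + real j) <= (dbl th * (r / D)) powr K" by (rule order_trans[rotated])
    then have 2: "(r / D) powr (l - e + real j) <= dbl th powr K * (r / D) powr K" by (simp only: powr_mult)
    show ?thesis using 1 2 c0[of j m] by (intro mult_right_mono mult_left_mono mult_mono prof_nonneg) auto
   qed
   finally show ?thesis by (simp only: powr_add mult_ac)
  qed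
  have "norm x powr l * \<bar>taylor_part th K t s x y\<bar> <= norm x powr l * (\<Sum>m\<le>nat \<lfloor>K / th\<rfloor>. \<Sum>j\<le>nat \<lfloor>K\<rfloor>. (s + 1) ^ m * \<bar>J th j m x y (t + 1)\<bar>)"
  proof (rule mult_left_mono)
   show "\<bar>taylor_part th K t s x y\<bar> <= (\<Sum>m\<le>nat \<lfloor>K / th\<rfloor>. \<Sum>j\<le>nat \<lfloor>K\<rfloor>. (s + 1) ^ m * \<bar>J th j m x y (t + 1)\<bar>)"
    unfolding taylor_part_def
   proof (rule order_trans[OF sum_abs], rule sum_mono, rule order_trans[OF sum_abs], rule sum_mono)
    fix m j
    have "(fact m * fact j :: real) >= 1 * 1" by (intro mult_mono fact_ge_1) auto
    then have "\<bar>(-1) ^ m / (fact m * fact j) :: real\<bar> <= 1" by (simp add: power_abs)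
    then have "(s + 1) ^ m * \<bar>(-1) ^ m / (fact m * fact j) :: real\<bar> * \<bar>J th j m x y (t + 1)\<bar> <= (s + 1) ^ m * 1 * \<bar>J th j m x y (t + 1)\<bar>"
     using s by (intro mult_right_mono mult_left_mono) auto
    then show "\<bar>(s + 1) ^ m * ((-1) ^ m / (fact m * fact j)) * J th j m x y (t + 1)\<bar> <= (s + 1) ^ m * \<bar>J th j m x y (t + 1)\<bar>"
     using s by (simp only: abs_mult power_abs)
   qed
  qed simp
  also have "... = (\<Sum>m\<le>nat \<lfloor>K / th\<rfloor>. \<Sum>j\<le>nat \<lfloor>K\<rfloor>. norm x powr l * ((s + 1) ^ m * \<bar>J th j m x y (t + 1)\<bar>))"
   by (simp only: sum_distrib_left)
  also have "... <= (\<Sum>m\<le>nat \<lfloor>K / th\<rfloor>. \<Sum>j\<le>nat \<lfloor>K\<rfloor>. ?c j m * dbl th powr (l + K) * ?P)"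
  proof (intro sum_mono trm)
   fix j assume "j \<in> {..nat \<lfloor>K\<rfloor>}"
   then have "real j <= real (nat \<lfloor>K\<rfloor>)" by simp
   also have "... <= K" using K by (simp add: of_nat_nat)
   finally show "real j <= K" .
  qed
  also have "... = ?C * ?P" by (simp only: sum_distrib_right)
  finally show "norm x powr l * \<bar>taylor_part th K t s x y\<bar> <= ?C * (scale th t powr l * (rad th s y / scale th t) powr K * prof (scale th t) th x)"
   by (simp only: D_def r_def)
 qed
qed

text \<open>There are three regions. If \<open>r\<close> is small against \<open>D\<close>, Taylor's
  formula applies. If not, but \<open>norm x\<close> exceeds \<open>dbl th * r\<close>, it applies
  again, because \<open>norm x\<close> dominates everything. In between, the kernel and the Taylor
  polynomial are separated; only there does the term with \<open>G\<close> arise.\<close>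

lemma kernel_pointwise:
 "\<exists>C\<ge>0. \<forall>(x::real^'n) y s t. 0 <= s --> s < t -->
  norm x powr l * \<bar>rem_kernel th K t s x y\<bar> <=
   C * (scale th t powr l * kernel_wt th K t s y * (prof (max (rad th s y) (scale th t)) (taylor_ord th K - l) x + prof (scale th t) th x))
   + (if scale th t < dbl th * rad th s y then C * (rad th s y powr l * \<bar>G th (x - y) (t - s)\<bar>) else 0)"
proof -
 let ?N = "real CARD('n)" and ?\<kappa> = "taylor_ord th K"
 have kap: "K < ?\<kappa>" by (rule taylor_ord_gt[OF th(1) K])
 obtain C1 where C1: "C1 >= 0" "!!(x::real^'n) y s t. 0 <= s ==> s < t ==>
  norm y <= (t + 1) powr (1/th) \<or> 2 * norm y <= norm x ==>
  s + 1 <= (t + 1) / 2 \<or> 2 * norm y <= norm x \<and> (t + 1) powr (1/th) <= norm x ==>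
  \<bar>rem_kernel th K t s x y\<bar> <= C1 * (norm y + (s + 1) powr (1/th)) powr ?\<kappa> * ((t + 1) powr (1/th) + norm x) powr (- (?N + ?\<kappa>))"
  using taylor_estimate[OF th K, where 'n='n] by blast
 obtain C2 where C2: "C2 >= 0" "!!(x::real^'n) y s t. 0 <= s ==> s < t ==> scale th t < dbl th * rad th s y ==> norm x <= dbl th * rad th s y ==>
  norm x powr l * \<bar>taylor_part th K t s x y\<bar> <= C2 * (scale th t powr l * (rad th s y / scale th t) powr K * prof (scale th t) th x)"
  using taylor_part_near[where 'n='n] by blast
 have q: "dbl th >= 2" by (simp add: dbl_def)
 \<comment> \<open>The price for inserting the cutoff factor of \<open>kernel_wt\<close> where
   \<open>r / D\<close> is at least \<open>1 / dbl th\<close>.\<close>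
 define Q where "Q = dbl th powr (?\<kappa> - K)"
 have Q: "Q >= 1" unfolding Q_def using q kap by (intro ge_one_powr_ge_zero) auto
 \<comment> \<open>Collects the powers of \<open>dbl th\<close> lost in the far region when
   \<open>D\<close> is replaced by \<open>max r D\<close> and the exponent \<open>l\<close> is
   raised to \<open>K\<close>.\<close>
 define Q1 where "Q1 = dbl th powr (?N + ?\<kappa> + K)"
 have Q1: "Q1 >= 1" unfolding Q1_def using q kap K by (intro ge_one_powr_ge_zero) auto
 let ?C = "C1 + C1 * Q1 * Q1 * Q + C2 * Q + dbl th powr l"
 show ?thesis
 proof (intro exI[of _ ?C] conjI allI impI)
  show C0: "?C >= 0" using C1 C2 Q Q1 by (intro add_nonneg_nonneg mult_nonneg_nonneg) auto
  fix x y :: "real^'n" and s t :: real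
  assume s: "0 <= s" and st: "s < t"
  define D where "D = scale th t"
  define r where "r = rad th s y"
  have D: "D > 0" using s st by (simp add: D_def scale_def)
  have r: "r > 0" using s by (simp add: r_def rad_def add_nonneg_pos)
  have yr: "norm y <= r" "(s + 1) powr (1/th) <= r" using s by (auto simp: r_def rad_def)
  let ?W = "kernel_wt th K t s y"
  let ?P1 = "prof (max r D) (?\<kappa> - l) x" and ?P2 = "prof D th x"
  have P: "?P1 >= 0" "?P2 >= 0" by (auto intro: prof_nonneg)
  have W0: "?W >= 0" by (rule kernel_wt_nonneg)
  let ?rhs1 = "D powr l * ?W * (?P1 + ?P2)"
  have rhs1: "?rhs1 >= 0" using W0 P by simp
  have goal: "norm x powr l * \<bar>rem_kernel th K t s x y\<bar> <= ?C * ?rhs1 + (if D < dbl th * r then ?C * (r powr l * \<bar>G th (x - y) (t - s)\<bar>) else 0)"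
  proof (cases "D < dbl th * r")
   case False
   have rD: "dbl th * r <= D" using False by simp
   have r1: "r / D <= 1"
   proof -
    have "r <= dbl th * r" using q r by simp
    then show ?thesis using rD D by simp
   qed
   have g1: "norm y <= (t + 1) powr (1/th)" using r1 yr D by (simp add: D_def scale_def)
   have g2: "s + 1 <= (t + 1) / 2"
   proof -
    have "2 powr (1/th) * (s + 1) powr (1/th) <= dbl th * r" using yr r by (intro mult_mono) (auto simp: dbl_def)
    also have "... <= (t + 1) powr (1/th)" using rD by (simp add: D_def scale_def)
    finally have "(2 * (s + 1)) powr (1/th) <= ..." by (simp only: powr_mult)
    moreover have "(t + 1) powr (1/th) < (2 * (s + 1)) powr (1/th)" if "t + 1 < 2 * (s + 1)"
     using that th s st by (intro powr_less_mono2) auto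
    ultimately have "2 * (s + 1) <= t + 1" by (meson not_le)
    then show ?thesis by simp
   qed
   have mx: "max r D = D" using r1 D by simp
   have "\<bar>rem_kernel th K t s x y\<bar> <= C1 * r powr ?\<kappa> * (D + norm x) powr (- (?N + ?\<kappa>))"
    using C1(2)[OF s st disjI1[OF g1] disjI1[OF g2]] by (simp only: r_def rad_def D_def scale_def)
   moreover have "norm x powr l <= (D + norm x) powr l" using D l by (intro powr_mono2) auto
   ultimately have "norm x powr l * \<bar>rem_kernel th K t s x y\<bar> <= (D + norm x) powr l * (C1 * r powr ?\<kappa> * (D + norm x) powr (- (?N + ?\<kappa>)))"
    by (intro mult_mono) auto
   also have "... = C1 * (D powr l * ?W * ?P1)"
   proof -
    have "?W = (r / D) powr K * (r / D) powr (?\<kappa> - K)" using r1 r D by (simp add: kernel_wt_def r_def D_def)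
    also have "... = (r / D) powr ?\<kappa>" unfolding powr_add[symmetric] by simp
    also have "... = r powr ?\<kappa> * D powr (- ?\<kappa>)" by (simp only: powr_divide powr_minus_divide) simp
    finally have W: "?W = ..." .
    define Y where "Y = (D + norm x) powr (- (?N + (?\<kappa> - l)))"
    have key: "D powr l * (D powr (- ?\<kappa>) * D powr (?\<kappa> - l)) = 1" using D unfolding powr_add[symmetric] by simp
    have Y: "(D + norm x) powr l * (D + norm x) powr (- (?N + ?\<kappa>)) = Y"
     unfolding powr_add[symmetric] Y_def by (simp add: algebra_simps)
    have "(D + norm x) powr l * (C1 * r powr ?\<kappa> * (D + norm x) powr (- (?N + ?\<kappa>))) = C1 * r powr ?\<kappa> * Y"
     unfolding Y[symmetric] by (simp only: mult_ac)
    also have "... = C1 * r powr ?\<kappa> * Y * (D powr l * (D powr (- ?\<kappa>) * D powr (?\<kappa> - l)))" unfolding key by simp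
    also have "... = C1 * (D powr l * (r powr ?\<kappa> * D powr (- ?\<kappa>)) * (D powr (?\<kappa> - l) * Y))" by (simp only: mult_ac)
    finally show ?thesis unfolding W mx prof_def Y_def .
   qed
   also have "... <= ?C * ?rhs1"
   proof (rule mult_mono)
    show "C1 <= ?C" using C1 C2 Q Q1 by simp
    show "D powr l * ?W * ?P1 <= ?rhs1" using P W0 by (intro mult_left_mono) auto
   qed (use C0 rhs1 W0 P in auto)
   finally show ?thesis using False by simp
  next
   case True
   have rD: "1 <= dbl th * (r / D)" using True D by (simp add: field_simps)
   have WQ: "(r / D) powr K <= Q * ?W"
   proof -
    have "1 / dbl th <= min 1 (r / D)" using rD q by (simp add: field_simps)
    then have "(1 / dbl th) powr (?\<kappa> - K) <= min 1 (r / D) powr (?\<kappa> - K)" using kap q by (intro powr_mono2) auto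
    then have "1 <= Q * min 1 (r / D) powr (?\<kappa> - K)" using q by (simp add: Q_def powr_divide field_simps)
    then have "(r / D) powr K * 1 <= (r / D) powr K * (Q * min 1 (r / D) powr (?\<kappa> - K))" by (intro mult_left_mono) auto
    then show ?thesis by (simp add: kernel_wt_def r_def D_def mult_ac)
   qed
   show ?thesis
   proof (cases "norm x <= dbl th * r")
    case near: True
    have "\<bar>rem_kernel th K t s x y\<bar> <= \<bar>G th (x - y) (t - s)\<bar> + \<bar>taylor_part th K t s x y\<bar>"
     unfolding rem_kernel_def by (rule abs_triangle_ineq4)
    then have "norm x powr l * \<bar>rem_kernel th K t s x y\<bar> <= norm x powr l * \<bar>G th (x - y) (t - s)\<bar> + norm x powr l * \<bar>taylor_part th K t s x y\<bar>"
     unfolding distrib_left[symmetric] by (rule mult_left_mono) simp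
    also have "norm x powr l * \<bar>G th (x - y) (t - s)\<bar> <= ?C * (r powr l * \<bar>G th (x - y) (t - s)\<bar>)"
    proof -
     have "norm x powr l <= (dbl th * r) powr l" using near l by (intro powr_mono2) auto
     also have "... = dbl th powr l * r powr l" using q r by (simp add: powr_mult)
     also have "... <= ?C * r powr l" using C1 C2 Q Q1 by (intro mult_right_mono) auto
     finally show ?thesis unfolding mult.assoc[symmetric] by (rule mult_right_mono) simp
    qed
    also have "norm x powr l * \<bar>taylor_part th K t s x y\<bar> <= ?C * ?rhs1"
    proof -
     have "norm x powr l * \<bar>taylor_part th K t s x y\<bar> <= C2 * (D powr l * (r / D) powr K * ?P2)"
      using C2(2)[OF s st] True near by (simp only: D_def r_def)
     also have "... <= C2 * (D powr l * (Q * ?W) * ?P2)"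
      using C2(1) WQ P by (intro mult_left_mono mult_right_mono) auto
     also have "... = (C2 * Q) * (D powr l * ?W * ?P2)" by (simp only: mult_ac)
     also have "... <= ?C * ?rhs1"
     proof (rule mult_mono)
      show "C2 * Q <= ?C" using C1 C2 Q Q1 by simp
      show "D powr l * ?W * ?P2 <= ?rhs1" using P W0 by (intro mult_left_mono) auto
     qed (use C0 rhs1 W0 P in auto)
     finally show ?thesis .
    qed
    finally show ?thesis using True by simp
   next
    case far: False
    have "2 * norm y <= dbl th * r" using q yr r by (intro mult_mono) auto
    then have g1: "2 * norm y <= norm x" using far by simp
    have g2: "(t + 1) powr (1/th) <= norm x" using True far by (simp add: D_def scale_def)
    \<comment> \<open>Here \<open>norm x\<close> also exceeds a multiple of \<open>r\<close>, so the
      profile can be taken with the larger scale. This is needed for its prefactor to match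
      \<open>r powr (?\<kappa> - l)\<close>.\<close>
    define \<rho> where "\<rho> = max r D"
    have rho: "\<rho> > 0" using r by (simp add: \<rho>_def)
    have "\<bar>rem_kernel th K t s x y\<bar> <= C1 * r powr ?\<kappa> * (D + norm x) powr (- (?N + ?\<kappa>))"
     using C1(2)[OF s st disjI2[OF g1] disjI2[OF conjI[OF g1 g2]]] by (simp only: r_def rad_def D_def scale_def)
    also have "... <= C1 * r powr ?\<kappa> * (Q1 * (\<rho> + norm x) powr (- (?N + ?\<kappa>)))"
    proof -
     have "\<rho> <= dbl th * r" using q r True by (auto simp: \<rho>_def)
     then have "\<rho> + norm x <= 2 * norm x" using far by simp
     also have "... <= dbl th * (D + norm x)" using q D by (intro mult_mono) auto
     finally have "(\<rho> + norm x) / dbl th <= D + norm x" using q by (simp add: field_simps)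
     then have "(D + norm x) powr (- (?N + ?\<kappa>)) <= ((\<rho> + norm x) / dbl th) powr (- (?N + ?\<kappa>))"
      using q rho kap K by (intro powr_mono2') (auto intro!: divide_pos_pos add_pos_nonneg)
     also have "... = dbl th powr (?N + ?\<kappa>) * (\<rho> + norm x) powr (- (?N + ?\<kappa>))"
      using q by (simp only: powr_divide powr_minus) (simp add: field_simps)
     also have "... <= Q1 * (\<rho> + norm x) powr (- (?N + ?\<kappa>))"
      unfolding Q1_def using q K by (intro mult_right_mono powr_mono) auto
     finally show ?thesis using C1 by (intro mult_left_mono) auto
    qed
    finally have "norm x powr l * \<bar>rem_kernel th K t s x y\<bar> <= (\<rho> + norm x) powr l * (C1 * r powr ?\<kappa> * (Q1 * (\<rho> + norm x) powr (- (?N + ?\<kappa>))))"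
     using rho l by (intro mult_mono powr_mono2) auto
    also have "... = C1 * Q1 * r powr ?\<kappa> * (\<rho> + norm x) powr (- (?N + (?\<kappa> - l)))"
    proof -
     have "(\<rho> + norm x) powr l * (\<rho> + norm x) powr (- (?N + ?\<kappa>)) = (\<rho> + norm x) powr (- (?N + (?\<kappa> - l)))"
      unfolding powr_add[symmetric] by (simp add: algebra_simps)
     then show ?thesis by (simp only: mult_ac)
    qed
    also have "r powr ?\<kappa> = r powr l * r powr (?\<kappa> - l)" unfolding powr_add[symmetric] by simp
    also have "C1 * Q1 * (r powr l * r powr (?\<kappa> - l)) * (\<rho> + norm x) powr (- (?N + (?\<kappa> - l))) <= C1 * Q1 * ((D powr l * (Q1 * (Q * ?W))) * \<rho> powr (?\<kappa> - l)) * (\<rho> + norm x) powr (- (?N + (?\<kappa> - l)))"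
    proof (intro mult_right_mono mult_left_mono mult_mono)
     show "r powr (?\<kappa> - l) <= \<rho> powr (?\<kappa> - l)" using r kap l by (intro powr_mono2) (auto simp: \<rho>_def)
     have "r powr l = D powr l * (r / D) powr l" using r D by (simp add: powr_divide)
     also have "(r / D) powr l <= (dbl th * (r / D)) powr l" using q r D l mult_right_mono[of 1 "dbl th" "r / D"] by (intro powr_mono2) auto
     also have "... <= (dbl th * (r / D)) powr K" using rD l by (intro powr_mono) auto
     also have "... = dbl th powr K * (r / D) powr K" by (simp only: powr_mult)
     also have "... <= Q1 * (Q * ?W)"
      using WQ q kap K Q1 by (intro mult_mono) (auto simp: Q1_def intro!: powr_mono)
     finally show "r powr l <= D powr l * (Q1 * (Q * ?W))" by (simp add: mult_left_mono)
    qed (use C1 Q1 Q W0 in auto)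
    also have "... = (C1 * Q1 * Q1 * Q) * (D powr l * ?W * ?P1)" by (simp only: prof_def \<rho>_def mult_ac)
    also have "... <= ?C * ?rhs1"
    proof (rule mult_mono)
     show "C1 * Q1 * Q1 * Q <= ?C" using C1 C2 Q by simp
     show "D powr l * ?W * ?P1 <= ?rhs1" using P W0 by (intro mult_left_mono) auto
    qed (use C0 rhs1 W0 P in auto)
    finally have "norm x powr l * \<bar>rem_kernel th K t s x y\<bar> <= ?C * ?rhs1" .
    moreover have "0 <= ?C * (r powr l * \<bar>G th (x - y) (t - s)\<bar>)" using C0 by (intro mult_nonneg_nonneg) auto
    ultimately show ?thesis using True by (simp only: if_True)
   qed
  qed
  then show "norm x powr l * \<bar>rem_kernel th K t s x y\<bar> <=
   ?C * (scale th t powr l * kernel_wt th K t s y * (prof (max (rad th s y) (scale th t)) (taylor_ord th K - l) x + prof (scale th t) th x))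
   + (if scale th t < dbl th * rad th s y then ?C * (rad th s y powr l * \<bar>G th (x - y) (t - s)\<bar>) else 0)"
   by (simp only: D_def r_def)
 qed
qed

text \<open>Where \<open>r / D\<close> is bounded below, its exponent may be raised from
  \<open>l\<close> to \<open>K\<close> and the cutoff factor is bounded below. The weight in front
  of \<open>G\<close> thus takes the same form as in the other term.\<close>

lemma radius_powr_le_kernel_wt:
 "\<exists>C\<ge>0. \<forall>(y::real^'n) s t. 0 <= s --> s < t --> scale th t < dbl th * rad th s y --> rad th s y powr l <= C * (scale th t powr l * kernel_wt th K t s y)"
proof (intro exI[of _ "dbl th powr (K - l) * dbl th powr (taylor_ord th K - K)"] conjI allI impI)
 let ?\<kappa> = "taylor_ord th K"
 have kap: "K < ?\<kappa>" by (rule taylor_ord_gt[OF th(1) K])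
 have q: "dbl th >= 2" by (simp add: dbl_def)
 fix y :: "real^'n" and s t :: real
 assume s: "0 <= s" "s < t" and c: "scale th t < dbl th * rad th s y"
 define D where "D = scale th t"
 define r where "r = rad th s y"
 have D: "D > 0" using s by (simp add: D_def scale_def)
 have r: "r > 0" using s by (simp add: r_def rad_def add_nonneg_pos)
 have rD: "1 <= dbl th * (r / D)" using c D by (simp add: D_def r_def field_simps)
 have a: "r powr l = D powr l * (r / D) powr l" using r D by (simp add: powr_divide)
 have b: "(r / D) powr l <= dbl th powr (K - l) * (r / D) powr K"
 proof -
  have "(dbl th * (r / D)) powr l <= (dbl th * (r / D)) powr K" using rD l by (intro powr_mono) auto
  then have "dbl th powr (- l) * (dbl th powr l * (r / D) powr l) <= dbl th powr (- l) * (dbl th powr K * (r / D) powr K)" unfolding powr_mult by (rule mult_left_mono) simp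
  then show ?thesis unfolding mult.assoc[symmetric] powr_add[symmetric] using q by (simp add: add.commute)
 qed
 have c: "(r / D) powr K <= dbl th powr (?\<kappa> - K) * kernel_wt th K t s y"
 proof -
  have "1 / dbl th <= min 1 (r / D)" using rD q by (simp add: field_simps)
  then have "(1 / dbl th) powr (?\<kappa> - K) <= min 1 (r / D) powr (?\<kappa> - K)" using kap q by (intro powr_mono2) auto
  then have "1 <= dbl th powr (?\<kappa> - K) * min 1 (r / D) powr (?\<kappa> - K)" using q by (simp add: powr_divide field_simps)
  then have "(r / D) powr K * 1 <= (r / D) powr K * (dbl th powr (?\<kappa> - K) * min 1 (r / D) powr (?\<kappa> - K))" by (intro mult_left_mono) auto
  then show ?thesis by (simp add: kernel_wt_def r_def D_def mult_ac)
 qed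
 have "r powr l <= D powr l * (dbl th powr (K - l) * (dbl th powr (?\<kappa> - K) * kernel_wt th K t s y))"
  unfolding a by (intro mult_left_mono order_trans[OF b] c) auto
 then show "rad th s y powr l <= dbl th powr (K - l) * dbl th powr (?\<kappa> - K) * (scale th t powr l * kernel_wt th K t s y)"
  unfolding r_def[symmetric] D_def[symmetric] by (simp only: mult_ac)
qed simp

end

lemma scale_pos: "0 < t ==> 0 < scale th t"
 by (simp add: scale_def)

lemma rad_pos: "0 <= s ==> 0 < rad th s y"
 by (simp add: rad_def add_nonneg_pos)

lemma rad_measurable [measurable]:
 assumes [measurable]: "f \<in> borel_measurable M" "h \<in> borel_measurable M"
 shows "(%x. rad th (f x) (h x)) \<in> borel_measurable M"
 unfolding rad_def by measurable

lemma kernel_wt_measurable [measurable]: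
 assumes [measurable]: "f \<in> borel_measurable M" "h \<in> borel_measurable M"
 shows "(%x. kernel_wt th K t (f x) (h x)) \<in> borel_measurable M"
 unfolding kernel_wt_def by measurable

lemma nn_integral_G:
 assumes th: "0 < th" "th < 2"
 shows "\<exists>C>0. \<forall>tau>0. \<forall>y::real^'n. (\<I> x. \<bar>G th (x - y) tau\<bar>) <= ennreal C \<and> (\<I> x. \<bar>G th (y - x) tau\<bar>) <= ennreal C"
proof -
 obtain C1 where C1: "C1 > 0" "!!tau (x::real^'n). tau > 0 ==> \<bar>G th x tau\<bar> <= C1 * prof (tau powr (1/th)) th x"
  using G_bound[OF th, where 'n='n] by blast
 obtain C2 where C2: "C2 > 0" "!!\<rho>. \<rho> > 0 ==> (\<I> x. prof \<rho> th (x::real^'n)) <= ennreal C2"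
  using nn_integral_prof[OF th(1), where 'n='n] by blast
 have "(\<I> x. \<bar>G th (x - y) tau\<bar>) <= ennreal (C1 * C2) \<and> (\<I> x. \<bar>G th (y - x) tau\<bar>) <= ennreal (C1 * C2)" if t: "tau > 0" for tau and y :: "real^'n"
 proof -
  let ?p = "prof (tau powr (1/th)) th :: real^'n => real"
  have sym: "?p (y - x) = ?p (x - y)" for x by (simp add: prof_def norm_minus_commute)
  have b: "ennreal \<bar>G th x tau\<bar> <= ennreal C1 * ennreal (?p x)" for x
   using C1(2)[OF t, of x] C1(1) by (simp add: ennreal_mult[symmetric] prof_nonneg ennreal_leI)
  have I: "(\<N> x. ennreal C1 * ennreal (?p (x - y))) <= ennreal (C1 * C2)"
  proof -
   have "(\<N> x. ennreal C1 * ennreal (?p (x - y))) = ennreal C1 * (\<I> x. ?p (x - y))"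
    by (rule nn_integral_cmult) measurable
   also have "(\<I> x. ?p (x - y)) = (\<I> x. ?p x)"
    by (rule nn_integral_lborel_shift[where f="%x. ennreal (?p x)"]) measurable
   also have "ennreal C1 * (\<I> x. ?p x) <= ennreal C1 * ennreal C2" using t by (intro mult_left_mono C2) auto
   finally show ?thesis using C1 C2 by (simp add: ennreal_mult)
  qed
  have "(\<I> x. \<bar>G th (x - y) tau\<bar>) <= (\<N> x. ennreal C1 * ennreal (?p (x - y)))"
   by (intro nn_integral_mono b)
  moreover have "(\<I> x. \<bar>G th (y - x) tau\<bar>) <= (\<N> x. ennreal C1 * ennreal (?p (x - y)))"
   unfolding sym[symmetric] by (intro nn_integral_mono b)
  ultimately show ?thesis using I by (auto intro: order_trans)
 qed
 then show ?thesis using C1 C2 by (intro exI[of _ "C1 * C2"]) auto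
qed

context
 fixes th K l :: real
 assumes th: "0 < th" "th < 2" and K: "0 <= K" and l: "0 <= l" "l <= K"
begin

lemma kernel_L1:
 "\<exists>C\<ge>0. \<forall>(y::real^'n) s t. 0 <= s --> s < t -->
  (\<I> x. norm x powr l * \<bar>rem_kernel th K t s x y\<bar>) <= ennreal (C * (scale th t powr l * kernel_wt th K t s y))"
proof -
 let ?\<kappa> = "taylor_ord th K"
 have kap: "?\<kappa> - l > 0" using taylor_ord_gt[OF th(1) K] l by simp
 obtain C where C: "C >= 0" "!!(x::real^'n) y s t. 0 <= s ==> s < t ==>
  norm x powr l * \<bar>rem_kernel th K t s x y\<bar> <=
   C * (scale th t powr l * kernel_wt th K t s y * (prof (max (rad th s y) (scale th t)) (?\<kappa> - l) x + prof (scale th t) th x))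
   + (if scale th t < dbl th * rad th s y then C * (rad th s y powr l * \<bar>G th (x - y) (t - s)\<bar>) else 0)"
  using kernel_pointwise[OF th K l, where 'n='n] by blast
 obtain C1 where C1: "C1 > 0" "!!\<rho>. \<rho> > 0 ==> (\<I> x. prof \<rho> (?\<kappa> - l) (x::real^'n)) <= ennreal C1"
  using nn_integral_prof[OF kap, where 'n='n] by blast
 obtain C2 where C2: "C2 > 0" "!!\<rho>. \<rho> > 0 ==> (\<I> x. prof \<rho> th (x::real^'n)) <= ennreal C2"
  using nn_integral_prof[OF th(1), where 'n='n] by blast
 obtain C3 where C3: "C3 > 0" "!!tau (y::real^'n). tau > 0 ==> (\<I> x. \<bar>G th (x - y) tau\<bar>) <= ennreal C3"
  using nn_integral_G[OF th, where 'n='n] by blast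
 obtain C4 where C4: "C4 >= 0" "!!(y::real^'n) s t. 0 <= s ==> s < t ==> scale th t < dbl th * rad th s y ==> rad th s y powr l <= C4 * (scale th t powr l * kernel_wt th K t s y)"
  using radius_powr_le_kernel_wt[OF th K l, where 'n='n] by blast
 show ?thesis
 proof (intro exI[of _ "C * (C1 + C2) + C * C4 * C3"] conjI allI impI)
  show "0 <= C * (C1 + C2) + C * C4 * C3" using C C1 C2 C3 C4 by simp
  fix y :: "real^'n" and s t :: real assume s: "0 <= s" and st: "s < t"
  define w where "w = scale th t powr l * kernel_wt th K t s y"
  have w: "w >= 0" unfolding w_def by (intro mult_nonneg_nonneg kernel_wt_nonneg) auto
  let ?P1 = "prof (max (rad th s y) (scale th t)) (?\<kappa> - l) :: real^'n => real" and ?P2 = "prof (scale th t) th :: real^'n => real"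
  define c where "c = (if scale th t < dbl th * rad th s y then C * rad th s y powr l else 0)"
  have c: "0 <= c" "c <= C * C4 * w"
   using C4(2)[OF s st, of y] C(1) C4(1) w by (auto simp: c_def w_def mult_left_mono mult.assoc)
  have "(\<I> x. norm x powr l * \<bar>rem_kernel th K t s x y\<bar>)
   <= (\<N> x. ennreal (C * w) * (ennreal (?P1 x) + ennreal (?P2 x)) + ennreal c * ennreal \<bar>G th (x - y) (t - s)\<bar>)"
  proof (intro nn_integral_mono)
   fix x :: "real^'n"
   have "norm x powr l * \<bar>rem_kernel th K t s x y\<bar> <= C * w * (?P1 x + ?P2 x) + c * \<bar>G th (x - y) (t - s)\<bar>"
    using C(2)[OF s st, of x y] by (auto simp: w_def c_def mult.assoc split: if_splits)
   then have "ennreal (norm x powr l * \<bar>rem_kernel th K t s x y\<bar>) <= ennreal (C * w * (?P1 x + ?P2 x) + c * \<bar>G th (x - y) (t - s)\<bar>)" by (rule ennreal_leI)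
   also have "... = ennreal (C * w) * (ennreal (?P1 x) + ennreal (?P2 x)) + ennreal c * ennreal \<bar>G th (x - y) (t - s)\<bar>"
    using C(1) w c by (simp add: ennreal_mult ennreal_plus prof_nonneg)
   finally show "ennreal (norm x powr l * \<bar>rem_kernel th K t s x y\<bar>) <= ..." .
  qed
  also have "... = ennreal (C * w) * ((\<I> x. ?P1 x) + (\<I> x. ?P2 x)) + ennreal c * (\<I> x. \<bar>G th (x - y) (t - s)\<bar>)"
   by (simp add: nn_integral_add nn_integral_cmult)
  also have "... <= ennreal (C * w) * (ennreal C1 + ennreal C2) + ennreal (C * C4 * w) * ennreal C3"
   using s st c C(1) w by (intro add_mono mult_mono C1 C2 C3 ennreal_leI) (auto simp: less_max_iff_disj rad_pos intro!: scale_pos)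
  also have "... = ennreal ((C * (C1 + C2) + C * C4 * C3) * w)"
   using C C1 C2 C3 C4 w by (simp add: ennreal_mult[symmetric] ennreal_plus[symmetric] algebra_simps del: ennreal_plus)
  finally show "(\<I> x. norm x powr l * \<bar>rem_kernel th K t s x y\<bar>) <= ennreal ((C * (C1 + C2) + C * C4 * C3) * (scale th t powr l * kernel_wt th K t s y))"
   by (simp only: w_def)
 qed
qed

text \<open>The profiles are bounded by their values at the origin, a multiple of
  \<open>t powr (- N / th)\<close>. The kernel \<open>G\<close> is kept, because it is unbounded as
  \<open>s\<close> approaches \<open>t\<close> and can be treated only after integration against the
  data.\<close>

lemma kernel_Linf:
 "\<exists>C\<ge>0. \<forall>(x::real^'n) y s t. 0 <= s --> s < t -->
  norm x powr l * \<bar>rem_kernel th K t s x y\<bar> <= C * (t powr (- (real CARD('n) / th)) * (scale th t powr l * kernel_wt th K t s y))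
    + C * (scale th t powr l * kernel_wt th K t s y) * \<bar>G th (x - y) (t - s)\<bar>"
proof -
 let ?\<kappa> = "taylor_ord th K" and ?N = "real CARD('n)"
 have kap: "?\<kappa> - l > 0" using taylor_ord_gt[OF th(1) K] l by simp
 obtain C where C: "C >= 0" "!!(x::real^'n) y s t. 0 <= s ==> s < t ==>
  norm x powr l * \<bar>rem_kernel th K t s x y\<bar> <=
   C * (scale th t powr l * kernel_wt th K t s y * (prof (max (rad th s y) (scale th t)) (?\<kappa> - l) x + prof (scale th t) th x))
   + (if scale th t < dbl th * rad th s y then C * (rad th s y powr l * \<bar>G th (x - y) (t - s)\<bar>) else 0)"
  using kernel_pointwise[OF th K l, where 'n='n] by blast
 obtain C4 where C4: "C4 >= 0" "!!(y::real^'n) s t. 0 <= s ==> s < t ==> scale th t < dbl th * rad th s y ==> rad th s y powr l <= C4 * (scale th t powr l * kernel_wt th K t s y)"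
  using radius_powr_le_kernel_wt[OF th K l, where 'n='n] by blast
 show ?thesis
 proof (intro exI[of _ "2 * C + C * C4"] conjI allI impI)
  show "0 <= 2 * C + C * C4" using C C4 by simp
  fix x y :: "real^'n" and s t :: real assume s: "0 <= s" and st: "s < t"
  define w where "w = scale th t powr l * kernel_wt th K t s y"
  have w: "w >= 0" unfolding w_def by (intro mult_nonneg_nonneg kernel_wt_nonneg) auto
  let ?P1 = "prof (max (rad th s y) (scale th t)) (?\<kappa> - l) x" and ?P2 = "prof (scale th t) th x"
  let ?T = "t powr (- (?N / th))" and ?G = "\<bar>G th (x - y) (t - s)\<bar>"
  have D: "scale th t > 0" using s st by (intro scale_pos) auto
  have DT: "scale th t powr (- ?N) <= ?T"
  proof -
   have "scale th t powr (- ?N) <= (t powr (1/th)) powr (- ?N)"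
    unfolding scale_def using s st th by (intro powr_mono2' powr_mono2) auto
   then show ?thesis by (simp add: powr_powr)
  qed
  have "?P1 <= max (rad th s y) (scale th t) powr (- ?N)" using D kap by (intro prof_le) auto
  also have "... <= scale th t powr (- ?N)" using D by (intro powr_mono2') auto
  finally have P1: "?P1 <= ?T" using DT by simp
  have P2: "?P2 <= ?T" using prof_le[OF D, of th x] th DT by simp
  have c: "(if scale th t < dbl th * rad th s y then C * (rad th s y powr l * ?G) else 0) <= C * (C4 * w * ?G)"
   using C4(2)[OF s st, of y] C(1) C4(1) w by (auto simp: w_def intro!: mult_left_mono mult_right_mono mult_nonneg_nonneg)
  have "norm x powr l * \<bar>rem_kernel th K t s x y\<bar> <= C * (w * (?P1 + ?P2)) + C * (C4 * w * ?G)"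
   using C(2)[OF s st, of x y] c by (simp add: w_def)
  also have "C * (w * (?P1 + ?P2)) <= C * (w * (?T + ?T))" using C(1) w P1 P2 by (intro mult_left_mono add_mono) auto
  also have "C * (w * (?T + ?T)) + C * (C4 * w * ?G) <= (2 * C + C * C4) * (?T * w) + (2 * C + C * C4) * w * ?G"
   using C C4 w by (simp add: algebra_simps add_increasing2)
  finally show "norm x powr l * \<bar>rem_kernel th K t s x y\<bar> <= (2 * C + C * C4) * (?T * (scale th t powr l * kernel_wt th K t s y)) + (2 * C + C * C4) * (scale th t powr l * kernel_wt th K t s y) * ?G"
   by (simp only: w_def)
 qed
qed

end

lemma kernel_wt_le:
 assumes "0 < th" "0 <= K"
 shows "kernel_wt th K t s y <= (rad th s y / scale th t) powr K"
proof -
 have "min 1 (rad th s y / scale th t) powr (taylor_ord th K - K) <= 1"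
 proof (cases "0 <= rad th s y / scale th t")
  case True
  then show ?thesis using taylor_ord_gt[OF assms] by (intro powr_le1) auto
 next
  case False
  have "0 <= rad th s y / scale th t" unfolding rad_def scale_def by (intro divide_nonneg_nonneg add_nonneg_nonneg) auto
  then show ?thesis using False by simp
 qed
 then have "(rad th s y / scale th t) powr K * min 1 (rad th s y / scale th t) powr (taylor_ord th K - K) <= (rad th s y / scale th t) powr K * 1"
  by (intro mult_left_mono) auto
 then show ?thesis by (simp add: kernel_wt_def)
qed

section \<open>Lebesgue norms\<close>

lemma Lq_norm_top: "Lq_norm \<infinity> h = esssup lebesgue (%x. ennreal \<bar>h x\<bar>)"
 by (simp add: Lq_norm_def)

lemma Lq_norm_top_le:
 assumes "h \<in> borel_measurable lebesgue" "AE x in lebesgue. \<bar>h x\<bar> <= c"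
 shows "Lq_norm \<infinity> h <= ennreal c"
 unfolding Lq_norm_top using assms by (intro esssup_I) (auto elim!: eventually_mono intro: ennreal_leI)

lemma Lq_norm_top_AE:
 assumes "h \<in> borel_measurable lebesgue" "Lq_norm \<infinity> h <= ennreal c" "c >= 0"
 shows "AE x in lebesgue. \<bar>h x\<bar> <= c"
proof -
 have "AE x in lebesgue. ennreal \<bar>h x\<bar> <= esssup lebesgue (%x. ennreal \<bar>h x\<bar>)" by (rule esssup_AE)
 then show ?thesis
 proof eventually_elim
  fix x assume "ennreal \<bar>h x\<bar> <= esssup lebesgue (%x. ennreal \<bar>h x\<bar>)"
  also have "... <= ennreal c" using assms unfolding Lq_norm_top by simp
  finally show "\<bar>h x\<bar> <= c" using assms by (simp add: ennreal_le_iff)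
 qed
qed

lemma Lq_norm_1: "Lq_norm 1 h = (\<integral>\<^sup>+ x. ennreal \<bar>h x\<bar> \<partial>lebesgue)"
 by (simp add: Lq_norm_def Let_def less_top)

lemma exponent_cases:
 fixes q :: ennreal
 assumes "1 <= q"
 obtains "q = \<infinity>" "recip q = 0" | p where "q = ennreal p" "p >= 1" "enn2real q = p" "recip q = 1 / p" "q \<noteq> \<infinity>"
proof (cases q)
 case (real p)
 then have "p >= 1" using assms by (simp flip: ennreal_1)
 then show ?thesis using real that(2)[of p] by (simp add: recip_def inverse_ennreal divide_inverse)
next
 case top
 then show ?thesis using that(1) by (simp add: recip_def)
qed

lemma recip_bounds: "1 <= q ==> 0 <= recip q \<and> recip q <= 1"
 by (erule exponent_cases) auto

lemma recip_1 [simp]: "recip 1 = 1" and recip_top [simp]: "recip \<infinity> = 0"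
 by (simp_all add: recip_def)

text \<open>Removes the root from the norm. An infinite integral is covered, since then both sides
  fail.\<close>

lemma Lq_norm_le_iff:
 assumes "p >= 1" "X >= 0"
 shows "Lq_norm (ennreal p) h <= ennreal X \<longleftrightarrow> (\<integral>\<^sup>+ x. ennreal (\<bar>h x\<bar> powr p) \<partial>lebesgue) <= ennreal (X powr p)"
proof (cases "(\<integral>\<^sup>+ x. ennreal (\<bar>h x\<bar> powr p) \<partial>lebesgue)")
 case (real r)
 then have "Lq_norm (ennreal p) h = ennreal (r powr (1 / p))" using assms by (simp add: Lq_norm_def Let_def)
 moreover have "r powr (1 / p) <= X \<longleftrightarrow> r <= X powr p"
 proof
  assume "r powr (1 / p) <= X"
  then have "(r powr (1 / p)) powr p <= X powr p" using assms by (intro powr_mono2) auto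
  then show "r <= X powr p" using assms real by (simp add: powr_powr)
 next
  assume "r <= X powr p"
  then have "r powr (1 / p) <= (X powr p) powr (1 / p)" using assms real by (intro powr_mono2) auto
  then show "r powr (1 / p) <= X" using assms real by (simp add: powr_powr)
 qed
 ultimately show ?thesis using real assms by simp
next
 case top
 then show ?thesis using assms by (simp add: Lq_norm_def Let_def top_unique)
qed

text \<open>The \<open>q\<close>-norm of a \<open>p\<close>-th power is the \<open>p\<close>-th
  power of the norm with exponent \<open>p * q\<close>. The case \<open>p = 1\<close> gives ordinary
  monotonicity.\<close>

lemma Lq_norm_mono:
 assumes q: "1 <= q" and [measurable]: "h \<in> borel_measurable lebesgue" "f \<in> borel_measurable lebesgue"
  and le: "AE x in lebesgue. \<bar>h x\<bar> <= c * \<bar>f x\<bar> powr p" and c: "c >= 0" and p: "p >= 1"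
  and X: "Lq_norm (ennreal p * q) f <= ennreal X" "X >= 0"
 shows "Lq_norm q h <= ennreal (c * X powr p)"
 using q
proof (cases rule: exponent_cases)
 case 1
 then have "ennreal p * q = \<infinity>" using p by (simp add: ennreal_mult_eq_top_iff)
 then have "AE x in lebesgue. \<bar>f x\<bar> <= X" using X by (intro Lq_norm_top_AE) auto
 with le have "AE x in lebesgue. \<bar>h x\<bar> <= c * X powr p"
 proof eventually_elim
  case (elim x)
  then have "\<bar>f x\<bar> powr p <= X powr p" using p by (intro powr_mono2) auto
  then have "c * \<bar>f x\<bar> powr p <= c * X powr p" using c by (rule mult_left_mono)
  with elim show ?case by linarith
 qed
 then show ?thesis unfolding 1 by (intro Lq_norm_top_le) auto
next
 case (2 r)
 have pr: "p * r >= 1" using p 2 mult_mono[of 1 p 1 r] by simp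
 have "ennreal p * q = ennreal (p * r)" using 2 p by (simp add: ennreal_mult)
 then have I: "(\<integral>\<^sup>+ x. ennreal (\<bar>f x\<bar> powr (p * r)) \<partial>lebesgue) <= ennreal (X powr (p * r))"
  using X Lq_norm_le_iff[OF pr X(2), of f] by simp
 have "(\<integral>\<^sup>+ x. ennreal (\<bar>h x\<bar> powr r) \<partial>lebesgue) <= (\<integral>\<^sup>+ x. ennreal (c powr r) * ennreal (\<bar>f x\<bar> powr (p * r)) \<partial>lebesgue)"
 proof (rule nn_integral_mono_AE)
  show "AE x in lebesgue. ennreal (\<bar>h x\<bar> powr r) <= ennreal (c powr r) * ennreal (\<bar>f x\<bar> powr (p * r))"
   using le
  proof eventually_elim
   case (elim x)
   then have "\<bar>h x\<bar> powr r <= (c * \<bar>f x\<bar> powr p) powr r" using 2 by (intro powr_mono2) auto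
   also have "... = c powr r * \<bar>f x\<bar> powr (p * r)" using c by (simp add: powr_mult powr_powr)
   finally show ?case by (simp add: ennreal_mult[symmetric] ennreal_leI)
  qed
 qed
 also have "... = ennreal (c powr r) * (\<integral>\<^sup>+ x. ennreal (\<bar>f x\<bar> powr (p * r)) \<partial>lebesgue)" by (rule nn_integral_cmult) auto
 also have "... <= ennreal (c powr r) * ennreal (X powr (p * r))" using I by (intro mult_left_mono) auto
 also have "... = ennreal ((c * X powr p) powr r)" using c by (simp add: ennreal_mult[symmetric] powr_mult powr_powr)
 finally show ?thesis unfolding 2(1) using c 2 by (subst Lq_norm_le_iff) auto
qed

lemma Lq_norm_mono_linear:
 assumes q: "1 <= q" and "h \<in> borel_measurable lebesgue" "f \<in> borel_measurable lebesgue"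
  and le: "AE x in lebesgue. \<bar>h x\<bar> <= c * \<bar>f x\<bar>" and c: "c >= 0"
  and X: "Lq_norm q f <= ennreal X" "X >= 0"
 shows "Lq_norm q h <= ennreal (c * X)"
 using Lq_norm_mono[OF q assms(2,3), of c 1 X] assms by simp

text \<open>For finite \<open>p\<close> everything follows from the pointwise bound of
  \<open>\<bar>h x\<bar> powr p\<close> by \<open>b powr (p - 1) * \<bar>h x\<bar>\<close>.\<close>

lemma Lq_norm_interpolate:
 assumes q: "1 <= q" and [measurable]: "h \<in> borel_measurable lebesgue"
  and a: "(\<integral>\<^sup>+ x. ennreal \<bar>h x\<bar> \<partial>lebesgue) <= ennreal a" "a > 0" and b: "AE x in lebesgue. \<bar>h x\<bar> <= b" "b > 0"
 shows "Lq_norm q h <= ennreal (a powr recip q * b powr (1 - recip q))"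
 using q
proof (cases rule: exponent_cases)
 case 1
 then show ?thesis using a b Lq_norm_top_le[OF assms(2) b(1)] by simp
next
 case (2 p)
 have "(\<integral>\<^sup>+ x. ennreal (\<bar>h x\<bar> powr p) \<partial>lebesgue) <= (\<integral>\<^sup>+ x. ennreal (b powr (p - 1)) * ennreal \<bar>h x\<bar> \<partial>lebesgue)"
 proof (rule nn_integral_mono_AE)
  show "AE x in lebesgue. ennreal (\<bar>h x\<bar> powr p) <= ennreal (b powr (p - 1)) * ennreal \<bar>h x\<bar>"
   using b(1)
  proof eventually_elim
   case (elim x)
   have "\<bar>h x\<bar> powr p = \<bar>h x\<bar> powr (p - 1) * \<bar>h x\<bar>"
    by (cases "h x = 0") (simp_all add: powr_diff)
   also have "... <= b powr (p - 1) * \<bar>h x\<bar>" using elim 2 by (intro mult_right_mono powr_mono2) auto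
   finally show ?case by (simp add: ennreal_mult[symmetric] ennreal_leI)
  qed
 qed
 also have "... = ennreal (b powr (p - 1)) * (\<integral>\<^sup>+ x. ennreal \<bar>h x\<bar> \<partial>lebesgue)" by (rule nn_integral_cmult) auto
 also have "... <= ennreal (b powr (p - 1)) * ennreal a" using a by (intro mult_left_mono) auto
 also have "... = ennreal ((a powr (1 / p) * b powr (1 - 1 / p)) powr p)"
 proof -
  have "(1 - 1 / p) * p = p - 1" using 2 by (simp add: field_simps)
  then show ?thesis using a b 2 by (simp add: ennreal_mult[symmetric] powr_mult powr_powr mult.commute)
 qed
 finally show ?thesis unfolding 2(4) unfolding 2(1) using a b 2 by (subst Lq_norm_le_iff) auto
qed

text \<open>A triangle inequality with a constant: a sum is at most twice the maximum, which costs
  one factor \<open>2\<close> inside the integral and another for the sum of the two integrals. This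
  replaces Minkowski's inequality, as constants are irrelevant here.\<close>

lemma Lq_norm_add_le:
 assumes q: "1 <= q" and [measurable]: "h \<in> borel_measurable lebesgue" "f \<in> borel_measurable lebesgue" "k \<in> borel_measurable lebesgue"
  and le: "AE x in lebesgue. \<bar>h x\<bar> <= \<bar>f x\<bar> + \<bar>k x\<bar>"
  and X: "Lq_norm q f <= ennreal X" "X >= 0" and Y: "Lq_norm q k <= ennreal Y" "Y >= 0"
 shows "Lq_norm q h <= ennreal (4 * (X + Y))"
 using q
proof (cases rule: exponent_cases)
 case 1
 have "AE x in lebesgue. \<bar>f x\<bar> <= X" "AE x in lebesgue. \<bar>k x\<bar> <= Y"
  using X Y 1 by (auto intro: Lq_norm_top_AE)
 with le have "AE x in lebesgue. \<bar>h x\<bar> <= 4 * (X + Y)" by eventually_elim (use X Y in auto)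
 then show ?thesis unfolding 1 by (intro Lq_norm_top_le) auto
next
 case (2 p)
 have I: "(\<integral>\<^sup>+ x. ennreal (\<bar>f x\<bar> powr p) \<partial>lebesgue) <= ennreal (X powr p)" "(\<integral>\<^sup>+ x. ennreal (\<bar>k x\<bar> powr p) \<partial>lebesgue) <= ennreal (Y powr p)"
  using X Y 2 Lq_norm_le_iff by auto
 have "(\<integral>\<^sup>+ x. ennreal (\<bar>h x\<bar> powr p) \<partial>lebesgue) <= (\<integral>\<^sup>+ x. ennreal (2 powr p) * (ennreal (\<bar>f x\<bar> powr p) + ennreal (\<bar>k x\<bar> powr p)) \<partial>lebesgue)"
 proof (rule nn_integral_mono_AE)
  show "AE x in lebesgue. ennreal (\<bar>h x\<bar> powr p) <= ennreal (2 powr p) * (ennreal (\<bar>f x\<bar> powr p) + ennreal (\<bar>k x\<bar> powr p))"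
   using le
  proof eventually_elim
   case (elim x)
   have "\<bar>h x\<bar> powr p <= (2 * max \<bar>f x\<bar> \<bar>k x\<bar>) powr p" using elim 2 by (intro powr_mono2) auto
   also have "... = 2 powr p * (max \<bar>f x\<bar> \<bar>k x\<bar>) powr p" by (simp add: powr_mult)
   also have "(max \<bar>f x\<bar> \<bar>k x\<bar>) powr p <= \<bar>f x\<bar> powr p + \<bar>k x\<bar> powr p" by (simp add: max_def)
   finally have "\<bar>h x\<bar> powr p <= 2 powr p * (\<bar>f x\<bar> powr p + \<bar>k x\<bar> powr p)" by simp
   then show ?case by (simp add: ennreal_mult[symmetric] ennreal_plus[symmetric] ennreal_leI del: ennreal_plus)
  qed
 qed
 also have "... = ennreal (2 powr p) * ((\<integral>\<^sup>+ x. ennreal (\<bar>f x\<bar> powr p) \<partial>lebesgue) + (\<integral>\<^sup>+ x. ennreal (\<bar>k x\<bar> powr p) \<partial>lebesgue))"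
  by (subst nn_integral_cmult) (auto simp: nn_integral_add)
 also have "... <= ennreal (2 powr p) * (ennreal (X powr p) + ennreal (Y powr p))" using I by (intro mult_left_mono add_mono) auto
 also have "... = ennreal (2 powr p * (X powr p + Y powr p))" by (simp add: ennreal_mult[symmetric] ennreal_plus[symmetric] del: ennreal_plus)
 also have "... <= ennreal ((4 * (X + Y)) powr p)"
 proof (rule ennreal_leI)
  have "X powr p + Y powr p <= (X + Y) powr p + (X + Y) powr p" using X Y 2 by (intro add_mono powr_mono2) auto
  also have "... <= 2 powr p * (X + Y) powr p" using 2 powr_mono[of 1 p 2] mult_right_mono[of 2 "2 powr p" "(X + Y) powr p"] by simp
  finally have "2 powr p * (X powr p + Y powr p) <= 2 powr p * (2 powr p * (X + Y) powr p)" by (intro mult_left_mono) auto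
  also have "... = (2 * 2 * (X + Y)) powr p" using X Y by (simp only: powr_mult mult.assoc)
  finally show "2 powr p * (X powr p + Y powr p) <= (4 * (X + Y)) powr p" by simp
 qed
 finally show ?thesis unfolding 2(1) using X Y 2 by (subst Lq_norm_le_iff) auto
qed

lemma AE_lebesgue_nonzero: "AE x in lebesgue. x \<noteq> (0::real^'n)"
 by (rule AE_completion) (rule AE_lborel_singleton)

lemma esssup_cong_AE:
 assumes [measurable]: "f \<in> borel_measurable M" "k \<in> borel_measurable M" and "AE x in M. f x = (k x :: ennreal)"
 shows "esssup M f = esssup M k"
proof (rule antisym)
 show "esssup M f <= esssup M k" using esssup_AE[of k M] assms(3) by (intro esssup_I) (auto elim: eventually_elim2)
 show "esssup M k <= esssup M f" using esssup_AE[of f M] assms(3) by (intro esssup_I) (auto elim: eventually_elim2)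
qed

lemma Lq_norm_cong_AE:
 assumes [measurable]: "f \<in> borel_measurable lebesgue" "k \<in> borel_measurable lebesgue" and "AE x in lebesgue. f x = k x"
 shows "Lq_norm q f = Lq_norm q k"
proof -
 have "(\<integral>\<^sup>+ x. ennreal (\<bar>f x\<bar> powr enn2real q) \<partial>lebesgue) = (\<integral>\<^sup>+ x. ennreal (\<bar>k x\<bar> powr enn2real q) \<partial>lebesgue)"
  using assms(3) by (intro nn_integral_cong_AE) (auto elim: eventually_mono)
 moreover have "esssup lebesgue (%x. ennreal \<bar>f x\<bar>) = esssup lebesgue (%x. ennreal \<bar>k x\<bar>)"
  using assms(3) by (intro esssup_cong_AE) (auto elim: eventually_mono)
 ultimately show ?thesis by (simp add: Lq_norm_def)
qed

lemma norm_powr_measurable [measurable]: "(%x::real^'n. norm x powr l) \<in> borel_measurable lebesgue"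
 by (rule measurable_completion) measurable

lemma wLq_norm_0: "h \<in> borel_measurable lebesgue ==> wLq_norm q 0 h = Lq_norm q (h :: real^'n => real)"
 unfolding wLq_norm_def
proof (rule Lq_norm_cong_AE)
 assume h: "h \<in> borel_measurable lebesgue"
 then show "(%x. norm x powr 0 * h x) \<in> borel_measurable lebesgue" by (intro borel_measurable_times norm_powr_measurable)
 show "AE x in lebesgue. norm x powr 0 * h x = h x"
  using AE_lebesgue_nonzero by eventually_elim simp
qed

lemma ennreal_le_divideI:
 assumes "ennreal a * X <= ennreal Y" "a > 0" "Y >= 0"
 shows "X <= ennreal (Y / a)"
proof -
 have "ennreal (1 / a) * (ennreal a * X) <= ennreal (1 / a) * ennreal Y" by (rule mult_left_mono[OF assms(1)]) simp
 moreover have "ennreal (1 / a) * (ennreal a * X) = X"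
  unfolding mult.assoc[symmetric] using assms by (simp add: ennreal_mult[symmetric])
 ultimately show ?thesis using assms by (simp add: ennreal_mult[symmetric])
qed

lemma SUP_ennreal_finite_imp_bound:
 fixes X :: "real => ennreal"
 assumes "(SUP t\<in>{0<..}. ennreal (w t) * X t) < \<infinity>" "!!t. t > 0 ==> w t > 0"
 shows "\<exists>B>0. \<forall>t>0. X t <= ennreal (B / w t)"
proof -
 define S where "S = (SUP t\<in>{0<..}. ennreal (w t) * X t)"
 have S: "S < top" using assms(1) by (simp add: S_def)
 then obtain B where B: "S = ennreal B" "B >= 0" by (cases S) auto
 show ?thesis
 proof (intro exI[of _ "B + 1"] conjI allI impI)
  show "B + 1 > 0" using B by simp
  fix t :: real assume t: "t > 0"
  have "ennreal (w t) * X t <= S" unfolding S_def using t by (intro SUP_upper) auto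
  then have "ennreal (w t) * X t <= ennreal (B + 1)" unfolding B using B by (auto intro: order_trans ennreal_leI)
  then show "X t <= ennreal ((B + 1) / w t)" using assms(2)[OF t] B by (intro ennreal_le_divideI) auto
 qed
qed

lemma add_powr_le:
 assumes "0 <= (a::real)" "0 <= b" "0 <= l"
 shows "(a + b) powr l <= 2 powr l * (a powr l + b powr l)"
proof -
 have "(a + b) powr l <= (2 * max a b) powr l" using assms by (intro powr_mono2) auto
 also have "... = 2 powr l * max a b powr l" by (simp only: powr_mult)
 also have "... <= 2 powr l * (a powr l + b powr l)" by (intro mult_left_mono) (auto simp: max_def)
 finally show ?thesis .
qed

section \<open>Decay of solutions and sources\<close>

text \<open>The weight is distributed over the power:
  \<open>norm x powr l * \<bar>u\<bar> powr p\<close> is the \<open>p\<close>-th power of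
  \<open>norm x powr (l / p) * \<bar>u\<bar>\<close>. Hence the decay of \<open>u\<close> is used
  with the exponent \<open>p * q\<close> and the weight \<open>l / p\<close>. Its side condition
  reads \<open>l < p * (N + th) - N / q\<close>, and the hypothesis on \<open>p\<close> is the worst
  case \<open>l = K\<close>, \<open>q = 1\<close>. The exponents of \<open>t + 1\<close> add up to
  those of \<open>E_norm\<close> because \<open>A = N * (p - 1) / th\<close>.\<close>

lemma source_decay_from_weighted_decay:
 fixes u :: "real^'n => real => real" and f :: "real^'n => real => real"
 assumes th: "0 < th" and K: "0 <= K" and p: "p > 1" and C: "C >= 0"
  and fu: "!!x t. t > 0 ==> \<bar>f x t\<bar> <= C * \<bar>u x t\<bar> powr p"
  and fm: "!!t. t > 0 ==> (%x. f x t) \<in> borel_measurable lebesgue"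
  and um: "!!t. t > 0 ==> (%x. u x t) \<in> borel_measurable lebesgue"
  and wd: "weighted_decay th K u" and pK: "p * (real CARD('n) + th) > K + real CARD('n)"
 shows "source_decay th K (real CARD('n) * (p - 1) / th) f"
proof -
 define N where "N = real CARD('n)"
 define A where "A = N * (p - 1) / th"
 have N: "N > 0" by (simp add: N_def)
 have main: "\<exists>B>0. \<forall>t>0. wLq_norm q l (%x. f x t) <= ennreal (B * (t + 1) powr (- A - N / th * (1 - recip q) + l / th))"
  if q: "1 <= q" and l: "0 <= l" "l <= K" for q l
 proof -
  have rq: "recip (ennreal p * q) = recip q / p" "1 <= ennreal p * q"
  proof -
   from q show "recip (ennreal p * q) = recip q / p"
   proof (cases rule: exponent_cases)
    case 1 then show ?thesis using p by (simp add: ennreal_mult_top recip_def)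
   next
    case (2 r) then show ?thesis using p by (simp add: ennreal_mult[symmetric] recip_def inverse_ennreal divide_inverse)
   qed
   have "1 <= ennreal p" using p by (simp flip: ennreal_1)
   from mult_mono[OF this q] show "1 <= ennreal p * q" by simp
  qed
  have l': "l / p <= K" using divide_left_mono[of 1 p l] l p by simp
  have "l < p * (th + N) - N * recip q"
  proof -
   have "N * recip q <= N * 1" using N recip_bounds[OF q] by (intro mult_left_mono) auto
   then show ?thesis using pK l unfolding N_def[symmetric] by (simp add: algebra_simps)
  qed
  then have l2: "l / p < th + N * (1 - recip (ennreal p * q))" unfolding rq using p by (simp add: field_simps)
  have "(SUP t\<in>{0<..}. ennreal ((t + 1) powr (N / th * (1 - recip (ennreal p * q)) - (l / p) / th)) * wLq_norm (ennreal p * q) (l / p) (%x. u x t)) < \<infinity>"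
  proof -
   have "1 <= ennreal p * q \<and> 0 <= l / p \<and> l / p <= K \<and> l / p < th + N * (1 - recip (ennreal p * q))"
    using rq(2) l' l2 l p by simp
   then show ?thesis using wd unfolding weighted_decay_def Let_def N_def by blast
  qed
  from SUP_ennreal_finite_imp_bound[OF this]
  obtain B where B: "B > 0" "!!t. t > 0 ==> wLq_norm (ennreal p * q) (l / p) (%x. u x t) <= ennreal (B / (t + 1) powr (N / th * (1 - recip (ennreal p * q)) - (l / p) / th))"
   by auto
  show ?thesis
  proof (intro exI[of _ "C * B powr p + 1"] conjI allI impI)
   show "C * B powr p + 1 > 0" using C by (simp add: add_nonneg_pos)
   fix t :: real assume t: "t > 0"
   let ?e = "N / th * (1 - recip (ennreal p * q)) - (l / p) / th"
   note [measurable] = fm[OF t] um[OF t]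
   have "wLq_norm q l (%x. f x t) <= ennreal (C * (B / (t + 1) powr ?e) powr p)"
    unfolding wLq_norm_def
   proof (rule Lq_norm_mono[OF q])
    show "Lq_norm (ennreal p * q) (%x. norm x powr (l / p) * u x t) <= ennreal (B / (t + 1) powr ?e)"
     using B(2)[OF t] by (simp add: wLq_norm_def)
    show "AE x in lebesgue. \<bar>norm x powr l * f x t\<bar> <= C * \<bar>norm x powr (l / p) * u x t\<bar> powr p"
    proof (rule AE_I2)
     fix x
     have "\<bar>norm x powr l * f x t\<bar> <= norm x powr l * (C * \<bar>u x t\<bar> powr p)"
      using fu[OF t, of x] by (simp add: abs_mult mult_left_mono)
     also have "... = C * \<bar>norm x powr (l / p) * u x t\<bar> powr p"
      using p by (simp add: abs_mult powr_mult powr_powr)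
     finally show "\<bar>norm x powr l * f x t\<bar> <= ..." .
    qed
   qed (use B C p in auto)
   also have "C * (B / (t + 1) powr ?e) powr p = C * B powr p * (t + 1) powr (- A - N / th * (1 - recip q) + l / th)"
   proof -
    have "- (?e * p) = - A - N / th * (1 - recip q) + l / th"
     unfolding rq A_def using p th by (simp add: field_simps)
    then have "(t + 1) powr (- A - N / th * (1 - recip q) + l / th) = 1 / (t + 1) powr (?e * p)"
     by (metis powr_minus_divide)
    then show ?thesis using B t by (simp add: powr_divide powr_powr)
   qed
   also have "ennreal ... <= ennreal ((C * B powr p + 1) * (t + 1) powr (- A - N / th * (1 - recip q) + l / th))"
    by (intro ennreal_leI mult_right_mono) auto
   finally show "wLq_norm q l (%x. f x t) <= ennreal ((C * B powr p + 1) * (t + 1) powr (- A - N / th * (1 - recip q) + l / th))" .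
  qed
 qed
 show ?thesis
  unfolding source_decay_def N_def[symmetric] A_def[symmetric]
 proof (intro allI impI)
  fix q :: ennreal assume q: "1 <= q"
  let ?e = "N / th * (1 - recip q)"
  have e: "?e >= 0" using N th recip_bounds[OF q] by simp
  obtain B1 where B1: "B1 > 0" "!!t. t > 0 ==> wLq_norm q 0 (%x. f x t) <= ennreal (B1 * (t + 1) powr (- A - ?e + 0 / th))"
   using main[OF q, of 0] K by blast
  obtain B2 where B2: "B2 > 0" "!!t. t > 0 ==> wLq_norm 1 0 (%x. f x t) <= ennreal (B2 * (t + 1) powr (- A - N / th * (1 - recip 1) + 0 / th))"
   using main[of 1 0] K by blast
  obtain B3 where B3: "B3 > 0" "!!t. t > 0 ==> wLq_norm q K (%x. f x t) <= ennreal (B3 * (t + 1) powr (- A - ?e + K / th))"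
   using main[OF q, of K] K by blast
  obtain B4 where B4: "B4 > 0" "!!t. t > 0 ==> wLq_norm 1 K (%x. f x t) <= ennreal (B4 * (t + 1) powr (- A - N / th * (1 - recip 1) + K / th))"
   using main[of 1 K] K by blast
  show "\<exists>C>0. \<forall>t>0. E_norm th K q f t <= ennreal (C * (t + 1) powr (K / th - A))"
  proof (intro exI[of _ "B1 + B2 + B3 + B4"] conjI allI impI)
   show "B1 + B2 + B3 + B4 > 0" using B1 B2 B3 B4 by simp
   fix t :: real assume t: "t > 0"
   have tp: "t powr ?e <= (t + 1) powr ?e" using t e by (intro powr_mono2) auto
   have L: "Lq_norm q' (%x. f x t) = wLq_norm q' 0 (%x. f x t)" for q' by (rule wLq_norm_0[OF fm[OF t], symmetric])
   have "E_norm th K q f t <= ennreal ((t + 1) powr (K / th)) * (ennreal ((t + 1) powr ?e) * ennreal (B1 * (t + 1) powr (- A - ?e)) + ennreal (B2 * (t + 1) powr (- A)))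
    + ennreal ((t + 1) powr ?e) * ennreal (B3 * (t + 1) powr (- A - ?e + K / th)) + ennreal (B4 * (t + 1) powr (- A + K / th))"
    unfolding E_norm_def Let_def N_def[symmetric] L
    using B1(2)[OF t] B2(2)[OF t] B3(2)[OF t] B4(2)[OF t] tp by (intro add_mono mult_mono) (auto intro: ennreal_leI)
   also have "... = ennreal ((t + 1) powr (K / th) * ((t + 1) powr ?e * (B1 * (t + 1) powr (- A - ?e)) + B2 * (t + 1) powr (- A))
    + (t + 1) powr ?e * (B3 * (t + 1) powr (- A - ?e + K / th)) + B4 * (t + 1) powr (- A + K / th))"
    using B1 B2 B3 B4 by (simp add: ennreal_mult[symmetric] ennreal_plus[symmetric] del: ennreal_plus)
   also have "... = ennreal ((B1 + B2 + B3 + B4) * (t + 1) powr (K / th - A))"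
   proof -
    let ?P = "%z. (t + 1) powr z"
    have "?P (K / th) * (?P ?e * (B1 * ?P (- A - ?e)) + B2 * ?P (- A)) + ?P ?e * (B3 * ?P (- A - ?e + K / th)) + B4 * ?P (- A + K / th)
     = B1 * (?P (K / th) * ?P ?e * ?P (- A - ?e)) + B2 * (?P (K / th) * ?P (- A)) + B3 * (?P ?e * ?P (- A - ?e + K / th)) + B4 * ?P (- A + K / th)"
     by (simp add: algebra_simps)
    also have "... = (B1 + B2 + B3 + B4) * ?P (K / th - A)"
     unfolding powr_add[symmetric] by (simp add: algebra_simps)
    finally show ?thesis by (simp only:)
   qed
   finally show "E_norm th K q f t <= ennreal ((B1 + B2 + B3 + B4) * (t + 1) powr (K / th - A))" .
  qed
 qed
qed

section \<open>Convolution with the profile and the integral inequality\<close>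

text \<open>Pointwise in \<open>y\<close> one of the two factors is bounded by a multiple of the
  target profile, so the product is at most that multiple times the sum of the factors, whose
  integral is bounded. If \<open>x - z\<close> is large compared with the scale, it is the factor
  with the larger argument; otherwise it is the one with the larger time.\<close>

lemma prof_convolution:
 assumes th: "0 < th"
 shows "\<exists>C>0. \<forall>s>0. \<forall>t>0. \<forall>x z::real^'n.
  (\<N> y. ennreal (prof (t powr (1/th)) th (x - y)) * ennreal (prof (s powr (1/th)) th (y - z)))
   <= ennreal (C * prof ((t + s) powr (1/th)) th (x - z))"
proof -
 let ?N = "real CARD('n)"
 obtain C1 where C1: "C1 > 0" "!!\<rho>. \<rho> > 0 ==> (\<I> x. prof \<rho> th (x::real^'n)) <= ennreal C1"
  using nn_integral_prof[OF th, where 'n='n] by blast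
 have pf: "prof (t powr (1/th)) th w = t * (t powr (1/th) + norm w) powr (- (?N + th))" if "t > 0" for t and w :: "real^'n"
  using that th by (simp add: prof_def powr_powr)
 let ?e = "?N + th"
 define B where "B = 4 powr ?e * 2 powr (?N / th + 1)"
 have B: "B >= 4 powr ?e" "B > 0"
 proof -
  have "2 powr (?N / th + 1) >= (1::real)" using th by (intro ge_one_powr_ge_zero) auto
  then have "4 powr ?e * 1 <= B" unfolding B_def by (intro mult_left_mono) auto
  then show "B >= 4 powr ?e" by simp
  then show "B > 0" by (rule less_le_trans[rotated]) simp
 qed
 have half: "prof (s powr (1/th)) th b <= B * prof (tau powr (1/th)) th w"
  if s: "0 < s" "s <= tau" and b: "norm w <= 2 * norm b" and w: "tau powr (1/th) <= norm w" for s tau and b w :: "real^'n"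
 proof -
  have tp: "tau powr (1/th) > 0" using s by simp
  have "(tau powr (1/th) + norm w) / 4 <= s powr (1/th) + norm b" using b w powr_ge_zero[of s "1/th"] by argo
  then have "(s powr (1/th) + norm b) powr (- ?e) <= ((tau powr (1/th) + norm w) / 4) powr (- ?e)"
   using tp th by (intro powr_mono2') (auto intro!: divide_pos_pos add_pos_nonneg)
  also have "... = 4 powr ?e * (tau powr (1/th) + norm w) powr (- ?e)"
   by (simp only: powr_divide powr_minus) (simp add: field_simps)
  finally have "s * (s powr (1/th) + norm b) powr (- ?e) <= tau * (4 powr ?e * (tau powr (1/th) + norm w) powr (- ?e))"
   using s by (intro mult_mono) auto
  also have "... = 4 powr ?e * prof (tau powr (1/th)) th w" using s by (simp add: pf)
  also have "... <= B * prof (tau powr (1/th)) th w" by (intro mult_right_mono B prof_nonneg)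
  finally show ?thesis using s by (simp add: pf)
 qed
 have big: "prof (t powr (1/th)) th a <= B * prof (tau powr (1/th)) th w"
  if t: "0 < t" "tau <= 2 * t" "t <= tau" and w: "norm w <= tau powr (1/th)" for t tau and a w :: "real^'n"
 proof -
  have tau: "tau > 0" using t by simp
  have "prof (t powr (1/th)) th a <= (t powr (1/th)) powr (- ?N)" using t th by (intro prof_le) auto
  also have "... = t powr (- (?N / th))" by (simp add: powr_powr)
  also have "... <= (tau / 2) powr (- (?N / th))" using t tau th by (intro powr_mono2') auto
  also have "... = 2 powr (?N / th) * tau powr (- (?N / th))" by (simp only: powr_divide powr_minus) (simp add: field_simps)
  also have "tau powr (- (?N / th)) = tau * (tau powr (1/th)) powr (- ?e)"
  proof -
   have "tau powr (- (?N / th)) = tau powr (1 + (1/th) * (- ?e))" using th by (simp add: field_simps)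
   then show ?thesis using tau by (simp add: powr_add powr_powr)
  qed
  also have "(tau powr (1/th)) powr (- ?e) <= ((tau powr (1/th) + norm w) / 2) powr (- ?e)"
   using w tau th by (intro powr_mono2') (auto intro!: divide_pos_pos add_pos_nonneg)
  also have "... = 2 powr ?e * (tau powr (1/th) + norm w) powr (- ?e)"
   by (simp only: powr_divide powr_minus) (simp add: field_simps)
  finally have "prof (t powr (1/th)) th a <= (2 powr (?N / th) * 2 powr ?e) * prof (tau powr (1/th)) th w"
   using tau by (simp add: pf mult_ac mult_left_mono)
  also have "... <= B * prof (tau powr (1/th)) th w"
  proof -
   have "2 powr (?N / th) * 2 powr ?e <= 2 powr (?N / th + 1) * 4 powr ?e" using th by (intro mult_mono powr_mono powr_mono2) auto
   then show ?thesis unfolding B_def by (intro mult_right_mono prof_nonneg) (simp add: mult.commute)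
  qed
  finally show ?thesis .
 qed
 show ?thesis
 proof (intro exI[of _ "B * (2 * C1)"] conjI allI impI)
  show "B * (2 * C1) > 0" using B C1 by simp
  fix s t :: real and x z :: "real^'n" assume s: "s > 0" and t: "t > 0"
  let ?p = "%y. prof (t powr (1/th)) th (x - y)" and ?q = "%y. prof (s powr (1/th)) th (y - z)" and ?w = "prof ((t + s) powr (1/th)) th (x - z)"
  have pt: "?p y * ?q y <= B * ?w * (?p y + ?q y)" for y
  proof -
   have tri: "norm (x - z) <= norm (x - y) + norm (y - z)" using norm_triangle_ineq[of "x - y" "y - z"] by simp
   have "?p y <= B * ?w \<or> ?q y <= B * ?w"
   proof (cases "(t + s) powr (1/th) <= norm (x - z)")
    case True
    show ?thesis
    proof (cases "norm (x - z) <= 2 * norm (y - z)")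
     case A: True
     show ?thesis by (rule disjI2, rule half) (use s t A True in auto)
    next
     case False
     then have "norm (x - z) <= 2 * norm (x - y)" using tri by argo
     then show ?thesis by (intro disjI1 half) (use s t True in auto)
    qed
   next
    case False
    show ?thesis
    proof (cases "s <= t")
     case A: True
     show ?thesis by (rule disjI1, rule big) (use s t A False in auto)
    next
     case A: False
     show ?thesis by (rule disjI2, rule big) (use s t A False in auto)
    qed
   qed
   then show ?thesis
   proof
    assume "?p y <= B * ?w"
    then have "?p y * ?q y <= (B * ?w) * ?q y" by (intro mult_right_mono prof_nonneg)
    also have "... <= (B * ?w) * (?p y + ?q y)" using B by (intro mult_left_mono) (auto simp: prof_nonneg)
    finally show ?thesis .
   next
    assume "?q y <= B * ?w"
    then have "?p y * ?q y <= ?p y * (B * ?w)" by (intro mult_left_mono prof_nonneg)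
    also have "... = (B * ?w) * ?p y" by simp
    also have "... <= (B * ?w) * (?p y + ?q y)" using B by (intro mult_left_mono) (auto simp: prof_nonneg)
    finally show ?thesis .
   qed
  qed
  have sh: "(\<I> y. prof \<rho> th (y - c)) <= ennreal C1" if "\<rho> > 0" for \<rho> and c :: "real^'n"
   using C1(2)[OF that] nn_integral_lborel_shift[of "%y. ennreal (prof \<rho> th y)" c] by simp
  have sym: "?p y = prof (t powr (1/th)) th (y - x)" for y by (simp add: prof_def norm_minus_commute)
  have "(\<N> y. ennreal (?p y) * ennreal (?q y)) <= (\<N> y. ennreal (B * ?w) * (ennreal (?p y) + ennreal (?q y)))"
  proof (intro nn_integral_mono)
   fix y
   have "ennreal (?p y) * ennreal (?q y) = ennreal (?p y * ?q y)" by (simp add: ennreal_mult prof_nonneg)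
   also have "... <= ennreal (B * ?w * (?p y + ?q y))" by (rule ennreal_leI[OF pt])
   also have "... = ennreal (B * ?w) * (ennreal (?p y) + ennreal (?q y))" using B by (simp add: ennreal_mult ennreal_plus prof_nonneg)
   finally show "ennreal (?p y) * ennreal (?q y) <= ..." .
  qed
  also have "... = ennreal (B * ?w) * ((\<I> y. ?p y) + (\<I> y. ?q y))"
   by (simp add: nn_integral_cmult nn_integral_add)
  also have "... <= ennreal (B * ?w) * (ennreal C1 + ennreal C1)"
   unfolding sym using s t by (intro mult_left_mono add_mono sh) auto
  also have "... = ennreal (B * (2 * C1) * ?w)"
   using B C1 prof_nonneg[of "(t + s) powr (1/th)" th "x - z"] by (simp add: ennreal_mult[symmetric] ennreal_plus[symmetric] mult_ac del: ennreal_plus)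
  finally show "(\<N> y. ennreal (?p y) * ennreal (?q y)) <= ..." .
 qed
qed

text \<open>With values in \<open>ennreal\<close> the convolution can be iterated by Tonelli's
  theorem alone.\<close>

definition smear :: "real => real => (real^'n => ennreal) => real^'n => ennreal" where
 "smear th t a x = (\<N> y. ennreal (prof (t powr (1/th)) th (x - y)) * a y)"

lemma prof_measurable2 [measurable]:
 assumes [measurable]: "f \<in> borel_measurable M"
 shows "(%x. prof \<rho> \<delta> (f x)) \<in> borel_measurable M"
 by (rule measurable_compose[OF assms prof_measurable])

lemma smear_measurable [measurable]:
 assumes [measurable]: "a \<in> borel_measurable borel"
 shows "smear th t a \<in> borel_measurable borel"
 unfolding smear_def by measurable

lemma smear_smear:
 assumes th: "0 < th"
 shows "\<exists>C>0. \<forall>s>0. \<forall>t>0. \<forall>a\<in>borel_measurable borel. \<forall>x::real^'n. smear th t (smear th s a) x <= ennreal C * smear th (t + s) a x"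
proof -
 obtain C where C: "C > 0" "!!s t (x::real^'n) z. s > 0 ==> t > 0 ==>
  (\<N> y. ennreal (prof (t powr (1/th)) th (x - y)) * ennreal (prof (s powr (1/th)) th (y - z)))
   <= ennreal (C * prof ((t + s) powr (1/th)) th (x - z))"
  using prof_convolution[OF th, where 'n='n] by blast
 show ?thesis
 proof (intro exI[of _ C] conjI allI impI ballI)
  fix s t :: real and a :: "real^'n => ennreal" and x :: "real^'n"
  assume s: "s > 0" and t: "t > 0" and [measurable]: "a \<in> borel_measurable borel"
  have "smear th t (smear th s a) x = (\<N> y. (\<N> z. ennreal (prof (t powr (1/th)) th (x - y)) * (ennreal (prof (s powr (1/th)) th (y - z)) * a z)))"
   unfolding smear_def by (intro nn_integral_cong nn_integral_cmult[symmetric]) measurable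
  also have "... = (\<N> z. (\<N> y. ennreal (prof (t powr (1/th)) th (x - y)) * (ennreal (prof (s powr (1/th)) th (y - z)) * a z)))"
   by (rule lborel_pair.Fubini') measurable
  also have "... = (\<N> z. (\<N> y. ennreal (prof (t powr (1/th)) th (x - y)) * ennreal (prof (s powr (1/th)) th (y - z))) * a z)"
   unfolding mult.assoc[symmetric] by (intro nn_integral_cong nn_integral_multc) measurable
  also have "... <= (\<N> z. ennreal (C * prof ((t + s) powr (1/th)) th (x - z)) * a z)"
   by (intro nn_integral_mono mult_right_mono C s t) auto
  also have "... = ennreal C * smear th (t + s) a x"
   unfolding smear_def using C(1) by (subst nn_integral_cmult[symmetric]) (auto simp: ennreal_mult prof_nonneg mult.assoc)
  finally show "smear th t (smear th s a) x <= ..." .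
 qed (rule C(1))
qed

text \<open>Inserting \<open>U <= e\<^sup>L\<^sup>b (2 c v + \<mu>)\<close> into the integral inequality with \<open>L = 2 c\<close> reproduces it with
 \<open>\<mu> / 2\<close> instead of \<open>\<mu>\<close>; iterating removes \<open>\<mu>\<close>.\<close>

lemma smear_gronwall:
 fixes U :: "real^'n => real => ennreal" and \<psi> :: "real^'n => ennreal"
 assumes th: "0 < th" and A: "A > 1" and c: "c >= 0" and B: "B >= 0" and M: "M >= 0"
  and psi [measurable]: "\<psi> \<in> borel_measurable borel"
  and U0: "!!t. t > 0 ==> AE x in lborel. U x t <= ennreal M"
  and U1: "!!t x. t > 0 ==> U x t <= ennreal c * smear th t \<psi> x + tint t (%s. ennreal (B * (s + 1) powr (- A)) * smear th (t - s) (%y. U y s) x)"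
 shows "\<exists>C>0. \<forall>t>0. AE x in lborel. U x t <= ennreal C * smear th t \<psi> x"
proof -
 obtain C1 where C1: "C1 > 0" "!!s t a (x::real^'n). s > 0 ==> t > 0 ==> a \<in> borel_measurable borel ==> smear th t (smear th s a) x <= ennreal C1 * smear th (t + s) a x"
  using smear_smear[OF th, where 'n='n] by blast
 obtain C2 where C2: "C2 > 0" "!!\<rho>. \<rho> > 0 ==> (\<I> x. prof \<rho> th (x::real^'n)) <= ennreal C2"
  using nn_integral_prof[OF th, where 'n='n] by blast
 define k where "k = max C1 C2"
 have k: "k > 0" "C1 <= k" "C2 <= k" using C1 C2 by (auto simp: k_def)
 \<comment> \<open>Makes \<open>B * k / L\<close> at most \<open>1/2\<close>, which produces the
   halving in each iteration; the added \<open>1\<close> keeps \<open>L\<close> positive.\<close>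
 define L where "L = 2 * (k * B + 1)"
 have L: "L > 0" using k B by (simp add: L_def add_nonneg_pos)
 \<comment> \<open>The primitive of \<open>(t + 1) powr (- A)\<close> that vanishes at
   \<open>0\<close>. As \<open>A > 1\<close> it stays below \<open>1 / (A - 1)\<close>, so the
   exponential factor costs only a constant, uniformly in time.\<close>
 define b where "b = (%t::real. (1 - (t + 1) powr (1 - A)) / (A - 1))"
 have db: "(b has_real_derivative (t + 1) powr (- A)) (at t)" if "t > -1" for t
 proof -
  have 1: "((%t. (t + 1) powr (1 - A)) has_real_derivative (1 - A) * (t + 1) powr (1 - A - 1) * 1) (at t)"
   by (rule DERIV_chain2[where g="%t. t + 1" and f="%z. z powr (1 - A)", OF has_real_derivative_powr])
    (use that in \<open>auto intro!: derivative_eq_intros\<close>)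
  have "(b has_real_derivative (0 - (1 - A) * (t + 1) powr (1 - A - 1) * 1) / (A - 1)) (at t)"
   unfolding b_def by (intro DERIV_cdivide DERIV_diff DERIV_const 1)
  moreover have "(0 - (1 - A) * X * 1) / (A - 1) = X" for X using A by (simp add: field_simps)
  moreover have "1 - A - 1 = - A" by simp
  ultimately show ?thesis by (simp only:)
 qed
 have b0: "b 0 = 0" by (simp add: b_def)
 have bb: "b t <= 1 / (A - 1)" for t unfolding b_def using A by (intro divide_right_mono) auto
 have I: "tint t (%s. ennreal ((s + 1) powr (- A) * exp (L * b s))) <= ennreal (exp (L * b t) / L)" if t: "t > 0" for t
 proof -
  have "(\<N> s. ennreal ((s + 1) powr (- A) * exp (L * b s)) * indicator {0..t} s) = ennreal (exp (L * b t) / L - exp (L * b 0) / L)"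
  proof (rule nn_integral_FTC_Icc[where F="%s. exp (L * b s) / L"])
   fix s assume s: "s \<in> {0..t}"
   then have "((%s. exp (L * b s) / L) has_real_derivative (s + 1) powr (- A) * exp (L * b s)) (at s)"
    using L by (auto intro!: derivative_eq_intros db)
   then show "((%s. exp (L * b s) / L) has_real_derivative (s + 1) powr (- A) * exp (L * b s)) (at s)" .
  qed (use t in \<open>auto simp: b_def\<close>)
  also have "... <= ennreal (exp (L * b t) / L)" using L by (intro ennreal_leI) auto
  finally show ?thesis by (rule order_trans[rotated]) (intro nn_integral_mono, auto simp: indicator_def)
 qed
 have bm [measurable]: "b \<in> borel_measurable borel" unfolding b_def by measurable
 have step: "AE x in lborel. U x t <= ennreal (exp (L * b t)) * (ennreal (2 * c) * smear th t \<psi> x + ennreal (M / 2 ^ n))" if "t > 0" for t n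
  using that
 proof (induction n arbitrary: t)
  case 0
  have "b t >= 0" unfolding b_def using A 0 powr_mono[of "1 - A" 0 "t + 1"] by simp
  then have e1: "exp (L * b t) >= 1" using L by simp
  show ?case using U0[OF 0]
  proof eventually_elim
   case (elim x)
   have "ennreal M <= ennreal (exp (L * b t)) * ennreal M"
    using e1 M mult_right_mono[of 1 "exp (L * b t)" M] by (simp add: ennreal_mult[symmetric] ennreal_leI)
   also have "... <= ennreal (exp (L * b t)) * (ennreal (2 * c) * smear th t \<psi> x + ennreal (M / 2 ^ 0))"
    by (intro mult_left_mono) auto
   finally show ?case using elim by simp
  qed
 next
  case (Suc n)
  define \<mu> where "\<mu> = M / 2 ^ n"
  have mu: "\<mu> >= 0" using M by (simp add: \<mu>_def)
  show ?case
  proof (rule AE_I2)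
   fix x :: "real^'n"
   let ?v = "smear th t \<psi> x"
   have inner: "smear th (t - s) (%y. U y s) x <= ennreal (exp (L * b s)) * (ennreal k * (ennreal (2 * c) * ?v + ennreal \<mu>))" if s: "0 < s" "s < t" for s
   proof -
    have "smear th (t - s) (%y. U y s) x <= smear th (t - s) (%y. ennreal (exp (L * b s)) * (ennreal (2 * c) * smear th s \<psi> y + ennreal \<mu>)) x"
     unfolding smear_def[of th "t - s"]
    proof (rule nn_integral_mono_AE)
     show "AE y in lborel. ennreal (prof ((t - s) powr (1/th)) th (x - y)) * U y s <= ennreal (prof ((t - s) powr (1/th)) th (x - y)) * (ennreal (exp (L * b s)) * (ennreal (2 * c) * smear th s \<psi> y + ennreal \<mu>))"
      using Suc.IH[OF s(1)] by eventually_elim (auto simp: \<mu>_def intro!: mult_left_mono)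
    qed
    also have "... = ennreal (exp (L * b s)) * (ennreal (2 * c) * smear th (t - s) (smear th s \<psi>) x + ennreal \<mu> * (\<I> y. prof ((t - s) powr (1/th)) th (x - y)))"
    proof -
     let ?p = "%y. ennreal (prof ((t - s) powr (1/th)) th (x - y))"
     have "smear th (t - s) (%y. ennreal (exp (L * b s)) * (ennreal (2 * c) * smear th s \<psi> y + ennreal \<mu>)) x
      = (\<N> y. ennreal (exp (L * b s)) * (ennreal (2 * c) * (?p y * smear th s \<psi> y) + ennreal \<mu> * ?p y))"
      unfolding smear_def[of th "t - s"] by (intro nn_integral_cong) (simp add: distrib_left mult_ac)
     also have "... = ennreal (exp (L * b s)) * (ennreal (2 * c) * (\<N> y. ?p y * smear th s \<psi> y) + ennreal \<mu> * (\<N> y. ?p y))"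
      by (simp add: nn_integral_cmult nn_integral_add)
     finally show ?thesis by (simp only: smear_def[of th "t - s"])
    qed
    also have "... <= ennreal (exp (L * b s)) * (ennreal (2 * c) * (ennreal k * ?v) + ennreal \<mu> * ennreal k)"
    proof (intro mult_left_mono add_mono)
     have "smear th (t - s) (smear th s \<psi>) x <= ennreal C1 * smear th (t - s + s) \<psi> x" using s by (intro C1 psi) auto
     also have "... <= ennreal k * ?v" using k by (auto intro!: mult_right_mono ennreal_leI)
     finally show "smear th (t - s) (smear th s \<psi>) x <= ..." .
     have "(\<I> y. prof ((t - s) powr (1/th)) th (x - y)) = (\<I> y. prof ((t - s) powr (1/th)) th (y - x))"
      by (simp add: prof_def norm_minus_commute)
     also have "... = (\<I> y. prof ((t - s) powr (1/th)) th (y::real^'n))"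
      by (rule nn_integral_lborel_shift[where f="%y. ennreal (prof ((t - s) powr (1/th)) th y)"]) measurable
     also have "... <= ennreal k" using s k by (intro order_trans[OF C2(2)] ennreal_leI) auto
     finally show "(\<I> y. prof ((t - s) powr (1/th)) th (x - y)) <= ennreal k" .
    qed auto
    also have "... = ennreal (exp (L * b s)) * (ennreal k * (ennreal (2 * c) * ?v + ennreal \<mu>))"
     by (simp add: distrib_left mult_ac)
    finally show ?thesis .
   qed
   let ?W = "ennreal (2 * c) * ?v + ennreal \<mu>"
   have "tint t (%s. ennreal (B * (s + 1) powr (- A)) * smear th (t - s) (%y. U y s) x)
    <= (\<N> s. (ennreal ((s + 1) powr (- A) * exp (L * b s)) * indicator {0<..<t} s) * (ennreal (B * k) * ?W))"
   proof (intro nn_integral_mono)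
    fix s :: real
    show "ennreal (B * (s + 1) powr (- A)) * smear th (t - s) (%y. U y s) x * indicator {0<..<t} s
     <= (ennreal ((s + 1) powr (- A) * exp (L * b s)) * indicator {0<..<t} s) * (ennreal (B * k) * ?W)"
    proof (cases "0 < s \<and> s < t")
     case True
     have "ennreal (B * (s + 1) powr (- A)) * smear th (t - s) (%y. U y s) x <= ennreal (B * (s + 1) powr (- A)) * (ennreal (exp (L * b s)) * (ennreal k * ?W))"
      using True by (intro mult_left_mono inner) auto
     also have "... = ennreal ((s + 1) powr (- A) * exp (L * b s)) * (ennreal (B * k) * ?W)"
      using B k by (simp add: ennreal_mult mult_ac)
     finally show ?thesis using True by simp
    qed simp
   qed
   also have "... = tint t (%s. ennreal ((s + 1) powr (- A) * exp (L * b s))) * (ennreal (B * k) * ?W)"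
    by (intro nn_integral_multc) measurable
   also have "... <= ennreal (exp (L * b t) / L) * (ennreal (B * k) * ?W)" by (intro mult_right_mono I Suc.prems) auto
   also have "... = ennreal (exp (L * b t) * (B * k / L)) * ?W"
    unfolding mult.assoc[symmetric] using B k L by (simp add: ennreal_mult[symmetric])
   also have "... <= ennreal (exp (L * b t) * (1 / 2)) * ?W"
   proof -
    have "B * k / L <= 1 / 2" using L B k by (simp add: L_def field_simps)
    then show ?thesis by (intro mult_right_mono ennreal_leI mult_left_mono) auto
   qed
   also have "... = ennreal (exp (L * b t)) * (ennreal c * ?v + ennreal (\<mu> / 2))"
   proof -
    have "ennreal (1/2) * ennreal (2 * c) = ennreal c" "ennreal (1/2) * ennreal \<mu> = ennreal (\<mu> / 2)"
     by (subst ennreal_mult[symmetric]; use c mu in simp)+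
    then have "ennreal (1/2) * ?W = ennreal c * ?v + ennreal (\<mu> / 2)"
     by (simp only: distrib_left mult.assoc[symmetric])
    moreover have "ennreal (exp (L * b t) * (1 / 2)) = ennreal (exp (L * b t)) * ennreal (1 / 2)" by (rule ennreal_mult) auto
    ultimately show ?thesis by (simp only: mult.assoc)
   qed
   finally have I2: "tint t (%s. ennreal (B * (s + 1) powr (- A)) * smear th (t - s) (%y. U y s) x) <= ..." .
   have "b t >= 0" unfolding b_def using A Suc.prems powr_mono[of "1 - A" 0 "t + 1"] by simp
   then have e1: "ennreal (exp (L * b t)) >= 1" using L by (simp flip: ennreal_1)
   have "U x t <= ennreal c * ?v + ennreal (exp (L * b t)) * (ennreal c * ?v + ennreal (\<mu> / 2))"
    by (rule order_trans[OF U1[OF Suc.prems] add_left_mono[OF I2]])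
   also have "... <= ennreal (exp (L * b t)) * (ennreal c * ?v) + ennreal (exp (L * b t)) * (ennreal c * ?v + ennreal (\<mu> / 2))"
    using mult_right_mono[OF e1, of "ennreal c * ?v"] by (intro add_right_mono) auto
   also have "... = ennreal (exp (L * b t)) * (ennreal (2 * c) * ?v + ennreal (\<mu> / 2))"
   proof -
    have "ennreal (2 * c) = ennreal c + ennreal c" using c by (simp add: ennreal_plus[symmetric] del: ennreal_plus)
    then show ?thesis by (simp add: distrib_left distrib_right add.assoc)
   qed
   finally show "U x t <= ennreal (exp (L * b t)) * (ennreal (2 * c) * ?v + ennreal (M / 2 ^ Suc n))"
    by (simp add: \<mu>_def mult.commute)
  qed
 qed
 define E where "E = exp (L * (1 / (A - 1)))"
 show ?thesis
 proof (intro exI[of _ "E * (2 * c) + 1"] conjI allI impI)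
  show "E * (2 * c) + 1 > 0" using c by (simp add: E_def add_nonneg_pos)
  fix t :: real assume t: "t > 0"
  have "AE x in lborel. \<forall>n. U x t <= ennreal (exp (L * b t)) * (ennreal (2 * c) * smear th t \<psi> x + ennreal (M / 2 ^ n))"
   unfolding AE_all_countable using step[OF t] by blast
  then show "AE x in lborel. U x t <= ennreal (E * (2 * c) + 1) * smear th t \<psi> x"
  proof eventually_elim
   case (elim x)
   have "(%n. ennreal (M / 2 ^ n)) \<longlonglongrightarrow> ennreal 0" by (intro tendsto_ennrealI) real_asymp
   then have "(%n. ennreal (exp (L * b t)) * (ennreal (2 * c) * smear th t \<psi> x + ennreal (M / 2 ^ n))) \<longlonglongrightarrow> ennreal (exp (L * b t)) * (ennreal (2 * c) * smear th t \<psi> x + ennreal 0)"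
    by (intro ennreal_tendsto_cmult tendsto_add tendsto_const) auto
   then have "U x t <= ennreal (exp (L * b t)) * (ennreal (2 * c) * smear th t \<psi> x + ennreal 0)"
    using elim by (intro LIMSEQ_le_const) auto
   also have "... = ennreal (exp (L * b t) * (2 * c)) * smear th t \<psi> x" using c by (simp add: ennreal_mult mult.assoc)
   also have "... <= ennreal (E * (2 * c) + 1) * smear th t \<psi> x"
   proof (intro mult_right_mono ennreal_leI)
    have "exp (L * b t) <= E" unfolding E_def using mult_left_mono[OF bb[of t], of L] L by simp
    then have "exp (L * b t) * (2 * c) <= E * (2 * c)" using c by (intro mult_right_mono) auto
    then show "exp (L * b t) * (2 * c) <= E * (2 * c) + 1" by simp
   qed auto
   finally show ?case .
  qed
 qed
qed

lemma recip_top' [simp]: "recip top = 0"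
 using recip_top by simp

section \<open>Young's inequality with power weights\<close>

text \<open>The profile with exponent \<open>th\<close>, multiplied by the weight
  \<open>(\<rho> + norm z) powr l\<close>. Using \<open>\<rho> + norm z\<close> instead of
  \<open>norm z\<close> keeps the kernel strictly positive and monotone in the radius whenever
  \<rho> is positive and \<open>l <= N + th\<close>.\<close>

definition kw :: "real => real => real => real^'n => real" where
 "kw th l \<rho> z = \<rho> powr th * (\<rho> + norm z) powr (l - (real CARD('n) + th))"

lemma kw_nonneg: "0 <= kw th l \<rho> z" by (simp add: kw_def)

lemma kw_measurable [measurable]:
 assumes [measurable]: "f \<in> borel_measurable M"
 shows "(%x. kw th l \<rho> (f x)) \<in> borel_measurable M"
 unfolding kw_def by measurable

lemma kw_0: "kw th 0 \<rho> z = prof \<rho> th z"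
 by (simp add: kw_def prof_def)

lemma norm_powr_prof_le: "\<rho> > 0 ==> l >= 0 ==> norm z powr l * prof \<rho> th (z::real^'n) <= kw th l \<rho> z"
proof -
 assume a: "\<rho> > 0" "l >= 0"
 have "norm z powr l * prof \<rho> th z <= (\<rho> + norm z) powr l * prof \<rho> th z"
  using a by (intro mult_right_mono powr_mono2 prof_nonneg) auto
 also have "... = kw th l \<rho> z"
 proof -
  have "(\<rho> + norm z) powr l * (\<rho> + norm z) powr (- (real CARD('n) + th)) = (\<rho> + norm z) powr (l - (real CARD('n) + th))"
   unfolding powr_add[symmetric] by (simp add: algebra_simps)
  then show ?thesis by (simp add: kw_def prof_def mult_ac)
 qed
 finally show ?thesis .
qed

definition wsmear :: "real => real => real => (real^'n => real) => real^'n => ennreal" where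
 "wsmear th l t \<psi> x = (\<N> y. ennreal (kw th l (t powr (1/th)) (x - y)) * ennreal (\<psi> y))"

lemma wsmear_measurable [measurable]:
 assumes [measurable]: "\<psi> \<in> borel_measurable borel"
 shows "wsmear th l t \<psi> \<in> borel_measurable borel"
 unfolding wsmear_def by measurable

lemma wsmear_0: "wsmear th 0 t \<psi> = smear th t (%y. ennreal (\<psi> y))"
 by (simp add: fun_eq_iff wsmear_def smear_def kw_0)

lemma wsmear_le:
 assumes "0 < th" "l <= real CARD('n) + th" "t > 0" "(\<I> y. \<psi> y) <= ennreal a" "a > 0"
  and [measurable]: "\<psi> \<in> borel_measurable borel"
 shows "wsmear th l t \<psi> (x::real^'n) <= ennreal (a * t powr (l / th - real CARD('n) / th))"
proof -
 let ?A = "l / th - real CARD('n) / th"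
 let ?\<rho> = "t powr (1/th)"
 have k: "kw th l ?\<rho> z <= t powr ?A" for z :: "real^'n"
 proof -
  have "kw th l ?\<rho> z <= ?\<rho> powr th * ?\<rho> powr (l - (real CARD('n) + th))"
   unfolding kw_def using assms by (intro mult_left_mono powr_mono2') auto
  also have "... = ?\<rho> powr (l - real CARD('n))" unfolding powr_add[symmetric] by simp
  also have "... = t powr ?A" by (simp add: powr_powr diff_divide_distrib)
  finally show ?thesis .
 qed
 have "wsmear th l t \<psi> x <= (\<N> y. ennreal (t powr ?A) * ennreal (\<psi> y))"
  unfolding wsmear_def by (intro nn_integral_mono mult_right_mono ennreal_leI k) auto
 also have "... = ennreal (t powr ?A) * (\<I> y. \<psi> y)"
  by (rule nn_integral_cmult) measurable
 also have "... <= ennreal (t powr ?A) * ennreal a" by (intro mult_left_mono assms) auto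
 also have "... = ennreal (a * t powr ?A)" using assms by (simp add: ennreal_mult[symmetric] mult.commute)
 finally show ?thesis .
qed

text \<open>The pointwise bound \<open>h\<^sup>p <= a\<^sup>p\<^sup>-\<^sup>1 \<integral> k\<^sup>p \<psi>\<close> is obtained from
 \<open>c\<^sup>p\<^sup>-\<^sup>1 k <= k\<^sup>p / p + (1 - 1/p) c\<^sup>p\<close> with \<open>c = h / a\<close>.\<close>

lemma young_pointwise:
 assumes p: "p >= 1" and a: "a > 0" "(\<I> y. \<psi> y) <= ennreal a"
  and [measurable]: "k \<in> borel_measurable borel" "\<psi> \<in> borel_measurable borel" and k: "!!y. k y > 0"
  and h: "0 <= h" "ennreal h <= (\<N> y. ennreal (k y) * ennreal (\<psi> y))"
 shows "ennreal (h powr p) <= ennreal (a powr (p - 1)) * (\<N> (y::real^'n). ennreal (k y powr p) * ennreal (\<psi> y))"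
proof (cases "h = 0")
 case True
 then show ?thesis by simp
next
 case False
 then have hp: "h > 0" using h by simp
 define c where "c = h / a"
 have c: "c > 0" using hp a by (simp add: c_def)
 let ?I = "\<integral>\<^sup>+ y. ennreal (k y powr p) * ennreal (\<psi> y) \<partial>lborel"
 have young: "c powr (p - 1) * k y <= k y powr p * (1 / p) + (1 - 1 / p) * c powr p" for y
 proof -
  have "(k y powr p) powr (1 / p) * (c powr p) powr (1 - 1 / p) <= 1 / p * (k y powr p) + (1 - 1 / p) * (c powr p)"
   using p k[of y] c by (intro Youngs_inequality_0) auto
  moreover have "p * (1 - 1 / p) = p - 1" using p by (simp add: field_simps)
  ultimately show ?thesis using p k[of y] c by (simp add: powr_powr mult.commute)
 qed
 have "ennreal (c powr (p - 1)) * ennreal h <= ennreal (c powr (p - 1)) * (\<N> y. ennreal (k y) * ennreal (\<psi> y))"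
  by (intro mult_left_mono h) auto
 also have "... = (\<N> y. ennreal (c powr (p - 1)) * (ennreal (k y) * ennreal (\<psi> y)))"
  by (rule nn_integral_cmult[symmetric]) measurable
 also have "... <= (\<N> y. ennreal (1 / p) * (ennreal (k y powr p) * ennreal (\<psi> y)) + ennreal ((1 - 1 / p) * c powr p) * ennreal (\<psi> y))"
 proof (intro nn_integral_mono)
  fix y
  have "ennreal (c powr (p - 1)) * (ennreal (k y) * ennreal (\<psi> y)) = ennreal (c powr (p - 1) * k y) * ennreal (\<psi> y)"
   using k[of y] by (simp add: ennreal_mult mult.assoc)
  also have "... <= ennreal (k y powr p * (1 / p) + (1 - 1 / p) * c powr p) * ennreal (\<psi> y)"
   by (intro mult_right_mono ennreal_leI young) auto
  also have "ennreal (k y powr p * (1 / p) + (1 - 1 / p) * c powr p) = ennreal (1 / p) * ennreal (k y powr p) + ennreal ((1 - 1 / p) * c powr p)"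
  proof -
   have "ennreal (k y powr p * (1 / p)) = ennreal (k y powr p) * ennreal (1 / p)" using p by (intro ennreal_mult) auto
   then show ?thesis using p by (subst ennreal_plus) (auto simp only: mult.commute intro!: mult_nonneg_nonneg, auto)
  qed
  also have "(ennreal (1 / p) * ennreal (k y powr p) + ennreal ((1 - 1 / p) * c powr p)) * ennreal (\<psi> y)
   = ennreal (1 / p) * (ennreal (k y powr p) * ennreal (\<psi> y)) + ennreal ((1 - 1 / p) * c powr p) * ennreal (\<psi> y)"
   by (simp only: distrib_right mult.assoc)
  finally show "ennreal (c powr (p - 1)) * (ennreal (k y) * ennreal (\<psi> y)) <= ..." .
 qed
 also have "... = ennreal (1 / p) * ?I + ennreal ((1 - 1 / p) * c powr p) * (\<I> y. \<psi> y)"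
  by (simp add: nn_integral_add nn_integral_cmult)
 also have "... <= ennreal (1 / p) * ?I + ennreal ((1 - 1 / p) * c powr p) * ennreal a"
  by (intro add_left_mono mult_left_mono a) auto
 finally have main: "ennreal (c powr (p - 1)) * ennreal h <= ..." .
 show ?thesis
 proof (cases ?I)
  case (real i)
  have "ennreal (c powr (p - 1) * h) <= ennreal (1 / p * i + (1 - 1 / p) * c powr p * a)"
   using main p a hp real by (simp add: ennreal_mult[symmetric] ennreal_plus[symmetric] del: ennreal_plus)
  then have "c powr (p - 1) * h <= 1 / p * i + (1 - 1 / p) * c powr p * a"
   using p a real by (subst (asm) ennreal_le_iff) auto
  moreover have "c powr (p - 1) * h = c powr p * a"
  proof -
   have "h = c * a" using a by (simp add: c_def)
   moreover have "c powr (p - 1) * c = c powr p" using c by (simp add: powr_diff)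
   ultimately show ?thesis by (simp add: mult.assoc[symmetric])
  qed
  ultimately have "c powr p * a <= 1 / p * i + (1 - 1 / p) * (c powr p * a)" by (simp only: mult.assoc)
  then have "1 / p * (c powr p * a) <= 1 / p * i" by (simp add: left_diff_distrib)
  then have "c powr p * a <= i" using p by (simp add: divide_le_cancel)
  then have "a powr (p - 1) * (c powr p * a) <= a powr (p - 1) * i" by (intro mult_left_mono) auto
  moreover have "a powr (p - 1) * (c powr p * a) = h powr p"
   unfolding c_def using a hp by (simp add: powr_divide powr_diff)
  ultimately show ?thesis unfolding real using real by (simp add: ennreal_mult[symmetric] ennreal_leI)
 next
  case top
  then show ?thesis using a by (simp add: ennreal_mult_top)
 qed
qed

text \<open>Convolution of an integrable function with a kernel of finite \<open>q\<close>-norm. For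
  finite \<open>q\<close> the norm of \<open>kw\<close> is finite exactly if
  \<open>l < th + N * (1 - recip q)\<close>, which is where this restriction in the weighted decay
  comes from.\<close>

lemma young_wsmear:
 assumes th: "0 < th" and q: "1 <= q" and l: "0 <= l" "l < th + real CARD('n) * (1 - recip q)"
 shows "\<exists>C>0. \<forall>t>0. \<forall>a>0. \<forall>\<psi>\<in>borel_measurable borel. \<forall>h\<in>borel_measurable lebesgue.
  (\<I> y. \<psi> y) <= ennreal a --> (\<forall>x::real^'n. ennreal \<bar>h x\<bar> <= wsmear th l t \<psi> x) -->
  Lq_norm q h <= ennreal (C * a * t powr (l / th - real CARD('n) / th * (1 - recip q)))"
 using q
proof (cases rule: exponent_cases)
 case 1
 show ?thesis
 proof (intro exI[of _ 1] conjI allI impI ballI)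
  fix t a :: real and \<psi> h :: "real^'n => real"
  assume *: "t > 0" "a > 0" "\<psi> \<in> borel_measurable borel" "h \<in> borel_measurable lebesgue"
   "(\<I> y. \<psi> y) <= ennreal a" "\<forall>x. ennreal \<bar>h x\<bar> <= wsmear th l t \<psi> x"
  have "\<bar>h x\<bar> <= a * t powr (l / th - real CARD('n) / th)" for x
  proof -
   have "ennreal \<bar>h x\<bar> <= wsmear th l t \<psi> x" using * by blast
   also have "... <= ennreal (a * t powr (l / th - real CARD('n) / th))"
    using * th l 1 by (intro wsmear_le) auto
   finally show ?thesis using * by (simp add: ennreal_le_iff)
  qed
  then show "Lq_norm q h <= ennreal (1 * a * t powr (l / th - real CARD('n) / th * (1 - recip q)))"
   unfolding 1 using * by (intro Lq_norm_top_le) auto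
 qed auto
next
 case (2 p)
 let ?N = "real CARD('n)"
 \<comment> \<open>The excess over \<open>N\<close> of the decay exponent of the \<open>p\<close>-th
   power of the kernel; its positivity is the condition on \<open>l\<close>.\<close>
 define \<delta> where "\<delta> = (?N + th - l) * p - ?N"
 have delta: "\<delta> > 0"
 proof -
  have "?N / p < ?N + th - l" using l 2 by (simp add: algebra_simps)
  then show ?thesis using 2 by (simp add: \<delta>_def field_simps)
 qed
 obtain C where C: "C > 0" "!!D. D > 0 ==> (\<I> (x::real^'n). (D + norm x) powr (-(?N + \<delta>))) <= ennreal (C * D powr (-\<delta>))"
  using nn_integral_radial_powr[where 'n='n, OF delta] by blast
 show ?thesis
 proof (intro exI[of _ "C powr (1 / p)"] conjI allI impI ballI)
  show "C powr (1 / p) > 0" using C by simp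
  fix t a :: real and \<psi> h :: "real^'n => real"
  assume t: "t > 0" and a: "a > 0" and [measurable]: "\<psi> \<in> borel_measurable borel" and hm: "h \<in> borel_measurable lebesgue"
   and psi: "(\<I> y. \<psi> y) <= ennreal a" and h: "\<forall>x. ennreal \<bar>h x\<bar> <= wsmear th l t \<psi> x"
  let ?\<rho> = "t powr (1/th)"
  have rho: "?\<rho> > 0" using t by simp
  let ?k = "%z::real^'n. kw th l ?\<rho> z"
  have kpos: "?k z > 0" for z
  proof -
   have "?\<rho> + norm z > 0" using rho by (simp add: add_pos_nonneg)
   then show ?thesis unfolding kw_def using rho by simp
  qed
  have kp: "?k z powr p = t powr p * (?\<rho> + norm z) powr (-(?N + \<delta>))" for z
  proof -
   have "(l - (?N + th)) * p = -(?N + \<delta>)" by (simp add: \<delta>_def algebra_simps)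
   then show ?thesis unfolding kw_def using th t by (simp add: powr_mult powr_powr)
  qed
  have "(\<integral>\<^sup>+ x. ennreal (\<bar>h x\<bar> powr p) \<partial>lebesgue) = (\<I> x. \<bar>h x\<bar> powr p)"
   by (rule nn_integral_completion)
  also have "... <= (\<N> x. ennreal (a powr (p - 1)) * (\<N> y. ennreal (?k (x - y) powr p) * ennreal (\<psi> y)))"
  proof (intro nn_integral_mono young_pointwise)
   fix x show "ennreal \<bar>h x\<bar> <= (\<N> y. ennreal (?k (x - y)) * ennreal (\<psi> y))"
    using h by (simp add: wsmear_def)
  qed (use 2 a psi kpos in auto)
  also have "... = ennreal (a powr (p - 1)) * (\<N> x. (\<N> y. ennreal (?k (x - y) powr p) * ennreal (\<psi> y)))"
   by (rule nn_integral_cmult) measurable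
  also have "(\<N> x. (\<N> y. ennreal (?k (x - y) powr p) * ennreal (\<psi> y))) = (\<N> y. (\<N> x. ennreal (?k (x - y) powr p) * ennreal (\<psi> y)))"
   by (rule lborel_pair.Fubini') measurable
  also have "... = (\<N> y. (\<I> x. ?k (x - y) powr p) * ennreal (\<psi> y))"
   by (intro nn_integral_cong nn_integral_multc) measurable
  also have "... <= (\<N> y. ennreal (t powr p * (C * ?\<rho> powr (-\<delta>))) * ennreal (\<psi> y))"
  proof (intro nn_integral_mono mult_right_mono)
   fix y :: "real^'n"
   have "(\<I> x. ?k (x - y) powr p) = (\<I> x. ?k x powr p)"
    by (rule nn_integral_lborel_shift[where f="%x. ennreal (?k x powr p)"]) measurable
   also have "... = (\<N> (x::real^'n). ennreal (t powr p) * ennreal ((?\<rho> + norm x) powr (-(?N + \<delta>))))"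
    by (simp add: kp ennreal_mult)
   also have "... = ennreal (t powr p) * (\<I> (x::real^'n). (?\<rho> + norm x) powr (-(?N + \<delta>)))"
    by (rule nn_integral_cmult) measurable
   also have "... <= ennreal (t powr p) * ennreal (C * ?\<rho> powr (-\<delta>))" by (intro mult_left_mono C rho) auto
   also have "... = ennreal (t powr p * (C * ?\<rho> powr (-\<delta>)))" using C by (simp add: ennreal_mult)
   finally show "(\<I> x. ?k (x - y) powr p) <= ..." .
  qed simp
  also have "... = ennreal (t powr p * (C * ?\<rho> powr (-\<delta>))) * (\<I> y. \<psi> y)"
   by (rule nn_integral_cmult) measurable
  also have "... <= ennreal (t powr p * (C * ?\<rho> powr (-\<delta>))) * ennreal a" by (intro mult_left_mono psi) auto
  finally have "(\<integral>\<^sup>+ x. ennreal (\<bar>h x\<bar> powr p) \<partial>lebesgue) <= ennreal (a powr (p - 1)) * (ennreal (t powr p * (C * ?\<rho> powr (-\<delta>))) * ennreal a)"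
   by (simp add: mult_left_mono)
  also have "... = ennreal (a powr (p - 1) * a * (C * (t powr p * ?\<rho> powr (-\<delta>))))"
   using a C by (simp add: ennreal_mult[symmetric] mult_ac)
  also have "a powr (p - 1) * a = a powr p" using a by (simp add: powr_diff)
  also have "a powr p * (C * (t powr p * ?\<rho> powr (-\<delta>))) = (C powr (1 / p) * a * t powr (l / th - ?N / th * (1 - recip q))) powr p"
  proof -
   have "t powr p * ?\<rho> powr (-\<delta>) = t powr (p - \<delta> / th)" unfolding powr_powr powr_add[symmetric] by simp
   also have "p - \<delta> / th = (l / th - ?N / th * (1 - recip q)) * p"
    unfolding 2 \<delta>_def using 2 th by (simp add: field_simps)
   finally have e: "t powr p * ?\<rho> powr (-\<delta>) = (t powr (l / th - ?N / th * (1 - recip q))) powr p" by (simp only: powr_powr)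
   have "C = (C powr (1 / p)) powr p" using C 2 by (simp add: powr_powr)
   then show ?thesis unfolding e by (simp only: powr_mult) (simp add: mult_ac)
  qed
  finally show "Lq_norm q h <= ennreal (C powr (1 / p) * a * t powr (l / th - ?N / th * (1 - recip q)))"
   unfolding 2(1) using 2 a by (subst Lq_norm_le_iff) auto
 qed
qed

text \<open>The profile has bounded mass, so convolution with it preserves both the integral bound
  and the supremum bound up to a constant. No negative power of \<open>t\<close> appears, which
  makes this the estimate for short times.\<close>

lemma smear_bounded_Lq:
 assumes th: "0 < th"
 shows "\<exists>C>0. \<forall>q\<ge>1. \<forall>t>0. \<forall>a>0. \<forall>\<psi>\<in>borel_measurable borel. \<forall>h\<in>borel_measurable lebesgue.
  (\<I> y. \<psi> y) <= ennreal a --> (AE y in lborel. \<psi> y <= a) -->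
  (\<forall>x::real^'n. ennreal \<bar>h x\<bar> <= smear th t (%y. ennreal (\<psi> y)) x) --> Lq_norm q h <= ennreal (C * a)"
proof -
 obtain C where C: "C > 0" "!!\<rho>. \<rho> > 0 ==> (\<I> x. prof \<rho> th (x::real^'n)) <= ennreal C"
  using nn_integral_prof[OF th, where 'n='n] by blast
 show ?thesis
 proof (intro exI[of _ C] conjI allI impI ballI)
  fix q :: ennreal and t a :: real and \<psi> h :: "real^'n => real"
  assume q: "1 <= q" and t: "t > 0" and a: "a > 0" and [measurable]: "\<psi> \<in> borel_measurable borel" and hm: "h \<in> borel_measurable lebesgue"
   and psi: "(\<I> y. \<psi> y) <= ennreal a" "AE y in lborel. \<psi> y <= a"
   and h: "\<forall>x. ennreal \<bar>h x\<bar> <= smear th t (%y. ennreal (\<psi> y)) x"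
  let ?p = "prof (t powr (1/th)) th :: real^'n => real"
  have sh: "(\<I> x. ?p (x - y)) <= ennreal C" for y
   using C(2)[of "t powr (1/th)"] t nn_integral_lborel_shift[of "%x. ennreal (?p x)" y] by simp
  have sh': "(\<I> y. ?p (x - y)) <= ennreal C" for x
   using sh[of x] by (simp add: prof_def norm_minus_commute)
  have "(\<integral>\<^sup>+ x. ennreal \<bar>h x\<bar> \<partial>lebesgue) = (\<I> x. \<bar>h x\<bar>)" by (rule nn_integral_completion)
  also have "... <= (\<N> x. (\<N> y. ennreal (?p (x - y)) * ennreal (\<psi> y)))"
   using h by (intro nn_integral_mono) (simp add: smear_def)
  also have "... = (\<N> y. (\<N> x. ennreal (?p (x - y)) * ennreal (\<psi> y)))"
   by (rule lborel_pair.Fubini') measurable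
  also have "... = (\<N> y. (\<I> x. ?p (x - y)) * ennreal (\<psi> y))"
   by (intro nn_integral_cong nn_integral_multc) measurable
  also have "... <= (\<N> y. ennreal C * ennreal (\<psi> y))" by (intro nn_integral_mono mult_right_mono sh) auto
  also have "... = ennreal C * (\<I> y. \<psi> y)" by (rule nn_integral_cmult) measurable
  also have "... <= ennreal C * ennreal a" by (intro mult_left_mono psi) auto
  also have "... = ennreal (C * a)" using C a by (simp add: ennreal_mult)
  finally have I: "(\<integral>\<^sup>+ x. ennreal \<bar>h x\<bar> \<partial>lebesgue) <= ..." .
  have b: "\<bar>h x\<bar> <= C * a" for x
  proof -
   have "ennreal \<bar>h x\<bar> <= (\<N> y. ennreal (?p (x - y)) * ennreal (\<psi> y))" using h by (simp add: smear_def)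
   also have "... <= (\<N> y. ennreal (?p (x - y)) * ennreal a)"
    by (intro nn_integral_mono_AE) (use psi(2) in \<open>eventually_elim, auto intro!: mult_left_mono ennreal_leI\<close>)
   also have "... = (\<I> y. ?p (x - y)) * ennreal a" by (rule nn_integral_multc) measurable
   also have "... <= ennreal C * ennreal a" by (intro mult_right_mono sh') auto
   also have "... = ennreal (C * a)" using C a by (simp add: ennreal_mult)
   finally show ?thesis using C a by (simp add: ennreal_le_iff)
  qed
  have Ca: "C * a > 0" using C a by simp
  have "Lq_norm q h <= ennreal ((C * a) powr recip q * (C * a) powr (1 - recip q))"
   by (rule Lq_norm_interpolate[OF q hm I Ca _ Ca]) (use b in auto)
  also have "(C * a) powr recip q * (C * a) powr (1 - recip q) = C * a" using Ca unfolding powr_add[symmetric] by simp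
  finally show "Lq_norm q h <= ..." .
 qed (rule C(1))
qed

lemma ennreal_norm_integral_le:
 fixes f :: "'a => 'b::{banach, second_countable_topology}"
 shows "ennreal (norm (LINT x|M. f x)) <= (\<integral>\<^sup>+ x. ennreal (norm (f x)) \<partial>M)"
proof (cases "\<integral>\<^sup>+ x. ennreal (norm (f x)) \<partial>M")
 case (real c)
 then show ?thesis using norm_integral_le_nn_integral[of M f c] by (simp add: ennreal_leI)
qed simp

lemma norm_powr_triangle:
 assumes "l >= 0"
 shows "norm (x::'a::real_normed_vector) powr l <= 2 powr l * (norm (x - y) powr l + norm y powr l)"
 using add_powr_le[of "norm (x - y)" "norm y" l] norm_triangle_ineq[of "x - y" y] assms
 by (auto intro: order_trans[OF powr_mono2])

text \<open>For \<open>t < 1\<close> the profile of scale \<open>t\<close> is split into its core \<open>norm (x - y) <= 1\<close> and its tail; the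
 tail is dominated by the profile of scale \<open>1\<close>.\<close>

lemma norm_powr_prof_split:
 fixes x y :: "real^'n"
 assumes th: "0 < th" and l: "l >= 0" and t: "t > 0"
 shows "norm x powr l * prof (t powr (1/th)) th (x - y) <=
  (if t < 1 then prof (t powr (1/th)) th (x - y) * (1 + norm y) powr l else 0)
  + 2 powr (l + real CARD('n) + th) * (kw th l (max t 1 powr (1/th)) (x - y) + kw th 0 (max t 1 powr (1/th)) (x - y) * norm y powr l)"
proof -
 let ?\<rho> = "max t 1 powr (1/th)" and ?c = "2 powr (l + real CARD('n) + th)" and ?z = "x - y"
 have main: "norm x powr l * P <= ?c * (kw th l ?\<rho> ?z + kw th 0 ?\<rho> ?z * norm y powr l)"
  if P: "0 <= P" "P <= 2 powr (real CARD('n) + th) * prof ?\<rho> th ?z" for P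
 proof -
  have "norm x powr l * P <= (2 powr l * (norm ?z powr l + norm y powr l)) * (2 powr (real CARD('n) + th) * prof ?\<rho> th ?z)"
   using P l by (intro mult_mono norm_powr_triangle) auto
  also have "... = ?c * (norm ?z powr l * prof ?\<rho> th ?z + prof ?\<rho> th ?z * norm y powr l)"
   by (simp add: powr_add algebra_simps)
  also have "... <= ?c * (kw th l ?\<rho> ?z + kw th 0 ?\<rho> ?z * norm y powr l)"
   using norm_powr_prof_le[of ?\<rho> l ?z th] l by (intro mult_left_mono) (auto simp: kw_0)
  finally show ?thesis .
 qed
 show ?thesis
 proof (cases "t < 1")
  case False
  have "1 <= 2 powr (real CARD('n) + th)" using th by (intro ge_one_powr_ge_zero) auto
  then have "1 * prof ?\<rho> th ?z <= 2 powr (real CARD('n) + th) * prof ?\<rho> th ?z" by (intro mult_right_mono prof_nonneg)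
  then show ?thesis using False main[of "prof ?\<rho> th ?z"] by (simp add: prof_nonneg max_def)
 next
  case True
  have nn: "0 <= ?c * (kw th l ?\<rho> ?z + kw th 0 ?\<rho> ?z * norm y powr l)"
   by (intro mult_nonneg_nonneg add_nonneg_nonneg kw_nonneg) auto
  show ?thesis
  proof (cases "norm ?z <= 1")
   case z: True
   have "norm x <= 1 + norm y" using norm_triangle_ineq[of ?z y] z by simp
   then have "norm x powr l * prof (t powr (1/th)) th ?z <= (1 + norm y) powr l * prof (t powr (1/th)) th ?z"
    using l by (intro mult_right_mono powr_mono2 prof_nonneg) auto
   then show ?thesis using True nn by (simp add: mult.commute)
  next
   case z: False
   have "(1 + norm ?z) / 2 <= t powr (1/th) + norm ?z" using z powr_ge_zero[of t "1/th"] by argo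
   moreover have "(1 + norm ?z) / 2 > 0" using norm_ge_zero[of ?z] by argo
   ultimately have "prof (t powr (1/th)) th ?z <= 1 * ((1 + norm ?z) / 2) powr (- (real CARD('n) + th))"
    unfolding prof_def using z th t True
    by (intro mult_mono powr_mono2') (auto simp: powr_powr)
   also have "... = 2 powr (real CARD('n) + th) * prof ?\<rho> th ?z"
   proof -
    have "(b / 2) powr (- d) = 2 powr d * b powr (- d)" for b d :: real
     by (simp add: powr_divide powr_minus_divide)
    then show ?thesis using True by (simp only: prof_def) (simp add: max_def)
   qed
   finally have "norm x powr l * prof (t powr (1/th)) th ?z <= ?c * (kw th l ?\<rho> ?z + kw th 0 ?\<rho> ?z * norm y powr l)"
    by (intro main prof_nonneg)
   then show ?thesis using prof_nonneg[of "t powr (1/th)" th ?z] True by (simp add: add_increasing)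
  qed
 qed
qed

lemma norm_powr_smear_split:
 fixes x :: "real^'n" and \<psi> :: "real^'n => real"
 assumes th: "0 < th" and l: "l >= 0" and t: "t > 0" and [measurable]: "\<psi> \<in> borel_measurable borel" and psi: "!!y. \<psi> y >= 0"
 shows "ennreal (norm x powr l) * smear th t (%y. ennreal (\<psi> y)) x <=
  (if t < 1 then smear th t (%y. ennreal ((1 + norm y) powr l * \<psi> y)) x else 0)
  + ennreal (2 powr (l + real CARD('n) + th)) * (wsmear th l (max t 1) \<psi> x + wsmear th 0 (max t 1) (%y. norm y powr l * \<psi> y) x)"
proof -
 let ?\<rho> = "max t 1 powr (1/th)" and ?c = "2 powr (l + real CARD('n) + th)"
 let ?a = "%y. if t < 1 then ennreal (prof (t powr (1/th)) th (x - y)) * ennreal ((1 + norm y) powr l * \<psi> y) else 0"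
 let ?b = "%y. ennreal (kw th l ?\<rho> (x - y)) * ennreal (\<psi> y)" and ?d = "%y. ennreal (kw th 0 ?\<rho> (x - y)) * ennreal (norm y powr l * \<psi> y)"
 have "ennreal (norm x powr l) * smear th t (%y. ennreal (\<psi> y)) x = (\<N> y. ennreal (norm x powr l) * (ennreal (prof (t powr (1/th)) th (x - y)) * ennreal (\<psi> y)))"
  unfolding smear_def by (rule nn_integral_cmult[symmetric]) measurable
 also have "... <= (\<N> y. ?a y + ennreal ?c * (?b y + ?d y))"
 proof (intro nn_integral_mono)
  fix y
  have "ennreal (norm x powr l) * (ennreal (prof (t powr (1/th)) th (x - y)) * ennreal (\<psi> y)) = ennreal (norm x powr l * prof (t powr (1/th)) th (x - y) * \<psi> y)"
   by (simp add: ennreal_mult prof_nonneg psi mult.assoc)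
  also have "... <= ennreal (((if t < 1 then prof (t powr (1/th)) th (x - y) * (1 + norm y) powr l else 0)
  + ?c * (kw th l ?\<rho> (x - y) + kw th 0 ?\<rho> (x - y) * norm y powr l)) * \<psi> y)"
   by (intro ennreal_leI mult_right_mono norm_powr_prof_split th l t psi)
  also have "... = ennreal ((if t < 1 then prof (t powr (1/th)) th (x - y) * ((1 + norm y) powr l * \<psi> y) else 0)
  + ?c * (kw th l ?\<rho> (x - y) * \<psi> y + kw th 0 ?\<rho> (x - y) * (norm y powr l * \<psi> y)))"
   by (simp add: algebra_simps)
  also have "... = ?a y + ennreal ?c * (?b y + ?d y)"
   by (simp add: ennreal_mult prof_nonneg kw_nonneg psi)
  finally show "ennreal (norm x powr l) * (ennreal (prof (t powr (1/th)) th (x - y)) * ennreal (\<psi> y)) <= ..." .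
 qed
 also have "... = (\<N> y. ?a y) + ennreal ?c * ((\<N> y. ?b y) + (\<N> y. ?d y))"
  by (simp add: nn_integral_add nn_integral_cmult)
 also have "(\<N> y. ?a y) = (if t < 1 then smear th t (%y. ennreal ((1 + norm y) powr l * \<psi> y)) x else 0)"
  by (simp add: smear_def)
 finally show ?thesis by (simp only: wsmear_def)
qed

text \<open>For \<open>t >= 1\<close> only the two convolutions with weight kernels occur and
  \<open>young_wsmear\<close> gives the rate. For \<open>t < 1\<close> it would give a singular
  power of \<open>t\<close>; there the core is handled by \<open>smear_bounded_Lq\<close>, and the
  tails are taken at scale \<open>1\<close>.\<close>

lemma smear_Lq_bound:
 assumes th: "0 < th" and q: "1 <= q" and l: "0 <= l" "l < th + real CARD('n) * (1 - recip q)"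
  and [measurable]: "\<psi> \<in> borel_measurable borel" and psi: "!!y. \<psi> y >= 0"
  and a: "a > 0" "(\<I> (y::real^'n). (1 + norm y) powr l * \<psi> y) <= ennreal a" "AE y in lborel. (1 + norm y) powr l * \<psi> y <= a"
 shows "\<exists>C>0. \<forall>t>0. \<forall>h\<in>borel_measurable lebesgue. (AE x in lborel. ennreal \<bar>h x\<bar> <= smear th t (%y. ennreal (\<psi> y)) x) -->
  wLq_norm q l h <= ennreal (C * (t + 1) powr (l / th - real CARD('n) / th * (1 - recip q)))"
proof -
 let ?N = "real CARD('n)" and ?c = "2 powr (l + real CARD('n) + th)"
 let ?e = "l / th - ?N / th * (1 - recip q)"
 let ?p1 = "%y. (1 + norm y) powr l * \<psi> y" and ?p2 = "%y. norm y powr l * \<psi> y"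
 have rq: "0 <= recip q" "recip q <= 1" using recip_bounds[OF q] by auto
 have pw: "norm y powr l <= (1 + norm y) powr l" "1 <= (1 + norm y) powr l" for y :: "real^'n"
  using l by (auto intro!: powr_mono2 ge_one_powr_ge_zero)
 have psi1: "(\<I> y. \<psi> y) <= ennreal a"
  using mult_right_mono[OF pw(2) psi] by (intro order_trans[OF nn_integral_mono a(2)] ennreal_leI) simp
 have psi2: "(\<I> y. ?p2 y) <= ennreal a"
  by (intro order_trans[OF nn_integral_mono a(2)] ennreal_leI mult_right_mono pw psi)
 obtain C1 where C1: "C1 > 0" and C1': "\<forall>t>0. \<forall>a>0. \<forall>\<psi>\<in>borel_measurable borel. \<forall>h\<in>borel_measurable lebesgue.
  (\<I> y. \<psi> y) <= ennreal a --> (\<forall>x::real^'n. ennreal \<bar>h x\<bar> <= wsmear th l t \<psi> x) -->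
  Lq_norm q h <= ennreal (C1 * a * t powr (l / th - ?N / th * (1 - recip q)))"
  using young_wsmear[OF th q l] by (elim exE conjE)
 note C1 = C1 C1'[rule_format]
 have l0: "0 < th + ?N * (1 - recip q)" using th rq by (simp add: add_pos_nonneg)
 obtain C2 where C2: "C2 > 0" and C2': "\<forall>t>0. \<forall>a>0. \<forall>\<psi>\<in>borel_measurable borel. \<forall>h\<in>borel_measurable lebesgue.
  (\<I> y. \<psi> y) <= ennreal a --> (\<forall>x::real^'n. ennreal \<bar>h x\<bar> <= wsmear th 0 t \<psi> x) -->
  Lq_norm q h <= ennreal (C2 * a * t powr (0 / th - ?N / th * (1 - recip q)))"
  using young_wsmear[OF th q order_refl l0] by (elim exE conjE)
 note C2 = C2 C2'[rule_format]
 obtain C3 where C3: "C3 > 0" and C3': "\<forall>q\<ge>1. \<forall>t>0. \<forall>a>0. \<forall>\<psi>\<in>borel_measurable borel. \<forall>h\<in>borel_measurable lebesgue.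
  (\<I> y. \<psi> y) <= ennreal a --> (AE y in lborel. \<psi> y <= a) -->
  (\<forall>x::real^'n. ennreal \<bar>h x\<bar> <= smear th t (%y. ennreal (\<psi> y)) x) --> Lq_norm q h <= ennreal (C3 * a)"
  using smear_bounded_Lq[OF th, where 'n='n] by (elim exE conjE)
 note C3 = C3 C3'[rule_format, OF q]
 define B where "B = 4 * (C3 * a + ?c * (4 * (C1 * a + C2 * a)))"
 have B: "B > 0" using C1(1) C2(1) C3(1) a(1) by (simp add: B_def add_pos_nonneg)
 show ?thesis
 proof (intro exI[of _ "2 powr \<bar>?e\<bar> * B"] conjI allI impI ballI)
  show "2 powr \<bar>?e\<bar> * B > 0" using B by simp
  fix t :: real and h :: "real^'n => real"
  assume t: "t > 0" and hm [measurable]: "h \<in> borel_measurable lebesgue" and h: "AE x in lborel. ennreal \<bar>h x\<bar> <= smear th t (%y. ennreal (\<psi> y)) x"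
  let ?tau = "max t 1"
  \<comment> \<open>Real-valued versions of the three parts in \<open>norm_powr_smear_split\<close>.
    They are finite everywhere by \<open>wsmear_le\<close>, so \<open>enn2real\<close> loses
    nothing.\<close>
  define h1 where "h1 = (%x. if t < 1 then enn2real (smear th t (%y. ennreal (?p1 y)) x) else 0)"
  define h2 where "h2 = (%x. enn2real (wsmear th l ?tau \<psi> x))"
  define h3 where "h3 = (%x. enn2real (wsmear th 0 ?tau ?p2 x))"
  have [measurable]: "h1 \<in> borel_measurable borel" "h2 \<in> borel_measurable borel" "h3 \<in> borel_measurable borel"
   unfolding h1_def h2_def h3_def by measurable
  have leb: "f \<in> borel_measurable lebesgue" if "f \<in> borel_measurable borel" for f :: "real^'n => real"
   using that by (intro measurable_completion) simp
  have lN: "l <= ?N + th" using l rq by (smt (verit, best) mult_left_le of_nat_0_le_iff)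
  have e1: "ennreal \<bar>h1 x\<bar> = (if t < 1 then smear th t (%y. ennreal (?p1 y)) x else 0)" for x
  proof -
   have "smear th t (%y. ennreal (?p1 y)) x < \<infinity>"
    unfolding wsmear_0[symmetric]
    by (rule le_less_trans[OF wsmear_le[OF th _ t a(2,1), of 0]]) (use th in auto)
   then show ?thesis by (auto simp: h1_def ennreal_enn2real_if)
  qed
  have e2: "ennreal \<bar>h2 x\<bar> = wsmear th l ?tau \<psi> x" for x
  proof -
   have "wsmear th l ?tau \<psi> x < \<infinity>"
    by (rule le_less_trans[OF wsmear_le[OF th lN _ psi1 a(1), of ?tau]]) auto
   then show ?thesis by (auto simp: h2_def ennreal_enn2real_if)
  qed
  have e3: "ennreal \<bar>h3 x\<bar> = wsmear th 0 ?tau ?p2 x" for x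
  proof -
   have "wsmear th 0 ?tau ?p2 x < \<infinity>"
    by (rule le_less_trans[OF wsmear_le[OF th _ _ psi2 a(1), of 0 ?tau]]) (use th in auto)
   then show ?thesis by (auto simp: h3_def ennreal_enn2real_if)
  qed
  have te: "1 <= ?tau powr (l / th)" using l th by (intro ge_one_powr_ge_zero) auto
  have tb: "?tau powr (0 / th - ?N / th * (1 - recip q)) <= ?tau powr ?e"
   using l th by (intro powr_mono) auto
  have b2: "Lq_norm q h2 <= ennreal (C1 * a * ?tau powr ?e)"
   by (rule C1(2)[OF _ a(1) _ leb psi1]) (auto simp: e2)
  have b1: "Lq_norm q h1 <= ennreal (C3 * a * ?tau powr ?e)"
  proof (cases "t < 1")
   case True
   have "Lq_norm q h1 <= ennreal (C3 * a)"
    by (rule C3(2)[OF t a(1) _ leb a(2,3)]) (use True in \<open>auto simp: e1\<close>)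
   then show ?thesis using True by (simp add: max_def)
  next
   case False
   then have "Lq_norm q h1 <= ennreal (0 * (C1 * a * ?tau powr ?e))"
    by (intro Lq_norm_mono_linear[OF q leb leb _ _ b2]) (use C1 a in \<open>auto simp: h1_def\<close>)
   then show ?thesis by simp
  qed
  have b3: "Lq_norm q h3 <= ennreal (C2 * a * ?tau powr ?e)"
  proof -
   have "Lq_norm q h3 <= ennreal (C2 * a * ?tau powr (0 / th - ?N / th * (1 - recip q)))"
    by (rule C2(2)[OF _ a(1) _ leb psi2]) (auto simp: e3)
   also have "... <= ennreal (C2 * a * ?tau powr ?e)" using C2(1) a(1) by (intro ennreal_leI mult_left_mono tb) auto
   finally show ?thesis .
  qed
  have b23: "Lq_norm q (%x. h2 x + h3 x) <= ennreal (4 * (C1 * a * ?tau powr ?e + C2 * a * ?tau powr ?e))"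
   by (rule Lq_norm_add_le[OF q leb leb leb _ b2 _ b3]) (use C1 C2 a in auto)
  have b23': "Lq_norm q (%x. ?c * (h2 x + h3 x)) <= ennreal (?c * (4 * (C1 * a * ?tau powr ?e + C2 * a * ?tau powr ?e)))"
   by (rule Lq_norm_mono_linear[OF q leb leb _ _ b23]) (use C1 C2 a in \<open>auto simp: abs_mult\<close>)
  have b: "Lq_norm q (%x. norm x powr l * h x) <= ennreal (4 * (C3 * a * ?tau powr ?e + ?c * (4 * (C1 * a * ?tau powr ?e + C2 * a * ?tau powr ?e))))"
  proof (rule Lq_norm_add_le[OF q _ leb leb _ b1 _ b23'])
   have "AE x in lborel. \<bar>norm x powr l * h x\<bar> <= \<bar>h1 x\<bar> + \<bar>?c * (h2 x + h3 x)\<bar>"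
    using h
   proof eventually_elim
    case (elim x)
    have hp: "h2 x >= 0" "h3 x >= 0" "h1 x >= 0" by (auto simp: h1_def h2_def h3_def)
    have "ennreal \<bar>norm x powr l * h x\<bar> = ennreal (norm x powr l) * ennreal \<bar>h x\<bar>"
     by (simp add: abs_mult ennreal_mult)
    also have "... <= ennreal (norm x powr l) * smear th t (%y. ennreal (\<psi> y)) x"
     by (intro mult_left_mono elim) auto
    also have "... <= ennreal \<bar>h1 x\<bar> + ennreal ?c * (ennreal \<bar>h2 x\<bar> + ennreal \<bar>h3 x\<bar>)"
     unfolding e1 e2 e3 by (rule norm_powr_smear_split) (use th l t psi in auto)
    also have "... = ennreal (h1 x + ?c * (h2 x + h3 x))"
     using hp by (simp add: ennreal_mult ennreal_plus[symmetric] del: ennreal_plus) (simp add: ennreal_mult[symmetric] ennreal_plus[symmetric] del: ennreal_plus)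
    finally have "\<bar>norm x powr l * h x\<bar> <= h1 x + ?c * (h2 x + h3 x)" using hp by (subst (asm) ennreal_le_iff) auto
    then show ?case using hp by simp
   qed
   then show "AE x in lebesgue. \<bar>norm x powr l * h x\<bar> <= \<bar>h1 x\<bar> + \<bar>?c * (h2 x + h3 x)\<bar>"
    by (rule AE_completion)
  qed (use C1 C2 C3 a in auto)
  have "4 * (C3 * a * ?tau powr ?e + ?c * (4 * (C1 * a * ?tau powr ?e + C2 * a * ?tau powr ?e))) = B * ?tau powr ?e"
   by (simp add: B_def algebra_simps)
  moreover have "B * ?tau powr ?e <= 2 powr \<bar>?e\<bar> * B * (t + 1) powr ?e"
  proof -
   \<comment> \<open>The quotient lies between \<open>1/2\<close> and \<open>1\<close>, whence
     powers of \<open>max t 1\<close> and of \<open>t + 1\<close> are comparable for exponents of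
     either sign.\<close>
   have "(?tau / (t + 1)) powr e <= 2 powr \<bar>e\<bar>" for e
   proof (cases "e >= 0")
    case True
    have "(?tau / (t + 1)) powr e <= 1" using t True by (intro powr_le1) (auto simp: max_def)
    also have "1 <= (2::real) powr \<bar>e\<bar>" by (intro ge_one_powr_ge_zero) auto
    finally show ?thesis .
   next
    case False
    have "(?tau / (t + 1)) powr e <= (1 / 2) powr e" using t False by (intro powr_mono2') (auto simp: max_def field_simps)
    then show ?thesis using False by (simp only: powr_divide) (simp add: powr_minus_divide)
   qed
   note this[of ?e]
   then have "?tau powr ?e <= 2 powr \<bar>?e\<bar> * (t + 1) powr ?e" using t by (simp add: powr_divide field_simps)
   from mult_left_mono[OF this less_imp_le[OF B]] show ?thesis by (simp only: mult_ac)
  qed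
  ultimately have "4 * (C3 * a * ?tau powr ?e + ?c * (4 * (C1 * a * ?tau powr ?e + C2 * a * ?tau powr ?e))) <= 2 powr \<bar>?e\<bar> * B * (t + 1) powr ?e"
   by (simp only:)
  from order_trans[OF b ennreal_leI[OF this]] show "wLq_norm q l h <= ennreal (2 powr \<bar>?e\<bar> * B * (t + 1) powr ?e)"
   unfolding wLq_norm_def .
 qed
qed

section \<open>Pointwise domination of the solution\<close>

lemma heat_le_smear:
 assumes th: "0 < th" "th < 2"
 shows "\<exists>C>0. \<forall>t>0. \<forall>a\<in>borel_measurable borel. \<forall>h. (AE y in lborel. ennreal \<bar>h y\<bar> <= a y) -->
  (\<forall>x::real^'n. ennreal \<bar>heat th t h x\<bar> <= ennreal C * smear th t a x)"
proof -
 obtain C where C: "C > 0" "!!tau (x::real^'n). tau > 0 ==> \<bar>G th x tau\<bar> <= C * prof (tau powr (1/th)) th x"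
  using G_bound[OF th, where 'n='n] by blast
 show ?thesis
 proof (intro exI[of _ C] conjI allI impI ballI)
  fix t :: real and a :: "real^'n => ennreal" and h :: "real^'n => real" and x :: "real^'n"
  assume t: "t > 0" and [measurable]: "a \<in> borel_measurable borel" and h: "AE y in lborel. ennreal \<bar>h y\<bar> <= a y"
  let ?p = "%y. prof (t powr (1/th)) th (x - y)"
  have "ennreal \<bar>heat th t h x\<bar> <= (\<integral>\<^sup>+ y. ennreal (norm (G th (x - y) t * h y)) \<partial>lebesgue)"
   unfolding heat_def real_norm_def[symmetric] by (rule ennreal_norm_integral_le)
  also have "... = (\<I> y. norm (G th (x - y) t * h y))" by (rule nn_integral_completion)
  also have "... <= (\<N> y. ennreal C * (ennreal (?p y) * a y))"
  proof (rule nn_integral_mono_AE)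
   show "AE y in lborel. ennreal (norm (G th (x - y) t * h y)) <= ennreal C * (ennreal (?p y) * a y)"
    using h
   proof eventually_elim
    case (elim y)
    have "ennreal (norm (G th (x - y) t * h y)) = ennreal \<bar>G th (x - y) t\<bar> * ennreal \<bar>h y\<bar>"
     by (simp add: abs_mult ennreal_mult)
    also have "... <= ennreal (C * ?p y) * a y"
     by (intro mult_mono ennreal_leI C t elim) auto
    also have "... = ennreal C * (ennreal (?p y) * a y)"
     using C(1) by (simp add: ennreal_mult prof_nonneg mult.assoc)
    finally show ?case .
   qed
  qed
  also have "... = ennreal C * smear th t a x" unfolding smear_def by (rule nn_integral_cmult) measurable
  finally show "ennreal \<bar>heat th t h x\<bar> <= ..." .
 qed (rule C(1))
qed

lemma smear_cmult:
 assumes [measurable]: "a \<in> borel_measurable borel"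
 shows "smear th t (%y. c * a y) x = c * smear th t a x"
proof -
 have "smear th t (%y. c * a y) x = (\<N> y. c * (ennreal (prof (t powr (1/th)) th (x - y)) * a y))"
  by (simp add: smear_def mult_ac)
 also have "... = c * smear th t a x" unfolding smear_def by (rule nn_integral_cmult) measurable
 finally show ?thesis .
qed

text \<open>The source is treated as a linear perturbation with coefficient
  \<open>B * (s + 1) powr (- A)\<close>. Since \<open>A > 1\<close> this coefficient is integrable
  in time, and \<open>smear_gronwall\<close> removes the perturbation up to a constant.\<close>

lemma mild_solution_le_smear:
 fixes u f :: "real^'n => real => real" and \<phi> \<psi> :: "real^'n => real"
 assumes th: "0 < th" "th < 2" and A: "A > 1" and B: "B >= 0" and M: "M >= 0"
  and sol: "!!x t. t > 0 ==> u x t = heat th t \<phi> x + (LINT s:{0<..<t}|lebesgue. heat th (t - s) (%y. f y s) x)"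
  and um [measurable]: "!!t. t > 0 ==> (%x. u x t) \<in> borel_measurable borel"
  and fu: "!!s. s > 0 ==> AE y in lborel. \<bar>f y s\<bar> <= B * (s + 1) powr (- A) * \<bar>u y s\<bar>"
  and uM: "!!t. t > 0 ==> AE x in lborel. \<bar>u x t\<bar> <= M"
  and psi [measurable]: "\<psi> \<in> borel_measurable borel" and phi: "AE y in lborel. \<bar>\<phi> y\<bar> <= \<psi> y"
 shows "\<exists>C>0. \<forall>t>0. AE x in lborel. ennreal \<bar>u x t\<bar> <= ennreal C * smear th t (%y. ennreal (\<psi> y)) x"
proof -
 obtain C where C: "C > 0" and C': "\<forall>t>0. \<forall>a\<in>borel_measurable borel. \<forall>h. (AE y in lborel. ennreal \<bar>h y\<bar> <= a y) -->
  (\<forall>x::real^'n. ennreal \<bar>heat th t h x\<bar> <= ennreal C * smear th t a x)"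
  using heat_le_smear[OF th, where 'n='n] by (elim exE conjE)
 note H = C'[rule_format]
 show ?thesis
 proof (rule smear_gronwall[OF th(1) A, of C "C * B" M])
  fix t :: real and x :: "real^'n" assume t: "t > 0"
  let ?S = "%s. smear th (t - s) (%y. ennreal \<bar>u y s\<bar>) x"
  have "\<bar>u x t\<bar> <= \<bar>heat th t \<phi> x\<bar> + \<bar>LINT s:{0<..<t}|lebesgue. heat th (t - s) (%y. f y s) x\<bar>"
   unfolding sol[OF t] by (rule abs_triangle_ineq)
  then have "ennreal \<bar>u x t\<bar> <= ennreal \<bar>heat th t \<phi> x\<bar> + ennreal \<bar>LINT s:{0<..<t}|lebesgue. heat th (t - s) (%y. f y s) x\<bar>"
   by (simp add: ennreal_plus[symmetric] ennreal_leI del: ennreal_plus)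
  also have "... <= ennreal C * smear th t (%y. ennreal (\<psi> y)) x + tint t (%s. ennreal (C * B * (s + 1) powr (- A)) * ?S s)"
  proof (rule add_mono)
   show "ennreal \<bar>heat th t \<phi> x\<bar> <= ennreal C * smear th t (%y. ennreal (\<psi> y)) x"
    by (rule H[OF t]) (use phi in \<open>auto elim!: eventually_mono intro: ennreal_leI\<close>)
   have "ennreal \<bar>LINT s:{0<..<t}|lebesgue. heat th (t - s) (%y. f y s) x\<bar>
     <= (\<integral>\<^sup>+ s. ennreal (norm (indicator {0<..<t} s *\<^sub>R heat th (t - s) (%y. f y s) x)) \<partial>lebesgue)"
    unfolding set_lebesgue_integral_def real_norm_def[symmetric] by (rule ennreal_norm_integral_le)
   also have "... = (\<I> s. norm (indicator {0<..<t} s *\<^sub>R heat th (t - s) (%y. f y s) x))"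
    by (rule nn_integral_completion)
   also have "... <= tint t (%s. ennreal (C * B * (s + 1) powr (- A)) * ?S s)"
   proof (rule nn_integral_mono)
    fix s :: real
    show "ennreal (norm (indicator {0<..<t} s *\<^sub>R heat th (t - s) (%y. f y s) x)) <= ennreal (C * B * (s + 1) powr (- A)) * ?S s * indicator {0<..<t} s"
    proof (cases "s \<in> {0<..<t}")
     case True
     then have s: "s > 0" "t - s > 0" by auto
     have [measurable]: "(%y. u y s) \<in> borel_measurable borel" by (rule um[OF s(1)])
     have "ennreal \<bar>heat th (t - s) (%y. f y s) x\<bar> <= ennreal C * smear th (t - s) (%y. ennreal (B * (s + 1) powr (- A)) * ennreal \<bar>u y s\<bar>) x"
     proof (rule H[OF s(2)])
      show "AE y in lborel. ennreal \<bar>f y s\<bar> <= ennreal (B * (s + 1) powr (- A)) * ennreal \<bar>u y s\<bar>"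
       using fu[OF s(1)] by eventually_elim (use B in \<open>auto simp: ennreal_mult[symmetric] intro!: ennreal_leI\<close>)
     qed measurable
     also have "... = ennreal (C * B * (s + 1) powr (- A)) * ?S s"
      using B C by (subst smear_cmult) (auto simp: ennreal_mult mult.assoc)
     finally show ?thesis using True by simp
    qed simp
   qed
   finally show "ennreal \<bar>LINT s:{0<..<t}|lebesgue. heat th (t - s) (%y. f y s) x\<bar> <= tint t (%s. ennreal (C * B * (s + 1) powr (- A)) * ?S s)" .
  qed
  finally show "ennreal \<bar>u x t\<bar> <= ennreal C * smear th t (%y. ennreal (\<psi> y)) x + tint t (%s. ennreal (C * B * (s + 1) powr (- A)) * ?S s)" .
 next
  fix t :: real assume "t > 0"
  then show "AE x in lborel. ennreal \<bar>u x t\<bar> <= ennreal M" using uM[of t] by (auto elim!: eventually_mono intro: ennreal_leI)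
 qed (use C B M in auto)
qed

lemma one_plus_powr_le:
 assumes "0 <= l" "l <= m" "0 <= (r::real)"
 shows "(1 + r) powr l <= 2 powr m * (1 + r powr m)"
 using powr_mono[of l m "1 + r"] add_powr_le[of 1 r m] assms by simp

text \<open>One factor of the power nonlinearity is kept and the other \<open>p - 1\<close> are
  estimated by the assumed supremum bound; this produces the coefficient
  \<open>(s + 1) powr (- A)\<close> with \<open>A > 1\<close>. The solution is then dominated by the
  profile acting on the initial datum, and only weighted norms of the datum remain. The restriction
  on \<open>l\<close> implies \<open>l <= N + th\<close>, so the weight in the supremum norm never
  exceeds the one that is assumed.\<close>

lemma weighted_decay_if_bounded_decay:
 fixes u f :: "real^'n => real => real" and \<phi> :: "real^'n => real"
 assumes th: "0 < th" "th < 2" and K: "0 <= K" and p: "p > 1 + th / real CARD('n)"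
  and sol: "!!x t. t > 0 ==> u x t = heat th t \<phi> x + (LINT s:{0<..<t}|lebesgue. heat th (t - s) (%y. f y s) x)"
  and um: "!!t. t > 0 ==> (%x. u x t) \<in> borel_measurable borel"
  and C: "C >= 0" and fu: "!!x t. t > 0 ==> \<bar>f x t\<bar> <= C * \<bar>u x t\<bar> powr p"
  and phi1: "\<phi> \<in> wLq 1 K" and phi2: "\<phi> \<in> wLq \<infinity> (min (real CARD('n) + th) K)"
  and sup: "(SUP t\<in>{0<..}. ennreal ((t + 1) powr (real CARD('n) / th)) * Lq_norm \<infinity> (%x. u x t)) < \<infinity>"
 shows "weighted_decay th K u"
proof -
 let ?N = "real CARD('n)"
 let ?k = "min (?N + th) K" and ?A = "?N * (p - 1) / th"
 have N: "?N >= 1" by simp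
 have A: "?A > 1" using p th N by (simp add: field_simps)
 have p1: "p > 1" using p th N by (smt (verit) divide_pos_pos)
 obtain M where M: "M > 0" "!!t. t > 0 ==> Lq_norm \<infinity> (%x. u x t) <= ennreal (M / (t + 1) powr (?N / th))"
  using SUP_ennreal_finite_imp_bound[OF sup] by auto
 have uM: "AE x in lborel. \<bar>u x t\<bar> <= M * (t + 1) powr (- (?N / th))" if t: "t > 0" for t
 proof -
  have "AE x in lebesgue. \<bar>u x t\<bar> <= M / (t + 1) powr (?N / th)"
   by (rule Lq_norm_top_AE[OF _ M(2)[OF t]]) (use M(1) um[OF t] in \<open>auto intro: measurable_completion\<close>)
  then show ?thesis unfolding AE_completion_iff by (simp add: powr_minus_divide)
 qed
 have phim: "\<phi> \<in> borel_measurable lebesgue" using phi1 by (simp add: wLq_def Lq_def)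
 \<comment> \<open>A Borel representative of the Lebesgue measurable datum, as the Tonelli arguments
   work with \<open>lborel\<close>.\<close>
 obtain \<phi>0 where p0 [measurable]: "\<phi>0 \<in> borel_measurable borel" and p0e: "AE y in lborel. \<phi> y = \<phi>0 y"
  using completion_ex_borel_measurable_real[OF phim] by auto
 have "\<exists>D>0. \<forall>t>0. AE x in lborel. ennreal \<bar>u x t\<bar> <= ennreal D * smear th t (%y. ennreal \<bar>\<phi>0 y\<bar>) x"
 proof (rule mild_solution_le_smear[OF th A, of "C * M powr (p - 1)" M u \<phi> f])
  fix s :: real assume s: "s > 0"
  show "AE y in lborel. \<bar>f y s\<bar> <= C * M powr (p - 1) * (s + 1) powr (- ?A) * \<bar>u y s\<bar>"
   using uM[OF s]
  proof eventually_elim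
   case (elim y)
   have "\<bar>f y s\<bar> <= C * (\<bar>u y s\<bar> powr (p - 1) * \<bar>u y s\<bar>)"
    using fu[OF s, of y] powr_add[of "\<bar>u y s\<bar>" "p - 1" 1] by simp
   also have "... <= C * ((M * (s + 1) powr (- (?N / th))) powr (p - 1) * \<bar>u y s\<bar>)"
    using elim C p1 by (intro mult_left_mono mult_right_mono powr_mono2) auto
   also have "(M * (s + 1) powr (- (?N / th))) powr (p - 1) = M powr (p - 1) * (s + 1) powr (- ?A)"
    by (simp only: powr_mult powr_powr) simp
   finally show ?case by (simp add: mult.assoc)
  qed
 next
  fix t :: real assume t: "t > 0"
  have "M * (t + 1) powr (- (?N / th)) <= M * 1"
   using t th M(1) powr_mono[of "- (?N / th)" 0 "t + 1"] by (intro mult_left_mono) auto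
  then show "AE x in lborel. \<bar>u x t\<bar> <= M" using uM[OF t] by (auto elim!: eventually_mono)
 next
  show "AE y in lborel. \<bar>\<phi> y\<bar> <= \<bar>\<phi>0 y\<bar>" using p0e by eventually_elim simp
 qed (use sol um C M in auto)
 then obtain D where D: "D > 0" "!!t. t > 0 ==> AE x in lborel. ennreal \<bar>u x t\<bar> <= ennreal D * smear th t (%y. ennreal \<bar>\<phi>0 y\<bar>) x"
  by blast
 let ?\<psi> = "%y. D * \<bar>\<phi>0 y\<bar>"
 have uD: "AE x in lborel. ennreal \<bar>u x t\<bar> <= smear th t (%y. ennreal (?\<psi> y)) x" if "t > 0" for t
  using D(2)[OF that] D(1) smear_cmult[of "%y. ennreal \<bar>\<phi>0 y\<bar>" th t "ennreal D"] by (simp add: ennreal_mult)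
 have "Lq_norm 1 \<phi> + wLq_norm 1 K \<phi> < \<infinity>" using phi1 by (simp add: wLq_def)
 then have L1: "(\<I> y. \<bar>\<phi>0 y\<bar>) + (\<I> y. norm y powr K * \<bar>\<phi>0 y\<bar>) < \<infinity>"
 proof -
  have "(\<integral>\<^sup>+ y. ennreal \<bar>\<phi> y\<bar> \<partial>lebesgue) = (\<I> y. \<bar>\<phi>0 y\<bar>)"
   unfolding nn_integral_completion by (rule nn_integral_cong_AE) (use p0e in \<open>eventually_elim, simp\<close>)
  moreover have "(\<integral>\<^sup>+ y. ennreal \<bar>norm y powr K * \<phi> y\<bar> \<partial>lebesgue) = (\<I> y. norm y powr K * \<bar>\<phi>0 y\<bar>)"
   unfolding nn_integral_completion by (rule nn_integral_cong_AE) (use p0e in \<open>eventually_elim, simp add: abs_mult\<close>)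
  ultimately show ?thesis using \<open>Lq_norm 1 \<phi> + wLq_norm 1 K \<phi> < \<infinity>\<close> by (simp add: wLq_norm_def Lq_norm_1)
 qed
 have "Lq_norm \<infinity> \<phi> + wLq_norm \<infinity> ?k \<phi> < \<infinity>" using phi2 by (simp add: wLq_def)
 then obtain b1 b2 where b: "b1 >= 0" "b2 >= 0" "Lq_norm \<infinity> \<phi> = ennreal b1" "wLq_norm \<infinity> ?k \<phi> = ennreal b2"
  by (cases "Lq_norm \<infinity> \<phi>"; cases "wLq_norm \<infinity> ?k \<phi>") auto
 have "AE y in lebesgue. \<bar>\<phi> y\<bar> <= b1" using b by (intro Lq_norm_top_AE phim) auto
 moreover have "AE y in lebesgue. \<bar>norm y powr ?k * \<phi> y\<bar> <= b2" 
  using b phim by (intro Lq_norm_top_AE) (auto simp: wLq_norm_def)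
 ultimately have Linf: "AE y in lborel. \<bar>\<phi>0 y\<bar> <= b1 \<and> norm y powr ?k * \<bar>\<phi>0 y\<bar> <= b2"
  unfolding AE_completion_iff using p0e by eventually_elim (simp add: abs_mult)
 show ?thesis
  unfolding weighted_decay_def Let_def
 proof (intro allI impI, elim conjE)
  fix q :: ennreal and l :: real
  assume q: "1 <= q" and l: "0 <= l" "l <= K" "l < th + ?N * (1 - recip q)"
  have rq: "0 <= recip q" "recip q <= 1" using recip_bounds[OF q] by auto
  have "?N * (1 - recip q) <= ?N * 1" using rq by (intro mult_left_mono) auto
  with l(3) have "l <= ?N + th" by argo
  then have lk: "l <= ?k" using l(2) by simp
  have "(\<I> (y::real^'n). (1 + norm y) powr l * ?\<psi> y) <= (\<N> y. ennreal (D * 2 powr K) * (ennreal \<bar>\<phi>0 y\<bar> + ennreal (norm y powr K * \<bar>\<phi>0 y\<bar>)))"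
  proof (intro nn_integral_mono)
   fix y :: "real^'n"
   have "(1 + norm y) powr l * ?\<psi> y <= (2 powr K * (1 + norm y powr K)) * ?\<psi> y"
    using l D(1) by (intro mult_right_mono one_plus_powr_le) auto
   also have "... = D * 2 powr K * (\<bar>\<phi>0 y\<bar> + norm y powr K * \<bar>\<phi>0 y\<bar>)" by (simp add: algebra_simps)
   finally have "ennreal ((1 + norm y) powr l * ?\<psi> y) <= ennreal (D * 2 powr K * (\<bar>\<phi>0 y\<bar> + norm y powr K * \<bar>\<phi>0 y\<bar>))" by (rule ennreal_leI)
   also have "... = ennreal (D * 2 powr K) * (ennreal \<bar>\<phi>0 y\<bar> + ennreal (norm y powr K * \<bar>\<phi>0 y\<bar>))"
    using D(1) by (subst ennreal_mult) auto
   finally show "ennreal ((1 + norm y) powr l * ?\<psi> y) <= ..." .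
  qed
  also have "... = ennreal (D * 2 powr K) * ((\<I> y. \<bar>\<phi>0 y\<bar>) + (\<I> y. norm y powr K * \<bar>\<phi>0 y\<bar>))"
   by (simp add: nn_integral_cmult nn_integral_add)
  also have "... < \<infinity>" using L1 by (auto simp: ennreal_mult_less_top)
  finally obtain a1 where a1: "(\<I> (y::real^'n). (1 + norm y) powr l * ?\<psi> y) = ennreal a1" "a1 >= 0"
   by (cases "\<integral>\<^sup>+ (y::real^'n). ennreal ((1 + norm y) powr l * ?\<psi> y) \<partial>lborel") auto
  \<comment> \<open>One number for both the weighted integral and the weighted supremum of the
    datum, made positive by the entry \<open>1\<close>.\<close>
  define a where "a = max 1 (max a1 (D * 2 powr ?k * (b1 + b2)))"
  have a: "a > 0" "(\<I> (y::real^'n). (1 + norm y) powr l * ?\<psi> y) <= ennreal a"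
   unfolding a1 by (auto simp: a_def intro!: ennreal_leI)
  have a2: "AE y in lborel. (1 + norm y) powr l * ?\<psi> y <= a"
   using Linf
  proof eventually_elim
   case (elim y)
   have "(1 + norm y) powr l * ?\<psi> y <= (2 powr ?k * (1 + norm y powr ?k)) * ?\<psi> y"
    using l(1) lk D(1) by (intro mult_right_mono one_plus_powr_le) auto
   also have "... = D * 2 powr ?k * (\<bar>\<phi>0 y\<bar> + norm y powr ?k * \<bar>\<phi>0 y\<bar>)" by (simp only: algebra_simps)
   also have "... <= D * 2 powr ?k * (b1 + b2)" using elim D(1) by (intro mult_left_mono add_mono) auto
   finally show ?case by (simp add: a_def)
  qed
  have psm: "?\<psi> \<in> borel_measurable borel" by measurable
  obtain X where X: "X > 0" and X': "\<forall>t>0. \<forall>h\<in>borel_measurable lebesgue. (AE x in lborel. ennreal \<bar>h x\<bar> <= smear th t (%y. ennreal (?\<psi> y)) x) -->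
   wLq_norm q l h <= ennreal (X * (t + 1) powr (l / th - ?N / th * (1 - recip q)))"
   using smear_Lq_bound[OF th(1) q l(1,3) psm _ a a2] D(1) by auto
  have "(SUP t\<in>{0<..}. ennreal ((t + 1) powr (?N / th * (1 - recip q) - l / th)) * wLq_norm q l (%x. u x t)) <= ennreal X"
  proof (rule SUP_least)
   fix t :: real assume "t \<in> {0<..}"
   then have t: "t > 0" by simp
   have "ennreal ((t + 1) powr (?N / th * (1 - recip q) - l / th)) * wLq_norm q l (%x. u x t)
    <= ennreal ((t + 1) powr (?N / th * (1 - recip q) - l / th)) * ennreal (X * (t + 1) powr (l / th - ?N / th * (1 - recip q)))"
    by (intro mult_left_mono X'[rule_format, OF t _ uD[OF t]]) (use um[OF t] in \<open>auto intro: measurable_completion\<close>)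
   also have "... = ennreal (X * ((t + 1) powr (?N / th * (1 - recip q) - l / th) * (t + 1) powr (l / th - ?N / th * (1 - recip q))))"
    using X by (simp add: ennreal_mult[symmetric] mult_ac)
   also have "... = ennreal X" using t by (simp only: powr_add[symmetric]) simp
   finally show "ennreal ((t + 1) powr (?N / th * (1 - recip q) - l / th)) * wLq_norm q l (%x. u x t) <= ennreal X" .
  qed
  then show "(SUP t\<in>{0<..}. ennreal ((t + 1) powr (?N / th * (1 - recip q) - l / th)) * wLq_norm q l (%x. u x t)) < \<infinity>"
   by (rule le_less_trans) simp
 qed
qed

section \<open>The asymptotic expansion\<close>

text \<open>The multi-indices are grouped by their order and each group is summed by
  \<open>sum_g_eq_J\<close>. Orders are integers, so order at most \<open>K\<close> and order at
  most the floor of \<open>K\<close> mean the same.\<close>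

lemma taylor_part_eq:
 fixes x y :: "real^'n"
 assumes "0 < th" "th <= 2" "0 <= K" "t > -1"
 shows "taylor_part th K t s x y =
  (\<Sum>m = 0..nat \<lfloor>K / th\<rfloor>. \<Sum>\<alpha> | real (mi_abs \<alpha>) <= K. ((s + 1) ^ m * g th \<alpha> m x t) * mi_power y \<alpha>)"
 unfolding taylor_part_def atLeast0AtMost
proof (intro sum.cong refl)
 fix m
 let ?S = "{\<alpha> :: 'n => nat. real (mi_abs \<alpha>) <= K}"
 let ?h = "%\<alpha>. ((s + 1) ^ m * g th \<alpha> m x t) * mi_power y \<alpha>"
 have "(\<Sum>j\<le>nat \<lfloor>K\<rfloor>. (s + 1) ^ m * ((-1) ^ m / (fact m * fact j)) * J th j m x y (t + 1))
   = (\<Sum>j\<le>nat \<lfloor>K\<rfloor>. \<Sum>\<alpha> | \<alpha> \<in> ?S \<and> mi_abs \<alpha> = j. ?h \<alpha>)"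
 proof (intro sum.cong refl)
  fix j assume "j \<in> {..nat \<lfloor>K\<rfloor>}"
  then have "{\<alpha>. \<alpha> \<in> ?S \<and> mi_abs \<alpha> = j} = {\<alpha>. mi_abs \<alpha> = j}" using assms(3) by auto linarith
  then have "(\<Sum>\<alpha> | \<alpha> \<in> ?S \<and> mi_abs \<alpha> = j. ?h \<alpha>) = (s + 1) ^ m * (\<Sum>\<alpha> | mi_abs \<alpha> = j. mi_power y \<alpha> * g th \<alpha> m x t)"
   by (simp add: sum_distrib_left mult_ac)
  then show "(s + 1) ^ m * ((-1) ^ m / (fact m * fact j)) * J th j m x y (t + 1) = (\<Sum>\<alpha> | \<alpha> \<in> ?S \<and> mi_abs \<alpha> = j. ?h \<alpha>)"
   unfolding sum_g_eq_J[OF assms(1,2,4)] by (simp only: mult.assoc)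
 qed
 also have "... = sum ?h ?S"
 proof (rule sum.group[OF finite_mi_abs_le])
  show "mi_abs ` ?S \<subseteq> {..nat \<lfloor>K\<rfloor>}" by (auto intro: le_nat_floor)
 qed auto
 finally show "(\<Sum>j\<le>nat \<lfloor>K\<rfloor>. (s + 1) ^ m * ((-1) ^ m / (fact m * fact j)) * J th j m x y (t + 1)) = sum ?h ?S" .
qed

lemma mi_power_measurable [measurable]: "(%y. mi_power y \<alpha>) \<in> borel_measurable borel"
 unfolding mi_power_def by measurable

lemma abs_mi_power_le: "\<bar>mi_power y \<alpha>\<bar> <= norm y ^ mi_abs \<alpha>"
proof -
 have "\<bar>mi_power y \<alpha>\<bar> = (\<Prod>i\<in>UNIV. \<bar>y $ i\<bar> ^ \<alpha> i)" by (simp add: mi_power_def abs_prod power_abs)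
 also have "... <= (\<Prod>i\<in>UNIV. norm y ^ \<alpha> i)" by (intro prod_mono conjI power_mono component_le_norm_cart) auto
 also have "... = norm y ^ mi_abs \<alpha>" by (simp add: mi_abs_def power_sum)
 finally show ?thesis .
qed

text \<open>The radius is at least \<open>1\<close> because \<open>s\<close> is nonnegative, so
  monomials of every lower order are controlled by the one power \<open>K\<close>.\<close>

lemma abs_mi_power_le_rad:
 assumes "0 < th" "0 <= s" "real (mi_abs \<alpha>) <= K"
 shows "\<bar>mi_power y \<alpha>\<bar> <= rad th s y powr K"
proof -
 have "1 <= (s + 1) powr (1/th)" using assms by (intro ge_one_powr_ge_zero) auto
 then have r: "1 <= rad th s y" "norm y <= rad th s y" by (auto simp: rad_def add_increasing)
 have "\<bar>mi_power y \<alpha>\<bar> <= norm y ^ mi_abs \<alpha>" by (rule abs_mi_power_le)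
 also have "... <= rad th s y ^ mi_abs \<alpha>" using r by (intro power_mono) auto
 also have "... = rad th s y powr real (mi_abs \<alpha>)" using r by (simp add: powr_realpow)
 also have "... <= rad th s y powr K" using r assms by (intro powr_mono) auto
 finally show ?thesis .
qed

lemma borel_imp_lebesgue: "(h :: 'a::euclidean_space => real) \<in> borel_measurable borel ==> h \<in> borel_measurable lebesgue"
 by (intro measurable_completion) simp

lemma moment_bound:
 fixes h :: "real^'n => real"
 assumes "0 < th" "0 <= s" "real (mi_abs \<alpha>) <= K" and [measurable]: "h \<in> borel_measurable borel"
  and I: "(\<I> y. rad th s y powr K * \<bar>h y\<bar>) <= ennreal b" "b >= 0"
 shows "integrable lebesgue (%y. mi_power y \<alpha> * h y)" "\<bar>moment \<alpha> h\<bar> <= b"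
proof -
 have "(\<integral>\<^sup>+ y. ennreal (norm (mi_power y \<alpha> * h y)) \<partial>lebesgue) = (\<I> y. norm (mi_power y \<alpha> * h y))"
  by (rule nn_integral_completion)
 also have "... <= (\<I> y. rad th s y powr K * \<bar>h y\<bar>)"
  unfolding real_norm_def abs_mult
  by (intro nn_integral_mono ennreal_leI mult_right_mono abs_mi_power_le_rad assms) auto
 also note I(1)
 finally have b: "(\<integral>\<^sup>+ y. ennreal (norm (mi_power y \<alpha> * h y)) \<partial>lebesgue) <= ennreal b" .
 show "\<bar>moment \<alpha> h\<bar> <= b"
  using norm_integral_le_nn_integral[OF b I(2)] by (simp add: moment_def)
 show "integrable lebesgue (%y. mi_power y \<alpha> * h y)"
 proof (rule integrableI_bounded)
  show "(%y. mi_power y \<alpha> * h y) \<in> borel_measurable lebesgue" by (rule borel_imp_lebesgue) measurable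
  show "(\<integral>\<^sup>+ y. ennreal (norm (mi_power y \<alpha> * h y)) \<partial>lebesgue) < \<infinity>" using b by (rule le_less_trans) simp
 qed
qed

lemma integral_taylor_part:
 fixes h :: "real^'n => real"
 assumes th: "0 < th" "th <= 2" and K: "0 <= K" and t: "t > -1" and s: "0 <= s" and h: "h \<in> borel_measurable borel"
  and I: "(\<I> y. rad th s y powr K * \<bar>h y\<bar>) <= ennreal b" "b >= 0"
 shows "has_bochner_integral lebesgue (%y. taylor_part th K t s x y * h y)
  (\<Sum>m = 0..nat \<lfloor>K / th\<rfloor>. \<Sum>\<alpha> | real (mi_abs \<alpha>) <= K. ((s + 1) ^ m * moment \<alpha> h) * g th \<alpha> m x t)"
proof -
 have "has_bochner_integral lebesgue (%y. \<Sum>m = 0..nat \<lfloor>K / th\<rfloor>. \<Sum>\<alpha> | real (mi_abs \<alpha>) <= K. ((s + 1) ^ m * g th \<alpha> m x t) * (mi_power y \<alpha> * h y))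
  (\<Sum>m = 0..nat \<lfloor>K / th\<rfloor>. \<Sum>\<alpha> | real (mi_abs \<alpha>) <= K. ((s + 1) ^ m * g th \<alpha> m x t) * moment \<alpha> h)"
 proof (intro has_bochner_integral_sum has_bochner_integral_mult_right)
  fix m and \<alpha> :: "'n => nat" assume "\<alpha> \<in> {\<alpha>. real (mi_abs \<alpha>) <= K}"
  then show "has_bochner_integral lebesgue (%y. mi_power y \<alpha> * h y) (moment \<alpha> h)"
   unfolding moment_def by (intro has_bochner_integral_integrable moment_bound(1)[OF th(1) s _ h I]) simp
 qed
 then show ?thesis
  unfolding taylor_part_eq[OF th K t] by (simp add: sum_distrib_right sum_distrib_left mult_ac)
qed

lemma powr_le_powr_abs:
 assumes "0 < s" "s < t"
 shows "(s + 1) powr e <= (t + 1) powr \<bar>e::real\<bar>"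
proof -
 have "(s + 1) powr e <= (s + 1) powr \<bar>e\<bar>" using assms by (intro powr_mono) auto
 also have "... <= (t + 1) powr \<bar>e\<bar>" using assms by (intro powr_mono2) auto
 finally show ?thesis .
qed

section \<open>The remainder as an integral of the data\<close>

text \<open>The decay of the source in the form in which it is used: a weighted integral
  \<open>I\<close> and a weighted supremum \<open>S\<close>, with the single radius
  \<open>rad\<close> in place of the separate weights in space and time. The data are Borel, the
  source jointly in both variables, so that integrals can be exchanged.\<close>

locale remainder =
 fixes th K A B :: real and \<phi> :: "real^'n => real" and f :: "real^'n => real => real"
 assumes th: "0 < th" "th < 2" and K: "0 <= K" and B: "0 <= B"
  and ph [measurable]: "\<phi> \<in> borel_measurable borel"
  and fm: "(%p. f (fst p) (snd p)) \<in> borel_measurable (borel \<Otimes>\<^sub>M borel)"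
  and I0: "(\<I> y. rad th 0 y powr K * \<bar>\<phi> y\<bar>) <= ennreal B"
  and I: "!!s. s > 0 ==> (\<I> y. rad th s y powr K * \<bar>f y s\<bar>) <= ennreal (B * (s + 1) powr (K / th - A))"
  and S: "!!s. s > 0 ==> AE y in lborel. rad th s y powr K * \<bar>f y s\<bar> <= B * s powr (- (real CARD('n) / th)) * (s + 1) powr (K / th - A)"
begin

lemma fm2 [measurable]: "a \<in> borel_measurable M ==> b \<in> borel_measurable M ==> (%x. f (a x) (b x)) \<in> borel_measurable M"
 using measurable_compose[OF measurable_Pair fm, of a M b] by simp

lemma moment_set_integrable:
 assumes al: "real (mi_abs \<alpha>) <= K"
 shows "set_integrable lebesgue {0<..<t} (%s. (s + 1) ^ m * moment \<alpha> (%y. f y s))"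
proof -
 let ?e = "K / th - A"
 \<comment> \<open>Written over \<open>lborel\<close>, the moment is visibly a measurable function
   of \<open>s\<close>.\<close>
 have m: "moment \<alpha> (%y. f y s) = (LINT y|lborel. mi_power y \<alpha> * f y s)" for s
  unfolding moment_def by (rule integral_completion) measurable
 have [measurable]: "(%s. moment \<alpha> (%y. f y s)) \<in> borel_measurable borel"
  unfolding m by measurable
 let ?c = "(t + 1) ^ m * (B * (t + 1) powr \<bar>?e\<bar>)"
 show ?thesis
  unfolding set_integrable_def
 proof (rule integrableI_bounded)
  show "(%s. indicator {0<..<t} s *\<^sub>R ((s + 1) ^ m * moment \<alpha> (%y. f y s))) \<in> borel_measurable lebesgue"
   by (rule borel_imp_lebesgue) measurable
  have "(\<integral>\<^sup>+ s. ennreal (norm (indicator {0<..<t} s *\<^sub>R ((s + 1) ^ m * moment \<alpha> (%y. f y s)))) \<partial>lebesgue) <= (\<integral>\<^sup>+ s. ennreal ?c * indicator {0<..<t} s \<partial>lebesgue)"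
  proof (rule nn_integral_mono)
   fix s :: real
   show "ennreal (norm (indicator {0<..<t} s *\<^sub>R ((s + 1) ^ m * moment \<alpha> (%y. f y s)))) <= ennreal ?c * indicator {0<..<t} s"
   proof (cases "s \<in> {0<..<t}")
    case True
    then have s: "s > 0" "s < t" by auto
    have "\<bar>moment \<alpha> (%y. f y s)\<bar> <= B * (s + 1) powr ?e"
     using s B by (intro moment_bound(2)[OF th(1) _ al _ I]) auto
    also have "... <= B * (t + 1) powr \<bar>?e\<bar>" using s B by (intro mult_left_mono powr_le_powr_abs) auto
    finally have "norm ((s + 1) ^ m * moment \<alpha> (%y. f y s)) <= ?c"
     unfolding real_norm_def abs_mult using s B by (intro mult_mono) (auto simp: power_mono)
    then show ?thesis using True by (simp add: ennreal_leI)
   qed simp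
  qed
  also have "... = ennreal ?c * emeasure lebesgue {0<..<t}" by (rule nn_integral_cmult_indicator) simp
  also have "... < \<infinity>" by (cases "0 <= t") (auto simp: ennreal_mult_less_top)
  finally show "(\<integral>\<^sup>+ s. ennreal (norm (indicator {0<..<t} s *\<^sub>R ((s + 1) ^ m * moment \<alpha> (%y. f y s)))) \<partial>lebesgue) < \<infinity>" .
 qed
qed

text \<open>Integrated against the data, the Taylor part of the kernel reproduces \<open>U0\<close>
  exactly: the powers of \<open>y\<close> become moments and the powers of \<open>s + 1\<close> the
  weights in time. Subtracting it under the integral leaves \<open>rem_kernel\<close>. The
  assumptions \<open>G1\<close> to \<open>G3\<close> make the subtraction of the integrals
  legitimate.\<close>

lemma solution_minus_U0_le:
 assumes t: "t > 0"
  and G1: "integrable lebesgue (%y. G th (x - y) t * \<phi> y)"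
  and G2: "AE s in lebesgue. s \<in> {0<..<t} --> integrable lebesgue (%y. G th (x - y) (t - s) * f y s)"
  and G3: "set_integrable lebesgue {0<..<t} (%s. heat th (t - s) (%y. f y s) x)"
 shows "ennreal \<bar>heat th t \<phi> x + (LINT s:{0<..<t}|lebesgue. heat th (t - s) (%y. f y s) x) - U0 th K \<phi> f x t\<bar>
  <= (\<I> y. \<bar>rem_kernel th K t 0 x y\<bar> * \<bar>\<phi> y\<bar>)
   + tint t (%s. (\<I> y. \<bar>rem_kernel th K t s x y\<bar> * \<bar>f y s\<bar>))"
proof -
 note th' = th(1) less_imp_le[OF th(2)]
 have t1: "t > -1" using t by simp
 have fs: "(%y. f y s) \<in> borel_measurable borel" for s by measurable
 let ?S = "{\<alpha> :: 'n => nat. real (mi_abs \<alpha>) <= K}" and ?M = "nat \<lfloor>K / th\<rfloor>"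
 define T where "T = (%s. LINT y|lebesgue. taylor_part th K t s x y * f y s)"
 define T0 where "T0 = (LINT y|lebesgue. taylor_part th K t 0 x y * \<phi> y)"
 have b0: "has_bochner_integral lebesgue (%y. taylor_part th K t 0 x y * \<phi> y)
  (\<Sum>m = 0..?M. \<Sum>\<alpha>\<in>?S. ((0 + 1) ^ m * moment \<alpha> \<phi>) * g th \<alpha> m x t)"
  by (rule integral_taylor_part[OF th' K t1 order_refl ph I0 B])
 have bs: "has_bochner_integral lebesgue (%y. taylor_part th K t s x y * f y s)
  (\<Sum>m = 0..?M. \<Sum>\<alpha>\<in>?S. ((s + 1) ^ m * moment \<alpha> (%y. f y s)) * g th \<alpha> m x t)" if "s > 0" for s
  using B that by (intro integral_taylor_part[OF th' K t1 _ fs I[OF that]]) auto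
 have T0: "T0 = (\<Sum>m = 0..?M. \<Sum>\<alpha>\<in>?S. moment \<alpha> \<phi> * g th \<alpha> m x t)"
  unfolding T0_def has_bochner_integral_integral_eq[OF b0] by simp
 let ?mm = "%m \<alpha> s. indicator {0<..<t} s *\<^sub>R ((s + 1) ^ m * moment \<alpha> (%y. f y s))"
 have hT: "has_bochner_integral lebesgue (%s. \<Sum>m = 0..?M. \<Sum>\<alpha>\<in>?S. ?mm m \<alpha> s * g th \<alpha> m x t)
  (\<Sum>m = 0..?M. \<Sum>\<alpha>\<in>?S. (LINT s|lebesgue. ?mm m \<alpha> s) * g th \<alpha> m x t)"
 proof (intro has_bochner_integral_sum has_bochner_integral_mult_left has_bochner_integral_integrable)
  fix m and \<alpha> :: "'n => nat" assume "\<alpha> \<in> ?S"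
  then show "integrable lebesgue (?mm m \<alpha>)"
   using moment_set_integrable[of \<alpha> t m] by (simp add: set_integrable_def)
 qed
 have eT: "(%s. \<Sum>m = 0..?M. \<Sum>\<alpha>\<in>?S. ?mm m \<alpha> s * g th \<alpha> m x t) = (%s. indicator {0<..<t} s *\<^sub>R T s)"
 proof
  fix s show "(\<Sum>m = 0..?M. \<Sum>\<alpha>\<in>?S. ?mm m \<alpha> s * g th \<alpha> m x t) = indicator {0<..<t} s *\<^sub>R T s"
   using has_bochner_integral_integral_eq[OF bs, of s] by (cases "s \<in> {0<..<t}") (auto simp: T_def)
 qed
 have U: "U0 th K \<phi> f x t = T0 + (LINT s:{0<..<t}|lebesgue. T s)"
  unfolding U0_def T0 set_lebesgue_integral_def using has_bochner_integral_integral_eq[OF hT, unfolded eT]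
  by (simp add: distrib_right sum.distrib)
 have intT: "set_integrable lebesgue {0<..<t} T"
  using hT unfolding eT set_integrable_def by (rule integrable.intros)
 have e1: "heat th t \<phi> x - T0 = (LINT y|lebesgue. rem_kernel th K t 0 x y * \<phi> y)"
 proof -
  have "heat th t \<phi> x - T0 = (LINT y|lebesgue. G th (x - y) t * \<phi> y - taylor_part th K t 0 x y * \<phi> y)"
   unfolding heat_def T0_def using b0 G1 by (intro Bochner_Integration.integral_diff[symmetric]) (auto simp: integrable.intros)
  then show ?thesis by (simp add: rem_kernel_def left_diff_distrib)
 qed
 have e2: "heat th (t - s) (%y. f y s) x - T s = (LINT y|lebesgue. rem_kernel th K t s x y * f y s)"
  if "s > 0" "integrable lebesgue (%y. G th (x - y) (t - s) * f y s)" for s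
 proof -
  have "heat th (t - s) (%y. f y s) x - T s = (LINT y|lebesgue. G th (x - y) (t - s) * f y s - taylor_part th K t s x y * f y s)"
   unfolding heat_def T_def using bs[OF that(1)] that(2) by (intro Bochner_Integration.integral_diff[symmetric]) (auto simp: integrable.intros)
  then show ?thesis by (simp add: rem_kernel_def left_diff_distrib)
 qed
 have e3: "(LINT s:{0<..<t}|lebesgue. heat th (t - s) (%y. f y s) x) - (LINT s:{0<..<t}|lebesgue. T s) = (LINT s:{0<..<t}|lebesgue. heat th (t - s) (%y. f y s) x - T s)"
  by (rule set_integral_diff(2)[OF G3 intT, symmetric])
 let ?A = "heat th t \<phi> x - T0" and ?B = "LINT s:{0<..<t}|lebesgue. heat th (t - s) (%y. f y s) x - T s"
 have kb: "ennreal \<bar>LINT y|lebesgue. rem_kernel th K t s x y * h y\<bar> <= (\<I> y. \<bar>rem_kernel th K t s x y\<bar> * \<bar>h y\<bar>)" for s h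
  using ennreal_norm_integral_le[of lebesgue "%y. rem_kernel th K t s x y * h y"]
  by (simp add: nn_integral_completion abs_mult)
 have "heat th t \<phi> x + (LINT s:{0<..<t}|lebesgue. heat th (t - s) (%y. f y s) x) - U0 th K \<phi> f x t = ?A + ?B"
  unfolding U e3[symmetric] by simp
 then have "ennreal \<bar>heat th t \<phi> x + (LINT s:{0<..<t}|lebesgue. heat th (t - s) (%y. f y s) x) - U0 th K \<phi> f x t\<bar> <= ennreal \<bar>?A\<bar> + ennreal \<bar>?B\<bar>"
  by (simp add: ennreal_plus[symmetric] ennreal_leI del: ennreal_plus)
 also have "... <= (\<I> y. \<bar>rem_kernel th K t 0 x y\<bar> * \<bar>\<phi> y\<bar>)
   + tint t (%s. (\<I> y. \<bar>rem_kernel th K t s x y\<bar> * \<bar>f y s\<bar>))"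
 proof (rule add_mono)
  show "ennreal \<bar>?A\<bar> <= (\<I> y. \<bar>rem_kernel th K t 0 x y\<bar> * \<bar>\<phi> y\<bar>)" unfolding e1 by (rule kb)
  have "ennreal \<bar>?B\<bar> <= (\<integral>\<^sup>+ s. ennreal (norm (indicator {0<..<t} s *\<^sub>R (heat th (t - s) (%y. f y s) x - T s))) \<partial>lebesgue)"
   unfolding set_lebesgue_integral_def real_norm_def[symmetric] by (rule ennreal_norm_integral_le)
  also have "... <= (\<integral>\<^sup>+ s\<in>{0<..<t}. (\<I> y. \<bar>rem_kernel th K t s x y\<bar> * \<bar>f y s\<bar>) \<partial>lebesgue)"
   by (rule nn_integral_mono_AE) (use G2 in \<open>eventually_elim, auto simp: e2 kb split: split_indicator\<close>)
  also have "... = tint t (%s. (\<I> y. \<bar>rem_kernel th K t s x y\<bar> * \<bar>f y s\<bar>))"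
   by (rule nn_integral_completion)
  finally show "ennreal \<bar>?B\<bar> <= ..." .
 qed
 finally show ?thesis .
qed

end

section \<open>Estimates for the integrated remainder\<close>

definition res_bound :: "real => real => (real^'n => real) => (real^'n => real => real) => real => real^'n => ennreal" where
 "res_bound th K \<phi> f t x = (\<I> y. \<bar>rem_kernel th K t 0 x y\<bar> * \<bar>\<phi> y\<bar>)
   + tint t (%s. (\<I> y. \<bar>rem_kernel th K t s x y\<bar> * \<bar>f y s\<bar>))"

text \<open>The total mass of the data measured by \<open>kernel_wt\<close>. Up to the factor
  \<open>scale th t powr l\<close> it bounds the weighted integral of the remainder, so the
  asymptotics in time are those of this one quantity.\<close>

definition res_mass :: "real => real => (real^'n => real) => (real^'n => real => real) => real => ennreal" where
 "res_mass th K \<phi> f t = (\<I> y. kernel_wt th K t 0 y * \<bar>\<phi> y\<bar>)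
   + tint t (%s. (\<I> y. kernel_wt th K t s y * \<bar>f y s\<bar>))"

lemma scale_powr: "scale th t powr l = (t + 1) powr (l / th)"
 by (simp add: scale_def powr_powr)

lemma abs_G_le_powr:
 assumes "0 < th" "th < 2"
 shows "\<exists>C>0. \<forall>tau>0. \<forall>x::real^'n. \<bar>G th x tau\<bar> <= C * tau powr (- (real CARD('n) / th))"
proof -
 obtain C where C: "C > 0" "!!tau (x::real^'n). tau > 0 ==> \<bar>G th x tau\<bar> <= C * prof (tau powr (1/th)) th x"
  using G_bound[OF assms, where 'n='n] by blast
 have "\<bar>G th x tau\<bar> <= C * tau powr (- (real CARD('n) / th))" if t: "tau > 0" for tau and x :: "real^'n"
 proof -
  have "prof (tau powr (1/th)) th x <= (tau powr (1/th)) powr (- real CARD('n))" using t assms by (intro prof_le) auto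
  then have "C * prof (tau powr (1/th)) th x <= C * tau powr (- (real CARD('n) / th))"
   using C(1) by (intro mult_left_mono) (auto simp: powr_powr)
  then show ?thesis using C(2)[OF t, of x] by linarith
 qed
 then show ?thesis using C(1) by blast
qed

lemma rem_kernel_smear_L1:
 assumes th: "0 < th" "th < 2" and K: "0 <= K" and l: "0 <= l" "l <= K"
 shows "\<exists>C>0. \<forall>s t. \<forall>h\<in>borel_measurable borel. 0 <= s --> s < t -->
  (\<N> x. ennreal (norm x powr l) * (\<I> y. \<bar>rem_kernel th K t s x y\<bar> * \<bar>h y\<bar>))
   <= ennreal (C * scale th t powr l) * (\<I> (y::real^'n). kernel_wt th K t s y * \<bar>h y\<bar>)"
proof -
 obtain C where C: "C >= 0" and C': "\<forall>(y::real^'n) s t. 0 <= s --> s < t -->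
  (\<I> x. norm x powr l * \<bar>rem_kernel th K t s x y\<bar>) <= ennreal (C * (scale th t powr l * kernel_wt th K t s y))"
  using kernel_L1[OF th K l, where 'n='n] by blast
 show ?thesis
 proof (intro exI[of _ "C + 1"] conjI allI impI ballI)
  show "C + 1 > 0" using C by simp
  fix s t :: real and h :: "real^'n => real"
  assume [measurable]: "h \<in> borel_measurable borel" and st: "0 <= s" "s < t"
  have "(\<N> x. ennreal (norm x powr l) * (\<I> y. \<bar>rem_kernel th K t s x y\<bar> * \<bar>h y\<bar>))
   = (\<N> x. (\<N> y. ennreal (norm x powr l) * ennreal (\<bar>rem_kernel th K t s x y\<bar> * \<bar>h y\<bar>)))"
   by (intro nn_integral_cong nn_integral_cmult[symmetric]) measurable
  also have "... = (\<N> y. (\<N> x. ennreal (norm x powr l) * ennreal (\<bar>rem_kernel th K t s x y\<bar> * \<bar>h y\<bar>)))"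
   by (rule lborel_pair.Fubini') measurable
  also have "... = (\<N> y. (\<I> x. norm x powr l * \<bar>rem_kernel th K t s x y\<bar>) * ennreal \<bar>h y\<bar>)"
   by (intro nn_integral_cong) (simp add: ennreal_mult mult.assoc nn_integral_multc[symmetric])
  also have "... <= (\<N> (y::real^'n). ennreal ((C + 1) * scale th t powr l) * ennreal (kernel_wt th K t s y * \<bar>h y\<bar>))"
  proof (intro nn_integral_mono)
   fix y :: "real^'n"
   have "(\<I> x. norm x powr l * \<bar>rem_kernel th K t s x y\<bar>) * ennreal \<bar>h y\<bar>
    <= ennreal (C * (scale th t powr l * kernel_wt th K t s y)) * ennreal \<bar>h y\<bar>"
    by (intro mult_right_mono C'[rule_format] st) auto
   also have "... <= ennreal ((C + 1) * (scale th t powr l * kernel_wt th K t s y)) * ennreal \<bar>h y\<bar>"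
    using C kernel_wt_nonneg[of th K t s y] by (intro mult_right_mono ennreal_leI) auto
   also have "... = ennreal ((C + 1) * scale th t powr l) * ennreal (kernel_wt th K t s y * \<bar>h y\<bar>)"
    using C by (simp add: ennreal_mult kernel_wt_nonneg mult.assoc)
   finally show "(\<I> x. norm x powr l * \<bar>rem_kernel th K t s x y\<bar>) * ennreal \<bar>h y\<bar>
    <= ennreal ((C + 1) * scale th t powr l) * ennreal (kernel_wt th K t s y * \<bar>h y\<bar>)" .
  qed
  also have "... = ennreal ((C + 1) * scale th t powr l) * (\<I> (y::real^'n). kernel_wt th K t s y * \<bar>h y\<bar>)"
   by (rule nn_integral_cmult) measurable
  finally show "(\<N> x. ennreal (norm x powr l) * (\<I> y. \<bar>rem_kernel th K t s x y\<bar> * \<bar>h y\<bar>))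
   <= ennreal ((C + 1) * scale th t powr l) * (\<I> (y::real^'n). kernel_wt th K t s y * \<bar>h y\<bar>)" .
 qed
qed

text \<open>For \<open>s <= t / 2\<close> the singular kernel \<open>G (t - s)\<close> is bounded by its supremum; for \<open>s > t / 2\<close> it is
 integrated and \<open>h\<close> is bounded instead.\<close>

lemma rem_kernel_smear_Linf:
 assumes th: "0 < th" "th < 2" and K: "0 <= K" and l: "0 <= l" "l <= K"
 shows "\<exists>C>0. \<forall>s t b. \<forall>h\<in>borel_measurable borel. \<forall>x. 0 <= s --> s < t --> 0 <= b -->
  (s <= t / 2 \<or> (AE y in lborel. kernel_wt th K t s y * \<bar>h y\<bar> <= t powr (- (real CARD('n) / th)) * b)) -->
  ennreal (norm x powr l) * (\<I> y. \<bar>rem_kernel th K t s x y\<bar> * \<bar>h y\<bar>)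
   <= ennreal (C * (t powr (- (real CARD('n) / th)) * scale th t powr l)) * ((\<I> (y::real^'n). kernel_wt th K t s y * \<bar>h y\<bar>) + ennreal b)"
proof -
 let ?e = "real CARD('n) / th"
 obtain C where C: "C >= 0" and C': "\<forall>(x::real^'n) y s t. 0 <= s --> s < t -->
  norm x powr l * \<bar>rem_kernel th K t s x y\<bar> <= C * (t powr (- ?e) * (scale th t powr l * kernel_wt th K t s y))
    + C * (scale th t powr l * kernel_wt th K t s y) * \<bar>G th (x - y) (t - s)\<bar>"
  using kernel_Linf[OF th K l, where 'n='n] by blast
 obtain C1 where C1: "C1 > 0" "!!tau (y::real^'n). tau > 0 ==> (\<I> x. \<bar>G th (y - x) tau\<bar>) <= ennreal C1"
  using nn_integral_G[OF th, where 'n='n] by blast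
 obtain C2 where C2: "C2 > 0" "!!tau (x::real^'n). tau > 0 ==> \<bar>G th x tau\<bar> <= C2 * tau powr (- ?e)"
  using abs_G_le_powr[OF th, where 'n='n] by blast
 define C3 where "C3 = max C1 (C2 * 2 powr ?e)"
 have C3: "C3 > 0" "C1 <= C3" "C2 * 2 powr ?e <= C3" using C1 by (auto simp: C3_def)
 show ?thesis
 proof (intro exI[of _ "(C + 1) * (1 + C3)"] conjI allI impI ballI)
  show "(C + 1) * (1 + C3) > 0" using C C3 by simp
  fix s t b :: real and h :: "real^'n => real" and x :: "real^'n"
  assume [measurable]: "h \<in> borel_measurable borel" and st: "0 <= s" "s < t" and b: "0 <= b"
   and alt: "s <= t / 2 \<or> (AE y in lborel. kernel_wt th K t s y * \<bar>h y\<bar> <= t powr (- ?e) * b)"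
  let ?k = "%y. kernel_wt th K t s y * \<bar>h y\<bar>" and ?D = "scale th t powr l" and ?T = "t powr (- ?e)"
  let ?I = "\<integral>\<^sup>+ y. ennreal (?k y) \<partial>lborel"
  have k: "?k y >= 0" for y by (simp add: kernel_wt_nonneg)
  have gpart: "(\<I> y. ?k y * \<bar>G th (x - y) (t - s)\<bar>) <= ennreal (C3 * ?T) * (?I + ennreal b)"
   using alt
  proof
   assume s2: "s <= t / 2"
   have "(t - s) powr (- ?e) <= (t / 2) powr (- ?e)" using st s2 th by (intro powr_mono2') auto
   also have "... = 2 powr ?e * ?T" by (simp only: powr_divide powr_minus) (simp add: field_simps)
   finally have p: "(t - s) powr (- ?e) <= ..." .
   have "\<bar>G th (x - y) (t - s)\<bar> <= C3 * ?T" for y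
   proof -
    have "\<bar>G th (x - y) (t - s)\<bar> <= C2 * (2 powr ?e * ?T)"
     using C2(2)[of "t - s" "x - y"] st mult_left_mono[OF p, of C2] C2(1) by linarith
    also have "... <= C3 * ?T" using mult_right_mono[OF C3(3), of ?T] by (simp add: mult.assoc)
    finally show ?thesis .
   qed
   then have "(\<I> y. ?k y * \<bar>G th (x - y) (t - s)\<bar>) <= (\<N> y. ennreal (C3 * ?T) * ennreal (?k y))"
    using C3 k by (intro nn_integral_mono) (simp add: ennreal_mult[symmetric] mult.commute mult_right_mono ennreal_leI)
   also have "... = ennreal (C3 * ?T) * ?I" by (rule nn_integral_cmult) measurable
   also have "... <= ennreal (C3 * ?T) * (?I + ennreal b)" by (intro mult_left_mono) auto
   finally show ?thesis .
  next
   assume a: "AE y in lborel. kernel_wt th K t s y * \<bar>h y\<bar> <= ?T * b"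
   have "(\<I> y. ?k y * \<bar>G th (x - y) (t - s)\<bar>) <= (\<N> y. ennreal (?T * b) * ennreal \<bar>G th (x - y) (t - s)\<bar>)"
    by (intro nn_integral_mono_AE) (use a in \<open>eventually_elim, use b in \<open>auto simp: ennreal_mult[symmetric] intro!: ennreal_leI mult_right_mono\<close>\<close>)
   also have "... = ennreal (?T * b) * (\<I> y. \<bar>G th (x - y) (t - s)\<bar>)" by (rule nn_integral_cmult) measurable
   also have "... <= ennreal (?T * b) * ennreal C3" 
    using st C3 by (intro mult_left_mono order_trans[OF C1(2)] ennreal_leI) auto
   also have "... = ennreal (C3 * ?T) * ennreal b" using b C3 by (simp add: ennreal_mult[symmetric] mult_ac)
   also have "... <= ennreal (C3 * ?T) * (?I + ennreal b)" by (intro mult_left_mono) auto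
   finally show ?thesis .
  qed
  have "ennreal (norm x powr l) * (\<I> y. \<bar>rem_kernel th K t s x y\<bar> * \<bar>h y\<bar>)
   = (\<N> y. ennreal (norm x powr l) * ennreal (\<bar>rem_kernel th K t s x y\<bar> * \<bar>h y\<bar>))"
   by (rule nn_integral_cmult[symmetric]) measurable
  also have "... <= (\<N> y. ennreal ((C + 1) * ?D) * (ennreal ?T * ennreal (?k y) + ennreal (?k y * \<bar>G th (x - y) (t - s)\<bar>)))"
  proof (intro nn_integral_mono)
   fix y
   have "norm x powr l * (\<bar>rem_kernel th K t s x y\<bar> * \<bar>h y\<bar>) <= (C * (?T * (?D * kernel_wt th K t s y))
    + C * (?D * kernel_wt th K t s y) * \<bar>G th (x - y) (t - s)\<bar>) * \<bar>h y\<bar>"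
    unfolding mult.assoc[symmetric, of "norm x powr l"] by (intro mult_right_mono C'[rule_format] st) auto
   also have "... = C * (?D * (?T * ?k y + ?k y * \<bar>G th (x - y) (t - s)\<bar>))" by (simp only: algebra_simps)
   also have "... <= (C + 1) * (?D * (?T * ?k y + ?k y * \<bar>G th (x - y) (t - s)\<bar>))"
    using k[of y] by (intro mult_right_mono mult_nonneg_nonneg add_nonneg_nonneg) (auto simp: kernel_wt_nonneg)
   finally have *: "norm x powr l * (\<bar>rem_kernel th K t s x y\<bar> * \<bar>h y\<bar>) <= (C + 1) * ?D * (?T * ?k y + ?k y * \<bar>G th (x - y) (t - s)\<bar>)"
    by (simp only: mult.assoc)
   have "ennreal ((C + 1) * ?D * (?T * ?k y + ?k y * \<bar>G th (x - y) (t - s)\<bar>)) = ennreal ((C + 1) * ?D) * (ennreal ?T * ennreal (?k y) + ennreal (?k y * \<bar>G th (x - y) (t - s)\<bar>))"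
   proof -
    have "ennreal (?T * ?k y + ?k y * \<bar>G th (x - y) (t - s)\<bar>) = ennreal ?T * ennreal (?k y) + ennreal (?k y * \<bar>G th (x - y) (t - s)\<bar>)"
     using k[of y] by (subst ennreal_plus) (auto simp: ennreal_mult)
    then show ?thesis using C k[of y] by (subst ennreal_mult) auto
   qed
   then show "ennreal (norm x powr l) * ennreal (\<bar>rem_kernel th K t s x y\<bar> * \<bar>h y\<bar>) <= ennreal ((C + 1) * ?D) * (ennreal ?T * ennreal (?k y) + ennreal (?k y * \<bar>G th (x - y) (t - s)\<bar>))"
    using ennreal_leI[OF *] by (simp add: ennreal_mult'[symmetric])
  qed
  also have "... = ennreal ((C + 1) * ?D) * (ennreal ?T * ?I + (\<I> y. ?k y * \<bar>G th (x - y) (t - s)\<bar>))"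
   by (simp add: nn_integral_cmult nn_integral_add)
  also have "... <= ennreal ((C + 1) * ?D) * (ennreal ?T * (?I + ennreal b) + ennreal (C3 * ?T) * (?I + ennreal b))"
   by (intro mult_left_mono add_mono gpart) auto
  also have "... = ennreal ((C + 1) * ?D) * (ennreal ((1 + C3) * ?T) * (?I + ennreal b))"
  proof -
   have "ennreal ((1 + C3) * ?T) = ennreal ?T + ennreal (C3 * ?T)" using C3 by (simp add: distrib_right)
   then show ?thesis by (simp only: distrib_right)
  qed
  also have "... = ennreal ((C + 1) * (1 + C3) * (?T * ?D)) * (?I + ennreal b)"
   unfolding mult.assoc[symmetric] using C C3 by (subst ennreal_mult[symmetric]) (auto simp: mult_ac)
  finally show "ennreal (norm x powr l) * (\<I> y. \<bar>rem_kernel th K t s x y\<bar> * \<bar>h y\<bar>)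
   <= ennreal ((C + 1) * (1 + C3) * (?T * ?D)) * (?I + ennreal b)" .
 qed
qed

lemma kernel_wt_le_powr:
 assumes "0 < th" "0 <= K" "0 <= s"
 shows "kernel_wt th K t s y <= rad th s y powr K * (t + 1) powr (- (K / th))"
proof -
 have "(rad th s y / scale th t) powr K = rad th s y powr K * (t + 1) powr (- (K / th))"
  by (simp only: powr_divide scale_powr powr_minus) (simp add: divide_inverse)
 then show ?thesis using kernel_wt_le[OF assms(1,2), of t s y] by simp
qed

lemma nn_integral_time_powr:
 assumes t: "0 < t"
 shows "e \<noteq> -1 ==> tint t (%s. ennreal ((s + 1) powr e)) <= ennreal (((t + 1) powr (e + 1) - 1) / (e + 1))"
  and "tint t (%s. ennreal ((s + 1) powr (-1))) <= ennreal (ln (t + 1))"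
proof -
 have le: "tint t (%s. ennreal ((s + 1) powr e)) <= ennreal (F t - F 0)"
  if F: "!!s. 0 <= s ==> (F has_real_derivative (s + 1) powr e) (at s)" for e and F :: "real => real"
 proof -
  have "tint t (%s. ennreal ((s + 1) powr e)) <= (\<N> s. ennreal ((s + 1) powr e) * indicator {0..t} s)"
   by (intro nn_integral_mono) (auto split: split_indicator)
  also have "... = ennreal (F t - F 0)"
   by (rule nn_integral_FTC_Icc) (use t F in auto)
  finally show ?thesis .
 qed
 show "tint t (%s. ennreal ((s + 1) powr e)) <= ennreal (((t + 1) powr (e + 1) - 1) / (e + 1))" if e: "e \<noteq> -1"
 proof -
  have "((%s. (s + 1) powr (e + 1) / (e + 1)) has_real_derivative (s + 1) powr e) (at s)" if s: "0 <= s" for s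
  proof -
   have "((%s. (s + 1) powr (e + 1)) has_real_derivative (e + 1) * (s + 1) powr (e + 1 - 1) * 1) (at s)"
    by (rule DERIV_chain2[where f="%z. z powr (e + 1)", OF has_real_derivative_powr])
     (use s in \<open>auto intro!: derivative_eq_intros\<close>)
   from DERIV_cdivide[OF this, of "e + 1"] show ?thesis using e by (simp add: add_eq_0_iff)
  qed
  from le[OF this] show ?thesis by (simp add: diff_divide_distrib)
 qed
 have "((%s. ln (s + 1)) has_real_derivative (s + 1) powr (-1)) (at s)" if s: "0 <= s" for s
  using s by (auto intro!: derivative_eq_intros simp: powr_minus field_simps)
 from le[OF this] show "tint t (%s. ennreal ((s + 1) powr (-1))) <= ennreal (ln (t + 1))" by simp
qed

lemma nn_integral_time_powr_le:
 assumes t: "0 < t" and e: "e < -1"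
 shows "tint t (%s. ennreal ((s + 1) powr e)) <= ennreal (1 / (- e - 1))"
proof -
 have "((t + 1) powr (e + 1) - 1) / (e + 1) = (1 - (t + 1) powr (e + 1)) / (- e - 1)"
  using e by (simp add: field_simps)
 also have "... <= 1 / (- e - 1)" using e by (intro divide_right_mono) auto
 finally show ?thesis using nn_integral_time_powr(1)[OF t, of e] e by (auto intro: order_trans ennreal_leI)
qed

text \<open>The cutoff is at most \<open>1\<close>, so \<open>h\<close> itself is the dominating
  function; for each fixed point \<open>scale th t\<close> eventually exceeds any multiple of
  \<open>r x\<close>. Finiteness of the integral of \<open>h\<close> excludes infinite values of
  \<open>h\<close> almost everywhere.\<close>

lemma cutoff_tendsto_0:
 assumes [measurable]: "h \<in> borel_measurable M" "r \<in> borel_measurable M" and r: "!!x. r x >= (0::real)"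
  and I: "(\<integral>\<^sup>+ x. h x \<partial>M) < \<infinity>" and d: "\<delta> > 0" and th: "th > 0"
 shows "((%t. \<integral>\<^sup>+ x. h x * ennreal (min 1 (r x / scale th t) powr \<delta>) \<partial>M) \<longlongrightarrow> 0) at_top"
proof (rule tendsto_at_topI_sequentially)
 fix X :: "nat => real" assume X: "filterlim X at_top sequentially"
 have "(%n. \<integral>\<^sup>+ x. h x * ennreal (min 1 (r x / scale th (X n)) powr \<delta>) \<partial>M) \<longlonglongrightarrow> (\<integral>\<^sup>+ x. 0 \<partial>M)"
 proof (rule nn_integral_dominated_convergence[where w = h])
  have le: "min 1 (a / scale th s) powr \<delta> <= 1" if "a >= 0" for a s
   using that d by (intro powr_le1) (auto simp: scale_def)
  show "AE x in M. h x * ennreal (min 1 (r x / scale th (X j)) powr \<delta>) <= h x" for j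
  proof (rule AE_I2)
   fix x
   have "h x * ennreal (min 1 (r x / scale th (X j)) powr \<delta>) <= h x * ennreal 1" by (intro mult_left_mono ennreal_leI le r) auto
   then show "h x * ennreal (min 1 (r x / scale th (X j)) powr \<delta>) <= h x" by simp
  qed
  have "AE x in M. h x \<noteq> \<infinity>" by (rule nn_integral_noteq_infinite) (use I in auto)
  then show "AE x in M. (%n. h x * ennreal (min 1 (r x / scale th (X n)) powr \<delta>)) \<longlonglongrightarrow> 0"
  proof eventually_elim
   case (elim x)
   have "((%t. r x / scale th t) \<longlongrightarrow> 0) at_top" unfolding scale_def using th by real_asymp
   then have "(%n. r x / scale th (X n)) \<longlonglongrightarrow> 0" by (rule filterlim_compose[OF _ X])
   then have "(%n. min 1 (r x / scale th (X n))) \<longlonglongrightarrow> min 1 0" by (intro tendsto_min tendsto_const)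
   then have "(%n. min 1 (r x / scale th (X n)) powr \<delta>) \<longlonglongrightarrow> 0"
    by (intro tendsto_zero_powrI[OF _ tendsto_const _ d]) (auto simp: scale_def r)
   then have "(%n. ennreal (min 1 (r x / scale th (X n)) powr \<delta>)) \<longlonglongrightarrow> ennreal 0" by (rule tendsto_ennrealI)
   then have "(%n. h x * ennreal (min 1 (r x / scale th (X n)) powr \<delta>)) \<longlonglongrightarrow> h x * ennreal 0"
    using elim by (intro ennreal_tendsto_cmult) (auto simp: top.not_eq_extremum)
   then show ?case by simp
  qed
 qed (use I in \<open>auto simp: scale_def\<close>)
 then show "(%n. \<integral>\<^sup>+ x. h x * ennreal (min 1 (r x / scale th (X n)) powr \<delta>) \<partial>M) \<longlonglongrightarrow> 0" by simp
qed

context remainder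
begin

lemma res_bound_measurable [measurable]: "res_bound th K \<phi> f t \<in> borel_measurable borel"
 unfolding res_bound_def by measurable

lemma res_bound_L1:
 assumes l: "0 <= l" "l <= K"
 shows "\<exists>C>0. \<forall>t>0. (\<N> x. ennreal (norm x powr l) * res_bound th K \<phi> f t x) <= ennreal (C * scale th t powr l) * res_mass th K \<phi> f t"
proof -
 obtain C where C: "C > 0" and C': "\<forall>s t. \<forall>h\<in>borel_measurable borel. 0 <= s --> s < t -->
  (\<N> x. ennreal (norm x powr l) * (\<I> y. \<bar>rem_kernel th K t s x y\<bar> * \<bar>h y\<bar>))
   <= ennreal (C * scale th t powr l) * (\<I> (y::real^'n). kernel_wt th K t s y * \<bar>h y\<bar>)"
  using rem_kernel_smear_L1[OF th K l, where 'n='n] by (elim exE conjE)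
 show ?thesis
 proof (intro exI[of _ C] conjI allI impI)
  fix t :: real assume t: "t > 0"
  let ?Q = "%s x. \<integral>\<^sup>+ y. ennreal (\<bar>rem_kernel th K t s x y\<bar> * \<bar>f y s\<bar>) \<partial>lborel"
  let ?w = "%x::real^'n. ennreal (norm x powr l)"
  have fs: "(%y. f y s) \<in> borel_measurable borel" for s by measurable
  have "(\<N> x. ?w x * res_bound th K \<phi> f t x)
   = (\<N> x. ?w x * (\<I> y. \<bar>rem_kernel th K t 0 x y\<bar> * \<bar>\<phi> y\<bar>)) + (\<N> x. ?w x * tint t (%s. ?Q s x))"
   unfolding res_bound_def distrib_left by (intro nn_integral_add) measurable
  also have "... <= ennreal (C * scale th t powr l) * (\<I> y. kernel_wt th K t 0 y * \<bar>\<phi> y\<bar>)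
   + ennreal (C * scale th t powr l) * tint t (%s. (\<I> y. kernel_wt th K t s y * \<bar>f y s\<bar>))"
  proof (rule add_mono)
   show "(\<N> x. ?w x * (\<I> y. \<bar>rem_kernel th K t 0 x y\<bar> * \<bar>\<phi> y\<bar>)) <= ennreal (C * scale th t powr l) * (\<I> y. kernel_wt th K t 0 y * \<bar>\<phi> y\<bar>)"
    using C'[rule_format, OF ph order_refl t] .
   have "(\<N> x. ?w x * tint t (%s. ?Q s x)) = (\<N> x. (\<N> s. ?w x * (?Q s x * indicator {0<..<t} s)))"
    by (intro nn_integral_cong nn_integral_cmult[symmetric]) measurable
   also have "... = (\<N> s. (\<N> x. ?w x * (?Q s x * indicator {0<..<t} s)))"
    by (rule lborel_pair.Fubini') measurable
   also have "... <= (\<N> s. ennreal (C * scale th t powr l) * ((\<I> y. kernel_wt th K t s y * \<bar>f y s\<bar>) * indicator {0<..<t} s))"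
    by (intro nn_integral_mono) (use C'[rule_format, OF fs] in \<open>auto split: split_indicator\<close>)
   also have "... = ennreal (C * scale th t powr l) * tint t (%s. (\<I> y. kernel_wt th K t s y * \<bar>f y s\<bar>))"
    by (rule nn_integral_cmult) measurable
   finally show "(\<N> x. ?w x * tint t (%s. ?Q s x)) <= ..." .
  qed
  also have "... = ennreal (C * scale th t powr l) * res_mass th K \<phi> f t" by (simp add: res_mass_def distrib_left)
  finally show "(\<N> x. ?w x * res_bound th K \<phi> f t x) <= ..." .
 qed (rule C)
qed

text \<open>The term \<open>(t + 1) powr (1 - A)\<close> comes from times \<open>s > t / 2\<close>.
  There the kernel is too singular for its supremum, and the source is bounded instead, by a
  multiple of \<open>t powr (- N / th) * (t + 1) powr (- A)\<close>, over a time interval shorter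
  than \<open>t\<close>.\<close>

lemma res_bound_Linf:
 assumes l: "0 <= l" "l <= K"
 shows "\<exists>C>0. \<forall>t>0. \<forall>x. ennreal (norm x powr l) * res_bound th K \<phi> f t x <=
  ennreal (C * (t powr (- (real CARD('n) / th)) * scale th t powr l)) * (res_mass th K \<phi> f t + ennreal ((t + 1) powr (1 - A)))"
proof -
 let ?e = "real CARD('n) / th"
 obtain C where C: "C > 0" and C': "\<forall>s t b. \<forall>h\<in>borel_measurable borel. \<forall>x. 0 <= s --> s < t --> 0 <= b -->
  (s <= t / 2 \<or> (AE y in lborel. kernel_wt th K t s y * \<bar>h y\<bar> <= t powr (- ?e) * b)) -->
  ennreal (norm x powr l) * (\<I> y. \<bar>rem_kernel th K t s x y\<bar> * \<bar>h y\<bar>)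
   <= ennreal (C * (t powr (- ?e) * scale th t powr l)) * ((\<I> (y::real^'n). kernel_wt th K t s y * \<bar>h y\<bar>) + ennreal b)"
  using rem_kernel_smear_Linf[OF th K l, where 'n='n] by (elim exE conjE)
 \<comment> \<open>For \<open>s\<close> between \<open>t / 2\<close> and \<open>t\<close>, powers of
   \<open>s\<close> and \<open>s + 1\<close> are traded for powers of \<open>t\<close> and
   \<open>t + 1\<close> at the price of these powers of \<open>2\<close>.\<close>
 define c where "c = max 1 (B * 2 powr ?e * 2 powr \<bar>K / th - A\<bar>)"
 have c: "c >= 1" "B * 2 powr ?e * 2 powr \<bar>K / th - A\<bar> <= c" by (auto simp: c_def)
 have fs: "(%y. f y s) \<in> borel_measurable borel" for s by measurable
 have sup: "AE y in lborel. kernel_wt th K t s y * \<bar>f y s\<bar> <= t powr (- ?e) * (c * (t + 1) powr (- A))" if s: "t / 2 < s" "s < t" "t > 0" for s t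
 proof -
  have s0: "s > 0" using s by simp
  have p1: "s powr (- ?e) <= 2 powr ?e * t powr (- ?e)"
  proof -
   have "s powr (- ?e) <= (t / 2) powr (- ?e)" using s th by (intro powr_mono2') auto
   also have "... = 2 powr ?e * t powr (- ?e)" by (simp only: powr_divide powr_minus) (simp add: field_simps)
   finally show ?thesis .
  qed
  have p2: "(s + 1) powr a <= 2 powr \<bar>a\<bar> * (t + 1) powr a" for a
  proof (cases "a >= 0")
   case True
   have "(s + 1) powr a <= (t + 1) powr a" using s True by (intro powr_mono2) auto
   also have "... <= 2 powr \<bar>a\<bar> * (t + 1) powr a" using mult_right_mono[of 1 "2 powr \<bar>a\<bar>" "(t + 1) powr a"] by (simp add: ge_one_powr_ge_zero)
   finally show ?thesis .
  next
   case False
   have "(s + 1) powr a <= ((t + 1) / 2) powr a" using s False by (intro powr_mono2') auto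
   also have "... = 2 powr \<bar>a\<bar> * (t + 1) powr a"
    using False powr_minus[of 2 a] by (simp only: powr_divide) (simp add: field_simps)
   finally show ?thesis .
  qed
  have p3: "(t + 1) powr (- (K / th)) * (t + 1) powr (K / th - A) = (t + 1) powr (- A)"
   using s by (simp flip: powr_add)
  show ?thesis
   using S[OF s0]
  proof eventually_elim
   case (elim y)
   have "kernel_wt th K t s y * \<bar>f y s\<bar> <= rad th s y powr K * (t + 1) powr (- (K / th)) * \<bar>f y s\<bar>"
    using s0 by (intro mult_right_mono kernel_wt_le_powr th K) auto
   also have "... = (t + 1) powr (- (K / th)) * (rad th s y powr K * \<bar>f y s\<bar>)" by simp
   also have "... <= (t + 1) powr (- (K / th)) * (B * (2 powr ?e * t powr (- ?e)) * (2 powr \<bar>K / th - A\<bar> * (t + 1) powr (K / th - A)))"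
    using elim B by (intro mult_left_mono order_trans[OF elim] mult_mono p1 p2) auto
   also have "... = t powr (- ?e) * ((B * 2 powr ?e * 2 powr \<bar>K / th - A\<bar>) * (t + 1) powr (- A))"
    unfolding p3[symmetric] by (simp only: mult_ac)
   also have "... <= t powr (- ?e) * (c * (t + 1) powr (- A))" by (intro mult_left_mono mult_right_mono c) auto
   finally show ?case .
  qed
 qed
 show ?thesis
 proof (intro exI[of _ "C * c"] conjI allI impI)
  show "C * c > 0" using C c by simp
  fix t :: real and x :: "real^'n" assume t: "t > 0"
  let ?X = "C * (t powr (- ?e) * scale th t powr l)"
  let ?Q = "%s. \<integral>\<^sup>+ y. ennreal (\<bar>rem_kernel th K t s x y\<bar> * \<bar>f y s\<bar>) \<partial>lborel"
  let ?P = "%s. \<integral>\<^sup>+ y. ennreal (kernel_wt th K t s y * \<bar>f y s\<bar>) \<partial>lborel"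
  let ?w = "ennreal (norm x powr l)"
  have 1: "?w * (\<I> y. \<bar>rem_kernel th K t 0 x y\<bar> * \<bar>\<phi> y\<bar>) <= ennreal ?X * ((\<I> y. kernel_wt th K t 0 y * \<bar>\<phi> y\<bar>) + ennreal 0)"
   by (rule C'[rule_format, OF ph order_refl t order_refl]) (use t in simp)
  have "?w * tint t (%s. ?Q s) = (\<N> s. ?w * (?Q s * indicator {0<..<t} s))"
   by (rule nn_integral_cmult[symmetric]) measurable
  also have "... <= (\<N> s. ennreal ?X * (?P s * indicator {0<..<t} s + ennreal (c * (t + 1) powr (- A)) * indicator {0<..<t} s))"
  proof (intro nn_integral_mono)
   fix s :: real
   show "?w * (?Q s * indicator {0<..<t} s) <= ennreal ?X * (?P s * indicator {0<..<t} s + ennreal (c * (t + 1) powr (- A)) * indicator {0<..<t} s)"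
   proof (cases "s \<in> {0<..<t}")
    case True
    then have s: "0 < s" "s < t" by auto
    have "?w * ?Q s <= ennreal ?X * (?P s + ennreal (c * (t + 1) powr (- A)))"
    proof (rule C'[rule_format, OF fs less_imp_le[OF s(1)] s(2)])
     show "s <= t / 2 \<or> (AE y in lborel. kernel_wt th K t s y * \<bar>f y s\<bar> <= t powr (- ?e) * (c * (t + 1) powr (- A)))"
      using sup[OF _ s(2) t] by (cases "s <= t / 2") auto
    qed (use c in simp)
    then show ?thesis using True by simp
   qed simp
  qed
  also have "... = ennreal ?X * (tint t (%s. ?P s) + ennreal (c * (t + 1) powr (- A)) * ennreal t)"
   using t by (subst nn_integral_cmult, measurable) (subst nn_integral_add, measurable, simp add: nn_integral_cmult_indicator)
  finally have 2: "?w * tint t (%s. ?Q s) <= ..." .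
  have 3: "ennreal (c * (t + 1) powr (- A)) * ennreal t <= ennreal c * ennreal ((t + 1) powr (1 - A))"
  proof -
   have "c * (t + 1) powr (- A) * t <= c * (t + 1) powr (- A) * (t + 1)" using c by (intro mult_left_mono) auto
   also have "... = c * (t + 1) powr (1 - A)" using t powr_add[of "t + 1" "- A" 1] by simp
   finally show ?thesis using c t by (simp add: ennreal_mult[symmetric] ennreal_leI)
  qed
  have c1: "1 <= ennreal c" using c(1) by (simp flip: ennreal_1)
  have "?w * res_bound th K \<phi> f t x <= ennreal ?X * ((\<I> y. kernel_wt th K t 0 y * \<bar>\<phi> y\<bar>) + ennreal 0)
    + ennreal ?X * (tint t (%s. ?P s) + ennreal (c * (t + 1) powr (- A)) * ennreal t)"
   unfolding res_bound_def distrib_left[of ?w] by (intro add_mono 1 2)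
  also have "... = ennreal ?X * (1 * res_mass th K \<phi> f t + ennreal (c * (t + 1) powr (- A)) * ennreal t)"
   unfolding res_mass_def by (simp add: distrib_left add.assoc)
  also have "... <= ennreal ?X * (ennreal c * res_mass th K \<phi> f t + ennreal c * ennreal ((t + 1) powr (1 - A)))"
   by (intro mult_left_mono add_mono mult_right_mono c1 3) auto
  also have "... = ennreal (C * c * (t powr (- ?e) * scale th t powr l)) * (res_mass th K \<phi> f t + ennreal ((t + 1) powr (1 - A)))"
  proof -
   have "ennreal (C * c * (t powr (- ?e) * scale th t powr l)) = ennreal ?X * ennreal c"
    using C c by (simp add: ennreal_mult[symmetric] mult_ac)
   then show ?thesis by (simp only: distrib_left mult.assoc)
  qed
  finally show "?w * res_bound th K \<phi> f t x <= ..." .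
 qed
qed

lemma res_mass_le:
 assumes t: "t > 0"
 shows "res_mass th K \<phi> f t <= ennreal (B * (t + 1) powr (- (K / th))) * (1 + tint t (%s. ennreal ((s + 1) powr (K / th - A))))"
proof -
 let ?T = "(t + 1) powr (- (K / th))"
 have k: "(\<I> y. kernel_wt th K t s y * \<bar>h y\<bar>) <= ennreal ?T * (\<I> y. rad th s y powr K * \<bar>h y\<bar>)"
  if s: "0 <= s" and [measurable]: "h \<in> borel_measurable borel" for s and h :: "real^'n => real"
 proof -
  have "(\<I> y. kernel_wt th K t s y * \<bar>h y\<bar>) <= (\<N> y. ennreal ?T * ennreal (rad th s y powr K * \<bar>h y\<bar>))"
  proof (intro nn_integral_mono)
   fix y :: "real^'n"
   have "kernel_wt th K t s y * \<bar>h y\<bar> <= rad th s y powr K * ?T * \<bar>h y\<bar>"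
    by (intro mult_right_mono kernel_wt_le_powr th K s) auto
   then show "ennreal (kernel_wt th K t s y * \<bar>h y\<bar>) <= ennreal ?T * ennreal (rad th s y powr K * \<bar>h y\<bar>)"
    by (simp add: ennreal_mult[symmetric] ennreal_leI mult_ac)
  qed
  also have "... = ennreal ?T * (\<I> y. rad th s y powr K * \<bar>h y\<bar>)" by (rule nn_integral_cmult) measurable
  finally show ?thesis .
 qed
 have fs: "(%y. f y s) \<in> borel_measurable borel" for s by measurable
 have 1: "(\<I> y. kernel_wt th K t 0 y * \<bar>\<phi> y\<bar>) <= ennreal ?T * ennreal B"
  by (rule order_trans[OF k[OF order_refl ph] mult_left_mono[OF I0]]) auto
 have "tint t (%s. (\<I> y. kernel_wt th K t s y * \<bar>f y s\<bar>))
  <= (\<N> s. ennreal (?T * B) * (ennreal ((s + 1) powr (K / th - A)) * indicator {0<..<t} s))"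
 proof (intro nn_integral_mono)
  fix s :: real
  show "(\<I> y. kernel_wt th K t s y * \<bar>f y s\<bar>) * indicator {0<..<t} s <= ennreal (?T * B) * (ennreal ((s + 1) powr (K / th - A)) * indicator {0<..<t} s)"
  proof (cases "s \<in> {0<..<t}")
   case True
   then have s: "0 < s" by simp
   have "(\<I> y. kernel_wt th K t s y * \<bar>f y s\<bar>) <= ennreal ?T * ennreal (B * (s + 1) powr (K / th - A))"
    by (rule order_trans[OF k[OF less_imp_le[OF s] fs] mult_left_mono[OF I[OF s]]]) auto
   then show ?thesis using True B by (simp add: ennreal_mult mult.assoc)
  qed simp
 qed
 also have "... = ennreal (?T * B) * tint t (%s. ennreal ((s + 1) powr (K / th - A)))" by (rule nn_integral_cmult) measurable
 finally have 2: "tint t (%s. (\<I> y. kernel_wt th K t s y * \<bar>f y s\<bar>)) <= ..." .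
 have "res_mass th K \<phi> f t <= ennreal ?T * ennreal B + ennreal (?T * B) * tint t (%s. ennreal ((s + 1) powr (K / th - A)))"
  unfolding res_mass_def by (intro add_mono 1 2)
 also have "... = ennreal (B * ?T) * (1 + tint t (%s. ennreal ((s + 1) powr (K / th - A))))"
  using B by (simp add: ennreal_mult[symmetric] distrib_left mult.commute)
 finally show ?thesis .
qed
text \<open>For \<open>s < t\<close> the growing factor \<open>(s + 1) powr (K / th)\<close> is
  cancelled by the prefactor \<open>(t + 1) powr (- (K / th))\<close>. The integrable power
  \<open>(s + 1) powr (- A)\<close> remains.\<close>

lemma res_mass_bounded:
 assumes t: "t > 0" and A: "A > 1"
 shows "res_mass th K \<phi> f t <= ennreal (B * (1 + 1 / (A - 1)))"
proof -
 let ?T = "(t + 1) powr (- (K / th))"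
 have T: "?T <= 1" using powr_mono[of "- (K / th)" 0 "t + 1"] t th K by simp
 have "ennreal ?T * tint t (%s. ennreal ((s + 1) powr (K / th - A)))
   = (\<N> s. ennreal ?T * (ennreal ((s + 1) powr (K / th - A)) * indicator {0<..<t} s))"
  by (rule nn_integral_cmult[symmetric]) measurable
 also have "... <= tint t (%s. ennreal ((s + 1) powr (- A)))"
 proof (rule nn_integral_mono)
  fix s
  have "?T * (s + 1) powr (K / th - A) <= (s + 1) powr (- A)" if s: "s \<in> {0<..<t}"
  proof -
   have "?T <= (s + 1) powr (- (K / th))" using s th K by (intro powr_mono2') auto
   then have "?T * (s + 1) powr (K / th - A) <= (s + 1) powr (- (K / th)) * (s + 1) powr (K / th - A)" by (rule mult_right_mono) simp
   then show ?thesis by (simp flip: powr_add)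
  qed
  then show "ennreal ?T * (ennreal ((s + 1) powr (K / th - A)) * indicator {0<..<t} s) <= ennreal ((s + 1) powr (- A)) * indicator {0<..<t} s"
   by (auto simp: ennreal_mult[symmetric] ennreal_leI split: split_indicator)
 qed
 also have "... <= ennreal (1 / (A - 1))" using nn_integral_time_powr_le[OF t, of "- A"] A by simp
 finally have 1: "ennreal ?T * tint t (%s. ennreal ((s + 1) powr (K / th - A))) <= ..." .
 have "res_mass th K \<phi> f t <= ennreal B * (ennreal ?T * (1 + tint t (%s. ennreal ((s + 1) powr (K / th - A)))))"
  using res_mass_le[OF t] B by (simp add: ennreal_mult mult.assoc)
 also have "... <= ennreal B * (1 + ennreal (1 / (A - 1)))"
  unfolding distrib_left[of "ennreal ?T"] using T by (intro mult_left_mono add_mono 1) auto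
 also have "... = ennreal (B * (1 + 1 / (A - 1)))"
  using A B by (simp add: ennreal_mult ennreal_plus)
 finally show ?thesis .
qed

lemma kernel_wt_scaled:
 assumes "s >= 0" "t > 0"
 shows "(t + 1) powr (K / th) * kernel_wt th K t s y = rad th s y powr K * min 1 (rad th s y / scale th t) powr (taylor_ord th K - K)"
proof -
 have "scale th t powr K > 0" using scale_pos[OF assms(2), of th] by simp
 then show ?thesis by (simp add: kernel_wt_def powr_divide scale_powr[symmetric])
qed

text \<open>After multiplication by \<open>(t + 1) powr (K / th)\<close> only the cutoff in
  \<open>kernel_wt\<close> depends on \<open>t\<close>. If \<open>K / th < A - 1\<close>, the
  remaining integrand is integrable over all positive times, so the time integral may be extended
  beyond \<open>t\<close> and \<open>cutoff_tendsto_0\<close> applies on the product space.\<close>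

lemma res_mass_tendsto_0:
 assumes A: "K / th < A - 1"
 shows "((%t. ennreal ((t + 1) powr (K / th)) * res_mass th K \<phi> f t) \<longlongrightarrow> 0) at_top"
proof -
 let ?d = "taylor_ord th K - K"
 have d: "?d > 0" using taylor_ord_gt[OF th(1) K] by simp
 define h1 where "h1 = (%y. ennreal (rad th 0 y powr K * \<bar>\<phi> y\<bar>))"
 define h2 where "h2 = (%(s, y). ennreal (rad th s y powr K * \<bar>f y s\<bar>) * indicator {0<..} s)"
 define r2 where "r2 = (%(s, y::real^'n). if s > 0 then rad th s y else 0)"
 define I1 where "I1 = (%t. \<integral>\<^sup>+ y. h1 y * ennreal (min 1 (rad th 0 y / scale th t) powr ?d) \<partial>lborel)"
 define I2 where "I2 = (%t. \<integral>\<^sup>+ p. h2 p * ennreal (min 1 (r2 p / scale th t) powr ?d) \<partial>(lborel \<Otimes>\<^sub>M lborel))"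
 have m: "h1 \<in> borel_measurable lborel" "h2 \<in> borel_measurable (lborel \<Otimes>\<^sub>M lborel)" "r2 \<in> borel_measurable (lborel \<Otimes>\<^sub>M lborel)"
  unfolding h1_def h2_def r2_def by measurable
 note m(2,3) [measurable]
 have l1: "(I1 \<longlongrightarrow> 0) at_top" unfolding I1_def
  by (rule cutoff_tendsto_0[OF m(1) _ _ _ d th(1)]) (use I0 in \<open>auto simp: h1_def rad_def intro: order_le_less_trans add_nonneg_nonneg\<close>)
 have "integral\<^sup>N (lborel \<Otimes>\<^sub>M lborel) h2 = (\<N> s. (\<N> y. h2 (s, y)))"
  by (rule lborel.nn_integral_fst[symmetric]) (use m in simp)
 also have "... <= (\<N> s. ennreal B * (ennreal ((1 + s) powr (- (1 + (A - 1 - K / th)))) * indicator {0..} s))"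
 proof (rule nn_integral_mono)
  fix s :: real
  show "(\<N> y. h2 (s, y)) <= ennreal B * (ennreal ((1 + s) powr (- (1 + (A - 1 - K / th)))) * indicator {0..} s)"
   using I[of s] B by (cases "s > 0") (auto simp: h2_def ennreal_mult add.commute diff_diff_eq2)
 qed
 also have "... = ennreal B * (\<integral>\<^sup>+ s\<in>{0..}. ennreal ((1 + s) powr (- (1 + (A - 1 - K / th)))) \<partial>lborel)"
  by (rule nn_integral_cmult) measurable
 also have "... < \<infinity>" using A by (subst nn_integral_powr_tail) (auto simp: ennreal_mult_less_top)
 finally have h2: "integral\<^sup>N (lborel \<Otimes>\<^sub>M lborel) h2 < \<infinity>" .
 have l2: "(I2 \<longlongrightarrow> 0) at_top" unfolding I2_def
  by (rule cutoff_tendsto_0[OF m(2,3) _ h2 d th(1)]) (auto simp: r2_def rad_def)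
 have le: "ennreal ((t + 1) powr (K / th)) * res_mass th K \<phi> f t <= I1 t + I2 t" if t: "t > 0" for t
 proof -
  let ?T = "(t + 1) powr (K / th)"
  have k: "ennreal ?T * (\<I> y. kernel_wt th K t s y * \<bar>h y\<bar>)
    = (\<N> y. ennreal (rad th s y powr K * \<bar>h y\<bar>) * ennreal (min 1 (rad th s y / scale th t) powr ?d))"
   if s: "0 <= s" and [measurable]: "h \<in> borel_measurable borel" for s and h :: "real^'n => real"
  proof -
   have "ennreal ?T * (\<I> y. kernel_wt th K t s y * \<bar>h y\<bar>) = (\<N> y. ennreal ?T * ennreal (kernel_wt th K t s y * \<bar>h y\<bar>))"
    by (rule nn_integral_cmult[symmetric]) measurable
   also have "... = (\<I> y. ?T * kernel_wt th K t s y * \<bar>h y\<bar>)"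
    by (simp add: ennreal_mult'[symmetric] mult.assoc)
   finally show ?thesis
    unfolding kernel_wt_scaled[OF s t] by (simp add: ennreal_mult'[symmetric] mult_ac)
  qed
  have fs: "(%y. f y s) \<in> borel_measurable borel" for s by measurable
  have "ennreal ?T * tint t (%s. (\<I> y. kernel_wt th K t s y * \<bar>f y s\<bar>))
   = (\<N> s. ennreal ?T * ((\<I> y. kernel_wt th K t s y * \<bar>f y s\<bar>) * indicator {0<..<t} s))"
   by (rule nn_integral_cmult[symmetric]) measurable
  also have "... <= (\<N> s. (\<N> y. h2 (s, y) * ennreal (min 1 (r2 (s, y) / scale th t) powr ?d)))"
  proof (rule nn_integral_mono)
   fix s :: real
   show "ennreal ?T * ((\<I> y. kernel_wt th K t s y * \<bar>f y s\<bar>) * indicator {0<..<t} s) <= (\<N> y. h2 (s, y) * ennreal (min 1 (r2 (s, y) / scale th t) powr ?d))"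
    using k[OF _ fs, of s s] by (cases "s \<in> {0<..<t}") (simp_all add: h2_def r2_def)
  qed
  also have "... = I2 t" unfolding I2_def by (rule lborel.nn_integral_fst) (use m in measurable)
  finally show ?thesis using k[OF order_refl ph]
   by (simp add: res_mass_def distrib_left I1_def h1_def)
 qed
 have ev: "\<forall>\<^sub>F t in at_top. ennreal ((t + 1) powr (K / th)) * res_mass th K \<phi> f t <= I1 t + I2 t"
  using eventually_gt_at_top[of 0] by eventually_elim (rule le)
 have "((%t. I1 t + I2 t) \<longlongrightarrow> 0) at_top" using tendsto_add[OF l1 l2] by simp
 from tendsto_sandwich[OF _ ev tendsto_const this] show ?thesis by simp
qed

text \<open>Interpolation between \<open>res_bound_L1\<close> and \<open>res_bound_Linf\<close>.
  Only the supremum bound contains \<open>t powr (- N / th)\<close>, and it enters with the power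
  \<open>1 - recip q\<close>.\<close>

lemma wLq_norm_le_res_mass:
 assumes A: "A > 1" and q: "1 <= q" and l: "0 <= l" "l <= K"
  and hm: "!!t. t > 0 ==> h t \<in> borel_measurable borel"
  and h: "!!t x. t > 0 ==> ennreal \<bar>h t x\<bar> <= res_bound th K \<phi> f t x"
 shows "\<exists>C>0. \<forall>t>0. wLq_norm q l (h t) <= ennreal (C * (t powr (- (real CARD('n) / th * (1 - recip q))) * (t + 1) powr (l / th)
  * (enn2real (res_mass th K \<phi> f t) + (t + 1) powr (1 - A))))"
proof -
 let ?e = "real CARD('n) / th"
 obtain C1 where C1: "C1 > 0" "!!t. t > 0 ==> (\<N> x. ennreal (norm x powr l) * res_bound th K \<phi> f t x) <= ennreal (C1 * scale th t powr l) * res_mass th K \<phi> f t"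
  using res_bound_L1[OF l] by blast
 obtain C2 where C2: "C2 > 0" "!!t x. t > 0 ==> ennreal (norm x powr l) * res_bound th K \<phi> f t x <=
  ennreal (C2 * (t powr (- ?e) * scale th t powr l)) * (res_mass th K \<phi> f t + ennreal ((t + 1) powr (1 - A)))"
  using res_bound_Linf[OF l] by blast
 define C where "C = max C1 C2"
 have C: "C > 0" "C1 <= C" "C2 <= C" using C1 by (auto simp: C_def)
 show ?thesis
 proof (intro exI[of _ C] conjI allI impI C)
  fix t :: real assume t: "t > 0"
  note hm[OF t, measurable]
  \<comment> \<open>The second summand is positive, so \<open>V\<close> is positive as well, as the
    interpolation lemma asks.\<close>
  define V where "V = enn2real (res_mass th K \<phi> f t) + (t + 1) powr (1 - A)"
  have V: "V > 0" unfolding V_def using t by (intro add_nonneg_pos) auto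
  have fin: "res_mass th K \<phi> f t < \<infinity>" using res_mass_bounded[OF t A] by (auto intro: order_le_less_trans)
  then have eV: "res_mass th K \<phi> f t + ennreal ((t + 1) powr (1 - A)) = ennreal V"
   by (simp add: V_def ennreal_plus)
  have D: "scale th t powr l > 0" using scale_pos[OF t, of th] by simp
  let ?X = "C * (scale th t powr l * V)"
  have X: "?X > 0" using C D V by simp
  have wm: "(%x. norm x powr l * h t x) \<in> borel_measurable lebesgue" by (rule borel_imp_lebesgue) measurable
  have le: "ennreal \<bar>norm x powr l * h t x\<bar> <= ennreal (norm x powr l) * res_bound th K \<phi> f t x" for x
   using mult_left_mono[OF h[OF t, of x], of "ennreal (norm x powr l)"] by (simp add: ennreal_mult abs_mult)
  have "(\<integral>\<^sup>+ x. ennreal \<bar>norm x powr l * h t x\<bar> \<partial>lebesgue) = (\<I> x. \<bar>norm x powr l * h t x\<bar>)"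
   by (rule nn_integral_completion)
  also have "... <= (\<N> x. ennreal (norm x powr l) * res_bound th K \<phi> f t x)" by (rule nn_integral_mono[OF le])
  also have "... <= ennreal (C1 * scale th t powr l) * res_mass th K \<phi> f t" by (rule C1(2)[OF t])
  also have "... <= ennreal (C * scale th t powr l) * ennreal V"
   unfolding eV[symmetric] using C D by (intro mult_mono ennreal_leI mult_right_mono) auto
  finally have 1: "(\<integral>\<^sup>+ x. ennreal \<bar>norm x powr l * h t x\<bar> \<partial>lebesgue) <= ennreal ?X"
   using C D V by (simp add: ennreal_mult[symmetric] mult.assoc)
  have 2: "AE x in lebesgue. \<bar>norm x powr l * h t x\<bar> <= t powr (- ?e) * ?X"
  proof (rule AE_I2)
   fix x
   have "ennreal \<bar>norm x powr l * h t x\<bar> <= ennreal (C2 * (t powr (- ?e) * scale th t powr l)) * ennreal V"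
    using order_trans[OF le C2(2)[OF t]] unfolding eV .
   also have "... <= ennreal (C * (t powr (- ?e) * scale th t powr l)) * ennreal V"
    using C D by (intro mult_right_mono ennreal_leI) auto
   also have "... = ennreal (t powr (- ?e) * ?X)" using C V by (simp add: ennreal_mult[symmetric] mult_ac)
   finally show "\<bar>norm x powr l * h t x\<bar> <= t powr (- ?e) * ?X" using X by (simp add: ennreal_le_iff)
  qed
  have "wLq_norm q l (h t) <= ennreal (?X powr recip q * (t powr (- ?e) * ?X) powr (1 - recip q))"
   unfolding wLq_norm_def using X t by (intro Lq_norm_interpolate[OF q wm 1 _ 2]) auto
  also have "?X powr recip q * (t powr (- ?e) * ?X) powr (1 - recip q) = t powr (- (?e * (1 - recip q))) * (?X powr recip q * ?X powr (1 - recip q))"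
   by (simp only: powr_mult powr_powr mult_minus_left mult_minus_right mult_ac)
  also have "?X powr recip q * ?X powr (1 - recip q) = ?X" using X by (simp flip: powr_add)
  finally show "wLq_norm q l (h t) <= ennreal (C * (t powr (- (?e * (1 - recip q))) * (t + 1) powr (l / th) * (enn2real (res_mass th K \<phi> f t) + (t + 1) powr (1 - A))))"
   unfolding V_def[symmetric] scale_powr[symmetric] by (simp only: mult_ac)
 qed
qed

lemma res_mass_le_real:
 assumes t: "t > 0" and x: "x >= 0" "tint t (%s. ennreal ((s + 1) powr (K / th - A))) <= ennreal x"
 shows "enn2real (res_mass th K \<phi> f t) <= B * (t + 1) powr (- (K / th)) * (1 + x)"
proof -
 have "res_mass th K \<phi> f t <= ennreal (B * (t + 1) powr (- (K / th))) * (1 + ennreal x)"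
  by (rule order_trans[OF res_mass_le[OF t]]) (intro mult_left_mono add_left_mono x, simp)
 also have "... = ennreal (B * (t + 1) powr (- (K / th)) * (1 + x))"
  using B x by (simp add: ennreal_mult ennreal_plus)
 finally show ?thesis using B x by (intro enn2real_leI) auto
qed

lemma res_mass_smallo:
 assumes A: "K / th < A - 1" "A > 1"
 shows "(%t. enn2real (res_mass th K \<phi> f t)) \<in> o[at_top](%t. t powr (- K / th))"
proof (rule smalloI_tendsto)
 have 0: "((%t. (t + 1) powr (K / th) * enn2real (res_mass th K \<phi> f t)) \<longlongrightarrow> 0) at_top"
  using tendsto_enn2real[of _ 0] res_mass_tendsto_0[OF A(1)] by (fastforce simp: enn2real_mult)
 show "((%t. enn2real (res_mass th K \<phi> f t) / t powr (- K / th)) \<longlongrightarrow> 0) at_top"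
 proof (rule tendsto_sandwich[OF _ _ tendsto_const 0])
  show "\<forall>\<^sub>F t in at_top. 0 <= enn2real (res_mass th K \<phi> f t) / t powr (- K / th)" by simp
  show "\<forall>\<^sub>F t in at_top. enn2real (res_mass th K \<phi> f t) / t powr (- K / th) <= (t + 1) powr (K / th) * enn2real (res_mass th K \<phi> f t)"
   using eventually_gt_at_top[of 0]
  proof eventually_elim
   case (elim t)
   have "t powr (K / th) * enn2real (res_mass th K \<phi> f t) <= (t + 1) powr (K / th) * enn2real (res_mass th K \<phi> f t)"
    using elim th K by (intro mult_right_mono powr_mono2) auto
   then show ?case by (simp add: powr_minus divide_inverse mult.commute)
  qed
 qed
 show "\<forall>\<^sub>F t in at_top. t powr (- K / th) \<noteq> 0" using eventually_gt_at_top[of 0] by eventually_elim simp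
qed

text \<open>The time integral of \<open>(s + 1) powr (K / th - A)\<close> decides. If it converges,
  the mass is \<open>o\<close> and the additional power is the \<open>O\<close> term. If it diverges
  like a power, the whole expression is of order \<open>t powr (1 - A)\<close>. In the borderline
  case the exponent is \<open>-1\<close> and the integral is a logarithm.\<close>

lemma expansion_asymptotics:
 assumes A: "A > 1" and C: "C > 0"
  and Q: "!!t. t >= 1 ==> 0 <= Q t \<and> Q t <= C * (enn2real (res_mass th K \<phi> f t) + (t + 1) powr (1 - A))"
 shows "A - 1 \<noteq> K / th ==> \<exists>r1 r2. r1 \<in> o[at_top](%t. t powr (- K / th)) \<and> r2 \<in> O[at_top](%t. t powr (- A + 1)) \<and> (\<forall>\<^sub>F t in at_top. Q t = r1 t + r2 t)"
  and "A - 1 = K / th ==> Q \<in> O[at_top](%t. t powr (- K / th) * ln t)"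
proof -
 let ?m = "%t. enn2real (res_mass th K \<phi> f t)"
 have T: "(t + 1) powr (1 - A) <= t powr (1 - A)" if "t >= 1" for t using that A by (intro powr_mono2') auto
 show "\<exists>r1 r2. r1 \<in> o[at_top](%t. t powr (- K / th)) \<and> r2 \<in> O[at_top](%t. t powr (- A + 1)) \<and> (\<forall>\<^sub>F t in at_top. Q t = r1 t + r2 t)"
  if ne: "A - 1 \<noteq> K / th"
 proof (cases "K / th < A - 1")
  case True
  \<comment> \<open>Splits \<open>Q\<close> additively: the part capped by the mass is
    \<open>o\<close>, and what exceeds the cap is at most the additional power.\<close>
  define r where "r t = min (Q t) (C * ?m t)" for t
  show ?thesis
  proof (rule exI[of _ r], rule exI[of _ "%t. Q t - r t"], intro conjI)
   have "r \<in> O[at_top](?m)"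
   proof (rule bigoI[of _ C], use eventually_ge_at_top[of 1] in eventually_elim)
    case (elim t)
    have "0 <= C * ?m t" using C by simp
    then have "0 <= r t" "r t <= C * ?m t" using Q[OF elim] by (auto simp: r_def)
    then show ?case by simp
   qed
   then show "r \<in> o[at_top](%t. t powr (- K / th))" by (rule landau_o.big_small_trans[OF _ res_mass_smallo[OF True A]])
   show "(%t. Q t - r t) \<in> O[at_top](%t. t powr (- A + 1))"
   proof (rule bigoI[of _ C], use eventually_ge_at_top[of 1] in eventually_elim)
    case (elim t)
    have "\<bar>Q t - r t\<bar> <= C * (t + 1) powr (1 - A)" using Q[OF elim] C by (auto simp: r_def distrib_left min_def)
    also have "... <= C * t powr (1 - A)" using T[OF elim] C by (intro mult_left_mono) auto
    finally show ?case by simp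
   qed
  qed simp
 next
  case False
  \<comment> \<open>The exponent of the time integrand; \<open>e + 1 > 0\<close> means that its
    integral grows like \<open>(t + 1) powr (e + 1)\<close>.\<close>
  define e where "e = K / th - A"
  have e: "e + 1 > 0" using False ne by (simp add: e_def)
  show ?thesis
  proof (rule exI[of _ "%_. 0"], rule exI[of _ Q], intro conjI)
   show "Q \<in> O[at_top](%t. t powr (- A + 1))"
   proof (rule bigoI[of _ "C * (B * (1 + 1 / (e + 1)) + 1)"], use eventually_ge_at_top[of 1] in eventually_elim)
    case (elim t)
    then have t: "t > 0" by simp
    let ?T = "(t + 1) powr (- (K / th))"
    have 1: "?T <= (t + 1) powr (1 - A)" using e t by (intro powr_mono) (auto simp: e_def)
    have 2: "?T * (t + 1) powr (e + 1) = (t + 1) powr (1 - A)" by (simp add: e_def flip: powr_add)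
    have g: "(t + 1) powr (e + 1) >= 1" using t e by (intro ge_one_powr_ge_zero) auto
    have "?m t <= B * ?T * (1 + ((t + 1) powr (e + 1) - 1) / (e + 1))"
     using nn_integral_time_powr(1)[OF t, of e] e g by (intro res_mass_le_real t) (auto simp: e_def)
    also have "... <= B * ?T * (1 + (t + 1) powr (e + 1) / (e + 1))"
     using B e by (intro mult_left_mono add_left_mono divide_right_mono) auto
    also have "... = B * (?T + (t + 1) powr (1 - A) / (e + 1))"
     unfolding 2[symmetric] by (simp add: algebra_simps)
    also have "... <= B * ((t + 1) powr (1 - A) + (t + 1) powr (1 - A) / (e + 1))" using B 1 by (intro mult_left_mono) auto
    finally have m: "?m t <= B * (1 + 1 / (e + 1)) * (t + 1) powr (1 - A)" by (simp add: algebra_simps)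
    have "Q t <= C * (?m t + (t + 1) powr (1 - A))" using Q[OF elim] by simp
    also have "... <= C * (B * (1 + 1 / (e + 1)) + 1) * (t + 1) powr (1 - A)"
     using m C by (simp add: distrib_right mult.assoc)
    also have "... <= C * (B * (1 + 1 / (e + 1)) + 1) * t powr (1 - A)"
     using T[OF elim] C B e by (intro mult_left_mono) auto
    finally show ?case using Q[OF elim] by simp
   qed
  qed simp_all
 qed
 show "Q \<in> O[at_top](%t. t powr (- K / th) * ln t)" if eq: "A - 1 = K / th"
 proof (rule landau_o.big_trans)
  let ?R = "%t. (t + 1) powr (- (K / th)) * (1 + ln (t + 1))"
  show "Q \<in> O[at_top](?R)"
  proof (rule bigoI[of _ "C * (B + 1)"], use eventually_ge_at_top[of 1] in eventually_elim)
   case (elim t)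
   then have t: "t > 0" by simp
   have ex: "K / th - A = -1" "1 - A = - (K / th)" using eq by auto
   have m: "?m t <= B * (t + 1) powr (- (K / th)) * (1 + ln (t + 1))"
    by (rule res_mass_le_real[OF t]) (use t nn_integral_time_powr(2)[OF t] in \<open>auto simp: ex\<close>)
   have R: "(t + 1) powr (- (K / th)) * 1 <= ?R t" using t by (intro mult_left_mono) auto
   have "Q t <= C * (?m t + (t + 1) powr (1 - A))" using Q[OF elim] by simp
   also have "... <= C * (B * ?R t + ?R t)" using m R C unfolding ex by (intro mult_left_mono add_mono) (auto simp: mult.assoc)
   finally have "Q t <= C * (B + 1) * ?R t" by (simp add: algebra_simps)
   then show ?case using Q[OF elim] t by simp
  qed
  show "?R \<in> O[at_top](%t. t powr (- K / th) * ln t)" by real_asymp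
 qed
qed

end

section \<open>From the norms of the data to the remainder estimates\<close>

lemma rad_powr_le:
 assumes "K >= 0" "s >= 0"
 shows "rad th s y powr K <= 2 powr K * (norm y powr K + (s + 1) powr (K / th))"
 using add_powr_le[of "norm y" "(s + 1) powr (1/th)" K] assms by (simp add: rad_def powr_powr)

lemma rad_moment_le:
 assumes "K >= 0" "s >= 0" and [measurable]: "h \<in> borel_measurable (lebesgue :: (real^'n) measure)"
 shows "(\<integral>\<^sup>+ y. ennreal (rad th s y powr K * \<bar>h y\<bar>) \<partial>lebesgue)
  <= ennreal (2 powr K) * (wLq_norm 1 K h + ennreal ((s + 1) powr (K / th)) * Lq_norm 1 h)"
proof -
 let ?T = "(s + 1) powr (K / th)"
 have "(\<integral>\<^sup>+ y. ennreal (rad th s y powr K * \<bar>h y\<bar>) \<partial>lebesgue)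
  <= (\<integral>\<^sup>+ y. ennreal (2 powr K) * (ennreal \<bar>norm y powr K * h y\<bar> + ennreal ?T * ennreal \<bar>h y\<bar>) \<partial>lebesgue)"
 proof (rule nn_integral_mono)
  fix y :: "real^'n"
  have "rad th s y powr K * \<bar>h y\<bar> <= 2 powr K * (norm y powr K + ?T) * \<bar>h y\<bar>"
   by (rule mult_right_mono[OF rad_powr_le]) (use assms in auto)
  also have "... = 2 powr K * (\<bar>norm y powr K * h y\<bar> + ?T * \<bar>h y\<bar>)" by (simp add: abs_mult algebra_simps)
  finally have "ennreal (rad th s y powr K * \<bar>h y\<bar>) <= ennreal ..." by (rule ennreal_leI)
  then show "ennreal (rad th s y powr K * \<bar>h y\<bar>) <= ennreal (2 powr K) * (ennreal \<bar>norm y powr K * h y\<bar> + ennreal ?T * ennreal \<bar>h y\<bar>)"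
   by (simp add: ennreal_mult ennreal_plus)
 qed
 also have "... = ennreal (2 powr K) * (wLq_norm 1 K h + ennreal ?T * Lq_norm 1 h)"
  unfolding wLq_norm_def Lq_norm_1 by (simp add: nn_integral_cmult nn_integral_add)
 finally show ?thesis .
qed

text \<open>The power of the radius is at most \<open>2 powr K\<close> times a sum of a space weight
  and a time weight. Each weight corresponds to one summand of the hypothesis, which explains the
  second factor \<open>2\<close>.\<close>

lemma AE_rad_powr_le:
 assumes K: "K >= 0" and t: "t > 0" and h: "h \<in> borel_measurable (lebesgue :: (real^'n) measure)" and Y: "Y >= 0"
  and E: "ennreal ((t + 1) powr (K / th)) * (ennreal (t powr e) * Lq_norm \<infinity> h) + ennreal (t powr e) * wLq_norm \<infinity> K h <= ennreal Y"
 shows "AE y in lebesgue. rad th t y powr K * \<bar>h y\<bar> <= 2 powr K * (2 * (Y * t powr (- e)))"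
proof -
 let ?T = "(t + 1) powr (K / th)"
 have "ennreal (?T * t powr e) * Lq_norm \<infinity> h <= ennreal Y"
  using order_trans[OF le_iff_add[THEN iffD2, OF exI, OF refl] E] by (simp add: ennreal_mult mult.assoc)
 then have 1: "AE y in lebesgue. \<bar>h y\<bar> <= Y / (?T * t powr e)"
  using t Y h by (intro Lq_norm_top_AE ennreal_le_divideI) auto
 have "ennreal (t powr e) * wLq_norm \<infinity> K h <= ennreal Y"
  using order_trans[OF le_iff_add[THEN iffD2, OF exI, OF add.commute] E] by simp
 then have 2: "AE y in lebesgue. \<bar>norm y powr K * h y\<bar> <= Y / t powr e"
  unfolding wLq_norm_def using t Y h by (intro Lq_norm_top_AE ennreal_le_divideI) auto
 from 1 2 show ?thesis
 proof eventually_elim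
  case (elim y)
  have "rad th t y powr K * \<bar>h y\<bar> <= 2 powr K * (norm y powr K + ?T) * \<bar>h y\<bar>"
   by (rule mult_right_mono[OF rad_powr_le]) (use assms in auto)
  also have "... = 2 powr K * (\<bar>norm y powr K * h y\<bar> + ?T * \<bar>h y\<bar>)" by (simp add: abs_mult algebra_simps)
  also have "... <= 2 powr K * (Y / t powr e + ?T * (Y / (?T * t powr e)))"
   by (intro mult_left_mono add_mono elim) auto
  also have "... = 2 powr K * (2 * (Y * t powr (- e)))" using t by (simp add: powr_minus divide_inverse)
  finally show ?case .
 qed
qed

lemma U0_measurable:
 fixes \<phi> :: "real^'n => real"
 assumes "0 < th" "th <= 2" "t > -1"
 shows "(%x. U0 th K \<phi> f x t) \<in> borel_measurable borel"
proof -
 have Fou: "Fou Q \<in> borel_measurable borel" if [measurable]: "Q \<in> borel_measurable borel" for Q :: "real^'n => complex"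
  unfolding Fou_def[abs_def] by measurable
 have "(%x. g th \<alpha> m x t) \<in> borel_measurable borel" for \<alpha> :: "'n => nat" and m
  unfolding g_eq_Fou(2)[OF assms]
  by (intro borel_measurable_times borel_measurable_const Fou rapid_measurable g_eq_Fou(1)[OF assms])
 then show ?thesis
  unfolding U0_def by (intro borel_measurable_sum borel_measurable_times borel_measurable_const)
qed

text \<open>\<open>U0\<close> sees the datum only through moments and the source only at positive
  times, so both may be replaced by better measurable versions.\<close>

lemma U0_cong:
 assumes "AE y in lebesgue. \<phi> y = \<psi> y" "\<phi> \<in> borel_measurable lebesgue" "\<psi> \<in> borel_measurable lebesgue"
  and f: "!!y s. s > 0 ==> f y s = h y s"
 shows "U0 th K \<phi> f x t = U0 th K \<psi> h x t"
proof -
 have m: "(%y. mi_power y \<alpha>) \<in> borel_measurable lebesgue" for \<alpha> :: "'a => nat" by (rule borel_imp_lebesgue) measurable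
 have "moment \<alpha> \<phi> = moment \<alpha> \<psi>" for \<alpha>
  unfolding moment_def using assms m by (intro integral_cong_AE borel_measurable_times) auto
 moreover have "(LINT s:{0<..<t}|lebesgue. (s + 1) ^ m * moment \<alpha> (%y. f y s)) = (LINT s:{0<..<t}|lebesgue. (s + 1) ^ m * moment \<alpha> (%y. h y s))" for m \<alpha>
  using f by (intro set_lebesgue_integral_cong) auto
 ultimately show ?thesis unfolding U0_def by simp
qed

text \<open>The cases \<open>q = 1\<close> and \<open>q = \<infinity>\<close> of
  \<open>source_decay\<close> supply the integral and the supremum bound of the locale
  \<open>remainder\<close>, which is instantiated with a Borel representative of the datum and with
  the source cut off at nonpositive times. All other exponents follow by interpolation.\<close>

lemma source_decay_expansion:
 fixes \<phi> :: "real^'n => real" and f u :: "real^'n => real => real"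
 assumes th: "0 < th" "th < 2" and K: "0 <= K" and A: "A > 1" and phi: "\<phi> \<in> wLq 1 K"
  and fm: "(%p. if 0 < snd p then f (fst p) (snd p) else 0) \<in> borel_measurable (borel \<Otimes>\<^sub>M borel)"
  and um: "!!t. t > 0 ==> (%x. u x t) \<in> borel_measurable borel"
  and sol: "!!x t. t > 0 ==> integrable lebesgue (%y. G th (x - y) t * \<phi> y) \<and>
    (AE s in lebesgue. s \<in> {0<..<t} --> integrable lebesgue (%y. G th (x - y) (t - s) * f y s)) \<and>
    set_integrable lebesgue {0<..<t} (%s. heat th (t - s) (%y. f y s) x) \<and>
    u x t = heat th t \<phi> x + (LINT s:{0<..<t}|lebesgue. heat th (t - s) (%y. f y s) x)"
  and sd: "source_decay th K A f" and q: "1 <= q" and l: "0 <= l" "l <= K"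
 defines "R \<equiv> %t. wLq_norm q l (%x. u x t - U0 th K \<phi> f x t)" and "e \<equiv> real CARD('n) / th * (1 - recip q)"
 shows "(SUP t\<in>{0<..}. ennreal (t powr e * (t + 1) powr (- l / th)) * R t) < \<infinity>"
  and "A - 1 \<noteq> K / th ==> \<exists>r1 r2. r1 \<in> o[at_top](%t. t powr (- K / th)) \<and> r2 \<in> O[at_top](%t. t powr (- A + 1)) \<and>
   (\<forall>\<^sub>F t in at_top. t powr (e - l / th) * enn2real (R t) = r1 t + r2 t)"
  and "A - 1 = K / th ==> (%t. t powr (e - l / th) * enn2real (R t)) \<in> O[at_top](%t. t powr (- K / th) * ln t)"
proof -
 have pm: "\<phi> \<in> borel_measurable lebesgue" and pf: "Lq_norm 1 \<phi> + wLq_norm 1 K \<phi> < \<infinity>"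
  using phi by (auto simp: wLq_def Lq_def)
 then obtain \<psi> where psi [measurable]: "\<psi> \<in> borel_measurable borel" and "AE y in lborel. \<phi> y = \<psi> y"
  using completion_ex_borel_measurable_real[of \<phi> lborel] by auto
 then have eq: "AE y in lebesgue. \<phi> y = \<psi> y" by (intro AE_completion)
 have psiL: "\<psi> \<in> borel_measurable lebesgue" by (rule borel_imp_lebesgue[OF psi])
 \<comment> \<open>At nonpositive times the source is uncontrolled and possibly not measurable;
   extending it by \<open>0\<close> gives a jointly Borel function with the same norms at positive
   times.\<close>
 define h where "h = (%y s. if 0 < s then f y s else 0)"
 have hm [measurable]: "(%p. h (fst p) (snd p)) \<in> borel_measurable (borel \<Otimes>\<^sub>M borel)" using fm by (simp add: h_def)
 have hs: "(%y. h y s) \<in> borel_measurable borel" for s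
  using measurable_compose[OF measurable_Pair[OF measurable_ident_sets[OF refl] measurable_const] hm] by simp
 have hsL: "(%y. h y s) \<in> borel_measurable lebesgue" for s by (rule borel_imp_lebesgue[OF hs])
 obtain C1 where C1: "C1 > 0" "!!t. t > 0 ==> E_norm th K 1 h t <= ennreal (C1 * (t + 1) powr (K / th - A))"
  using sd by (force simp: source_decay_def E_norm_def h_def)
 obtain C2 where C2: "C2 > 0" "!!t. t > 0 ==> E_norm th K \<infinity> h t <= ennreal (C2 * (t + 1) powr (K / th - A))"
  using sd[unfolded source_decay_def, rule_format, of \<infinity>] by (force simp: E_norm_def h_def)
 define b where "b = enn2real (Lq_norm 1 \<phi> + wLq_norm 1 K \<phi>)"
 \<comment> \<open>The factor \<open>2 powr K\<close> comes from \<open>rad_powr_le\<close>, and the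
   extra \<open>2\<close> from the two summands in \<open>AE_rad_powr_le\<close>.\<close>
 define B where "B = 2 powr K * (2 * max b (max C1 C2))"
 have B: "0 <= B" "2 powr K * b <= B" "2 powr K * C1 <= B" "2 powr K * (2 * C2) <= B"
  using C1 C2 by (auto simp: B_def b_def max_def)
 interpret remainder th K A B \<psi> h
 proof
  have "(\<I> y. rad th 0 y powr K * \<bar>\<psi> y\<bar>) = (\<integral>\<^sup>+ y. ennreal (rad th 0 y powr K * \<bar>\<psi> y\<bar>) \<partial>lebesgue)"
   by (rule nn_integral_completion[symmetric])
  also have "... = (\<integral>\<^sup>+ y. ennreal (rad th 0 y powr K * \<bar>\<phi> y\<bar>) \<partial>lebesgue)"
   by (rule nn_integral_cong_AE) (use eq in eventually_elim, simp)
  also have "... <= ennreal (2 powr K) * (wLq_norm 1 K \<phi> + Lq_norm 1 \<phi>)"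
   using rad_moment_le[OF K order_refl pm, of th] by simp
  also have "... = ennreal (2 powr K * b)" using pf by (simp add: b_def ennreal_mult add.commute)
  also have "... <= ennreal B" by (intro ennreal_leI B)
  finally show "(\<I> y. rad th 0 y powr K * \<bar>\<psi> y\<bar>) <= ennreal B" .
  fix s :: real assume s: "s > 0"
  have "(\<I> y. rad th s y powr K * \<bar>h y s\<bar>) = (\<integral>\<^sup>+ y. ennreal (rad th s y powr K * \<bar>h y s\<bar>) \<partial>lebesgue)"
   by (rule nn_integral_completion[symmetric])
  also have "... <= ennreal (2 powr K) * (wLq_norm 1 K (%y. h y s) + ennreal ((s + 1) powr (K / th)) * Lq_norm 1 (%y. h y s))"
   by (rule rad_moment_le[OF K less_imp_le[OF s] hsL])
  also have "... <= ennreal (2 powr K) * E_norm th K 1 h s"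
  proof (rule mult_left_mono)
   have "w + y <= x + y + z + w" for w x y z :: ennreal
    using le_iff_add[THEN iffD2, OF exI, OF refl, of "w + y" "x + z"] by (simp add: ac_simps)
   then show "wLq_norm 1 K (%y. h y s) + ennreal ((s + 1) powr (K / th)) * Lq_norm 1 (%y. h y s) <= E_norm th K 1 h s"
    unfolding E_norm_def Let_def distrib_left .
  qed simp
  also have "... <= ennreal (2 powr K) * ennreal (C1 * (s + 1) powr (K / th - A))" by (intro mult_left_mono C1 s) simp
  also have "... <= ennreal (B * (s + 1) powr (K / th - A))"
   using C1 B(3) by (simp add: ennreal_mult[symmetric] mult.assoc[symmetric] ennreal_leI mult_right_mono)
  finally show "(\<I> y. rad th s y powr K * \<bar>h y s\<bar>) <= ..." .
  let ?e = "real CARD('n) / th" and ?Y = "C2 * (s + 1) powr (K / th - A)"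
  have "ennreal ((s + 1) powr (K / th)) * (ennreal (s powr ?e) * Lq_norm \<infinity> (%y. h y s)) + ennreal (s powr ?e) * wLq_norm \<infinity> K (%y. h y s)
   <= E_norm th K \<infinity> h s"
   unfolding E_norm_def Let_def by (simp add: distrib_left add.assoc)
  also have "... <= ennreal ?Y" by (rule C2(2)[OF s])
  finally have "AE y in lebesgue. rad th s y powr K * \<bar>h y s\<bar> <= 2 powr K * (2 * (?Y * s powr (- ?e)))"
   using C2 by (intro AE_rad_powr_le K s hsL) auto
  then have "AE y in lebesgue. rad th s y powr K * \<bar>h y s\<bar> <= B * s powr (- ?e) * (s + 1) powr (K / th - A)"
  proof eventually_elim
   case (elim y)
   also have "2 powr K * (2 * (?Y * s powr (- ?e))) = 2 powr K * (2 * C2) * (s powr (- ?e) * (s + 1) powr (K / th - A))" by (simp only: mult_ac)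
   also have "... <= B * (s powr (- ?e) * (s + 1) powr (K / th - A))" by (intro mult_right_mono B) auto
   finally show ?case by (simp only: mult.assoc)
  qed
  then show "AE y in lborel. rad th s y powr K * \<bar>h y s\<bar> <= B * s powr (- ?e) * (s + 1) powr (K / th - A)"
   by (subst (asm) AE_completion_iff) measurable
 qed (use th K B psi hm in auto)
 have Gm: "(%y. G th (x - y) t) \<in> borel_measurable lebesgue" for x :: "real^'n" and t by (rule borel_imp_lebesgue) measurable
 have Ueq: "U0 th K \<phi> f x t = U0 th K \<psi> h x t" for x t by (rule U0_cong[OF eq pm psiL]) (simp add: h_def)
 have res: "ennreal \<bar>u x t - U0 th K \<phi> f x t\<bar> <= res_bound th K \<psi> h t x" if t: "t > 0" for x t
 proof -
  have hh: "heat th (t - s) (%y. h y s) x = heat th (t - s) (%y. f y s) x" if "s \<in> {0<..<t}" for s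
   using that by (simp add: heat_def h_def)
  have aeq: "AE y in lebesgue. G th (x - y) t * \<phi> y = G th (x - y) t * \<psi> y" using eq by eventually_elim simp
  have G1: "integrable lebesgue (%y. G th (x - y) t * \<psi> y)"
   using sol[OF t, of x] integrable_cong_AE[OF _ _ aeq] Gm pm psiL by simp
  have G2: "AE s in lebesgue. s \<in> {0<..<t} --> integrable lebesgue (%y. G th (x - y) (t - s) * h y s)"
   using sol[OF t, of x, THEN conjunct2, THEN conjunct1] by eventually_elim (auto simp: h_def)
  have "set_integrable lebesgue {0<..<t} (%s. heat th (t - s) (%y. f y s) x)" using sol[OF t, of x] by blast
  then have G3: "set_integrable lebesgue {0<..<t} (%s. heat th (t - s) (%y. h y s) x)"
   by (subst set_integrable_cong[OF refl refl hh]) auto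
  have "heat th t \<phi> x = heat th t \<psi> x"
   unfolding heat_def using Gm pm psiL by (intro integral_cong_AE aeq) simp_all
  moreover have "(LINT s:{0<..<t}|lebesgue. heat th (t - s) (%y. f y s) x) = (LINT s:{0<..<t}|lebesgue. heat th (t - s) (%y. h y s) x)"
   using hh by (intro set_lebesgue_integral_cong) auto
  ultimately have "u x t - U0 th K \<phi> f x t = heat th t \<psi> x + (LINT s:{0<..<t}|lebesgue. heat th (t - s) (%y. h y s) x) - U0 th K \<psi> h x t"
   using sol[OF t, of x] Ueq by simp
  then show ?thesis
   unfolding res_bound_def using solution_minus_U0_le[OF t G1 G2 G3] by simp
 qed
 have Um: "(%x. u x t - U0 th K \<phi> f x t) \<in> borel_measurable borel" if t: "t > 0" for t
  using um[OF t] U0_measurable[of th t K \<phi> f] th t by (intro borel_measurable_diff) auto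
 let ?m = "%t. enn2real (res_mass th K \<psi> h t)"
 obtain C where C: "C > 0" and R: "!!t. t > 0 ==> R t <= ennreal (C * (t powr (- e) * (t + 1) powr (l / th) * (?m t + (t + 1) powr (1 - A))))"
  using wLq_norm_le_res_mass[OF A q l Um res] unfolding R_def e_def by blast
 have m: "?m t + (t + 1) powr (1 - A) <= B * (1 + 1 / (A - 1)) + 1" if t: "t > 0" for t
 proof -
  have "?m t <= B * (1 + 1 / (A - 1))" using res_mass_bounded[OF t A] A B(1) by (intro enn2real_leI) auto
  moreover have "(t + 1) powr (1 - A) <= 1" using powr_mono[of "1 - A" 0 "t + 1"] t A by simp
  ultimately show ?thesis by simp
 qed
 have "(SUP t\<in>{0<..}. ennreal (t powr e * (t + 1) powr (- l / th)) * R t) <= ennreal (C * (B * (1 + 1 / (A - 1)) + 1))"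
 proof (rule SUP_least)
  fix t :: real assume "t \<in> {0<..}"
  then have t: "t > 0" by simp
  have "ennreal (t powr e * (t + 1) powr (- l / th)) * R t <= ennreal (t powr e * (t + 1) powr (- l / th)) * ennreal (C * (t powr (- e) * (t + 1) powr (l / th) * (?m t + (t + 1) powr (1 - A))))"
   by (intro mult_left_mono R t) simp
  also have "... = ennreal (C * (?m t + (t + 1) powr (1 - A)))"
   using t by (subst ennreal_mult[symmetric]) (auto simp: powr_minus divide_simps C less_imp_le)
  also have "... <= ennreal (C * (B * (1 + 1 / (A - 1)) + 1))" using C by (intro ennreal_leI mult_left_mono m t) auto
  finally show "ennreal (t powr e * (t + 1) powr (- l / th)) * R t <= ..." .
 qed
 then show "(SUP t\<in>{0<..}. ennreal (t powr e * (t + 1) powr (- l / th)) * R t) < \<infinity>" by (rule order_le_less_trans) simp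
 define Q where "Q t = t powr (e - l / th) * enn2real (R t)" for t
 \<comment> \<open>For \<open>t >= 1\<close> the factor \<open>(t + 1) powr (l / th)\<close> is
   replaced by a multiple of \<open>t powr (l / th)\<close>, so that all powers of \<open>t\<close>
   cancel.\<close>
 have Q: "0 <= Q t \<and> Q t <= 2 powr (l / th) * C * (?m t + (t + 1) powr (1 - A))" if t1: "t >= 1" for t
 proof -
  have t: "t > 0" using t1 by simp
  let ?V = "?m t + (t + 1) powr (1 - A)"
  have V: "?V >= 0" by simp
  have "(t + 1) powr (l / th) <= (2 * t) powr (l / th)" using t1 l th by (intro powr_mono2) auto
  then have T: "(t + 1) powr (l / th) <= 2 powr (l / th) * t powr (l / th)" by (simp only: powr_mult)
  have "enn2real (R t) <= C * (t powr (- e) * (t + 1) powr (l / th) * ?V)" using C V by (intro enn2real_leI R t) auto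
  also have "... <= C * (t powr (- e) * (2 powr (l / th) * t powr (l / th)) * ?V)"
   using C V T by (intro mult_left_mono mult_right_mono) auto
  finally have "Q t <= t powr (e - l / th) * (C * (t powr (- e) * (2 powr (l / th) * t powr (l / th)) * ?V))"
   unfolding Q_def by (rule mult_left_mono) simp
  also have "... = 2 powr (l / th) * C * ?V * (t powr (e - l / th) * t powr (- e) * t powr (l / th))" by (simp only: mult_ac)
  also have "t powr (e - l / th) * t powr (- e) * t powr (l / th) = 1" using t by (simp flip: powr_add)
  finally show ?thesis by (simp add: Q_def)
 qed
 have C': "2 powr (l / th) * C > 0" using C by simp
 note asy = expansion_asymptotics[OF A C' Q]
 show "A - 1 \<noteq> K / th ==> \<exists>r1 r2. r1 \<in> o[at_top](%t. t powr (- K / th)) \<and> r2 \<in> O[at_top](%t. t powr (- A + 1)) \<and>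
   (\<forall>\<^sub>F t in at_top. t powr (e - l / th) * enn2real (R t) = r1 t + r2 t)"
  and "A - 1 = K / th ==> (%t. t powr (e - l / th) * enn2real (R t)) \<in> O[at_top](%t. t powr (- K / th) * ln t)"
  using asy unfolding Q_def by simp_all
qed

theorem theorem5p1:
  fixes \<theta> K p :: real
    and \<phi> :: "real ^ 'n \<Rightarrow> real"
    and F :: "real ^ 'n \<Rightarrow> real \<Rightarrow> real \<Rightarrow> real"
    and u :: "real ^ 'n \<Rightarrow> real \<Rightarrow> real"
  assumes "0 < \<theta>" "\<theta> < 2" "0 \<le> K"
    and "\<phi> \<in> wLq 1 K \<inter> Lq \<infinity>"
    and "continuous_on (UNIV \<times> {0..} \<times> UNIV) (\<lambda>(x, t, v). F x t v)"
    and "p > 1 + \<theta> / real CARD('n)"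
    and "\<exists>C>0. \<forall>x t v w. 0 \<le> t \<longrightarrow>
           \<bar>F x t v - F x t w\<bar> \<le> C * (\<bar>v\<bar> + \<bar>w\<bar>) powr (p - 1) * \<bar>v - w\<bar>"
    and "continuous_on (UNIV \<times> {0<..}) (\<lambda>(x, t). u x t)"
    and "solution \<theta> F \<phi> u"
  shows
    "let N = real CARD('n);
         A = N * (p - 1) / \<theta>;
         f = (\<lambda>x t. F x t (u x t));
         R = (\<lambda>q l t. wLq_norm q l (\<lambda>x. u x t - U0 \<theta> K \<phi> f x t))
     in
      ((\<forall>x t. 0 \<le> t \<longrightarrow> F x t 0 = 0) \<and>
       \<phi> \<in> wLq \<infinity> (min (N + \<theta>) K) \<and>
       (SUP t\<in>{0<..}. ennreal ((t + 1) powr (N / \<theta>)) * Lq_norm \<infinity> (\<lambda>x. u x t)) < \<infinity>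
       \<longrightarrow> weighted_decay \<theta> K u)
    \<and>
      ((\<forall>x t. 0 \<le> t \<longrightarrow> F x t 0 = 0) \<and>
       weighted_decay \<theta> K u \<and> p * (N + \<theta>) > K + N
       \<longrightarrow> source_decay \<theta> K A f)
    \<and>
      (source_decay \<theta> K A f
       \<longrightarrow> (\<forall>q l. 1 \<le> q \<and> 0 \<le> l \<and> l \<le> K \<longrightarrow>
             (SUP t\<in>{0<..}. ennreal (t powr (N / \<theta> * (1 - recip q)) * (t + 1) powr (- l / \<theta>)) *
                            R q l t) < \<infinity> \<and>
             (A - 1 \<noteq> K / \<theta> \<longrightarrow>
               (\<exists>r1 r2. r1 \<in> o[at_top](\<lambda>t. t powr (- K / \<theta>)) \<and>
                        r2 \<in> O[at_top](\<lambda>t. t powr (- A + 1)) \<and>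
                        (\<forall>\<^sub>F t in at_top.
                           t powr (N / \<theta> * (1 - recip q) - l / \<theta>) * enn2real (R q l t) = r1 t + r2 t))) \<and>
             (A - 1 = K / \<theta> \<longrightarrow>
               (\<lambda>t. t powr (N / \<theta> * (1 - recip q) - l / \<theta>) * enn2real (R q l t))
                 \<in> O[at_top](\<lambda>t. t powr (- K / \<theta>) * ln t))))"
proof -
 define N where "N = real CARD('n)"
 define A where "A = N * (p - 1) / \<theta>"
 define f where "f = (%x t. F x t (u x t))"
 have N: "N > 0" by (simp add: N_def)
 have "\<theta> / N > 0" using assms(1) N by simp
 then have p1: "p > 1" using assms(6) unfolding N_def[symmetric] by linarith
 have A: "A > 1" using assms(1,6) N by (auto simp: A_def N_def[symmetric] field_simps)
 obtain C where C: "C > 0" and Fl: "!!x t v w. 0 <= t \<Longrightarrow> \<bar>F x t v - F x t w\<bar> <= C * (\<bar>v\<bar> + \<bar>w\<bar>) powr (p - 1) * \<bar>v - w\<bar>"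
 using assms(7) by blast
 have uc: "continuous_on (UNIV \<times> {0<..}) (%p. u (fst p) (snd p))" using assms(8) by (simp add: case_prod_unfold)
 have fc: "continuous_on (UNIV \<times> {0<..}) (%p. f (fst p) (snd p))"
 proof -
 have "continuous_on (UNIV \<times> {0<..}) (%p. (fst p, snd p, u (fst p) (snd p)))" by (intro continuous_intros uc)
 from continuous_on_compose2[OF assms(5) this] show ?thesis by (fastforce simp: f_def)
 qed
 have slice: "(%x. v x t) \<in> borel_measurable borel"
 if v: "continuous_on (UNIV \<times> {0<..}) (%p. v (fst p) (snd p))" and t: "t > 0" for v :: "real^'n \<Rightarrow> real \<Rightarrow> real" and t
 proof (rule borel_measurable_continuous_onI)
 show "continuous_on UNIV (%x. v x t)"
  using continuous_on_compose2[OF v, of UNIV "%x. (x, t)"] t by (simp add: continuous_intros image_subset_iff)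
 qed
 \<comment> \<open>Continuity holds on the open set of positive times only; extension by
   \<open>0\<close> preserves joint Borel measurability.\<close>
 have fm: "(%p. if 0 < snd p then f (fst p) (snd p) else 0) \<in> borel_measurable (borel \<Otimes>\<^sub>M borel)"
 proof -
 have "(UNIV :: (real^'n) set) \<times> {0::real<..} \<in> sets borel" by (intro borel_open open_Times) auto
 then have "(%p. if p \<in> UNIV \<times> {0<..} then f (fst p) (snd p) else 0) \<in> borel_measurable borel"
  by (rule borel_measurable_continuous_on_if) (use fc in auto)
 then show ?thesis by (simp add: borel_prod mem_Times_iff)
 qed
 have sol: "integrable lebesgue (%y. G \<theta> (x - y) t * \<phi> y) \<and>
   (AE s in lebesgue. s \<in> {0<..<t} \<longrightarrow> integrable lebesgue (%y. G \<theta> (x - y) (t - s) * f y s)) \<and>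
   set_integrable lebesgue {0<..<t} (%s. heat \<theta> (t - s) (%y. f y s) x) \<and>
   u x t = heat \<theta> t \<phi> x + (LINT s:{0<..<t}|lebesgue. heat \<theta> (t - s) (%y. f y s) x)" if "t > 0" for x t
 using assms(9) that unfolding solution_def f_def by blast
 \<comment> \<open>The Lipschitz condition with \<open>w = 0\<close>, where \<open>F\<close>
   vanishes by assumption, gives the power bound on which parts (a) and (b) rest.\<close>
 have fu: "\<bar>f x t\<bar> <= C * \<bar>u x t\<bar> powr p" if F0: "\<forall>x t. 0 <= t \<longrightarrow> F x t 0 = 0" and t: "t > 0" for x t
 proof -
 have "\<bar>f x t\<bar> <= C * (\<bar>u x t\<bar> powr (p - 1) * \<bar>u x t\<bar>)" using Fl[of t x "u x t" 0] F0 t by (simp add: f_def mult.assoc)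
 also have "\<bar>u x t\<bar> powr (p - 1) * \<bar>u x t\<bar> = \<bar>u x t\<bar> powr p"
  by (cases "u x t = 0") (simp_all add: powr_diff)
 finally show ?thesis .
 qed
 have phi1: "\<phi> \<in> wLq 1 K" using assms(4) by simp
 note um = slice[OF uc] and fmt = slice[OF fc]
 have a: "weighted_decay \<theta> K u"
 if "\<forall>x t. 0 <= t \<longrightarrow> F x t 0 = 0" "\<phi> \<in> wLq \<infinity> (min (N + \<theta>) K)" "(SUP t\<in>{0<..}. ennreal ((t + 1) powr (N / \<theta>)) * Lq_norm \<infinity> (%x. u x t)) < \<infinity>"
 proof (rule weighted_decay_if_bounded_decay[OF assms(1-3,6)])
 show "!!x t. t > 0 \<Longrightarrow> u x t = heat \<theta> t \<phi> x + (LINT s:{0<..<t}|lebesgue. heat \<theta> (t - s) (%y. f y s) x)"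
  using sol by blast
 qed (use that less_imp_le[OF C] um fu[OF that(1)] phi1 in \<open>simp_all add: N_def\<close>)
 have b: "source_decay \<theta> K A f"
 if "\<forall>x t. 0 <= t \<longrightarrow> F x t 0 = 0" "weighted_decay \<theta> K u" "p * (N + \<theta>) > K + N"
 unfolding A_def N_def
 by (rule source_decay_from_weighted_decay[OF assms(1,3) p1 less_imp_le[OF C] fu[OF that(1)] _ _ that(2)])
  (use that(3) um fmt in \<open>simp_all add: N_def borel_imp_lebesgue\<close>)
 note c = source_decay_expansion[OF assms(1-3) A phi1 fm um sol, folded N_def]
 show ?thesis
 unfolding Let_def N_def[symmetric] f_def[symmetric] A_def[symmetric]
 apply (rule conjI)
 using a apply blast
 apply (rule conjI)
 using b apply blast
 apply (intro allI impI conjI)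
  apply (elim conjE)
  apply (rule c(1); assumption)
  apply (elim conjE)
  apply (rule c(2); assumption)
 apply (elim conjE)
 apply (rule c(3); assumption)
 done
qed

end
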